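(* For any fixed $\eta\in\mathcal P(\mathbb T^d)$ there exists a sequence $\delta_n\to0^+$ such that $\mathcal V_{\delta_n}(\cdot)-\mathcal V_{\delta_n}(\eta)$ converges uniformly on $\mathcal P(\mathbb T^d)$, as $n\to+\infty$, to a function $\chi:\mathcal P(\mathbb T^d)\to\mathbb R$. Moreover, $\delta_n\mathcal V_{\delta_n}$ converges uniformly on $\mathcal P(\mathbb T^d)$ to a constant $-\lambda$.
   Context: $\mathbb T^d=\mathbb R^d/\mathbb Z^d$. $\mathcal P(\mathbb T^d)$ is the set of Borel probability measures on $\mathbb T^d$ with the distance $\mathbf d(\mu,\nu)=\sup\{\int_{\mathbb T^d}\phi\,d(\mu-\nu):\phi:\mathbb T^d\to\mathbb R,\ \mathrm{Lip}(\phi)\le1\}$. Derivatives: $\Phi:\mathcal P(\mathbb T^d)\to\mathbb R$ is $C^1$ if there is a continuous $\frac{\delta\Phi}{\delta m}:\mathcal P(\mathbb T^d)\times\mathbb T^d\to\mathbb R$ with $\Phi(m_2)-\Phi(m_1)=\int_0^1\int_{\mathbb T^d}\frac{\delta\Phi}{\delta m}((1-t)m_1+tm_2,x)(m_2-m_1)(dx)\,dt$ for all $m_1,m_2$, normalized by $\int_{\mathbb T^d}\frac{\delta\Phi}{\delta m}(m,x)\,m(dx)=0$; $C^2$ is understood in the same sense. Standing assumptions. (1) $H:\mathbb T^d\times\mathbb R^d\to\mathbb R$ is $C^2$, $p\mapsto D_{pp}H(x,p)$ is Lipschitz uniformly in $x$; there is $\bar C>0$ with $\bar C^{-1}I_d\le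 D_{pp}H(x,p)\le\bar C I_d$ for all $(x,p)$; there are $\theta\in(0,1)$, $C>0$ with $|D_{xx}H(x,p)|\le C(1+|p|)^{1+\theta}$ and $|D_{xp}H(x,p)|\le C(1+|p|)^\theta$ for all $(x,p)$. (2) $\mathcal F:\mathcal P(\mathbb T^d)\to\mathbb R$ is $C^2$; its derivative $F(x,m)=\frac{\delta\mathcal F}{\delta m}(m,x)$ is twice differentiable in $x$ and $D^2_{xx}F$ is bounded. $H^*(x,q)=\sup_{p\in\mathbb R^d}\{p\cdot q-H(x,p)\}$. For $\delta>0$ and $m_0\in\mathcal P(\mathbb T^d)$, $$\mathcal V_\delta(m_0)=\inf_{(m,\alpha)}\int_0^\infty e^{-\delta t}\Big(\int_{\mathbb T^d}H^*(x,\alpha(t,x))\,m(t,dx)+\mathcal F(m(t))\Big)dt,$$ over $m\in C^0([0,\infty),\mathcal P(\mathbb T^d))$ and $\alpha:[0,\infty)\times\mathbb T^d\to\mathbb R^d$ with $\int_0^\infty e^{-\delta t}\int|\alpha|^2dm(t)\,dt<\infty$, such that $-\partial_tm+\Delta m+\mathrm{div}(m\alpha)=0$ in the sense of distributions on $[0,\infty)\times\mathbb T^d$ with $m(0)=m_0$. *)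

theory Defs
  imports "HOL-Probability.Probability"
begin

section \<open>The flat torus\<close>

text \<open>The distance on the quotient is the smallest Euclidean distance between representatives;
  it metrizes the quotient topology.\<close>

quotient_type 'n torus = "real ^ 'n::finite" / "\<lambda>x y. \<forall>i. x $ i - y $ i \<in> \<int>"
  morphisms rep_torus tproj
proof (rule equivpI)
  show "reflp (\<lambda>x y::real^'n. \<forall>i. x $ i - y $ i \<in> \<int>)"
    by (simp add: reflp_def)
  show "symp (\<lambda>x y::real^'n. \<forall>i. x $ i - y $ i \<in> \<int>)"
  proof (rule sympI, rule allI)
    fix x y :: "real^'n" and i
    assume "\<forall>i. x $ i - y $ i \<in> \<int>"
    then have "- (x $ i - y $ i) \<in> \<int>" by (blast intro: Ints_minus)
    then show "y $ i - x $ i \<in> \<int>" by simp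
  qed
  show "transp (\<lambda>x y::real^'n. \<forall>i. x $ i - y $ i \<in> \<int>)"
  proof (rule transpI, rule allI)
    fix x y z :: "real^'n" and i
    assume "\<forall>i. x $ i - y $ i \<in> \<int>" "\<forall>i. y $ i - z $ i \<in> \<int>"
    then have "(x $ i - y $ i) + (y $ i - z $ i) \<in> \<int>" by (blast intro: Ints_add)
    then show "x $ i - z $ i \<in> \<int>" by simp
  qed
qed

instantiation torus :: (finite) ab_group_add
begin

lift_definition zero_torus :: "'a torus" is "0" .

lift_definition plus_torus :: "'a torus \<Rightarrow> 'a torus \<Rightarrow> 'a torus" is "(+)"
proof -
  fix x y z w :: "real^'a" and i
  assume "\<And>i. x $ i - y $ i \<in> \<int>" "\<And>i. z $ i - w $ i \<in> \<int>"
  then have "(x $ i - y $ i) + (z $ i - w $ i) \<in> \<int>" by (blast intro: Ints_add)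
  then show "(x + z) $ i - (y + w) $ i \<in> \<int>" by (simp add: algebra_simps)
qed

lift_definition uminus_torus :: "'a torus \<Rightarrow> 'a torus" is "uminus"
proof -
  fix x y :: "real^'a" and i
  assume "\<And>i. x $ i - y $ i \<in> \<int>"
  then have "- (x $ i - y $ i) \<in> \<int>" by (blast intro: Ints_minus)
  then show "(- x) $ i - (- y) $ i \<in> \<int>" by simp
qed

definition minus_torus :: "'a torus \<Rightarrow> 'a torus \<Rightarrow> 'a torus" where
  "minus_torus x y = x + - y"

instance
proof
  fix a b c :: "'a torus"
  show "a + b + c = a + (b + c)" by transfer (simp add: algebra_simps)
  show "a + b = b + a" by transfer (simp add: algebra_simps)
  show "0 + a = a" by transfer simp
  show "- a + a = 0" by transfer simp
  show "a - b = a + - b" by (rule minus_torus_def)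
qed

end

lemma tproj_eq_iff: "tproj x = tproj y \<longleftrightarrow> (\<forall>i. x $ i - y $ i \<in> \<int>)"
  by (rule torus.abs_eq_iff)

lemma tproj_add: "tproj (x + y) = tproj x + tproj y"
  by (rule plus_torus.abs_eq[symmetric])

lemma tproj_minus: "tproj (- x) = - tproj x"
  by (rule uminus_torus.abs_eq[symmetric])

lemma tproj_zero: "tproj 0 = 0"
  by (rule zero_torus.abs_eq[symmetric])

lemma tproj_surj: "\<exists>v. tproj v = x"
  by (rule exI[of _ "rep_torus x"], rule Quotient3_abs_rep[OF Quotient3_torus])

definition torus_norm :: "'n::finite torus \<Rightarrow> real" where
  "torus_norm x = Inf {norm v | v. tproj v = x}"

lemma torus_norm_nonempty: "{norm v | v. tproj v = x} \<noteq> {}"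
  using tproj_surj by blast

lemma torus_norm_bdd: "bdd_below {norm v | v. tproj v = x}"
  by (auto intro!: bdd_belowI[of _ 0])

lemma torus_norm_le: "torus_norm (tproj v) \<le> norm v"
  unfolding torus_norm_def using torus_norm_bdd by (intro cInf_lower) auto

lemma torus_norm_nonneg: "0 \<le> torus_norm x"
  unfolding torus_norm_def using torus_norm_nonempty by (intro cInf_greatest) auto

lemma torus_norm_approx:
  assumes "torus_norm x < e"
  obtains v where "tproj v = x" "norm v < e"
proof -
  have "\<exists>r\<in>{norm v | v. tproj v = x}. r < e"
    using assms torus_norm_nonempty unfolding torus_norm_def by (rule cInf_lessD[rotated])
  then show ?thesis using that by auto
qed

lemma torus_norm_zero: "torus_norm (0 :: 'n::finite torus) = 0"
  using torus_norm_le[of "0 :: real^'n"] torus_norm_nonneg[of "0 :: 'n torus"] by (simp add: tproj_zero)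

lemma torus_norm_triangle: "torus_norm (x + y) \<le> torus_norm x + torus_norm y"
proof (rule field_le_epsilon)
  fix e :: real assume e: "0 < e"
  obtain v where v: "tproj v = x" "norm v < torus_norm x + e/2"
    by (rule torus_norm_approx[of x "torus_norm x + e/2"]) (use e in auto)
  obtain w where w: "tproj w = y" "norm w < torus_norm y + e/2"
    by (rule torus_norm_approx[of y "torus_norm y + e/2"]) (use e in auto)
  have "torus_norm (x + y) \<le> norm (v + w)"
    using torus_norm_le[of "v + w"] v w by (simp add: tproj_add)
  also have "\<dots> \<le> norm v + norm w" by (rule norm_triangle_ineq)
  finally show "torus_norm (x + y) \<le> torus_norm x + torus_norm y + e"
    using v w by linarith
qed

lemma torus_norm_minus: "torus_norm (- x) = torus_norm x"
proof -
  have "torus_norm (- x) \<le> torus_norm x" for x :: "'a torus"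
  proof (rule field_le_epsilon)
    fix e :: real assume e: "0 < e"
    obtain v where v: "tproj v = x" "norm v < torus_norm x + e"
      by (rule torus_norm_approx[of x "torus_norm x + e"]) (use e in auto)
    then show "torus_norm (- x) \<le> torus_norm x + e"
      using torus_norm_le[of "- v"] by (simp add: tproj_minus)
  qed
  from this[of x] this[of "- x"] show ?thesis by simp
qed

lemma torus_norm_eq_zero:
  assumes "torus_norm x = 0" shows "x = 0"
proof (rule ccontr)
  assume x: "x \<noteq> 0"
  obtain v where v: "tproj v = x" "norm v < 1/2"
    by (rule torus_norm_approx[of x "1/2"]) (use assms in auto)
  have "v \<noteq> 0" using x v tproj_zero by auto
  then obtain w where w: "tproj w = x" "norm w < min (norm v) (1/2)"
    by (rule_tac torus_norm_approx[of x "min (norm v) (1/2)"]) (use assms in auto)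
  have "v $ i = w $ i" for i
  proof -
    have Z: "v $ i - w $ i \<in> \<int>" using v w tproj_eq_iff by metis
    have "\<bar>v $ i - w $ i\<bar> < 1"
      using component_le_norm_cart[of v i] component_le_norm_cart[of w i] v w by linarith
    with Z show ?thesis by (metis Ints_nonzero_abs_less1 eq_iff_diff_eq_0)
  qed
  then have "v = w" by (simp add: vec_eq_iff)
  with w show False by simp
qed

instantiation torus :: (finite) metric_space
begin

definition dist_torus :: "'a torus \<Rightarrow> 'a torus \<Rightarrow> real" where
  "dist_torus x y = torus_norm (x - y)"

definition uniformity_torus :: "('a torus \<times> 'a torus) filter" where
  "uniformity_torus = (INF e\<in>{0<..}. principal {(x, y). dist x y < e})"

definition open_torus :: "'a torus set \<Rightarrow> bool" where
  "open_torus U \<longleftrightarrow> (\<forall>x\<in>U. \<forall>\<^sub>F (x', y) in uniformity. x' = x \<longrightarrow> y \<in> U)"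

instance
proof
  fix x y z :: "'a torus"
  show "dist x y = 0 \<longleftrightarrow> x = y"
    using torus_norm_eq_zero[of "x - y"] by (auto simp: dist_torus_def torus_norm_zero)
  show "dist x y \<le> dist x z + dist y z"
    using torus_norm_triangle[of "x - z" "z - y"] torus_norm_minus[of "y - z"]
    by (simp add: dist_torus_def)
qed (rule uniformity_torus_def open_torus_def)+

end

lemma dist_torus_bounded: "dist x (y :: 'n::finite torus) \<le> CARD('n)"
proof -
  obtain u where u: "tproj u = x - y" using tproj_surj by blast
  define v :: "real^'n" where "v = (\<chi> i. frac (u $ i))"
  have "tproj v = tproj u"
    unfolding tproj_eq_iff by (simp add: v_def frac_def)
  then have "dist x y \<le> norm v"
    using torus_norm_le[of v] u by (simp add: dist_torus_def)
  also have "\<dots> \<le> (\<Sum>i\<in>UNIV. \<bar>v $ i\<bar>)" by (rule norm_le_l1_cart)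
  also have "\<dots> \<le> (\<Sum>i\<in>(UNIV::'n set). 1)"
    by (rule sum_mono) (simp add: v_def frac_lt_1 less_imp_le)
  finally show ?thesis by simp
qed

section \<open>Borel probability measures on the torus\<close>

typedef (overloaded) 'n tprob =
    "{M :: 'n::finite torus measure. prob_space M \<and> sets M = sets borel}"
  morphisms meas Abs_tprob
  by (rule exI[of _ "return borel 0"]) (simp add: prob_space_return)

lemma prob_space_meas: "prob_space (meas m)" and sets_meas: "sets (meas m) = sets borel"
  using meas[of m] by auto

lemma space_meas: "space (meas m) = UNIV"
  using sets_eq_imp_space_eq[OF sets_meas[of m]] by simp

lemma lipschitz_bound_torus:
  fixes \<phi> :: "'n::finite torus \<Rightarrow> real"
  assumes "L-lipschitz_on UNIV \<phi>"
  shows "\<bar>\<phi> x - \<phi> y\<bar> \<le> L * CARD('n)"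
proof -
  have "\<bar>\<phi> x - \<phi> y\<bar> \<le> L * dist x y"
    using lipschitz_onD[OF assms, of x y] by (simp add: dist_real_def)
  also have "\<dots> \<le> L * CARD('n)"
    using lipschitz_on_nonneg[OF assms] by (intro mult_left_mono dist_torus_bounded)
  finally show ?thesis .
qed

lemma borel_measurable_lipschitz_torus:
  fixes \<phi> :: "'n::finite torus \<Rightarrow> real"
  assumes "L-lipschitz_on UNIV \<phi>"
  shows "\<phi> \<in> borel_measurable (meas m)"
proof -
  have "continuous_on UNIV \<phi>" by (rule lipschitz_on_continuous_on[OF assms])
  then have "\<phi> \<in> borel_measurable borel" by (rule borel_measurable_continuous_onI)
  then show ?thesis unfolding measurable_cong_sets[OF sets_meas refl] .
qed

lemma integrable_lipschitz_torus:
  fixes \<phi> :: "'n::finite torus \<Rightarrow> real"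
  assumes "L-lipschitz_on UNIV \<phi>"
  shows "integrable (meas m) \<phi>"
proof -
  interpret prob_space "meas m" by (rule prob_space_meas)
  have b: "norm (\<phi> x) \<le> \<bar>\<phi> 0\<bar> + L * CARD('n)" for x
    using lipschitz_bound_torus[OF assms, of x 0] by simp
  show ?thesis
    by (rule integrable_const_bound[where B="\<bar>\<phi> 0\<bar> + L * CARD('n)"])
       (use b borel_measurable_lipschitz_torus[OF assms] in auto)
qed

definition kr_values :: "'n::finite tprob \<Rightarrow> 'n tprob \<Rightarrow> real set" where
  "kr_values \<mu> \<nu> = {integral\<^sup>L (meas \<mu>) \<phi> - integral\<^sup>L (meas \<nu>) \<phi> | \<phi>. 1-lipschitz_on UNIV \<phi>}"

lemma integral_lipschitz_bound:
  fixes \<phi> :: "'n::finite torus \<Rightarrow> real"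
  assumes "L-lipschitz_on UNIV \<phi>"
  shows "\<bar>integral\<^sup>L (meas m) \<phi> - \<phi> 0\<bar> \<le> L * CARD('n)"
proof -
  interpret prob_space "meas m" by (rule prob_space_meas)
  have "integral\<^sup>L (meas m) \<phi> - \<phi> 0 = integral\<^sup>L (meas m) (\<lambda>x. \<phi> x - \<phi> 0)"
    using integrable_lipschitz_torus[OF assms] by (simp add: prob_space)
  also have "\<bar>\<dots>\<bar> \<le> integral\<^sup>L (meas m) (\<lambda>x. \<bar>\<phi> x - \<phi> 0\<bar>)"
    by (rule integral_abs_bound)
  also have "\<dots> \<le> integral\<^sup>L (meas m) (\<lambda>x. L * CARD('n))"
    by (rule integral_mono)
       (use integrable_lipschitz_torus[OF assms] lipschitz_bound_torus[OF assms] in auto)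
  finally show ?thesis by (simp add: prob_space)
qed

lemma kr_values_bdd: "bdd_above (kr_values \<mu> (\<nu> :: 'n::finite tprob))"
proof (rule bdd_aboveI[of _ "2 * real CARD('n)"])
  fix r assume "r \<in> kr_values \<mu> \<nu>"
  then obtain \<phi> :: "'n torus \<Rightarrow> real" where
    \<phi>: "1-lipschitz_on UNIV \<phi>" "r = integral\<^sup>L (meas \<mu>) \<phi> - integral\<^sup>L (meas \<nu>) \<phi>"
    unfolding kr_values_def by auto
  show "r \<le> 2 * real CARD('n)"
    using integral_lipschitz_bound[OF \<phi>(1), of \<mu>] integral_lipschitz_bound[OF \<phi>(1), of \<nu>] \<phi>(2)
    by simp
qed

lemma zero_in_kr_values: "0 \<in> kr_values \<mu> \<nu>"
  unfolding kr_values_def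
  by (rule CollectI, rule exI[of _ "\<lambda>_. 0"]) (simp add: lipschitz_on_def)

lemma kr_values_commute: "kr_values \<mu> \<nu> = kr_values \<nu> \<mu>"
proof -
  have "kr_values \<mu> \<nu> \<subseteq> kr_values \<nu> \<mu>" for \<mu> \<nu> :: "'a tprob"
  proof
    fix r assume "r \<in> kr_values \<mu> \<nu>"
    then obtain \<phi> :: "'a torus \<Rightarrow> real" where
      \<phi>: "1-lipschitz_on UNIV \<phi>" "r = integral\<^sup>L (meas \<mu>) \<phi> - integral\<^sup>L (meas \<nu>) \<phi>"
      unfolding kr_values_def by auto
    have "1-lipschitz_on UNIV (\<lambda>x. - \<phi> x)"
      using \<phi>(1) by (simp add: lipschitz_on_def dist_minus)
    moreover have "r = integral\<^sup>L (meas \<nu>) (\<lambda>x. - \<phi> x) - integral\<^sup>L (meas \<mu>) (\<lambda>x. - \<phi> x)"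
      using \<phi>(2) by simp
    ultimately show "r \<in> kr_values \<nu> \<mu>" unfolding kr_values_def by blast
  qed
  then show ?thesis by blast
qed

lemma kr_values_scale:
  assumes "L-lipschitz_on UNIV \<phi>" "0 < L"
  shows "integral\<^sup>L (meas \<mu>) \<phi> - integral\<^sup>L (meas \<nu>) \<phi> \<le> L * Sup (kr_values \<mu> \<nu>)"
proof -
  have "1-lipschitz_on UNIV (\<lambda>x. \<phi> x / L)"
    using assms by (auto simp: lipschitz_on_def dist_real_def abs_divide
        diff_divide_distrib[symmetric] divide_le_eq mult.commute)
  then have "integral\<^sup>L (meas \<mu>) (\<lambda>x. \<phi> x / L) - integral\<^sup>L (meas \<nu>) (\<lambda>x. \<phi> x / L)
      \<le> Sup (kr_values \<mu> \<nu>)"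
    by (intro cSup_upper kr_values_bdd) (unfold kr_values_def, blast)
  then show ?thesis using assms
    by (simp add: diff_divide_distrib[symmetric] divide_le_eq mult.commute)
qed

lemma lipschitz_cutoff:
  fixes A :: "'a::metric_space set"
  shows "(real k)-lipschitz_on UNIV (\<lambda>x. max 0 (1 - real k * infdist x A))"
proof (rule lipschitz_onI)
  fix x y :: 'a
  have "\<bar>infdist x A - infdist y A\<bar> \<le> dist x y"
    using infdist_triangle_abs by blast
  then have "real k * \<bar>infdist x A - infdist y A\<bar> \<le> real k * dist x y"
    by (rule mult_left_mono) simp
  then have "\<bar>real k * infdist x A - real k * infdist y A\<bar> \<le> real k * dist x y"
    by (simp add: right_diff_distrib[symmetric] abs_mult)
  then show "dist (max 0 (1 - real k * infdist x A)) (max 0 (1 - real k * infdist y A))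
      \<le> real k * dist x y"
    unfolding dist_real_def by linarith
qed simp

lemma cutoff_tendsto_indicator:
  fixes A :: "'a::metric_space set"
  assumes "closed A" "A \<noteq> {}"
  shows "(\<lambda>k. max 0 (1 - real k * infdist x A)) \<longlonglongrightarrow> indicator A x"
proof (cases "x \<in> A")
  case True then show ?thesis by simp
next
  case False
  then have p: "infdist x A > 0"
    using assms in_closed_iff_infdist_zero[of A x] infdist_nonneg[of x A]
    by (simp add: less_le)
  obtain N :: nat where N: "1 / infdist x A < real N" using reals_Archimedean2 by blast
  have "max 0 (1 - real k * infdist x A) = indicator A x" if "k \<ge> N" for k
  proof -
    have "1 / infdist x A \<le> real k" using N that by (simp add: order_trans less_imp_le)
    then have "1 \<le> real k * infdist x A" using p by (simp add: divide_le_eq)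
    then show ?thesis using False by simp
  qed
  then show ?thesis
    by (intro tendsto_eventually) (auto simp: eventually_sequentially)
qed

lemma kr_eq_zero_imp_eq:
  fixes \<mu> \<nu> :: "'n::finite tprob"
  assumes "Sup (kr_values \<mu> \<nu>) = 0"
  shows "\<mu> = \<nu>"
proof -
  have eqL: "integral\<^sup>L (meas \<mu>) \<phi> = integral\<^sup>L (meas \<nu>) \<phi>"
    if "L-lipschitz_on UNIV \<phi>" for L and \<phi> :: "'n torus \<Rightarrow> real"
  proof -
    have L: "(max L 1)-lipschitz_on UNIV \<phi>" by (rule lipschitz_on_mono[OF that]) auto
    have p: "0 < max L 1" by simp
    show ?thesis
      using kr_values_scale[OF L p, of \<mu> \<nu>] kr_values_scale[OF L p, of \<nu> \<mu>] assms
      by (simp add: kr_values_commute[of \<nu> \<mu>])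
  qed
  have cl: "emeasure (meas \<mu>) A = emeasure (meas \<nu>) A" if A: "closed A" for A
  proof (cases "A = {}")
    case False
    have lim: "(\<lambda>k. integral\<^sup>L (meas m) (\<lambda>x. max 0 (1 - real k * infdist x A)))
        \<longlonglongrightarrow> measure (meas m) A" for m :: "'n tprob"
    proof -
      interpret prob_space "meas m" by (rule prob_space_meas)
      have Am: "A \<in> sets (meas m)" using A by (simp add: sets_meas)
      have "(\<lambda>k. integral\<^sup>L (meas m) (\<lambda>x. max 0 (1 - real k * infdist x A)))
          \<longlonglongrightarrow> integral\<^sup>L (meas m) (indicator A)"
      proof (rule integral_dominated_convergence[where w="\<lambda>_. 1"])
        show "indicator A \<in> borel_measurable (meas m)" using Am by simp
        show "(\<lambda>x. max 0 (1 - real k * infdist x A)) \<in> borel_measurable (meas m)" for k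
          by (rule borel_measurable_lipschitz_torus[OF lipschitz_cutoff])
        show "AE x in meas m. norm (max 0 (1 - real k * infdist x A)) \<le> 1" for k
          by (simp add: infdist_nonneg)
      qed (use cutoff_tendsto_indicator[OF A False] in auto)
      then show ?thesis using Am by simp
    qed
    have "measure (meas \<mu>) A = measure (meas \<nu>) A"
      using LIMSEQ_unique[OF lim[of \<mu>]] lim[of \<nu>] eqL[OF lipschitz_cutoff] by simp
    then show ?thesis
      using prob_space_meas[of \<mu>] prob_space_meas[of \<nu>]
      by (simp add: finite_measure.emeasure_eq_measure prob_space_def)
  qed simp
  have "meas \<mu> = meas \<nu>"
  proof (rule measure_eqI_generator_eq[where E="Collect closed" and A="\<lambda>_. UNIV" and \<Omega>=UNIV])
    show "Int_stable (Collect (closed :: 'n torus set \<Rightarrow> bool))"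
      by (auto simp: Int_stable_def)
    show "sets (meas \<mu>) = sigma_sets UNIV (Collect closed)"
      by (simp add: sets_meas borel_eq_closed)
    show "sets (meas \<nu>) = sigma_sets UNIV (Collect closed)"
      by (simp add: sets_meas borel_eq_closed)
    show "emeasure (meas \<mu>) UNIV \<noteq> \<infinity>"
      using prob_space.emeasure_space_1[OF prob_space_meas[of \<mu>]] by (simp add: space_meas)
  qed (use cl in auto)
  then show ?thesis by (simp add: meas_inject)
qed

text \<open>The supremum below is over a nonempty bounded set (\<open>kr_values_bdd\<close>), so it is the Kantorovich--Rubinstein
  distance.\<close>

instantiation tprob :: (finite) metric_space
begin

definition dist_tprob :: "'a tprob \<Rightarrow> 'a tprob \<Rightarrow> real" where
  "dist_tprob \<mu> \<nu> = Sup {integral\<^sup>L (meas \<mu>) \<phi> - integral\<^sup>L (meas \<nu>) \<phi> | \<phi>. 1-lipschitz_on UNIV \<phi>}"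

definition uniformity_tprob :: "('a tprob \<times> 'a tprob) filter" where
  "uniformity_tprob = (INF e\<in>{0<..}. principal {(x, y). dist x y < e})"

definition open_tprob :: "'a tprob set \<Rightarrow> bool" where
  "open_tprob U \<longleftrightarrow> (\<forall>x\<in>U. \<forall>\<^sub>F (x', y) in uniformity. x' = x \<longrightarrow> y \<in> U)"

instance
proof
  fix x y z :: "'a tprob"
  have d: "dist x y = Sup (kr_values x y)" for x y :: "'a tprob"
    by (simp add: dist_tprob_def kr_values_def)
  show "dist x y = 0 \<longleftrightarrow> x = y"
  proof
    assume "x = y"
    then have "kr_values x y = {0}" using zero_in_kr_values by (auto simp: kr_values_def)
    then show "dist x y = 0" by (simp add: d)
  next
    assume "dist x y = 0"
    then show "x = y" unfolding d by (rule kr_eq_zero_imp_eq)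
  qed
  show "dist x y \<le> dist x z + dist y z"
    unfolding d
  proof (rule cSup_least)
    show "kr_values x y \<noteq> {}" using zero_in_kr_values by blast
    fix r assume "r \<in> kr_values x y"
    then obtain \<phi> :: "'a torus \<Rightarrow> real" where
      \<phi>: "1-lipschitz_on UNIV \<phi>" "r = integral\<^sup>L (meas x) \<phi> - integral\<^sup>L (meas y) \<phi>"
      unfolding kr_values_def by auto
    have "integral\<^sup>L (meas x) \<phi> - integral\<^sup>L (meas z) \<phi> \<le> Sup (kr_values x z)"
      "integral\<^sup>L (meas z) \<phi> - integral\<^sup>L (meas y) \<phi> \<le> Sup (kr_values z y)"
      using kr_values_scale[OF \<phi>(1)] by simp_all
    then show "r \<le> Sup (kr_values x z) + Sup (kr_values y z)"
      using \<phi>(2) kr_values_commute[of z y] by simp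
  qed
qed (rule uniformity_tprob_def open_tprob_def)+

end

text \<open>\<open>mix t \<mu> \<nu>\<close> is \<open>(1 - t) \<mu> + t \<nu>\<close>; it is only meaningful for \<open>0 \<le> t \<le> 1\<close>.\<close>

definition mix :: "real \<Rightarrow> 'n::finite tprob \<Rightarrow> 'n tprob \<Rightarrow> 'n tprob" where
  "mix t \<mu> \<nu> = Abs_tprob (measure_of UNIV (sets borel)
     (\<lambda>A. ennreal (1 - t) * emeasure (meas \<mu>) A + ennreal t * emeasure (meas \<nu>) A))"

lemma
  fixes \<mu> \<nu> :: "'n::finite tprob"
  assumes t: "0 \<le> t" "t \<le> 1"
  shows meas_mix: "meas (mix t \<mu> \<nu>) = measure_of UNIV (sets borel)
      (\<lambda>A. ennreal (1 - t) * emeasure (meas \<mu>) A + ennreal t * emeasure (meas \<nu>) A)" (is "_ = ?M")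
    and emeasure_mix: "A \<in> sets borel \<Longrightarrow> emeasure (meas (mix t \<mu> \<nu>)) A =
      ennreal (1 - t) * emeasure (meas \<mu>) A + ennreal t * emeasure (meas \<nu>) A"
proof -
  let ?f = "\<lambda>A. ennreal (1 - t) * emeasure (meas \<mu>) A + ennreal t * emeasure (meas \<nu>) A"
  have ca: "countably_additive (sets borel) ?f"
  proof (rule countably_additiveI)
    fix A :: "nat \<Rightarrow> 'n torus set"
    assume A: "range A \<subseteq> sets borel" "disjoint_family A"
    have "(\<Sum>i. ?f (A i)) = ennreal (1 - t) * (\<Sum>i. emeasure (meas \<mu>) (A i))
        + ennreal t * (\<Sum>i. emeasure (meas \<nu>) (A i))"
      by (simp add: suminf_add[symmetric])
    then show "(\<Sum>i. ?f (A i)) = ?f (\<Union> (range A))"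
      using A by (simp add: suminf_emeasure sets_meas)
  qed
  have sa: "sigma_algebra UNIV (sets (borel :: 'n torus measure))"
    using sets.sigma_algebra_axioms[of "borel :: 'n torus measure"] by simp
  have em: "emeasure ?M A = ?f A" if "A \<in> sets borel" for A
    by (rule emeasure_measure_of_sigma[OF sa]) (use ca that in \<open>auto simp: positive_def\<close>)
  have s: "sets ?M = sets borel"
    using sigma_algebra.sets_measure_of_eq[OF sa] by simp
  have "emeasure ?M UNIV = ennreal (1 - t) + ennreal t"
    using prob_space.emeasure_space_1[OF prob_space_meas[of \<mu>]]
      prob_space.emeasure_space_1[OF prob_space_meas[of \<nu>]]
    by (simp add: em space_meas)
  also have "\<dots> = 1" using t by (simp flip: ennreal_plus)
  finally have "prob_space ?M"
    by (intro prob_spaceI) (simp add: space_measure_of_conv)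
  then show *: "meas (mix t \<mu> \<nu>) = ?M" unfolding mix_def by (intro Abs_tprob_inverse) (simp add: s)
  show "A \<in> sets borel \<Longrightarrow> emeasure (meas (mix t \<mu> \<nu>)) A = ?f A" using em * by simp
qed

section \<open>Derivatives with respect to the measure\<close>

definition flat_derivative ::
    "('n::finite tprob \<Rightarrow> real) \<Rightarrow> ('n tprob \<Rightarrow> 'n torus \<Rightarrow> real) \<Rightarrow> bool" where
  "flat_derivative \<Phi> D \<longleftrightarrow>
     continuous_on UNIV (\<lambda>(m, x). D m x) \<and>
     (\<forall>m\<^sub>1 m\<^sub>2. \<Phi> m\<^sub>2 - \<Phi> m\<^sub>1 =
        (LINT t:{0..1}|lborel. (\<integral>x. D (mix t m\<^sub>1 m\<^sub>2) x \<partial>meas m\<^sub>2) - (\<integral>x. D (mix t m\<^sub>1 m\<^sub>2) x \<partial>meas m\<^sub>1))) \<and>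
     (\<forall>m. (\<integral>x. D m x \<partial>meas m) = 0)"

text \<open>\<open>C\<^sup>2\<close>: the first derivative exists, each \<open>m \<mapsto> D m x\<close> is again \<open>C\<^sup>1\<close>, and the second
  derivative \<open>D2 m x y\<close> is jointly continuous.\<close>

definition C2_prob :: "('n::finite tprob \<Rightarrow> real) \<Rightarrow> bool" where
  "C2_prob \<Phi> \<longleftrightarrow> (\<exists>D D2. flat_derivative \<Phi> D \<and>
     (\<forall>x. flat_derivative (\<lambda>m. D m x) (\<lambda>m y. D2 m x y)) \<and>
     continuous_on UNIV (\<lambda>(m, x, y). D2 m x y))"

section \<open>Derivatives in space\<close>

text \<open>Regularity of a function on the torus is regularity of its periodic lift, i.e. of its
  composition with \<^const>\<open>tproj\<close>. Partial derivatives on the torus (\<open>tpd\<close>) are taken along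
  translations in the group; they agree with those of the lift.\<close>

primrec Ck :: "nat \<Rightarrow> ('a::euclidean_space \<Rightarrow> real) \<Rightarrow> bool" where
  "Ck 0 = (\<lambda>f. continuous_on UNIV f)"
| "Ck (Suc k) = (\<lambda>f. (\<forall>x. f differentiable (at x)) \<and>
     (\<forall>b\<in>Basis. Ck k (\<lambda>x. frechet_derivative f (at x) b)))"

definition pd :: "'n::finite \<Rightarrow> (real ^ 'n \<Rightarrow> real) \<Rightarrow> real ^ 'n \<Rightarrow> real" where
  "pd i f p = deriv (\<lambda>s. f (p + s *\<^sub>R axis i 1)) 0"

definition tpd :: "'n::finite \<Rightarrow> ('n torus \<Rightarrow> real) \<Rightarrow> 'n torus \<Rightarrow> real" where
  "tpd i f x = deriv (\<lambda>s. f (x + tproj (s *\<^sub>R axis i 1))) 0"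

definition tgrad :: "('n::finite torus \<Rightarrow> real) \<Rightarrow> 'n torus \<Rightarrow> real ^ 'n" where
  "tgrad f x = (\<chi> i. tpd i f x)"

definition thess :: "('n::finite torus \<Rightarrow> real) \<Rightarrow> 'n torus \<Rightarrow> real ^ 'n ^ 'n" where
  "thess f x = (\<chi> i j. tpd i (tpd j f) x)"

definition tlap :: "('n::finite torus \<Rightarrow> real) \<Rightarrow> 'n torus \<Rightarrow> real" where
  "tlap f x = (\<Sum>i\<in>UNIV. tpd i (tpd i f) x)"

definition twice_differentiable_torus :: "('n::finite torus \<Rightarrow> real) \<Rightarrow> bool" where
  "twice_differentiable_torus f \<longleftrightarrow>
     (\<forall>y. (\<lambda>z. f (tproj z)) differentiable (at y)) \<and>
     (\<forall>y. (\<lambda>z. tgrad f (tproj z)) differentiable (at y))"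

definition D_xx :: "('n::finite torus \<Rightarrow> real ^ 'n \<Rightarrow> real) \<Rightarrow> 'n torus \<Rightarrow> real ^ 'n \<Rightarrow> real ^ 'n ^ 'n" where
  "D_xx H x p = thess (\<lambda>z. H z p) x"

definition D_xp :: "('n::finite torus \<Rightarrow> real ^ 'n \<Rightarrow> real) \<Rightarrow> 'n torus \<Rightarrow> real ^ 'n \<Rightarrow> real ^ 'n ^ 'n" where
  "D_xp H x p = (\<chi> i j. tpd i (\<lambda>z. pd j (H z) p) x)"

definition D_pp :: "('n::finite torus \<Rightarrow> real ^ 'n \<Rightarrow> real) \<Rightarrow> 'n torus \<Rightarrow> real ^ 'n \<Rightarrow> real ^ 'n ^ 'n" where
  "D_pp H x p = (\<chi> i j. pd i (pd j (H x)) p)"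

section \<open>The control problem\<close>

definition H_star :: "('n::finite torus \<Rightarrow> real ^ 'n \<Rightarrow> real) \<Rightarrow> 'n torus \<Rightarrow> real ^ 'n \<Rightarrow> real" where
  "H_star H x q = (SUP p. p \<bullet> q - H x p)"

text \<open>The test functions are the elements of \<open>C\<^sub>c\<^sup>\<infinity>([0,\<infinity>) \<times> \<T>\<^sup>d)\<close>, represented by smooth
  extensions to \<open>\<real> \<times> \<T>\<^sup>d\<close>; they need not vanish at time \<open>0\<close>, and only their values for
  \<open>t \<ge> 0\<close> are used.\<close>

definition test_function :: "(real \<Rightarrow> 'n::finite torus \<Rightarrow> real) \<Rightarrow> bool" where
  "test_function \<phi> \<longleftrightarrow>
     (\<forall>k. Ck k (\<lambda>(t, y). \<phi> t (tproj y))) \<and>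
     (\<exists>T. \<forall>t\<ge>T. \<forall>x. \<phi> t x = 0)"

definition fokker_planck ::
    "(real \<Rightarrow> 'n::finite tprob) \<Rightarrow> (real \<Rightarrow> 'n torus \<Rightarrow> real ^ 'n) \<Rightarrow> 'n tprob \<Rightarrow> bool" where
  "fokker_planck m \<alpha> m\<^sub>0 \<longleftrightarrow>
     m 0 = m\<^sub>0 \<and>
     (\<forall>\<phi>. test_function \<phi> \<longrightarrow>
        (\<integral>x. \<phi> 0 x \<partial>meas m\<^sub>0) +
        (LINT t:{0..}|lborel.
           \<integral>x. deriv (\<lambda>s. \<phi> s x) t + tlap (\<phi> t) x - \<alpha> t x \<bullet> tgrad (\<phi> t) x \<partial>meas (m t)) = 0)"

definition admissible ::
    "real \<Rightarrow> 'n::finite tprob \<Rightarrow> (real \<Rightarrow> 'n tprob) \<Rightarrow> (real \<Rightarrow> 'n torus \<Rightarrow> real ^ 'n) \<Rightarrow> bool" where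
  "admissible \<delta> m\<^sub>0 m \<alpha> \<longleftrightarrow>
     continuous_on {0..} m \<and>
     (\<lambda>(t, x). \<alpha> t x) \<in> borel_measurable (restrict_space borel ({0..} \<times> UNIV)) \<and>
     (\<integral>\<^sup>+t\<in>{0..}. ennreal (exp (- \<delta> * t)) * (\<integral>\<^sup>+x. ennreal ((norm (\<alpha> t x))\<^sup>2) \<partial>meas (m t)) \<partial>lborel) < \<infinity> \<and>
     fokker_planck m \<alpha> m\<^sub>0"

text \<open>Under the standing growth assumptions \<open>H_star H x q\<close> is bounded above and below by
  quadratic functions of \<open>q\<close>, and \<open>\<F>\<close> is bounded, so for admissible pairs the integrals below
  converge absolutely and the infimum is over a nonempty set that is bounded below.\<close>

definition cost ::
    "('n::finite torus \<Rightarrow> real ^ 'n \<Rightarrow> real) \<Rightarrow> ('n tprob \<Rightarrow> real) \<Rightarrow> real \<Rightarrow>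
     (real \<Rightarrow> 'n tprob) \<Rightarrow> (real \<Rightarrow> 'n torus \<Rightarrow> real ^ 'n) \<Rightarrow> real" where
  "cost H \<F> \<delta> m \<alpha> = (LINT t:{0..}|lborel.
     exp (- \<delta> * t) * ((\<integral>x. H_star H x (\<alpha> t x) \<partial>meas (m t)) + \<F> (m t)))"

definition value_fun ::
    "('n::finite torus \<Rightarrow> real ^ 'n \<Rightarrow> real) \<Rightarrow> ('n tprob \<Rightarrow> real) \<Rightarrow> real \<Rightarrow> 'n tprob \<Rightarrow> real" where
  "value_fun H \<F> \<delta> m\<^sub>0 = Inf {cost H \<F> \<delta> m \<alpha> | m \<alpha>. admissible \<delta> m\<^sub>0 m \<alpha>}"

end

theory Submission
  imports Defs "HOL-Complex_Analysis.Great_Picard" "HOL-Real_Asymp.Real_Asymp"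
begin

text \<open>
  The theorem rests on one estimate, \<open>value_diff_le\<close>, whose constant does not depend on the discount:
  if \<open>v\<close> is the displacement in a coupling of \<open>\<mu>\<close> and \<open>\<nu>\<close>, then for \<open>0 < \<tau> \<le> 1\<close> the value at \<open>\<mu>\<close> exceeds
  the value at \<open>\<nu>\<close> by at most a multiple of \<open>E |v|\<^sup>2 / \<tau> + sqrt \<tau> * (1 + R)\<close>, where \<open>R\<close> bounds the
  oscillation of the value function.

  To see this, let a particle start from \<open>\<mu>\<close>, move with constant velocity \<open>v / \<tau>\<close> and diffuse. At time
  \<open>\<tau>\<close> its law is \<open>\<nu>\<close> smeared by a Gaussian of variance \<open>2 \<tau>\<close>, and the cost so far is of order
  \<open>\<tau> + E |v|\<^sup>2 / \<tau>\<close> (\<open>ito\<close>, \<open>steering\<close>). The velocity depends on the whole coupling and not only on time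
  and position, but its conditional expectation does, and passing to it preserves the laws and does
  not increase the convex cost (\<open>relaxed_to_feedback\<close>). From time \<open>\<tau>\<close> on the particle follows a nearly
  optimal evolution for \<open>\<nu>\<close>, translated by \<open>sqrt (2 \<tau>) exp (- t) z\<close> with a Gaussian \<open>z\<close>
  (\<open>cost_from_smeared\<close>). The translation costs \<open>sqrt \<tau>\<close> times the kinetic energy with weight
  \<open>exp (- t)\<close>, and dynamic programming bounds this energy by the oscillation of the value function
  (\<open>shift_admissible\<close>, \<open>early_energy_le\<close>).

  For the product coupling and a small fixed \<open>\<tau>\<close> the term with \<open>R\<close> is absorbed, so the oscillation is
  bounded uniformly in the discount (\<open>osc_bound\<close>). Then choosing first \<open>\<tau>\<close> and then \<open>E |v|\<^sup>2\<close> small gives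
  equicontinuity. As the measures fall into finitely many classes any two members of which have a
  coupling with small displacement (\<open>finite_coupling_classes\<close>), the Arzela-Ascoli argument yields a
  uniformly convergent subsequence of the normalised value functions. Along a further subsequence
  the discount times the value at \<open>\<eta>\<close> converges, and the discount times the oscillation tends to
  \<open>0\<close>, so the limit is the same at every measure.

  These arguments take place in the locale \<open>control_problem\<close>: \<open>H\<close> grows quadratically and is
  Lipschitz in space with a constant of order \<open>1 + |p|\<^sup>2\<close>, and \<open>\<F>\<close> is bounded and Lipschitz. These bounds follow
  from those on the second derivatives (\<open>hamiltonian_bounds\<close>, \<open>lipschitz_of_thess_bound\<close>,
  \<open>flat_derivative_Lipschitz\<close>).
\<close>

lemmas integrable_dominated = Bochner_Integration.integrable_bound
lemmas Lebesgue_integral_cong = Bochner_Integration.integral_cong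

section \<open>Topology of the torus\<close>

lemma dist_torus_tproj_le: "dist (tproj u) (tproj v) \<le> norm (u - v)"
proof -
  have "tproj u - tproj v = tproj (u - v)"
    by (simp add: minus_torus_def flip: tproj_add tproj_minus)
  then show ?thesis
    unfolding dist_torus_def using torus_norm_le[of "u - v"] by simp
qed

lemma dist_torus_add_le: "dist (x + tproj u) (x + tproj v) \<le> norm (u - v)"
  using dist_torus_tproj_le[of u v] by (simp add: dist_torus_def)

lemma dist_torus_shift_le: "dist (x + tproj u) x \<le> norm u"
  using dist_torus_add_le[of x u 0] by (simp add: tproj_zero)

lemma dist_torus_translate: "dist (x + a) (y + a) = dist x (y :: 'n::finite torus)"
  by (simp add: dist_torus_def)

lemma tproj_lipschitz: "1-lipschitz_on UNIV (tproj :: real^'n::finite \<Rightarrow> _)"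
  by (rule lipschitz_onI) (use dist_torus_tproj_le in \<open>auto simp: dist_norm\<close>)

lemma continuous_on_tproj [continuous_intros]:
  "continuous_on A f \<Longrightarrow> continuous_on A (\<lambda>x. tproj (f x))"
  using continuous_on_compose2[OF lipschitz_on_continuous_on[OF tproj_lipschitz], of A f] by simp

lemma open_tproj_image:
  fixes U :: "(real^'n::finite) set"
  assumes "open U" shows "open (tproj ` U)"
  unfolding open_dist
proof (intro ballI)
  fix x assume "x \<in> tproj ` U"
  then obtain u where u: "u \<in> U" "x = tproj u" by auto
  obtain e where e: "e > 0" "\<And>w. dist w u < e \<Longrightarrow> w \<in> U"
    using assms u(1) unfolding open_dist by blast
  have "y \<in> tproj ` U" if d: "dist y x < e" for y
  proof -
    obtain v where v: "tproj v = y - x" "norm v < e"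
      by (rule torus_norm_approx[of "y - x" e]) (use d in \<open>simp add: dist_torus_def\<close>)
    have "y = tproj (u + v)" using u v by (simp add: tproj_add)
    moreover have "u + v \<in> U" using e(2)[of "u + v"] v by (simp add: dist_norm)
    ultimately show ?thesis by blast
  qed
  then show "\<exists>e>0. \<forall>y. dist y x < e \<longrightarrow> y \<in> tproj ` U" using e by blast
qed

instance torus :: (finite) second_countable_topology
proof
  obtain B :: "(real^'a) set set" where B: "countable B" "topological_basis B"
    using ex_countable_basis by blast
  let ?B = "(\<lambda>b. tproj ` b) ` B"
  have "topological_basis ?B"
  proof (rule topological_basisI)
    fix b assume "b \<in> ?B" then show "open b"
      using B(2) open_tproj_image topological_basis_open by blast
  next
    fix U :: "'a torus set" and x assume U: "open U" "x \<in> U"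
    obtain u where u: "tproj u = x" using tproj_surj by blast
    have "open (tproj -` U)"
      by (rule open_vimage[OF U(1)]) (intro continuous_on_tproj continuous_on_id)
    moreover have "u \<in> tproj -` U" using u U(2) by simp
    ultimately obtain b where b: "b \<in> B" "u \<in> b" "b \<subseteq> tproj -` U"
      using topological_basisE[OF B(2)] by metis
    then show "\<exists>b\<in>?B. x \<in> b \<and> b \<subseteq> U"
      using u by (intro bexI[of _ "tproj ` b"]) auto
  qed
  then have "open = generate_topology ?B"
    by (rule topological_basis_imp_subbasis)
  then show "\<exists>B::'a torus set set. countable B \<and> open = generate_topology B"
    using B(1) by blast
qed

lemma continuous_on_torus_plus [continuous_intros]:
  fixes f g :: "'a::topological_space \<Rightarrow> 'n::finite torus"
  assumes "continuous_on A f" "continuous_on A g"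
  shows "continuous_on A (\<lambda>x. f x + g x)"
proof -
  have "continuous_on UNIV (\<lambda>p :: 'n torus \<times> 'n torus. fst p + snd p)"
    unfolding continuous_on_iff
  proof (intro ballI allI impI)
    fix p :: "'n torus \<times> 'n torus" and e :: real assume e: "0 < e"
    have "dist (fst q + snd q) (fst p + snd p) < e" if "dist q p < e/2" for q
    proof -
      have "dist (fst q + snd q) (fst p + snd p) \<le>
          dist (fst q + snd q) (fst p + snd q) + dist (fst p + snd q) (fst p + snd p)"
        by (rule dist_triangle)
      also have "\<dots> = dist (fst q) (fst p) + dist (snd q) (snd p)"
        by (simp add: dist_torus_def)
      also have "\<dots> < e"
        using dist_fst_le[of q p] dist_snd_le[of q p] that by linarith
      finally show ?thesis .
    qed
    then show "\<exists>d>0. \<forall>q\<in>UNIV. dist q p < d \<longrightarrow> dist (fst q + snd q) (fst p + snd p) < e"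
      using e by (intro exI[of _ "e/2"]) auto
  qed
  from continuous_on_compose2[OF this, of A "\<lambda>x. (f x, g x)"] show ?thesis
    using continuous_on_Pair[OF assms] by simp
qed

lemma measurable_tproj [measurable]: "tproj \<in> borel_measurable borel"
  by (intro borel_measurable_continuous_onI continuous_intros)

lemma measurable_torus_plus [measurable (raw)]:
  fixes f g :: "'a \<Rightarrow> 'n::finite torus"
  assumes [measurable]: "f \<in> borel_measurable M" "g \<in> borel_measurable M"
  shows "(\<lambda>x. f x + g x) \<in> borel_measurable M"
  by (rule borel_measurable_continuous_Pair[OF assms])
     (intro continuous_on_torus_plus continuous_on_fst continuous_on_snd continuous_on_id)

text \<open>A measurable choice of representatives: the difference of the representatives of two points is a bounded
  displacement that carries one to the other.\<close>

definition cube_rep :: "'n::finite torus \<Rightarrow> real^'n" where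
  "cube_rep x = (\<chi> i. frac (rep_torus x $ i))"

lemma tproj_cube_rep [simp]: "tproj (cube_rep x) = x"
proof -
  have "tproj (cube_rep x) = tproj (rep_torus x)"
    unfolding tproj_eq_iff by (simp add: cube_rep_def frac_def)
  also have "\<dots> = x" by (rule Quotient3_abs_rep[OF Quotient3_torus])
  finally show ?thesis .
qed

lemma cube_rep_bounds: "0 \<le> cube_rep x $ i" "cube_rep x $ i < 1"
  by (simp_all add: cube_rep_def frac_lt_1)

lemma cube_rep_tproj: "cube_rep (tproj v) $ i = frac (v $ i)"
proof -
  have "tproj (cube_rep (tproj v)) = tproj v" by simp
  then have "cube_rep (tproj v) $ i - v $ i \<in> \<int>" unfolding tproj_eq_iff by blast
  then have "v $ i - cube_rep (tproj v) $ i \<in> \<int>" using Ints_minus[of "cube_rep (tproj v) $ i - v $ i"] by simp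
  then have "frac (v $ i) = cube_rep (tproj v) $ i"
    unfolding frac_unique_iff using cube_rep_bounds by blast
  then show ?thesis by simp
qed

lemma norm_le_of_components:
  fixes v :: "real^'n::finite"
  assumes "\<And>i. \<bar>v $ i\<bar> \<le> c" shows "norm v \<le> real CARD('n) * c"
proof -
  have "norm v \<le> (\<Sum>i\<in>UNIV. \<bar>v $ i\<bar>)" by (rule norm_le_l1_cart)
  also have "\<dots> \<le> (\<Sum>i\<in>(UNIV::'n set). c)" using assms by (intro sum_mono)
  finally show ?thesis by simp
qed

lemma norm_cube_rep_diff: "norm (cube_rep x - cube_rep (y :: 'n::finite torus)) \<le> CARD('n)"
proof -
  have "\<bar>(cube_rep x - cube_rep y) $ i\<bar> \<le> 1" for i
    using cube_rep_bounds[of x i] cube_rep_bounds[of y i] by (simp add: abs_le_iff)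
  from norm_le_of_components[OF this] show ?thesis by simp
qed

lemma compact_torus: "compact (UNIV :: 'n::finite torus set)"
proof -
  have "(UNIV :: 'n torus set) = tproj ` cbox 0 1"
  proof (intro equalityI subsetI)
    fix x :: "'n torus"
    have "cube_rep x \<in> cbox 0 1"
      using cube_rep_bounds[of x] by (auto simp: mem_box_cart less_imp_le)
    then show "x \<in> tproj ` cbox 0 1" by (metis imageI tproj_cube_rep)
  qed simp
  also have "compact \<dots>"
    by (intro compact_continuous_image continuous_intros compact_cbox)
  finally show ?thesis .
qed

text \<open>The half-open cube is a countable union of compact sets, so preimages of closed sets under
  \<^const>\<open>cube_rep\<close> are countable unions of compact images.\<close>

lemma measurable_cube_rep [measurable]:
  "(cube_rep :: 'n::finite torus \<Rightarrow> _) \<in> borel_measurable borel"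
proof (rule measurable_sigma_sets[OF _ _ ])
  show "sets (borel :: (real^'n) measure) = sigma_sets UNIV (Collect closed)"
    by (simp add: borel_eq_closed)
  fix A :: "(real^'n) set" assume "A \<in> Collect closed"
  then have A: "closed A" by simp
  have *: "cube_rep -` A \<inter> space borel = (\<Union>k::nat. tproj ` (A \<inter> cbox 0 (\<chi> i. 1 - 1 / Suc k)))"
  proof (intro equalityI subsetI)
    fix x :: "'n torus" assume x: "x \<in> cube_rep -` A \<inter> space borel"
    have "\<forall>i. \<exists>k::nat. 1 / Suc k < 1 - cube_rep x $ i"
    proof
      fix i
      have "0 < 1 - cube_rep x $ i" using cube_rep_bounds(2)[of x i] by simp
      from reals_Archimedean[OF this] show "\<exists>k::nat. 1 / Suc k < 1 - cube_rep x $ i"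
        by (simp add: inverse_eq_divide)
    qed
    then obtain k :: "'n \<Rightarrow> nat" where k: "\<And>i. 1 / Suc (k i) < 1 - cube_rep x $ i" by metis
    define K where "K = Max (range k)"
    have "cube_rep x $ i \<le> 1 - 1 / Suc K" for i
    proof -
      have "k i \<le> K" unfolding K_def by (intro Max_ge) auto
      then have "1 / real (Suc K) \<le> 1 / Suc (k i)" by (intro divide_left_mono) auto
      then show ?thesis using k[of i] by linarith
    qed
    then have "cube_rep x \<in> A \<inter> cbox 0 (\<chi> i. 1 - 1 / Suc K)"
      using x cube_rep_bounds[of x] by (auto simp: mem_box_cart)
    then show "x \<in> (\<Union>k::nat. tproj ` (A \<inter> cbox 0 (\<chi> i. 1 - 1 / Suc k)))"
      by (intro UN_I[of K] image_eqI[of _ _ "cube_rep x"]) auto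
  next
    fix x assume "x \<in> (\<Union>k::nat. tproj ` (A \<inter> cbox 0 (\<chi> i. 1 - 1 / Suc k)))"
    then obtain k :: nat and v where v: "x = tproj v" "v \<in> A" "v \<in> cbox 0 (\<chi> i. 1 - 1 / Suc k)"
      by blast
    have "cube_rep x $ i = v $ i" for i
    proof -
      have "0 \<le> v $ i" "v $ i \<le> 1 - 1 / Suc k" using v(3) by (auto simp: mem_box_cart)
      moreover have "1 / real (Suc k) > 0" by simp
      ultimately have "frac (v $ i) = v $ i" by (subst frac_eq) linarith
      then show ?thesis using v(1) cube_rep_tproj by metis
    qed
    then have "cube_rep x = v" by (simp add: vec_eq_iff)
    then show "x \<in> cube_rep -` A \<inter> space borel" using v by simp
  qed
  show "cube_rep -` A \<inter> space borel \<in> sets borel"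
    unfolding * 
  proof (intro sets.countable_UN image_subsetI)
    fix k :: nat show "tproj ` (A \<inter> cbox 0 (\<chi> i. 1 - 1 / Suc k)) \<in> sets borel"
    by (intro borel_compact compact_continuous_image continuous_intros closed_Int_compact A compact_cbox)
  qed
qed auto

section \<open>Lipschitz bounds from second derivatives\<close>

lemma has_derivative_imp_DERIV_line:
  fixes f :: "'a::real_normed_vector \<Rightarrow> 'b::real_normed_vector"
  assumes "(f has_derivative f') (at (y + s *\<^sub>R v))"
  shows "((\<lambda>s. f (y + s *\<^sub>R v)) has_vector_derivative f' v) (at s)"
proof -
  have "((\<lambda>s. y + s *\<^sub>R v) has_derivative (\<lambda>h. h *\<^sub>R v)) (at s)"
    by (auto intro!: derivative_eq_intros)
  from has_derivative_compose[OF this assms]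
  have "((\<lambda>s. f (y + s *\<^sub>R v)) has_derivative (\<lambda>h. f' (h *\<^sub>R v))) (at s)" by simp
  moreover have "linear f'" using assms has_derivative_linear by blast
  ultimately show ?thesis
    unfolding has_vector_derivative_def by (simp add: linear_scale)
qed

lemma tpd_lift: "tpd i f (tproj y) = deriv (\<lambda>s. f (tproj (y + s *\<^sub>R axis i 1))) 0"
  by (simp add: tpd_def tproj_add)

lemma tpd_DERIV:
  fixes f :: "'n::finite torus \<Rightarrow> real"
  assumes "\<forall>y. (\<lambda>z. f (tproj z)) differentiable (at y)"
  shows "((\<lambda>s. f (x + tproj (s *\<^sub>R axis i 1))) has_real_derivative tpd i f (x + tproj (s *\<^sub>R axis i 1))) (at s)"
proof -
  obtain y where y: "tproj y = x" using tproj_surj by blast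
  obtain f' where f': "((\<lambda>z. f (tproj z)) has_derivative f') (at (y + s *\<^sub>R axis i 1))"
    using assms unfolding differentiable_def by blast
  have d: "((\<lambda>s. f (x + tproj (s *\<^sub>R axis i 1))) has_real_derivative f' (axis i 1)) (at s)"
    using has_derivative_imp_DERIV_line[OF f'] y
    by (simp add: tproj_add has_real_derivative_iff_has_vector_derivative)
  have "((\<lambda>r. f (x + tproj ((s + r) *\<^sub>R axis i 1))) has_real_derivative f' (axis i 1)) (at 0)"
    using d DERIV_shift[of "\<lambda>s. f (x + tproj (s *\<^sub>R axis i 1))" "f' (axis i 1)" 0 s]
    by (simp add: add.commute)
  then have "tpd i f (x + tproj (s *\<^sub>R axis i 1)) = f' (axis i 1)"
    unfolding tpd_def by (intro DERIV_imp_deriv) (simp add: tproj_add scaleR_left_distrib add.assoc)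
  with d show ?thesis by simp
qed

text \<open>Along a coordinate circle a differentiable function has a critical point, so a bound on its
  second derivative bounds the first one.\<close>

lemma tpd_bound:
  fixes f :: "'n::finite torus \<Rightarrow> real" and K :: real
  assumes f: "twice_differentiable_torus f" and K: "\<And>x. norm (thess f x) \<le> K"
  shows "\<bar>tpd i f x\<bar> \<le> K"
proof -
  let ?c = "\<lambda>s. x + tproj (s *\<^sub>R axis i (1::real))"
  have f1: "\<forall>y. (\<lambda>z. f (tproj z)) differentiable (at y)"
    and f2: "\<forall>y. (\<lambda>z. tgrad f (tproj z)) differentiable (at y)"
    using f unfolding twice_differentiable_torus_def by blast+
  have f2': "\<forall>y. (\<lambda>z. tpd i f (tproj z)) differentiable (at y)"
  proof
    fix y
    obtain D where "((\<lambda>z. tgrad f (tproj z)) has_derivative D) (at y)"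
      using f2 unfolding differentiable_def by blast
    then have "((\<lambda>z. tgrad f (tproj z) $ i) has_derivative (\<lambda>h. D h $ i)) (at y)"
      by (rule bounded_linear.has_derivative[OF bounded_linear_vec_nth])
    then show "(\<lambda>z. tpd i f (tproj z)) differentiable (at y)"
      unfolding differentiable_def tgrad_def by auto
  qed
  have d1: "((\<lambda>s. f (?c s)) has_real_derivative tpd i f (?c s)) (at s)" for s
    by (rule tpd_DERIV[OF f1])
  have d2: "((\<lambda>s. tpd i f (?c s)) has_real_derivative tpd i (tpd i f) (?c s)) (at s)" for s
    by (rule tpd_DERIV[OF f2'])
  have per: "?c 1 = ?c 0"
    by (simp, simp add: tproj_zero[symmetric] tproj_eq_iff axis_def)
  obtain z where z: "0 < z" "z < 1" "tpd i f (?c z) = 0"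
  proof -
    have "\<exists>z. z > 0 \<and> z < (1::real) \<and> ((\<lambda>s. f (?c s)) has_real_derivative 0) (at z)"
    proof (rule Rolle)
      show "continuous_on {0..1} (\<lambda>s. f (?c s))"
        using d1 by (intro DERIV_continuous_on[where D="\<lambda>s. tpd i f (?c s)"]) (rule has_field_derivative_at_within)
      show "(\<lambda>s. f (?c s)) differentiable at s" for s
        using d1 real_differentiable_def by blast
    qed (use per in auto)
    then show ?thesis using that DERIV_unique[OF d1] by blast
  qed
  have bd: "\<bar>tpd i (tpd i f) w\<bar> \<le> K" for w
  proof -
    have "\<bar>thess f w $ i $ i\<bar> \<le> norm (thess f w $ i)" by (rule component_le_norm_cart)
    also have "\<dots> \<le> norm (thess f w)" by (rule Finite_Cartesian_Product.norm_nth_le)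
    finally show ?thesis using K[of w] by (simp add: thess_def)
  qed
  have "\<exists>w. 0 < w \<and> w < z \<and> tpd i f (?c z) - tpd i f (?c 0) = (z - 0) * tpd i (tpd i f) (?c w)"
    by (rule MVT2[OF z(1)]) (rule d2)
  then obtain w where "tpd i f (?c z) - tpd i f (?c 0) = z * tpd i (tpd i f) (?c w)" by auto
  then have "tpd i f (?c 0) = - z * tpd i (tpd i f) (?c w)" using z(3) by linarith
  then have "\<bar>tpd i f (?c 0)\<bar> = z * \<bar>tpd i (tpd i f) (?c w)\<bar>" using z(1) by (simp add: abs_mult)
  also have "\<dots> \<le> 1 * K" using z bd by (intro mult_mono) auto
  finally show ?thesis by (simp add: tproj_zero)
qed

lemma lipschitz_on_torusI:
  fixes f :: "'n::finite torus \<Rightarrow> real" and M :: real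
  assumes f: "\<And>y w. \<bar>f (tproj y) - f (tproj w)\<bar> \<le> M * norm (y - w)" and M0: "0 \<le> M"
  shows "M-lipschitz_on UNIV f"
proof (rule lipschitz_onI)
  fix x y :: "'n torus"
  show "dist (f x) (f y) \<le> M * dist x y"
  proof (rule field_le_epsilon)
    fix e :: real assume e: "0 < e"
    obtain v where v: "tproj v = x - y" "norm v < torus_norm (x - y) + e / (M + 1)"
      by (rule torus_norm_approx[of "x - y" "torus_norm (x - y) + e / (M + 1)"]) (use e M0 in auto)
    obtain w where w: "tproj w = y" using tproj_surj by blast
    have "dist (f x) (f y) \<le> M * norm v"
      using f[of "w + v" w] v(1) w by (simp add: tproj_add dist_real_def)
    also have "\<dots> \<le> M * (dist x y + e / (M + 1))"
      using v(2) M0 by (intro mult_left_mono) (auto simp: dist_torus_def)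
    also have "\<dots> = M * dist x y + e * (M / (M + 1))" by (simp add: algebra_simps)
    also have "\<dots> \<le> M * dist x y + e"
      using e M0 by (intro add_left_mono mult_left_le) auto
    finally show "dist (f x) (f y) \<le> M * dist x y + e" .
  qed
qed (rule M0)

lemma lipschitz_of_thess_bound:
  fixes f :: "'n::finite torus \<Rightarrow> real" and K :: real
  assumes f: "twice_differentiable_torus f" and K: "\<And>x. norm (thess f x) \<le> K"
  shows "(CARD('n) * K)-lipschitz_on UNIV f"
proof -
  have K0: "0 \<le> K" using K[of 0] norm_ge_zero order_trans by blast
  have f1: "(\<lambda>z. f (tproj z)) differentiable (at y)" for y
    using f unfolding twice_differentiable_torus_def by blast
  define D where "D y = frechet_derivative (\<lambda>z. f (tproj z)) (at y)" for y
  have D: "((\<lambda>z. f (tproj z)) has_derivative D y) (at y)" for y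
    using f1 unfolding D_def by (simp add: frechet_derivative_works)
  have Dax: "D y (axis i 1) = tpd i f (tproj y)" for y i
  proof -
    have "((\<lambda>s. f (tproj (y + s *\<^sub>R axis i 1))) has_real_derivative D y (axis i 1)) (at 0)"
      using has_derivative_imp_DERIV_line[of "\<lambda>z. f (tproj z)" "D y" y 0 "axis i 1"] D[of y]
      by (simp add: has_real_derivative_iff_has_vector_derivative)
    then show ?thesis unfolding tpd_lift by (simp add: DERIV_imp_deriv)
  qed
  have on: "onorm (D y) \<le> CARD('n) * K" for y
  proof (rule onorm_le)
    fix h :: "real^'n"
    have lin: "linear (D y)" using D has_derivative_linear by blast
    have "D y h = D y (\<Sum>i\<in>UNIV. h $ i *\<^sub>R axis i 1)"
      by (simp add: basis_expansion scalar_mult_eq_scaleR[symmetric])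
    also have "\<dots> = (\<Sum>i\<in>UNIV. h $ i * tpd i f (tproj y))"
      by (simp add: linear_sum[OF lin] linear_scale[OF lin] Dax)
    finally have "norm (D y h) \<le> (\<Sum>i\<in>UNIV. \<bar>h $ i * tpd i f (tproj y)\<bar>)"
      by (simp add: sum_abs)
    also have "\<dots> \<le> (\<Sum>i\<in>(UNIV::'n set). norm h * K)"
      unfolding abs_mult by (intro sum_mono mult_mono component_le_norm_cart tpd_bound[OF f K]) auto
    finally show "norm (D y h) \<le> CARD('n) * K * norm h" by (simp add: mult.commute mult.left_commute)
  qed
  show ?thesis
  proof (rule lipschitz_on_torusI)
    show "\<bar>f (tproj y) - f (tproj w)\<bar> \<le> CARD('n) * K * norm (y - w)" for y w :: "real^'n"
      using differentiable_bound[of UNIV "\<lambda>z. f (tproj z)" D "CARD('n) * K" y w] D on by simp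
  qed (use K0 in simp)
qed

section \<open>The standard Gaussian\<close>

definition gauss1 :: "real measure" where
  "gauss1 = density lborel std_normal_density"

definition gauss :: "(real^'n::finite) measure" where
  "gauss = distr (PiM UNIV (\<lambda>_. gauss1)) borel (\<lambda>f. \<chi> i. f i)"

lemma gauss1: "prob_space gauss1" "sets gauss1 = sets borel" "space gauss1 = UNIV"
  using prob_space_normal_density[of 1 0] by (simp_all add: gauss1_def)

lemma measurable_gauss_vec:
  "(\<lambda>f. \<chi> i. f i) \<in> PiM UNIV (\<lambda>_. gauss1) \<rightarrow>\<^sub>M (borel :: (real^'n::finite) measure)"
proof (subst borel_measurable_euclidean_space, intro ballI)
  fix b :: "real^'n" assume "b \<in> Basis"
  then obtain i where b: "b = axis i 1" unfolding Basis_vec_def by auto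
  have "(\<lambda>f. f i) \<in> PiM UNIV (\<lambda>_. gauss1) \<rightarrow>\<^sub>M gauss1" by measurable
  then have "(\<lambda>f. f i) \<in> borel_measurable (PiM UNIV (\<lambda>_. gauss1))"
    using measurable_cong_sets[OF refl gauss1(2)] by blast
  then show "(\<lambda>f. (\<chi> i. f i) \<bullet> b) \<in> borel_measurable (PiM UNIV (\<lambda>_. gauss1))"
    by (simp add: b inner_axis)
qed

lemma prob_space_gauss: "prob_space gauss"
proof -
  interpret prob_space gauss1 by (rule gauss1)
  interpret product_prob_space "\<lambda>_. gauss1" UNIV by unfold_locales
  show ?thesis unfolding gauss_def
    by (rule prob_space_distr[OF measurable_gauss_vec])
qed

lemma sets_gauss [measurable_cong]: "sets gauss = sets borel" and space_gauss [simp]: "space gauss = UNIV"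
  by (simp_all add: gauss_def)

lemma gauss1_integration_by_parts:
  fixes h h' :: "real \<Rightarrow> real"
  assumes d: "\<And>x. (h has_real_derivative h' x) (at x)" and c: "continuous_on UNIV h'"
    and b: "\<And>x. \<bar>h x\<bar> \<le> B" "\<And>x. \<bar>h' x\<bar> \<le> B"
  shows "(\<integral>x. x * h x \<partial>gauss1) = (\<integral>x. h' x \<partial>gauss1)"
    and "integrable gauss1 (\<lambda>x. x * h x)"
proof -
  let ?\<phi> = std_normal_density
  have ch: "continuous_on UNIV h"
    by (rule DERIV_continuous_on[where D=h']) (rule has_field_derivative_at_within[OF d])
  have [measurable]: "h \<in> borel_measurable borel" "h' \<in> borel_measurable borel"
    using c ch by (auto intro: borel_measurable_continuous_onI)
  have B: "0 \<le> B" using b(1)[of 0] by linarith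
  have i1: "integrable lborel (\<lambda>x. ?\<phi> x * (x * h x))"
  proof (rule integrable_dominated)
    show "integrable lborel (\<lambda>x. B * (?\<phi> x * \<bar>x\<bar>^1))"
      by (intro integrable_mult_right integrable_std_normal_moment_abs)
    show "AE x in lborel. norm (?\<phi> x * (x * h x)) \<le> norm (B * (?\<phi> x * \<bar>x\<bar> ^ 1))"
    proof (rule AE_I2)
      fix x :: real
      have "\<bar>h x\<bar> * (?\<phi> x * \<bar>x\<bar>) \<le> B * (?\<phi> x * \<bar>x\<bar>)" using b(1) by (intro mult_right_mono) auto
      then show "norm (?\<phi> x * (x * h x)) \<le> norm (B * (?\<phi> x * \<bar>x\<bar> ^ 1))"
        using B by (simp add: abs_mult ac_simps)
    qed
  qed simp
  have i2: "integrable lborel (\<lambda>x. ?\<phi> x * h' x)"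
  proof (rule integrable_dominated)
    show "integrable lborel (\<lambda>x. B * (?\<phi> x * \<bar>x\<bar>^0))"
      by (intro integrable_mult_right integrable_std_normal_moment_abs)
    show "AE x in lborel. norm (?\<phi> x * h' x) \<le> norm (B * (?\<phi> x * \<bar>x\<bar> ^ 0))"
    proof (rule AE_I2)
      fix x :: real
      have "\<bar>h' x\<bar> * ?\<phi> x \<le> B * ?\<phi> x" using b(2) by (intro mult_right_mono) auto
      then show "norm (?\<phi> x * h' x) \<le> norm (B * (?\<phi> x * \<bar>x\<bar> ^ 0))"
        using B by (simp add: abs_mult ac_simps)
    qed
  qed simp
  have "((\<lambda>x. k * exp (- x\<^sup>2 / 2)) has_real_derivative - x * (k * exp (- x\<^sup>2 / 2))) (at x)"
    for k x :: real
    by (auto intro!: derivative_eq_intros)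
  then have d\<phi>: "(?\<phi> has_real_derivative - x * ?\<phi> x) (at x)" for x
    unfolding std_normal_density_def by blast
  have F: "((\<lambda>x. ?\<phi> x * h x) has_real_derivative ?\<phi> x * h' x - ?\<phi> x * (x * h x)) (at x)" for x
    by (rule derivative_eq_intros d\<phi> d refl)+ (simp add: algebra_simps)
  have lim: "((\<lambda>x. ?\<phi> x * h x) \<longlongrightarrow> 0) G" if "(?\<phi> \<longlongrightarrow> 0) G" for G
  proof (rule Lim_null_comparison)
    show "\<forall>\<^sub>F x in G. norm (?\<phi> x * h x) \<le> ?\<phi> x * B"
      by (intro always_eventually allI) (simp add: abs_mult mult_left_mono b(1))
    show "((\<lambda>x. ?\<phi> x * B) \<longlongrightarrow> 0) G" using tendsto_mult_right[OF that, of B] by simp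
  qed
  have l1: "(?\<phi> \<longlongrightarrow> 0) at_top" unfolding std_normal_density_def by real_asymp
  have l2: "(?\<phi> \<longlongrightarrow> 0) at_bot" unfolding std_normal_density_def by real_asymp
  have "(LBINT x=-\<infinity>..\<infinity>. ?\<phi> x * h' x - ?\<phi> x * (x * h x)) = 0 - 0"
  proof (rule interval_integral_FTC_integrable)
    show "((\<lambda>x. ?\<phi> x * h x) has_vector_derivative ?\<phi> x * h' x - ?\<phi> x * (x * h x)) (at x)" for x
      using F by (simp add: has_real_derivative_iff_has_vector_derivative)
    show "isCont (\<lambda>x. ?\<phi> x * h' x - ?\<phi> x * (x * h x)) x" for x
      using c ch d\<phi>[of x, THEN DERIV_isCont]
      by (auto intro!: continuous_intros simp: continuous_on_eq_continuous_at)
    show "set_integrable lborel (einterval (- \<infinity>) \<infinity>) (\<lambda>x. ?\<phi> x * h' x - ?\<phi> x * (x * h x))"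
      using i1 i2 by (simp add: set_integrable_def)
  qed (use lim l1 l2 in \<open>auto simp: ereal_tendsto_simps\<close>)
  then have "(\<integral>x. ?\<phi> x * h' x - ?\<phi> x * (x * h x) \<partial>lborel) = 0"
    by (simp add: interval_lebesgue_integral_def set_lebesgue_integral_def)
  then show "(\<integral>x. x * h x \<partial>gauss1) = (\<integral>x. h' x \<partial>gauss1)"
    using i1 i2 by (simp add: gauss1_def integral_density)
  show "integrable gauss1 (\<lambda>x. x * h x)"
    using i1 by (simp add: gauss1_def integrable_density)
qed

lemma gauss_component:
  fixes f :: "real \<Rightarrow> real"
  assumes "integrable gauss1 f" shows "integrable gauss (\<lambda>z :: real^'n::finite. f (z $ i))"
proof -
  interpret G: prob_space gauss1 by (rule gauss1)
  interpret product_prob_space "\<lambda>_. gauss1" "UNIV :: 'n set" by unfold_locales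
  have [measurable]: "f \<in> borel_measurable borel"
    using assms measurable_cong_sets[OF gauss1(2) refl] by (metis borel_measurable_integrable)
  have "distr (PiM UNIV (\<lambda>_. gauss1)) gauss1 (\<lambda>x. x i) = gauss1"
    by (rule PiM_component) simp
  then have "integrable (PiM UNIV (\<lambda>_. gauss1)) (\<lambda>x. f (x i))"
    using assms integrable_distr[of "\<lambda>x. x i" "PiM UNIV (\<lambda>_. gauss1)" gauss1 f] by simp
  moreover have "(\<lambda>z :: real^'n. f (z $ i)) \<in> borel_measurable borel" by measurable
  ultimately show ?thesis unfolding gauss_def
    by (subst integrable_distr_eq[OF measurable_gauss_vec]) auto
qed

lemma gauss_moments: "integrable gauss (\<lambda>z :: real^'n::finite. (norm z) ^ 4)"
proof (rule integrable_dominated)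
  have "integrable gauss1 (\<lambda>x. x ^ 4)"
    using integrable_std_normal_moment[of 4] by (simp add: gauss1_def integrable_density)
  then show "integrable gauss (\<lambda>z :: real^'n. CARD('n) * (\<Sum>i\<in>UNIV. (z $ i) ^ 4))"
    by (intro integrable_mult_right Bochner_Integration.integrable_sum gauss_component[where f="\<lambda>x. x ^ 4"])
  show "(\<lambda>z :: real^'n. (norm z) ^ 4) \<in> borel_measurable gauss" by measurable
  show "AE z :: real^'n in gauss. norm ((norm z) ^ 4) \<le> norm (CARD('n) * (\<Sum>i\<in>UNIV. (z $ i) ^ 4))"
  proof (rule AE_I2)
    fix z :: "real^'n"
    have "(norm z) ^ 4 = ((norm z)\<^sup>2)\<^sup>2" by simp
    also have "\<dots> = (\<Sum>i\<in>UNIV. (z $ i)\<^sup>2)\<^sup>2"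
      unfolding power2_norm_eq_inner inner_vec_def by (simp add: power2_eq_square)
    also have "\<dots> \<le> (\<Sum>i\<in>UNIV. ((z $ i)\<^sup>2)\<^sup>2) * card (UNIV :: 'n set)"
      by (rule sum_squared_le_sum_of_squares)
    also have "\<dots> = CARD('n) * (\<Sum>i\<in>UNIV. (z $ i) ^ 4)" by simp
    finally show "norm ((norm z) ^ 4) \<le> norm (CARD('n) * (\<Sum>i\<in>UNIV. (z $ i) ^ 4))"
      by (simp add: sum_nonneg)
  qed
qed

text \<open>Fubini in the \<open>i\<close>-th coordinate reduces this to the one-dimensional identity.\<close>

lemma gauss_integration_by_parts:
  fixes g g' :: "real^'n::finite \<Rightarrow> real"
  assumes d: "\<And>z. ((\<lambda>s. g (z + s *\<^sub>R axis i 1)) has_real_derivative g' z) (at 0)"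
    and c: "continuous_on UNIV g" "continuous_on UNIV g'"
    and b: "\<And>x. \<bar>g x\<bar> \<le> B" "\<And>x. \<bar>g' x\<bar> \<le> B"
  shows "(\<integral>z. z $ i * g z \<partial>gauss) = (\<integral>z. g' z \<partial>gauss)"
proof -
  interpret G: prob_space gauss1 by (rule gauss1)
  interpret product_prob_space "\<lambda>_. gauss1" "UNIV :: 'n set" by unfold_locales
  have [measurable]: "g \<in> borel_measurable borel" "g' \<in> borel_measurable borel"
    using c by (auto intro: borel_measurable_continuous_onI)
  have B: "0 \<le> B" using b(1)[of 0] by linarith
  have "integrable gauss1 (\<lambda>x. x)"
    using integrable_std_normal_moment[of 1] by (simp add: gauss1_def integrable_density)
  from gauss_component[OF this] have iz: "integrable gauss (\<lambda>z :: real^'n. z $ i)" .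
  have i1: "integrable gauss (\<lambda>z. z $ i * g z)"
  proof (rule integrable_dominated)
    show "integrable gauss (\<lambda>z. B * z $ i)" using iz by simp
    show "AE z in gauss. norm (z $ i * g z) \<le> norm (B * z $ i)"
      using b(1) B by (auto intro!: mult_right_mono simp: abs_mult mult.commute[of _ "\<bar>g _\<bar>"])
  qed simp
  have i2: "integrable gauss g'"
    by (rule finite_measure.integrable_const_bound[OF prob_space.finite_measure[OF prob_space_gauss], where B=B]) (use b in auto)
  let ?P = "PiM UNIV (\<lambda>_::'n. gauss1)" and ?Q = "PiM (UNIV - {i}) (\<lambda>_::'n. gauss1)"
  let ?v = "\<lambda>f :: 'n \<Rightarrow> real. \<chi> j. f j"
  have UN: "insert i (UNIV - {i}) = (UNIV :: 'n set)" by auto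
  have red: "(\<integral>z. f z \<partial>gauss) = (\<integral>x. (\<integral>t. f (?v (x(i := t))) \<partial>gauss1) \<partial>?Q)"
    if f: "integrable gauss f" for f :: "real^'n \<Rightarrow> real"
  proof -
    have fm: "f \<in> borel_measurable borel" using f borel_measurable_integrable by fastforce
    have "integrable ?P (\<lambda>x. f (?v x))"
      using f unfolding gauss_def by (subst (asm) integrable_distr_eq[OF measurable_gauss_vec fm])
    then have "integrable (PiM (insert i (UNIV - {i})) (\<lambda>_::'n. gauss1)) (\<lambda>x. f (?v x))"
      unfolding UN .
    from product_integral_insert[OF _ _ this]
    have "(\<integral>x. f (?v x) \<partial>?P) = (\<integral>x. (\<integral>t. f (?v (x(i := t))) \<partial>gauss1) \<partial>?Q)"
      unfolding UN by simp
    then show ?thesis unfolding gauss_def by (subst integral_distr[OF measurable_gauss_vec fm])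
  qed
  have "(\<integral>t. ?v (x(i := t)) $ i * g (?v (x(i := t))) \<partial>gauss1) = (\<integral>t. g' (?v (x(i := t))) \<partial>gauss1)" for x
  proof -
    have sh: "?v (x(i := t + s)) = ?v (x(i := t)) + s *\<^sub>R axis i 1" for t s
      by (simp add: vec_eq_iff axis_def)
    have ct: "continuous_on UNIV (\<lambda>t. ?v (x(i := t)))"
    proof (rule continuous_on_vec_lambda)
      show "continuous_on UNIV (\<lambda>t. (x(i := t)) j)" for j
        by (cases "j = i") (auto intro!: continuous_intros)
    qed
    have "((\<lambda>t. g (?v (x(i := t)))) has_real_derivative g' (?v (x(i := t)))) (at t)" for t
    proof -
      have "((\<lambda>s. g (?v (x(i := t + s)))) has_real_derivative g' (?v (x(i := t)))) (at 0)"
        unfolding sh by (rule d)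
      then show ?thesis
        using DERIV_shift[of "\<lambda>t. g (?v (x(i := t)))" "g' (?v (x(i := t)))" 0 t] by (simp add: add.commute)
    qed
    then have "(\<integral>t. t * g (?v (x(i := t))) \<partial>gauss1) = (\<integral>t. g' (?v (x(i := t))) \<partial>gauss1)"
      by (rule gauss1_integration_by_parts(1)[where B=B])
         (use b continuous_on_compose2[OF c(2) ct] in auto)
    then show ?thesis by simp
  qed
  then show ?thesis unfolding red[OF i1] red[OF i2] by (simp only:)
qed

section \<open>Laws and continuous paths of laws\<close>

lemma measurable_meas [measurable_cong]: "sets (meas m) = sets borel"
  by (rule sets_meas)

lemma dist_tprob_leI:
  fixes \<mu> \<nu> :: "'n::finite tprob"
  assumes "\<And>\<phi>. 1-lipschitz_on UNIV \<phi> \<Longrightarrow> integral\<^sup>L (meas \<mu>) \<phi> - integral\<^sup>L (meas \<nu>) \<phi> \<le> c"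
  shows "dist \<mu> \<nu> \<le> c"
  unfolding dist_tprob_def
  by (rule cSup_least) (use assms zero_in_kr_values[of \<mu> \<nu>] in \<open>auto simp: kr_values_def\<close>)

lemma integral_diff_le_dist_tprob:
  fixes \<mu> \<nu> :: "'n::finite tprob"
  assumes "L-lipschitz_on UNIV \<phi>"
  shows "\<bar>integral\<^sup>L (meas \<mu>) \<phi> - integral\<^sup>L (meas \<nu>) \<phi>\<bar> \<le> L * dist \<mu> \<nu>"
proof -
  have d: "dist \<mu> \<nu> = Sup (kr_values \<mu> \<nu>)" for \<mu> \<nu> :: "'n tprob"
    by (simp add: dist_tprob_def kr_values_def)
  show ?thesis
  proof (cases "L = 0")
    case True
    have "\<phi> x = \<phi> 0" for x
      using lipschitz_onD[OF assms, of x 0] True by simp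
    then have "\<phi> = (\<lambda>_. \<phi> 0)" by auto
    then have "integral\<^sup>L (meas m) \<phi> = \<phi> 0" for m
      by (metis (no_types) lebesgue_integral_const prob_space.prob_space prob_space_meas scaleR_one)
    then show ?thesis using True by simp
  next
    case False
    then have L: "0 < L" using lipschitz_on_nonneg[OF assms] by simp
    show ?thesis
      using kr_values_scale[OF assms L, of \<mu> \<nu>] kr_values_scale[OF assms L, of \<nu> \<mu>]
      unfolding d[symmetric] by (simp add: dist_commute abs_le_iff)
  qed
qed

definition law :: "'a measure \<Rightarrow> ('a \<Rightarrow> 'n::finite torus) \<Rightarrow> 'n tprob" where
  "law P Y = Abs_tprob (distr P borel Y)"

lemma meas_law:
  assumes "prob_space P" "Y \<in> borel_measurable P"
  shows "meas (law P Y) = distr P borel Y"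
  unfolding law_def using assms by (intro Abs_tprob_inverse) (simp add: prob_space.prob_space_distr)

lemma integral_law:
  fixes f :: "'n::finite torus \<Rightarrow> real"
  assumes "prob_space P" "Y \<in> borel_measurable P" "f \<in> borel_measurable borel"
  shows "integral\<^sup>L (meas (law P Y)) f = (\<integral>\<omega>. f (Y \<omega>) \<partial>P)"
  using assms by (simp add: meas_law integral_distr)

lemma law_eqI:
  assumes "prob_space P" "Y \<in> borel_measurable P" "distr P borel Y = meas \<mu>"
  shows "law P Y = \<mu>"
  using meas_law[OF assms(1,2)] assms(3) by (simp add: meas_inject)

lemma integrable_bounded_torus:
  fixes f :: "'n::finite torus \<Rightarrow> real"
  assumes "f \<in> borel_measurable borel" "\<And>x. \<bar>f x\<bar> \<le> B"
  shows "integrable (meas m) f"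
  by (rule finite_measure.integrable_const_bound[OF prob_space.finite_measure[OF prob_space_meas], where B=B])
     (use assms in auto)

lemma dist_law_le:
  fixes Y Y' :: "'a \<Rightarrow> 'n::finite torus"
  assumes P: "prob_space P" and Y [measurable]: "Y \<in> borel_measurable P" "Y' \<in> borel_measurable P"
    and d: "\<And>\<omega>. \<omega> \<in> space P \<Longrightarrow> dist (Y \<omega>) (Y' \<omega>) \<le> g \<omega>" and g: "integrable P g"
  shows "dist (law P Y) (law P Y') \<le> (\<integral>\<omega>. g \<omega> \<partial>P)"
proof (rule dist_tprob_leI)
  fix \<phi> :: "'n torus \<Rightarrow> real" assume L: "1-lipschitz_on UNIV \<phi>"
  interpret prob_space P by (rule P)
  have m [measurable]: "\<phi> \<in> borel_measurable borel"
    using lipschitz_on_continuous_on[OF L] by (rule borel_measurable_continuous_onI)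
  have i: "integrable P (\<lambda>\<omega>. \<phi> (Z \<omega>))" if [measurable]: "Z \<in> borel_measurable P" for Z
    using integrable_lipschitz_torus[OF L, of "law P Z"] that P
    by (simp add: meas_law integrable_distr_eq)
  have "integral\<^sup>L (meas (law P Y)) \<phi> - integral\<^sup>L (meas (law P Y')) \<phi>
      = (\<integral>\<omega>. \<phi> (Y \<omega>) - \<phi> (Y' \<omega>) \<partial>P)"
    using i P by (simp add: integral_law)
  also have "\<dots> \<le> (\<integral>\<omega>. g \<omega> \<partial>P)"
  proof (rule integral_mono)
    fix \<omega> assume "\<omega> \<in> space P"
    then show "\<phi> (Y \<omega>) - \<phi> (Y' \<omega>) \<le> g \<omega>"
      using lipschitz_onD[OF L, of "Y \<omega>" "Y' \<omega>"] d[of \<omega>] by (simp add: dist_real_def)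
  qed (use i g in auto)
  finally show "integral\<^sup>L (meas (law P Y)) \<phi> - integral\<^sup>L (meas (law P Y')) \<phi> \<le> (\<integral>\<omega>. g \<omega> \<partial>P)" .
qed

text \<open>The mass of a closed set is a limit of integrals of Lipschitz cutoffs, which are continuous in time, and
  closed sets generate the Borel sets.\<close>

lemma measurable_path_kernel:
  fixes m :: "real \<Rightarrow> 'n::finite tprob"
  assumes m: "continuous_on UNIV m"
  shows "(\<lambda>t. meas (m t)) \<in> borel \<rightarrow>\<^sub>M prob_algebra borel"
proof (rule measurable_prob_algebra_generated)
  show "sets (borel :: 'n torus measure) = sigma_sets UNIV (Collect closed)"
    by (simp add: borel_eq_closed)
  show "Int_stable (Collect (closed :: 'n torus set \<Rightarrow> bool))"
    by (auto simp: Int_stable_def)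
  show "prob_space (meas (m t))" "sets (meas (m t)) = sets borel" for t
    by (rule prob_space_meas sets_meas)+
  fix A :: "'n torus set" assume "A \<in> Collect closed"
  then have A: "closed A" by simp
  show "(\<lambda>t. emeasure (meas (m t)) A) \<in> borel_measurable borel"
  proof (cases "A = {}")
    case False
    let ?c = "\<lambda>k x. max 0 (1 - real k * infdist x A)"
    have lim: "(\<lambda>k. integral\<^sup>L (meas (m t)) (?c k)) \<longlonglongrightarrow> measure (meas (m t)) A" for t
    proof -
      interpret prob_space "meas (m t)" by (rule prob_space_meas)
      have Am: "A \<in> sets (meas (m t))" using A by (simp add: sets_meas)
      have "(\<lambda>k. integral\<^sup>L (meas (m t)) (?c k)) \<longlonglongrightarrow> integral\<^sup>L (meas (m t)) (indicator A)"
      proof (rule integral_dominated_convergence[where w="\<lambda>_. 1"])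
        show "indicator A \<in> borel_measurable (meas (m t))" using Am by simp
        show "?c k \<in> borel_measurable (meas (m t))" for k
          by (rule borel_measurable_lipschitz_torus[OF lipschitz_cutoff])
        show "AE x in meas (m t). norm (?c k x) \<le> 1" for k
          by (simp add: infdist_nonneg)
      qed (use cutoff_tendsto_indicator[OF A False] in auto)
      then show ?thesis using Am by simp
    qed
    have "(\<lambda>t. integral\<^sup>L (meas (m t)) (?c k)) \<in> borel_measurable borel" for k
    proof (rule borel_measurable_continuous_onI)
      show "continuous_on UNIV (\<lambda>t. integral\<^sup>L (meas (m t)) (?c k))"
      proof -
        have "(real k)-lipschitz_on UNIV (\<lambda>\<mu>. integral\<^sup>L (meas \<mu>) (?c k))"
          using integral_diff_le_dist_tprob[OF lipschitz_cutoff[of k A]]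
          by (intro lipschitz_onI) (auto simp: dist_real_def)
        from lipschitz_on_continuous_on[OF this] show ?thesis
          using m by (rule continuous_on_compose2) auto
      qed
    qed
    from borel_measurable_LIMSEQ_real[OF lim this]
    have "(\<lambda>t. measure (meas (m t)) A) \<in> borel_measurable borel" by simp
    moreover have "emeasure (meas (m t)) A = ennreal (measure (meas (m t)) A)" for t
      using prob_space_meas[of "m t"]
      by (simp add: finite_measure.emeasure_eq_measure prob_space.finite_measure)
    ultimately show ?thesis by simp
  qed simp
qed auto

section \<open>Space-time measures\<close>

text \<open>Fubini for a kernel, by splitting into positive and negative parts. The running costs to which this is
  applied are unbounded.\<close>

lemma
  fixes f :: "'b \<Rightarrow> real"
  assumes N [measurable]: "N \<in> M \<rightarrow>\<^sub>M subprob_algebra K" and ne: "space M \<noteq> {}"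
    and f: "integrable (M \<bind> N) f"
  shows AE_integrable_bind_kernel: "AE x in M. integrable (N x) f"
    and integrable_integral_bind_kernel: "integrable M (\<lambda>x. \<integral>y. f y \<partial>N x)"
    and integral_bind_kernel: "integral\<^sup>L (M \<bind> N) f = (\<integral>x. \<integral>y. f y \<partial>N x \<partial>M)"
proof -
  have sB: "sets (M \<bind> N) = sets K" by (rule sets_bind[OF sets_kernel[OF N] ne])
  have sN: "sets (N x) = sets K" if "x \<in> space M" for x by (rule sets_kernel[OF N that])
  have pos: "(AE x in M. integrable (N x) g) \<and> integrable M (\<lambda>x. \<integral>y. g y \<partial>N x)
      \<and> integral\<^sup>L (M \<bind> N) g = (\<integral>x. \<integral>y. g y \<partial>N x \<partial>M)"
    if g: "integrable (M \<bind> N) g" and nn: "\<And>y. 0 \<le> g y" for g :: "'b \<Rightarrow> real"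
  proof -
    have gK [measurable]: "g \<in> borel_measurable K"
      using borel_measurable_integrable[OF g] measurable_cong_sets[OF sB refl] by blast
    have gN: "g \<in> borel_measurable (N x)" if "x \<in> space M" for x
      using gK measurable_cong_sets[OF sN[OF that] refl] by blast
    have nb: "(\<integral>\<^sup>+y. ennreal (g y) \<partial>(M \<bind> N)) = (\<integral>\<^sup>+x. \<integral>\<^sup>+y. ennreal (g y) \<partial>N x \<partial>M)"
      by (rule nn_integral_bind[OF _ N]) simp
    have fin: "(\<integral>\<^sup>+x. \<integral>\<^sup>+y. ennreal (g y) \<partial>N x \<partial>M) < \<infinity>"
      using g nn unfolding nb[symmetric] by (simp add: integrable_iff_bounded)
    have me [measurable]: "(\<lambda>x. \<integral>\<^sup>+y. ennreal (g y) \<partial>N x) \<in> borel_measurable M"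
      by (rule measurable_compose[OF N nn_integral_measurable_subprob_algebra]) simp
    have ae: "AE x in M. (\<integral>\<^sup>+y. ennreal (g y) \<partial>N x) \<noteq> \<infinity>"
      by (rule nn_integral_PInf_AE[OF me]) (use fin in auto)
    have ii: "AE x in M. integrable (N x) g"
      using ae AE_space
      by eventually_elim (use gN nn in \<open>auto simp: integrable_iff_bounded top.not_eq_extremum\<close>)
    have eq: "(\<integral>y. g y \<partial>N x) = enn2real (\<integral>\<^sup>+y. ennreal (g y) \<partial>N x)" if "x \<in> space M" for x
      by (rule integral_eq_nn_integral[OF gN[OF that]]) (use nn in auto)
    have mi: "(\<lambda>x. \<integral>y. g y \<partial>N x) \<in> borel_measurable M"
      by (subst measurable_cong[OF eq]) auto
    have nni: "(\<integral>\<^sup>+x. ennreal (\<integral>y. g y \<partial>N x) \<partial>M) = (\<integral>\<^sup>+x. \<integral>\<^sup>+y. ennreal (g y) \<partial>N x \<partial>M)"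
    proof (rule nn_integral_cong_AE)
      show "AE x in M. ennreal (\<integral>y. g y \<partial>N x) = (\<integral>\<^sup>+y. ennreal (g y) \<partial>N x)"
        using ii by eventually_elim (use nn in \<open>auto simp: nn_integral_eq_integral\<close>)
    qed
    have "integral\<^sup>L (M \<bind> N) g = enn2real (\<integral>\<^sup>+y. ennreal (g y) \<partial>(M \<bind> N))"
      by (rule integral_eq_nn_integral) (use g nn in auto)
    also have "\<dots> = enn2real (\<integral>\<^sup>+x. ennreal (\<integral>y. g y \<partial>N x) \<partial>M)" unfolding nb nni ..
    also have "\<dots> = (\<integral>x. \<integral>y. g y \<partial>N x \<partial>M)"
      by (rule integral_eq_nn_integral[OF mi, symmetric]) (use nn in auto)
    finally have "integral\<^sup>L (M \<bind> N) g = (\<integral>x. \<integral>y. g y \<partial>N x \<partial>M)" .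
    moreover have "integrable M (\<lambda>x. \<integral>y. g y \<partial>N x)"
      using mi fin nn unfolding nni[symmetric] by (simp add: integrable_iff_bounded)
    ultimately show ?thesis using ii by blast
  qed
  have p1: "integrable (M \<bind> N) (\<lambda>y. max 0 (f y))" and p2: "integrable (M \<bind> N) (\<lambda>y. max 0 (- f y))"
    using f by auto
  note P = pos[OF p1] and Q = pos[OF p2]
  have fe: "f = (\<lambda>y. max 0 (f y) - max 0 (- f y))" by auto
  have ae1: "AE x in M. integrable (N x) (\<lambda>y. max 0 (f y))"
    and ae2: "AE x in M. integrable (N x) (\<lambda>y. max 0 (- f y))"
    using P Q by auto
  show ii: "AE x in M. integrable (N x) f"
    using ae1 ae2 by eventually_elim (subst fe, rule Bochner_Integration.integrable_diff)
  have fK [measurable]: "f \<in> borel_measurable K"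
    using borel_measurable_integrable[OF f] measurable_cong_sets[OF sB refl] by blast
  have ae: "AE x in M. (\<integral>y. max 0 (f y) \<partial>N x) - (\<integral>y. max 0 (- f y) \<partial>N x) = (\<integral>y. f y \<partial>N x)"
    using ae1 ae2
  proof eventually_elim
    case (elim x)
    then have "(\<integral>y. max 0 (f y) \<partial>N x) - (\<integral>y. max 0 (- f y) \<partial>N x)
        = (\<integral>y. max 0 (f y) - max 0 (- f y) \<partial>N x)" by simp
    then show ?case by (simp flip: fe)
  qed
  have mi: "(\<lambda>x. \<integral>y. f y \<partial>N x) \<in> borel_measurable M"
    by (rule measurable_compose[OF N integral_measurable_subprob_algebra]) simp
  have d: "integrable M (\<lambda>x. (\<integral>y. max 0 (f y) \<partial>N x) - (\<integral>y. max 0 (- f y) \<partial>N x))"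
    using P Q by auto
  show "integrable M (\<lambda>x. \<integral>y. f y \<partial>N x)"
    by (rule integrable_cong_AE_imp[OF d mi]) (use ae in eventually_elim, auto)
  have "integral\<^sup>L (M \<bind> N) f = integral\<^sup>L (M \<bind> N) (\<lambda>y. max 0 (f y) - max 0 (- f y))"
    by (simp flip: fe)
  also have "\<dots> = integral\<^sup>L (M \<bind> N) (\<lambda>y. max 0 (f y)) - integral\<^sup>L (M \<bind> N) (\<lambda>y. max 0 (- f y))"
    using p1 p2 by simp
  also have "\<dots> = (\<integral>x. (\<integral>y. max 0 (f y) \<partial>N x) - (\<integral>y. max 0 (- f y) \<partial>N x) \<partial>M)"
    using P Q by simp
  also have "\<dots> = (\<integral>x. \<integral>y. f y \<partial>N x \<partial>M)"
    by (rule integral_cong_AE) (use d mi ae in auto)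
  finally show "integral\<^sup>L (M \<bind> N) f = (\<integral>x. \<integral>y. f y \<partial>N x \<partial>M)" .
qed

text \<open>The measure \<open>w(t) m(t)(dx) dt\<close>. Only times \<open>t \<ge> 0\<close> matter for a path, so it is frozen
  at its initial value before time \<open>0\<close>, which makes it continuous on the whole line.\<close>

definition spacetime :: "(real \<Rightarrow> real) \<Rightarrow> (real \<Rightarrow> 'n::finite tprob) \<Rightarrow> (real \<times> 'n torus) measure" where
  "spacetime w m = density lborel (\<lambda>t. ennreal (w t)) \<bind> (\<lambda>t. distr (meas (m (max 0 t))) borel (Pair t))"

context
  fixes m :: "real \<Rightarrow> 'n::finite tprob" and w :: "real \<Rightarrow> real"
  assumes m: "continuous_on {0..} m"
    and w [measurable]: "w \<in> borel_measurable borel"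
    and w0: "\<And>t. 0 \<le> w t" and wneg: "\<And>t. t < 0 \<Longrightarrow> w t = 0"
begin

lemma continuous_frozen_path: "continuous_on UNIV (\<lambda>t. m (max 0 t))"
  by (rule continuous_on_compose2[OF m]) (auto intro!: continuous_intros)

lemma spacetime_kernel:
  "(\<lambda>t. distr (meas (m (max 0 t))) borel (Pair t)) \<in>
    density lborel (\<lambda>t. ennreal (w t)) \<rightarrow>\<^sub>M subprob_algebra (borel :: (real \<times> 'n torus) measure)"
proof -
  have k: "(\<lambda>t. meas (m (max 0 t))) \<in> borel \<rightarrow>\<^sub>M subprob_algebra borel"
    by (rule measurable_prob_algebraD[OF measurable_path_kernel[OF continuous_frozen_path]])
  have "(\<lambda>t. distr (meas (m (max 0 t))) (borel :: (real \<times> 'n torus) measure) (Pair t)) \<in> borel \<rightarrow>\<^sub>M subprob_algebra borel"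
  proof (rule measurable_distr2[OF _ k])
    have "(\<lambda>x::real \<times> 'n torus. x) \<in> borel \<Otimes>\<^sub>M borel \<rightarrow>\<^sub>M borel"
      by (subst borel_prod) simp
    then show "(\<lambda>(t, x::'n torus). (t::real, x)) \<in> borel \<Otimes>\<^sub>M borel \<rightarrow>\<^sub>M borel"
      by (simp add: case_prod_beta)
  qed
  then show ?thesis by simp
qed

lemma sets_spacetime: "sets (spacetime w m) = sets borel"
  unfolding spacetime_def by (rule sets_bind[OF sets_kernel[OF spacetime_kernel]]) auto

lemma space_spacetime: "space (spacetime w m) = UNIV"
  using sets_eq_imp_space_eq[OF sets_spacetime] by simp

lemma measurable_Pair_torus: "Pair t \<in> borel \<rightarrow>\<^sub>M (borel :: (real \<times> 'n torus) measure)"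
  by (intro borel_measurable_continuous_onI continuous_intros)

lemma measurable_section:
  assumes "f \<in> borel_measurable (borel :: (real \<times> 'n torus) measure)"
  shows "(\<lambda>x. f (t, x)) \<in> borel_measurable (meas \<mu>)"
  using measurable_compose[OF measurable_Pair_torus assms] measurable_cong_sets[OF sets_meas refl] by blast

lemma nn_integral_distr_Pair:
  fixes f :: "real \<times> 'n torus \<Rightarrow> ennreal"
  assumes f: "f \<in> borel_measurable borel"
  shows "(\<integral>\<^sup>+z. f z \<partial>distr (meas \<mu>) borel (Pair t)) = (\<integral>\<^sup>+x. f (t, x) \<partial>meas \<mu>)"
proof -
  have "Pair t \<in> meas \<mu> \<rightarrow>\<^sub>M (borel :: (real \<times> 'n torus) measure)"
    using measurable_Pair_torus measurable_cong_sets[OF sets_meas refl] by blast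
  then show ?thesis by (rule nn_integral_distr) (simp add: f)
qed

lemma nn_integral_spacetime:
  fixes f :: "real \<times> 'n torus \<Rightarrow> ennreal"
  assumes f: "f \<in> borel_measurable borel"
  shows "(\<integral>\<^sup>+z. f z \<partial>spacetime w m) = (\<integral>\<^sup>+t. ennreal (w t) * (\<integral>\<^sup>+x. f (t, x) \<partial>meas (m t)) \<partial>lborel)"
proof -
  have me: "(\<lambda>t. \<integral>\<^sup>+x. f (t, x) \<partial>meas (m (max 0 t))) \<in> borel_measurable lborel"
    using measurable_compose[OF spacetime_kernel nn_integral_measurable_subprob_algebra[OF f]]
    by (simp add: nn_integral_distr_Pair[OF f])
  have "(\<integral>\<^sup>+z. f z \<partial>spacetime w m) = (\<integral>\<^sup>+t. ennreal (w t) * (\<integral>\<^sup>+x. f (t, x) \<partial>meas (m (max 0 t))) \<partial>lborel)"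
    unfolding spacetime_def nn_integral_bind[OF f spacetime_kernel] nn_integral_distr_Pair[OF f]
    by (rule nn_integral_density[OF _ me]) simp
  also have "\<dots> = (\<integral>\<^sup>+t. ennreal (w t) * (\<integral>\<^sup>+x. f (t, x) \<partial>meas (m t)) \<partial>lborel)"
  proof (rule nn_integral_cong)
    fix t show "ennreal (w t) * (\<integral>\<^sup>+x. f (t, x) \<partial>meas (m (max 0 t))) = ennreal (w t) * (\<integral>\<^sup>+x. f (t, x) \<partial>meas (m t))"
      using wneg[of t] by (cases "t < 0") (auto simp: max_def)
  qed
  finally show ?thesis .
qed

lemma
  fixes f :: "real \<times> 'n torus \<Rightarrow> real"
  assumes f: "integrable (spacetime w m) f"
  shows AE_integrable_spacetime: "AE t in lborel. w t \<noteq> 0 \<longrightarrow> integrable (meas (m t)) (\<lambda>x. f (t, x))"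
    and integrable_spacetimeD: "integrable lborel (\<lambda>t. w t * (\<integral>x. f (t, x) \<partial>meas (m t)))"
    and integral_spacetime: "integral\<^sup>L (spacetime w m) f = (\<integral>t. w t * (\<integral>x. f (t, x) \<partial>meas (m t)) \<partial>lborel)"
proof -
  have ne: "space (density lborel (\<lambda>t. ennreal (w t))) \<noteq> {}" by simp
  note * = f[unfolded spacetime_def]
  have fm: "f \<in> borel_measurable borel"
    using borel_measurable_integrable[OF f] measurable_cong_sets[OF sets_spacetime refl] by blast
  have P: "Pair t \<in> meas \<mu> \<rightarrow>\<^sub>M (borel :: (real \<times> 'n torus) measure)" for t \<mu>
    using measurable_Pair_torus measurable_cong_sets[OF sets_meas refl] by blast
  have fr: "w t * (\<integral>x. f (t, x) \<partial>meas (m (max 0 t))) = w t * (\<integral>x. f (t, x) \<partial>meas (m t))" for t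
    using wneg[of t] by (cases "t < 0") (auto simp: max_def)
  have me: "(\<lambda>t. \<integral>x. f (t, x) \<partial>meas (m (max 0 t))) \<in> borel_measurable borel"
    using measurable_compose[OF spacetime_kernel integral_measurable_subprob_algebra[OF fm]]
    by (simp add: integral_distr[OF P fm])
  have "AE t in lborel. 0 < w t \<longrightarrow> integrable (meas (m (max 0 t))) (\<lambda>x. f (t, x))"
    using AE_integrable_bind_kernel[OF spacetime_kernel ne *]
    by (simp add: AE_density integrable_distr_eq[OF P fm])
  then show "AE t in lborel. w t \<noteq> 0 \<longrightarrow> integrable (meas (m t)) (\<lambda>x. f (t, x))"
  proof eventually_elim
    case (elim t)
    then show ?case using w0[of t] wneg[of t] by (cases "t < 0") (auto simp: max_def)
  qed
  show "integrable lborel (\<lambda>t. w t * (\<integral>x. f (t, x) \<partial>meas (m t)))"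
    using integrable_integral_bind_kernel[OF spacetime_kernel ne *] me w0
    by (simp add: integral_distr[OF P fm] integrable_density fr)
  show "integral\<^sup>L (spacetime w m) f = (\<integral>t. w t * (\<integral>x. f (t, x) \<partial>meas (m t)) \<partial>lborel)"
    unfolding spacetime_def integral_bind_kernel[OF spacetime_kernel ne *]
    using me w0 by (simp add: integral_distr[OF P fm] integral_density fr)
qed

lemma finite_measure_spacetime:
  assumes "integrable lborel w" shows "finite_measure (spacetime w m)"
proof (rule finite_measureI)
  have "emeasure (spacetime w m) (space (spacetime w m)) = (\<integral>\<^sup>+z. 1 \<partial>spacetime w m)" by simp
  also have "\<dots> = (\<integral>\<^sup>+t. ennreal (w t) \<partial>lborel)"
    by (subst nn_integral_spacetime) (simp_all add: prob_space.emeasure_space_1[OF prob_space_meas])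
  also have "\<dots> < \<infinity>" using assms w0 by (simp add: integrable_iff_bounded)
  finally show "emeasure (spacetime w m) (space (spacetime w m)) \<noteq> \<infinity>" by simp
qed

end

section \<open>From relaxed to feedback controls\<close>

text \<open>The conditional expectation \<open>E[u | X]\<close> as a function of the value of \<open>X\<close>: a Radon-Nikodym
  density of the image of \<open>u dM\<close> with respect to the law of \<open>X\<close>.\<close>

lemma conditional_density_nonneg:
  fixes u :: "'w \<Rightarrow> real"
  assumes X: "X \<in> M \<rightarrow>\<^sub>M N" and S: "finite_measure M" and u: "integrable M u" "\<And>\<omega>. 0 \<le> u \<omega>"
  obtains k :: "'z \<Rightarrow> real" where "k \<in> borel_measurable N" "\<And>z. 0 \<le> k z"
    "\<And>f. f \<in> borel_measurable N \<Longrightarrow>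
      (\<integral>\<^sup>+z. f z * ennreal (k z) \<partial>distr M N X) = (\<integral>\<^sup>+\<omega>. f (X \<omega>) * ennreal (u \<omega>) \<partial>M)"
proof -
  interpret M: finite_measure M by (rule S)
  interpret S: finite_measure "distr M N X" by (rule M.finite_measure_distr[OF X])
  have um [measurable]: "u \<in> borel_measurable M" using u by auto
  note X [measurable]
  define \<nu> where "\<nu> = distr (density M (\<lambda>\<omega>. ennreal (u \<omega>))) N X"
  have s\<nu>: "sets \<nu> = sets (distr M N X)" by (simp add: \<nu>_def)
  have nn: "(\<integral>\<^sup>+z. f z \<partial>\<nu>) = (\<integral>\<^sup>+\<omega>. f (X \<omega>) * ennreal (u \<omega>) \<partial>M)" if [measurable]: "f \<in> borel_measurable N" for f
    unfolding \<nu>_def by (simp add: nn_integral_distr nn_integral_density mult.commute)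
  have ac: "absolutely_continuous (distr M N X) \<nu>"
    unfolding absolutely_continuous_def
  proof
    fix A assume "A \<in> null_sets (distr M N X)"
    then have A [measurable]: "A \<in> sets N" and 0: "emeasure M (X -` A \<inter> space M) = 0"
      by (auto simp: null_sets_def emeasure_distr)
    have "AE \<omega> in M. X \<omega> \<notin> A"
      by (rule AE_I[of _ _ "X -` A \<inter> space M"]) (use 0 in auto)
    then have "(\<integral>\<^sup>+\<omega>. indicator A (X \<omega>) * ennreal (u \<omega>) \<partial>M) = (\<integral>\<^sup>+\<omega>. 0 \<partial>M)"
      by (intro nn_integral_cong_AE) (auto simp: indicator_def)
    then have "emeasure \<nu> A = 0" using nn[of "indicator A"] A s\<nu> by simp
    then show "A \<in> null_sets \<nu>" using A s\<nu> by (auto simp: null_sets_def)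
  qed
  define r where "r = RN_deriv (distr M N X) \<nu>"
  have r [measurable]: "r \<in> borel_measurable N" unfolding r_def by measurable
  have dr: "density (distr M N X) r = \<nu>" unfolding r_def by (rule S.density_RN_deriv[OF ac s\<nu>])
  have nr: "(\<integral>\<^sup>+z. f z \<partial>\<nu>) = (\<integral>\<^sup>+z. f z * r z \<partial>distr M N X)" if [measurable]: "f \<in> borel_measurable N" for f
    unfolding dr[symmetric] by (simp add: nn_integral_density mult.commute)
  have "(\<integral>\<^sup>+z. r z \<partial>distr M N X) = (\<integral>\<^sup>+\<omega>. ennreal (u \<omega>) \<partial>M)"
    using nr[of "\<lambda>_. 1"] nn[of "\<lambda>_. 1"] by simp
  also have "\<dots> < \<infinity>" using u by (simp add: integrable_iff_bounded)
  finally have fin: "AE z in distr M N X. r z \<noteq> \<infinity>"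
    by (intro nn_integral_PInf_AE) auto
  show ?thesis
  proof
    show "(\<lambda>z. enn2real (r z)) \<in> borel_measurable N" by measurable
    show "0 \<le> enn2real (r z)" for z by simp
    fix f :: "'z \<Rightarrow> ennreal" assume [measurable]: "f \<in> borel_measurable N"
    have "(\<integral>\<^sup>+z. f z * ennreal (enn2real (r z)) \<partial>distr M N X) = (\<integral>\<^sup>+z. f z * r z \<partial>distr M N X)"
    proof (rule nn_integral_cong_AE)
      show "AE z in distr M N X. f z * ennreal (enn2real (r z)) = f z * r z"
        using fin by eventually_elim (simp add: top.not_eq_extremum)
    qed
    then show "(\<integral>\<^sup>+z. f z * ennreal (enn2real (r z)) \<partial>distr M N X) = (\<integral>\<^sup>+\<omega>. f (X \<omega>) * ennreal (u \<omega>) \<partial>M)"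
      using nr[of f] nn[of f] by simp
  qed
qed

lemma conditional_density:
  fixes u :: "'w \<Rightarrow> real"
  assumes X: "X \<in> M \<rightarrow>\<^sub>M N" and S: "finite_measure M" and u: "integrable M u"
  obtains k :: "'z \<Rightarrow> real" where "k \<in> borel_measurable N" "integrable (distr M N X) k"
    "\<And>f B. f \<in> borel_measurable N \<Longrightarrow> (\<And>z. \<bar>f z\<bar> \<le> B) \<Longrightarrow>
      integrable (distr M N X) (\<lambda>z. f z * k z) \<and>
      (\<integral>z. f z * k z \<partial>distr M N X) = (\<integral>\<omega>. f (X \<omega>) * u \<omega> \<partial>M)"
proof -
  note X [measurable]
  have pos: "\<exists>k. k \<in> borel_measurable N \<and> (\<forall>(f :: 'z \<Rightarrow> real) B. f \<in> borel_measurable N \<longrightarrow> (\<forall>z. \<bar>f z\<bar> \<le> B) \<longrightarrow>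
      integrable (distr M N X) (\<lambda>z. f z * k z) \<and>
      (\<integral>z. f z * k z \<partial>distr M N X) = (\<integral>\<omega>. f (X \<omega>) * v \<omega> \<partial>M))"
    if v: "integrable M v" "\<And>\<omega>. 0 \<le> v \<omega>" for v :: "'w \<Rightarrow> real"
  proof -
    have vm [measurable]: "v \<in> borel_measurable M" using v by auto
    obtain k :: "'z \<Rightarrow> real" where km [measurable]: "k \<in> borel_measurable N" and k0: "\<And>z. 0 \<le> k z"
      and k: "\<And>f. f \<in> borel_measurable N \<Longrightarrow>
      (\<integral>\<^sup>+z. f z * ennreal (k z) \<partial>distr M N X) = (\<integral>\<^sup>+\<omega>. f (X \<omega>) * ennreal (v \<omega>) \<partial>M)"
      using conditional_density_nonneg[OF X S v] by blast
    have nonneg: "integrable (distr M N X) (\<lambda>z. f z * k z) \<and>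
      (\<integral>z. f z * k z \<partial>distr M N X) = (\<integral>\<omega>. f (X \<omega>) * v \<omega> \<partial>M)"
      if f [measurable]: "f \<in> borel_measurable N" and b: "\<And>z. 0 \<le> f z" "\<And>z. \<bar>f z\<bar> \<le> B" for f :: "'z \<Rightarrow> real" and B
    proof -
      have i: "integrable M (\<lambda>\<omega>. f (X \<omega>) * v \<omega>)"
      proof (rule integrable_dominated[OF integrable_mult_right[OF v(1), of B]])
        show "AE \<omega> in M. norm (f (X \<omega>) * v \<omega>) \<le> norm (B * v \<omega>)"
          using b order_trans[OF abs_ge_zero b(2)] v(2)
          by (auto intro!: AE_I2 mult_right_mono simp: abs_mult)
      qed simp
      have e: "(\<integral>\<^sup>+z. ennreal (f z * k z) \<partial>distr M N X) = (\<integral>\<^sup>+\<omega>. ennreal (f (X \<omega>) * v \<omega>) \<partial>M)"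
        using k[of "\<lambda>z. ennreal (f z)"] b(1) k0 v(2) by (simp add: ennreal_mult)
      have i': "integrable (distr M N X) (\<lambda>z. f z * k z)"
        using i e b(1) k0 v(2) by (simp add: integrable_iff_bounded)
      have "(\<integral>z. f z * k z \<partial>distr M N X) = enn2real (\<integral>\<^sup>+z. ennreal (f z * k z) \<partial>distr M N X)"
        by (rule integral_eq_nn_integral) (use b(1) k0 in auto)
      also have "\<dots> = (\<integral>\<omega>. f (X \<omega>) * v \<omega> \<partial>M)"
        unfolding e by (rule integral_eq_nn_integral[symmetric]) (use b(1) v(2) in auto)
      finally show ?thesis using i' by blast
    qed
    show ?thesis
    proof (intro exI[of _ k] conjI allI impI)
      fix f :: "'z \<Rightarrow> real" and B assume f [measurable]: "f \<in> borel_measurable N" and "\<forall>z. \<bar>f z\<bar> \<le> B"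
      then have b: "\<bar>f z\<bar> \<le> B" for z by blast
      note P = nonneg[of "\<lambda>z. max 0 (f z)" B] and Q = nonneg[of "\<lambda>z. max 0 (- f z)" B]
      have bb: "\<bar>max 0 (f z)\<bar> \<le> B" "\<bar>max 0 (- f z)\<bar> \<le> B" for z using b[of z] by auto
      have fe: "f z * c = max 0 (f z) * c - max 0 (- f z) * c" for z c by (simp add: max_def)
      have iv: "integrable M (\<lambda>\<omega>. g (X \<omega>) * v \<omega>)" if [measurable]: "g \<in> borel_measurable N" and "\<And>z. \<bar>g z\<bar> \<le> B" for g :: "'z \<Rightarrow> real"
      proof (rule integrable_dominated[OF integrable_mult_right[OF v(1), of B]])
        show "AE \<omega> in M. norm (g (X \<omega>) * v \<omega>) \<le> norm (B * v \<omega>)"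
          using that(2) order_trans[OF abs_ge_zero that(2)] v(2)
          by (auto intro!: AE_I2 mult_right_mono simp: abs_mult)
      qed simp
      show "integrable (distr M N X) (\<lambda>z. f z * k z)"
        unfolding fe using P Q bb by (intro Bochner_Integration.integrable_diff) auto
      show "(\<integral>z. f z * k z \<partial>distr M N X) = (\<integral>\<omega>. f (X \<omega>) * v \<omega> \<partial>M)"
        unfolding fe using P Q bb iv[of "\<lambda>z. max 0 (f z)"] iv[of "\<lambda>z. max 0 (- f z)"] by simp
    qed (rule km)
  qed
  have u1: "integrable M (\<lambda>\<omega>. max 0 (u \<omega>))" and u2: "integrable M (\<lambda>\<omega>. max 0 (- u \<omega>))" using u by auto
  obtain k1 where k1m: "k1 \<in> borel_measurable N" and k1: "\<And>f B. f \<in> borel_measurable N \<Longrightarrow> (\<And>z. \<bar>f z\<bar> \<le> B) \<Longrightarrow>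
      integrable (distr M N X) (\<lambda>z. f z * k1 z) \<and>
      (\<integral>z. f z * k1 z \<partial>distr M N X) = (\<integral>\<omega>. f (X \<omega>) * max 0 (u \<omega>) \<partial>M)"
    using pos[OF u1] by auto
  obtain k2 where k2m: "k2 \<in> borel_measurable N" and k2: "\<And>f B. f \<in> borel_measurable N \<Longrightarrow> (\<And>z. \<bar>f z\<bar> \<le> B) \<Longrightarrow>
      integrable (distr M N X) (\<lambda>z. f z * k2 z) \<and>
      (\<integral>z. f z * k2 z \<partial>distr M N X) = (\<integral>\<omega>. f (X \<omega>) * max 0 (- u \<omega>) \<partial>M)"
    using pos[OF u2] by auto
  have main: "integrable (distr M N X) (\<lambda>z. f z * (k1 z - k2 z)) \<and>
      (\<integral>z. f z * (k1 z - k2 z) \<partial>distr M N X) = (\<integral>\<omega>. f (X \<omega>) * u \<omega> \<partial>M)"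
    if f [measurable]: "f \<in> borel_measurable N" and b: "\<And>z. \<bar>f z\<bar> \<le> B" for f :: "'z \<Rightarrow> real" and B
  proof -
    have iv: "integrable M (\<lambda>\<omega>. f (X \<omega>) * v \<omega>)" if v: "integrable M v" for v :: "'w \<Rightarrow> real"
    proof (rule integrable_dominated[OF integrable_mult_right[OF v, of B]])
      show "AE \<omega> in M. norm (f (X \<omega>) * v \<omega>) \<le> norm (B * v \<omega>)"
        using b order_trans[OF abs_ge_zero b]
        by (auto intro!: AE_I2 mult_right_mono simp: abs_mult)
      have [measurable]: "v \<in> borel_measurable M" using v by auto
      show "(\<lambda>\<omega>. f (X \<omega>) * v \<omega>) \<in> borel_measurable M" by measurable
    qed
    have "(\<integral>\<omega>. f (X \<omega>) * u \<omega> \<partial>M) = (\<integral>\<omega>. f (X \<omega>) * max 0 (u \<omega>) - f (X \<omega>) * max 0 (- u \<omega>) \<partial>M)"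
      by (rule Lebesgue_integral_cong) (auto simp: max_def)
    also have "\<dots> = (\<integral>\<omega>. f (X \<omega>) * max 0 (u \<omega>) \<partial>M) - (\<integral>\<omega>. f (X \<omega>) * max 0 (- u \<omega>) \<partial>M)"
      using iv[OF u1] iv[OF u2] by simp
    finally show ?thesis
      using k1[OF f b] k2[OF f b] by (simp add: right_diff_distrib)
  qed
  show ?thesis
  proof (rule that[of "\<lambda>z. k1 z - k2 z"])
    show "(\<lambda>z. k1 z - k2 z) \<in> borel_measurable N" using k1m k2m by measurable
    show "integrable (distr M N X) (\<lambda>z. k1 z - k2 z)" using main[of "\<lambda>_. 1" 1] by simp
  qed (use main in blast)
qed

lemma norm_le_one_plus_square: "norm v \<le> 1 + (norm v)\<^sup>2"
proof -
  have "2 * norm v \<le> 1 + (norm v)\<^sup>2"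
    using zero_le_power2[of "norm v - 1"] by (simp add: power2_diff)
  then show ?thesis using norm_ge_zero[of v] by linarith
qed

lemma borel_measurable_component [measurable (raw)]:
  fixes f :: "'a \<Rightarrow> real^'n::finite"
  assumes "f \<in> borel_measurable M" shows "(\<lambda>x. f x $ i) \<in> borel_measurable M"
  by (rule measurable_compose[OF assms borel_measurable_continuous_onI[OF continuous_on_component[OF continuous_on_id]]])

text \<open>Averaging a random drift over its conditional law given time and position changes neither the
  flux nor the law of the position. Convex costs do not increase: the cost is a supremum of
  functions affine in the drift, each of which is averaged exactly.\<close>

lemma relaxed_to_feedback:
  fixes B :: "'w \<Rightarrow> real^'n::finite"
  assumes X: "X \<in> M \<rightarrow>\<^sub>M N" and S: "finite_measure M"
    and B [measurable]: "B \<in> borel_measurable M" and B2: "integrable M (\<lambda>\<omega>. (norm (B \<omega>))\<^sup>2)"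
  obtains \<beta> :: "'z \<Rightarrow> real^'n" where "\<beta> \<in> borel_measurable N"
    "\<And>g C. g \<in> borel_measurable N \<Longrightarrow> (\<And>z. norm (g z) \<le> C) \<Longrightarrow>
      integrable (distr M N X) (\<lambda>z. \<beta> z \<bullet> g z) \<and> (\<integral>z. \<beta> z \<bullet> g z \<partial>distr M N X) = (\<integral>\<omega>. B \<omega> \<bullet> g (X \<omega>) \<partial>M)"
    "\<And>h b u. (\<And>p. (\<lambda>z. h z p) \<in> borel_measurable N) \<Longrightarrow> (\<And>z p. \<bar>h z p\<bar> \<le> b p) \<Longrightarrow>
      (\<And>z. continuous_on UNIV (h z)) \<Longrightarrow> integrable M u \<Longrightarrow>
      (\<And>\<omega> p. B \<omega> \<bullet> p - h (X \<omega>) p \<le> u \<omega>) \<Longrightarrow>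
      \<exists>k. integrable (distr M N X) k \<and> (\<integral>z. k z \<partial>distr M N X) = (\<integral>\<omega>. u \<omega> \<partial>M) \<and>
        (AE z in distr M N X. \<forall>p. \<beta> z \<bullet> p - h z p \<le> k z)"
proof -
  interpret M: finite_measure M by (rule S)
  note X [measurable]
  have Bi: "integrable M (\<lambda>\<omega>. B \<omega> $ i)" for i
  proof (rule integrable_dominated)
    show "integrable M (\<lambda>\<omega>. 1 + (norm (B \<omega>))\<^sup>2)" using B2 by simp
    show "AE \<omega> in M. norm (B \<omega> $ i) \<le> norm (1 + (norm (B \<omega>))\<^sup>2)"
    proof (rule AE_I2)
      fix \<omega>
      have "\<bar>B \<omega> $ i\<bar> \<le> norm (B \<omega>)" by (rule component_le_norm_cart)
      also have "\<dots> \<le> 1 + (norm (B \<omega>))\<^sup>2"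
        by (rule norm_le_one_plus_square)
      finally show "norm (B \<omega> $ i) \<le> norm (1 + (norm (B \<omega>))\<^sup>2)" by simp
    qed
  qed measurable
  have "\<forall>i. \<exists>k. k \<in> borel_measurable N \<and> integrable (distr M N X) k \<and>
    (\<forall>f b. f \<in> borel_measurable N \<longrightarrow> (\<forall>z. \<bar>f z\<bar> \<le> b) \<longrightarrow>
      integrable (distr M N X) (\<lambda>z. f z * k z) \<and>
      (\<integral>z. f z * k z \<partial>distr M N X) = (\<integral>\<omega>. f (X \<omega>) * B \<omega> $ i \<partial>M))"
  proof
    fix i
    show "\<exists>k. k \<in> borel_measurable N \<and> integrable (distr M N X) k \<and>
      (\<forall>f b. f \<in> borel_measurable N \<longrightarrow> (\<forall>z. \<bar>f z\<bar> \<le> b) \<longrightarrow>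
        integrable (distr M N X) (\<lambda>z. f z * k z) \<and>
        (\<integral>z. f z * k z \<partial>distr M N X) = (\<integral>\<omega>. f (X \<omega>) * B \<omega> $ i \<partial>M))"
      by (rule conditional_density[OF X S Bi[of i]]) blast
  qed
  from choice[OF this] obtain k where km [measurable]: "\<And>i. k i \<in> borel_measurable N"
    and ki: "\<And>i. integrable (distr M N X) (k i)"
    and k: "\<And>i f b. f \<in> borel_measurable N \<Longrightarrow> (\<And>z. \<bar>f z\<bar> \<le> b) \<Longrightarrow>
      integrable (distr M N X) (\<lambda>z. f z * k i z) \<and>
      (\<integral>z. f z * k i z \<partial>distr M N X) = (\<integral>\<omega>. f (X \<omega>) * B \<omega> $ i \<partial>M)" by blast
  define \<beta> where "\<beta> z = (\<chi> i. k i z)" for z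
  have \<beta>m [measurable]: "\<beta> \<in> borel_measurable N"
  proof (subst borel_measurable_euclidean_space, intro ballI)
    fix e :: "real^'n" assume "e \<in> Basis"
    then obtain i where "e = axis i 1" unfolding Basis_vec_def by auto
    then show "(\<lambda>z. \<beta> z \<bullet> e) \<in> borel_measurable N" by (simp add: \<beta>_def inner_axis)
  qed
  have lin: "integrable (distr M N X) (\<lambda>z. \<beta> z \<bullet> g z) \<and> (\<integral>z. \<beta> z \<bullet> g z \<partial>distr M N X) = (\<integral>\<omega>. B \<omega> \<bullet> g (X \<omega>) \<partial>M)"
    if g [measurable]: "g \<in> borel_measurable N" and C: "\<And>z. norm (g z) \<le> C" for g C
  proof -
    have gi [measurable]: "(\<lambda>z. g z $ i) \<in> borel_measurable N" for i by measurable
    have Ci: "\<bar>g z $ i\<bar> \<le> C" for z i using component_le_norm_cart[of "g z" i] C[of z] by linarith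
    note kk = k[OF gi Ci]
    have iB: "integrable M (\<lambda>\<omega>. g (X \<omega>) $ i * B \<omega> $ i)" for i
    proof (rule integrable_dominated[OF integrable_mult_right[OF Bi[of i], of C]])
      show "AE \<omega> in M. norm (g (X \<omega>) $ i * B \<omega> $ i) \<le> norm (C * B \<omega> $ i)"
        using Ci order_trans[OF abs_ge_zero Ci]
        by (auto intro!: AE_I2 mult_right_mono simp: abs_mult)
    qed measurable
    have \<beta>i: "integrable (distr M N X) (\<lambda>z. \<beta> z \<bullet> g z)"
      unfolding inner_vec_def \<beta>_def using kk by (simp add: mult.commute)
    have "(\<integral>z. \<beta> z \<bullet> g z \<partial>distr M N X) = (\<Sum>i\<in>UNIV. \<integral>z. g z $ i * k i z \<partial>distr M N X)"
      unfolding inner_vec_def \<beta>_def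
      using kk by (simp add: mult.commute)
    also have "\<dots> = (\<Sum>i\<in>UNIV. \<integral>\<omega>. g (X \<omega>) $ i * B \<omega> $ i \<partial>M)" using kk by simp
    also have "\<dots> = (\<integral>\<omega>. B \<omega> \<bullet> g (X \<omega>) \<partial>M)"
      unfolding inner_vec_def using iB by (simp add: mult.commute)
    finally show ?thesis
      using \<beta>i by blast
  qed
  have jensen: "\<exists>k0. integrable (distr M N X) k0 \<and> (\<integral>z. k0 z \<partial>distr M N X) = (\<integral>\<omega>. u \<omega> \<partial>M) \<and>
        (AE z in distr M N X. \<forall>p. \<beta> z \<bullet> p - h z p \<le> k0 z)"
    if h [measurable]: "\<And>p. (\<lambda>z. h z p) \<in> borel_measurable N" and b: "\<And>z p. \<bar>h z p\<bar> \<le> b p"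
      and c: "\<And>z. continuous_on UNIV (h z)" and u: "integrable M u"
      and le: "\<And>\<omega> p. B \<omega> \<bullet> p - h (X \<omega>) p \<le> u \<omega>" for h b u
  proof -
    have um [measurable]: "u \<in> borel_measurable M" using u by auto
    obtain k0 where k0m [measurable]: "k0 \<in> borel_measurable N" and k0i: "integrable (distr M N X) k0"
      and k0: "\<And>f B. f \<in> borel_measurable N \<Longrightarrow> (\<And>z. \<bar>f z\<bar> \<le> B) \<Longrightarrow>
      integrable (distr M N X) (\<lambda>z. f z * k0 z) \<and>
      (\<integral>z. f z * k0 z \<partial>distr M N X) = (\<integral>\<omega>. f (X \<omega>) * u \<omega> \<partial>M)"
      using conditional_density[OF X S u] by blast
    have one: "AE z in distr M N X. \<beta> z \<bullet> p - h z p \<le> k0 z" for p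
    proof -
      define d where "d z = \<beta> z \<bullet> p - h z p - k0 z" for z
      have dm [measurable]: "d \<in> borel_measurable N" unfolding d_def by measurable
      define f where "f z = (if 0 < d z then 1 else 0 :: real)" for z
      have fm [measurable]: "f \<in> borel_measurable N" unfolding f_def by measurable
      have fb: "\<bar>f z\<bar> \<le> 1" for z by (simp add: f_def)
      have L: "integrable (distr M N X) (\<lambda>z. \<beta> z \<bullet> (f z *\<^sub>R p)) \<and>
          (\<integral>z. \<beta> z \<bullet> (f z *\<^sub>R p) \<partial>distr M N X) = (\<integral>\<omega>. B \<omega> \<bullet> (f (X \<omega>) *\<^sub>R p) \<partial>M)"
        by (rule lin[where C="norm p"]) (use fb in \<open>auto simp: mult_left_le_one_le\<close>)
      have Hb: "\<bar>f z * h z p\<bar> \<le> b p" for z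
        using b[of z p] by (auto simp: f_def)
      have Hi: "integrable (distr M N X) (\<lambda>z. f z * h z p)"
        by (rule finite_measure.integrable_const_bound[OF M.finite_measure_distr[OF X], where B="b p"])
           (use Hb in auto)
      have HiM: "integrable M (\<lambda>\<omega>. f (X \<omega>) * h (X \<omega>) p)"
        by (rule M.integrable_const_bound[where B="b p"]) (use Hb in auto)
      have Ui: "integrable M (\<lambda>\<omega>. f (X \<omega>) * u \<omega>)"
        by (rule integrable_dominated[OF u]) (auto simp: f_def)
      have Bp: "integrable M (\<lambda>\<omega>. B \<omega> \<bullet> (f (X \<omega>) *\<^sub>R p))"
      proof (rule integrable_dominated)
        show "integrable M (\<lambda>\<omega>. norm p * (1 + (norm (B \<omega>))\<^sup>2))" using B2 by simp
        show "AE \<omega> in M. norm (B \<omega> \<bullet> (f (X \<omega>) *\<^sub>R p)) \<le> norm (norm p * (1 + (norm (B \<omega>))\<^sup>2))"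
        proof (rule AE_I2)
          fix \<omega>
          have "norm (B \<omega> \<bullet> (f (X \<omega>) *\<^sub>R p)) \<le> norm (B \<omega>) * norm p"
            using Cauchy_Schwarz_ineq2[of "B \<omega>" p] by (auto simp: f_def)
          also have "norm (B \<omega>) \<le> 1 + (norm (B \<omega>))\<^sup>2"
            by (rule norm_le_one_plus_square)
          finally show "norm (B \<omega> \<bullet> (f (X \<omega>) *\<^sub>R p)) \<le> norm (norm p * (1 + (norm (B \<omega>))\<^sup>2))"
            by (simp add: mult.commute mult_right_mono)
        qed
      qed measurable
      have fd: "f z * d z = \<beta> z \<bullet> (f z *\<^sub>R p) - f z * h z p - f z * k0 z" for z
        by (simp add: d_def algebra_simps)
      have fdi: "integrable (distr M N X) (\<lambda>z. f z * d z)"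
        unfolding fd using L Hi k0[OF fm fb] by auto
      have "(\<integral>z. f z * d z \<partial>distr M N X) = (\<integral>\<omega>. B \<omega> \<bullet> (f (X \<omega>) *\<^sub>R p) \<partial>M)
          - (\<integral>\<omega>. f (X \<omega>) * h (X \<omega>) p \<partial>M) - (\<integral>\<omega>. f (X \<omega>) * u \<omega> \<partial>M)"
        unfolding fd using L Hi k0[OF fm fb] by (simp add: integral_distr)
      also have "\<dots> = (\<integral>\<omega>. f (X \<omega>) * (B \<omega> \<bullet> p - h (X \<omega>) p - u \<omega>) \<partial>M)"
        using Bp HiM Ui by (simp add: algebra_simps)
      also have "\<dots> \<le> (\<integral>\<omega>. 0 \<partial>M)"
      proof (rule integral_mono)
        show "integrable M (\<lambda>\<omega>. f (X \<omega>) * (B \<omega> \<bullet> p - h (X \<omega>) p - u \<omega>))"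
          using Bp HiM Ui by (simp add: algebra_simps)
        show "f (X \<omega>) * (B \<omega> \<bullet> p - h (X \<omega>) p - u \<omega>) \<le> 0" for \<omega>
          using le[of \<omega> p] by (simp add: f_def)
      qed simp
      finally have le0: "(\<integral>z. f z * d z \<partial>distr M N X) \<le> 0" by simp
      have nn: "AE z in distr M N X. 0 \<le> f z * d z" by (simp add: f_def)
      have "(\<integral>z. f z * d z \<partial>distr M N X) = 0"
        using le0 integral_nonneg_AE[OF nn] by linarith
      then have "AE z in distr M N X. f z * d z = 0"
        using integral_nonneg_eq_0_iff_AE[OF fdi nn] by simp
      then show ?thesis
        by eventually_elim (auto simp: f_def d_def split: if_splits)
    qed
    \<comment> \<open>Continuity in the slope extends the inequality from a countable dense set of slopes, which costs only
      one null set, to all slopes.\<close>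
    obtain D :: "(real^'n) set" where D: "countable D" "\<And>U. open U \<Longrightarrow> U \<noteq> {} \<Longrightarrow> \<exists>d\<in>D. d \<in> U"
      by (rule countable_dense_setE) blast
    have cl: "closure D = UNIV"
    proof (rule ccontr)
      assume "closure D \<noteq> UNIV"
      then obtain d where "d \<in> D" "d \<in> - closure D"
        using D(2)[of "- closure D"] by (metis Compl_empty_eq compl_eq_compl_iff double_complement open_Compl closed_closure)
      then show False using closure_subset by auto
    qed
    have "AE z in distr M N X. \<forall>p\<in>D. \<beta> z \<bullet> p - h z p \<le> k0 z"
      by (subst AE_ball_countable[OF D(1)]) (use one in blast)
    then have "AE z in distr M N X. \<forall>p. \<beta> z \<bullet> p - h z p \<le> k0 z"
    proof eventually_elim
      case (elim z)
      show ?case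
      proof
        fix p
        have "continuous_on (closure D) (\<lambda>p. \<beta> z \<bullet> p - h z p)"
          unfolding cl by (intro continuous_intros c)
        then show "\<beta> z \<bullet> p - h z p \<le> k0 z"
          by (rule continuous_le_on_closure) (use cl elim in auto)
      qed
    qed
    then show ?thesis
      using k0i k0[of "\<lambda>_. 1" 1] by auto
  qed
  show ?thesis
  proof (rule that[of \<beta>], goal_cases)
    case 1 show ?case by (rule \<beta>m)
  next
    case (2 g C) then show ?case by (rule lin)
  next
    case (3 h b u)
    show ?case by (rule jensen[OF 3])
  qed
qed

section \<open>Test functions\<close>

lemma Ck_SucI:
  assumes "\<And>x. (f has_derivative D x) (at x)" "\<And>b. b \<in> Basis \<Longrightarrow> Ck k (\<lambda>x. D x b)"
  shows "Ck (Suc k) f"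
proof -
  have "frechet_derivative f (at x) = D x" for x
    using frechet_derivative_at[OF assms(1)] by simp
  then show ?thesis using assms by (auto simp: differentiable_def)
qed

lemma Ck_SucE:
  assumes "Ck (Suc k) f"
  obtains D where "\<And>x. (f has_derivative D x) (at x)" "\<And>b. b \<in> Basis \<Longrightarrow> Ck k (\<lambda>x. D x b)"
  using assms by (auto simp: frechet_derivative_works intro: that[of "\<lambda>x. frechet_derivative f (at x)"])

lemma Ck_imp_continuous: "Ck k f \<Longrightarrow> continuous_on UNIV f"
  by (cases k) (auto simp: continuous_on_eq_continuous_within differentiable_imp_continuous_within)

lemma Ck_SucD: "Ck (Suc k) f \<Longrightarrow> Ck k f"
proof (induction k arbitrary: f)
  case 0
  then have "continuous_on UNIV f" by (rule Ck_imp_continuous)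
  then show ?case by simp
next
  case (Suc k)
  then obtain D where D: "\<And>x. (f has_derivative D x) (at x)" "\<And>b. b \<in> Basis \<Longrightarrow> Ck (Suc k) (\<lambda>x. D x b)"
    by (elim Ck_SucE) blast
  show ?case by (rule Ck_SucI[OF D(1)]) (use D(2) Suc.IH in blast)
qed

lemma Ck_const: "Ck k (\<lambda>_. c)"
proof (induction k arbitrary: c)
  case (Suc k)
  show ?case by (rule Ck_SucI[where D="\<lambda>_ _. 0"]) (auto intro: Suc)
qed simp

lemma Ck_add: "Ck k f \<Longrightarrow> Ck k g \<Longrightarrow> Ck k (\<lambda>x. f x + g x)"
proof (induction k arbitrary: f g)
  case 0 then show ?case by (simp add: continuous_on_add)
next
  case (Suc k)
  obtain D where D: "\<And>x. (f has_derivative D x) (at x)" "\<And>b. b \<in> Basis \<Longrightarrow> Ck k (\<lambda>x. D x b)"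
    using Suc.prems(1) by (elim Ck_SucE) blast
  obtain E where E: "\<And>x. (g has_derivative E x) (at x)" "\<And>b. b \<in> Basis \<Longrightarrow> Ck k (\<lambda>x. E x b)"
    using Suc.prems(2) by (elim Ck_SucE) blast
  show ?case
    by (rule Ck_SucI[where D="\<lambda>x h. D x h + E x h"])
       (use D E Suc.IH in \<open>auto intro: has_derivative_add\<close>)
qed

lemma Ck_mult: "Ck k f \<Longrightarrow> Ck k g \<Longrightarrow> Ck k (\<lambda>x. f x * g x)"
proof (induction k arbitrary: f g)
  case 0 then show ?case by (simp add: continuous_on_mult)
next
  case (Suc k)
  obtain D where D: "\<And>x. (f has_derivative D x) (at x)" "\<And>b. b \<in> Basis \<Longrightarrow> Ck k (\<lambda>x. D x b)"
    using Suc.prems(1) by (elim Ck_SucE) blast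
  obtain E where E: "\<And>x. (g has_derivative E x) (at x)" "\<And>b. b \<in> Basis \<Longrightarrow> Ck k (\<lambda>x. E x b)"
    using Suc.prems(2) by (elim Ck_SucE) blast
  note fg = Ck_SucD[OF Suc.prems(1)] Ck_SucD[OF Suc.prems(2)]
  show ?case
  proof (rule Ck_SucI)
    show "((\<lambda>x. f x * g x) has_derivative (\<lambda>h. f x * E x h + D x h * g x)) (at x)" for x
      by (rule has_derivative_mult[OF D(1) E(1)])
    show "Ck k (\<lambda>x. f x * E x b + D x b * g x)" if "b \<in> Basis" for b
      using D(2)[OF that] E(2)[OF that] fg by (intro Ck_add Suc.IH)
  qed
qed

lemma Ck_sum:
  assumes "finite I" "\<And>i. i \<in> I \<Longrightarrow> Ck k (f i)" shows "Ck k (\<lambda>x. \<Sum>i\<in>I. f i x)"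
  using assms by (induction I rule: finite_induct) (auto intro: Ck_const Ck_add)

lemma Ck_exp_time: "Ck k (\<lambda>z :: real \<times> 'b::euclidean_space. exp (- fst z))"
proof (induction k)
  case 0 show ?case by (auto intro!: continuous_intros)
next
  case (Suc k)
  show ?case
  proof (rule Ck_SucI)
    show "((\<lambda>z :: real \<times> 'b. exp (- fst z)) has_derivative (\<lambda>h. (- fst h) * exp (- fst z))) (at z)" for z
      by (auto intro!: derivative_eq_intros)
    show "Ck k (\<lambda>z :: real \<times> 'b. (- fst b) * exp (- fst z))" for b :: "real \<times> 'b"
      by (intro Ck_mult Ck_const Suc)
  qed
qed

lemma Ck_autonomous_time:
  fixes \<eta> :: "real \<Rightarrow> real"
  assumes d: "\<And>t. (\<eta> has_real_derivative n * (\<eta> t * (1 + (-1) * \<eta> t))) (at t)"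
  shows "Ck k (\<lambda>z :: real \<times> 'b::euclidean_space. \<eta> (fst z))"
proof (induction k)
  case 0
  have "continuous_on UNIV \<eta>" by (rule DERIV_continuous_on) (rule has_field_derivative_at_within[OF d])
  from continuous_on_compose2[OF this continuous_on_fst[OF continuous_on_id]]
  show ?case by simp
next
  case (Suc k)
  show ?case
  proof (rule Ck_SucI)
    fix z :: "real \<times> 'b"
    have "((\<lambda>z :: real \<times> 'b. \<eta> (fst z)) has_derivative (\<lambda>h. (n * (\<eta> (fst z) * (1 + (-1) * \<eta> (fst z)))) * fst h)) (at z)"
      by (rule has_derivative_compose[OF has_derivative_fst[OF has_derivative_ident]])
         (use d[of "fst z"] in \<open>simp add: has_field_derivative_def\<close>)
    then show "((\<lambda>z :: real \<times> 'b. \<eta> (fst z)) has_derivative (\<lambda>h. fst h * (n * (\<eta> (fst z) * (1 + (-1) * \<eta> (fst z)))))) (at z)"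
      by (simp add: mult.commute)
  next
    fix b :: "real \<times> 'b"
    show "Ck k (\<lambda>z :: real \<times> 'b. fst b * (n * (\<eta> (fst z) * (1 + (-1) * \<eta> (fst z)))))"
      by (intro Ck_mult Ck_add Ck_const Suc)
  qed
qed

lemma Basis_time_space:
  fixes b :: "real \<times> (real^'n::finite)"
  assumes "b \<in> Basis" shows "b = (1, 0) \<or> (\<exists>i. b = (0, axis i 1))"
  using assms by (auto simp: Basis_prod_def Basis_vec_def)

lemma time_space_Basis: "(1, 0) \<in> (Basis :: (real \<times> (real^'n::finite)) set)"
  "(0, axis i 1) \<in> (Basis :: (real \<times> (real^'n::finite)) set)"
  by (auto simp: Basis_prod_def Basis_vec_def)

lemma linear_time_space:
  fixes D :: "real \<times> (real^'n::finite) \<Rightarrow> real"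
  assumes "linear D" shows "D (a, h) = a * D (1, 0) + (\<Sum>i\<in>UNIV. h $ i * D (0, axis i 1))"
proof -
  have "(a, h) = a *\<^sub>R (1, 0) + (\<Sum>i\<in>UNIV. h $ i *\<^sub>R (0, axis i 1))"
  proof -
    have "(\<Sum>i\<in>UNIV. h $ i *\<^sub>R (0::real, axis i (1::real))) = (0, \<Sum>i\<in>UNIV. h $ i *\<^sub>R axis i 1)"
      by (simp add: prod_eq_iff fst_sum snd_sum)
    also have "(\<Sum>i\<in>UNIV. h $ i *\<^sub>R axis i 1) = h"
      using basis_expansion[of h] by (simp add: scalar_mult_eq_scaleR)
    finally show ?thesis by simp
  qed
  then have "D (a, h) = D (a *\<^sub>R (1, 0) + (\<Sum>i\<in>UNIV. h $ i *\<^sub>R (0, axis i 1)))" by simp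
  also have "\<dots> = a * D (1, 0) + (\<Sum>i\<in>UNIV. h $ i * D (0, axis i 1))"
    by (simp only: linear_add[OF assms] linear_sum[OF assms] linear_scale[OF assms] real_scaleR_def o_def)
  finally show ?thesis .
qed

lemma Ck_translate:
  fixes f :: "real \<times> (real^'n::finite) \<Rightarrow> real"
  shows "Ck k f \<Longrightarrow> Ck k (\<lambda>z. f (fst z + \<tau>, snd z + exp (- fst z) *\<^sub>R c))"
proof (induction k arbitrary: f)
  case 0
  then have "continuous_on UNIV f" by simp
  then have "continuous_on UNIV (\<lambda>z. f (fst z + \<tau>, snd z + exp (- fst z) *\<^sub>R c))"
    by (rule continuous_on_compose2) (auto intro!: continuous_intros)
  then show ?case by simp
next
  case (Suc k)
  obtain D where D: "\<And>x. (f has_derivative D x) (at x)" "\<And>b. b \<in> Basis \<Longrightarrow> Ck k (\<lambda>x. D x b)"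
    using Suc.prems by (elim Ck_SucE) blast
  let ?G = "\<lambda>z. (fst z + \<tau>, snd z + exp (- fst z) *\<^sub>R c)"
  let ?E = "\<lambda>z h. D (?G z) (fst h, snd h + (- fst h * exp (- fst z)) *\<^sub>R c)"
  have lin: "linear (D z)" for z using D(1) has_derivative_linear by blast
  show ?case
  proof (rule Ck_SucI)
    show "((\<lambda>z. f (?G z)) has_derivative ?E z) (at z)" for z
    proof (rule has_derivative_compose[where g=f and f="?G" and g'="D (?G z)"])
      show "(?G has_derivative (\<lambda>h. (fst h, snd h + (- fst h * exp (- fst z)) *\<^sub>R c))) (at z)"
        by (auto intro!: derivative_eq_intros)
    qed (rule D)
    fix b :: "real \<times> (real^'n)" assume "b \<in> Basis"
    then consider "b = (1, 0)" | i where "b = (0, axis i 1)" using Basis_time_space by blast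
    then show "Ck k (\<lambda>z. ?E z b)"
    proof cases
      case 1
      have "?E z b = D (?G z) (1, 0) + (\<Sum>i\<in>UNIV. (- c $ i) * exp (- fst z) * D (?G z) (0, axis i 1))" for z
        unfolding 1 by (subst linear_time_space[OF lin]) (simp add: mult.commute)
      moreover have "Ck k (\<lambda>z. D (?G z) (1, 0) + (\<Sum>i\<in>UNIV. (- c $ i) * exp (- fst z) * D (?G z) (0, axis i 1)))"
        by (intro Ck_add Ck_sum Ck_mult Ck_const Ck_exp_time Suc.IH D(2) time_space_Basis) simp
      ultimately show ?thesis by simp
    next
      case 2
      show ?thesis unfolding 2 using Suc.IH[OF D(2)[OF time_space_Basis(2)], of i] by simp
    qed
  qed
qed

text \<open>Nearby points of the torus have nearby representatives, so continuity of the lift passes to the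
  quotient.\<close>

lemma continuous_on_torus_lift:
  fixes g :: "'a::metric_space \<Rightarrow> 'n::finite torus \<Rightarrow> 'b::metric_space"
  assumes "continuous_on UNIV (\<lambda>(t, y). g t (tproj y))"
  shows "continuous_on UNIV (\<lambda>(t, x). g t x)"
  unfolding continuous_on_iff
proof (intro ballI allI impI)
  fix p :: "'a \<times> 'n torus" and e :: real assume e: "0 < e"
  obtain t0 x0 where p: "p = (t0, x0)" by (cases p)
  obtain y0 where y0: "tproj y0 = x0" using tproj_surj by blast
  obtain d where d: "d > 0" "\<And>q. dist q (t0, y0) < d \<Longrightarrow> dist (case q of (t, y) \<Rightarrow> g t (tproj y)) (g t0 x0) < e"
    using assms e unfolding continuous_on_iff by (metis (mono_tags, lifting) UNIV_I case_prod_conv y0)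
  have "dist (case q of (t, x) \<Rightarrow> g t x) (g t0 x0) < e" if q: "dist q p < d/2" for q
  proof -
    obtain t x where tx: "q = (t, x)" by (cases q)
    have dt: "dist t t0 < d/2" and dx: "dist x x0 < d/2"
      using dist_fst_le[of q p] dist_snd_le[of q p] q unfolding p tx by auto
    obtain v where v: "tproj v = x - x0" "norm v < d/2"
      by (rule torus_norm_approx[of "x - x0" "d/2"]) (use dx in \<open>simp add: dist_torus_def\<close>)
    have "dist (t, y0 + v) (t0, y0) \<le> dist t t0 + dist (y0 + v) y0"
      unfolding dist_Pair_Pair by (rule sqrt_sum_squares_le_sum) auto
    also have "\<dots> < d" using dt v by (simp add: dist_norm)
    finally show ?thesis using d(2)[of "(t, y0 + v)"] v y0 by (simp add: tx tproj_add)
  qed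
  then show "\<exists>d>0. \<forall>q\<in>UNIV. dist q p < d \<longrightarrow> dist (case q of (t, x) \<Rightarrow> g t x) (case p of (t, x) \<Rightarrow> g t x) < e"
    using d(1) by (intro exI[of _ "d/2"]) (auto simp: p)
qed

definition lift :: "(real \<Rightarrow> 'n::finite torus \<Rightarrow> real) \<Rightarrow> real \<times> (real^'n) \<Rightarrow> real" where
  "lift \<phi> z = \<phi> (fst z) (tproj (snd z))"

definition time_deriv :: "(real \<Rightarrow> 'n::finite torus \<Rightarrow> real) \<Rightarrow> real \<Rightarrow> 'n torus \<Rightarrow> real" where
  "time_deriv \<phi> t x = deriv (\<lambda>s. \<phi> s x) t"

lemma test_function_lift: "test_function \<phi> \<longleftrightarrow> (\<forall>k. Ck k (lift \<phi>)) \<and> (\<exists>T. \<forall>t\<ge>T. \<forall>x. \<phi> t x = 0)"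
proof -
  have "(\<lambda>(t, y). \<phi> t (tproj y)) = lift \<phi>" by (auto simp: lift_def)
  then show ?thesis unfolding test_function_def by simp
qed

lemma lift_partial:
  assumes "(lift \<phi> has_derivative D) (at (t, y))"
  shows "((\<lambda>s. \<phi> s (tproj y)) has_real_derivative D (1, 0)) (at t)"
    and "((\<lambda>s. \<phi> t (tproj (y + s *\<^sub>R v))) has_real_derivative D (0, v)) (at 0)"
proof -
  have "((\<lambda>s. lift \<phi> ((0, y) + s *\<^sub>R (1, 0))) has_vector_derivative D (1, 0)) (at t)"
    by (rule has_derivative_imp_DERIV_line) (use assms in simp)
  then show "((\<lambda>s. \<phi> s (tproj y)) has_real_derivative D (1, 0)) (at t)"
    by (simp add: lift_def has_real_derivative_iff_has_vector_derivative)
  have "((\<lambda>s. lift \<phi> ((t, y) + s *\<^sub>R (0, v))) has_vector_derivative D (0, v)) (at 0)"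
    by (rule has_derivative_imp_DERIV_line) (use assms in simp)
  then show "((\<lambda>s. \<phi> t (tproj (y + s *\<^sub>R v))) has_real_derivative D (0, v)) (at 0)"
    by (simp add: lift_def has_real_derivative_iff_has_vector_derivative)
qed

lemma
  assumes "test_function \<phi>"
  shows test_function_time_deriv: "test_function (time_deriv \<phi>)"
    and test_function_tpd: "test_function (\<lambda>t. tpd i (\<phi> t))"
    and lift_has_derivative: "(lift \<phi> has_derivative
      (\<lambda>(a, h). a * time_deriv \<phi> t (tproj y) + h \<bullet> tgrad (\<phi> t) (tproj y))) (at (t, y))"
    and DERIV_time_deriv: "((\<lambda>s. \<phi> s x) has_real_derivative time_deriv \<phi> t x) (at t)"
proof -
  have C: "Ck k (lift \<phi>)" for k using assms test_function_lift by blast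
  obtain T where T: "\<And>t x. t \<ge> T \<Longrightarrow> \<phi> t x = 0" using assms test_function_lift by blast
  define D where "D z = frechet_derivative (lift \<phi>) (at z)" for z
  have D: "(lift \<phi> has_derivative D z) (at z)" for z
    using C[of "Suc 0"] unfolding D_def by (cases z) (simp add: frechet_derivative_works)
  have CD: "Ck k (\<lambda>z. D z b)" if "b \<in> Basis" for b k
    using C[of "Suc k"] that unfolding D_def by simp
  have dt: "D (t, y) (1, 0) = time_deriv \<phi> t (tproj y)" for t y
    unfolding time_deriv_def using lift_partial(1)[OF D] by (metis DERIV_imp_deriv)
  have dx: "D (t, y) (0, axis i 1) = tpd i (\<phi> t) (tproj y)" for t y i
    unfolding tpd_lift using lift_partial(2)[OF D] by (metis DERIV_imp_deriv)
  show "test_function (time_deriv \<phi>)"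
    unfolding test_function_lift
  proof (intro conjI allI exI[of _ "T + 1"] impI)
    have "lift (time_deriv \<phi>) = (\<lambda>z. D z (1, 0))" by (auto simp: lift_def dt[symmetric])
    then show "Ck k (lift (time_deriv \<phi>))" for k using CD[OF time_space_Basis(1)] by simp
    fix t x assume "T + 1 \<le> t"
    then have "eventually (\<lambda>s. T < s) (nhds t)"
      by (intro eventually_nhds_in_open[of "{T<..}", simplified]) auto
    then have "eventually (\<lambda>s. \<phi> s x = 0) (nhds t)"
      by eventually_elim (simp add: T)
    then have "deriv (\<lambda>s. \<phi> s x) t = deriv (\<lambda>s. 0) t" by (intro deriv_cong_ev) auto
    then show "time_deriv \<phi> t x = 0" by (simp add: time_deriv_def)
  qed
  show "test_function (\<lambda>t. tpd i (\<phi> t))"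
    unfolding test_function_lift
  proof (intro conjI allI exI[of _ T] impI)
    have "lift (\<lambda>t. tpd i (\<phi> t)) = (\<lambda>z. D z (0, axis i 1))" by (auto simp: lift_def dx[symmetric])
    then show "Ck k (lift (\<lambda>t. tpd i (\<phi> t)))" for k using CD[OF time_space_Basis(2)] by simp
    show "tpd i (\<phi> t) x = 0" if "T \<le> t" for t x using that by (simp add: tpd_def T)
  qed
  have lin: "linear (D z)" for z by (rule has_derivative_linear[OF D])
  have "D (t, y) = (\<lambda>(a, h). a * time_deriv \<phi> t (tproj y) + h \<bullet> tgrad (\<phi> t) (tproj y))"
  proof (rule ext)
    fix z :: "real \<times> (real^'a)"
    show "D (t, y) z = (case z of (a, h) \<Rightarrow> a * time_deriv \<phi> t (tproj y) + h \<bullet> tgrad (\<phi> t) (tproj y))"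
      using linear_time_space[OF lin, of "(t, y)" "fst z" "snd z"]
      by (simp add: dt dx inner_vec_def tgrad_def case_prod_beta)
  qed
  then show "(lift \<phi> has_derivative
      (\<lambda>(a, h). a * time_deriv \<phi> t (tproj y) + h \<bullet> tgrad (\<phi> t) (tproj y))) (at (t, y))"
    using D[of "(t, y)"] by simp
  obtain y' where "tproj y' = x" using tproj_surj by blast
  then show "((\<lambda>s. \<phi> s x) has_real_derivative time_deriv \<phi> t x) (at t)"
    using lift_partial(1)[OF D[of "(t, y')"]] by (simp add: dt)
qed

lemma test_function_continuous:
  assumes "test_function \<phi>" shows "continuous_on UNIV (\<lambda>(t, x). \<phi> t x)"
proof (rule continuous_on_torus_lift)
  have "Ck 0 (\<lambda>(t, y). \<phi> t (tproj y))" using assms unfolding test_function_def by blast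
  then show "continuous_on UNIV (\<lambda>(t, y). \<phi> t (tproj y))" by simp
qed

lemma test_function_measurable:
  assumes "test_function \<phi>"
  shows "(\<lambda>z. \<phi> (fst z) (snd z)) \<in> borel_measurable borel"
  using borel_measurable_continuous_onI[OF test_function_continuous[OF assms]] by (simp add: case_prod_beta')

lemma test_function_bounded:
  assumes "test_function \<phi>" obtains C where "\<And>t x. 0 \<le> t \<Longrightarrow> \<bar>exp (\<delta> * t) * \<phi> t x\<bar> \<le> C"
proof -
  obtain T where T: "\<And>t x. t \<ge> T \<Longrightarrow> \<phi> t x = 0" using assms test_function_lift by blast
  have "continuous_on ({0..T} \<times> UNIV) (\<lambda>z. exp (\<delta> * fst z) * \<phi> (fst z) (snd z))"
    using test_function_continuous[OF assms]
    by (intro continuous_intros) (auto simp: case_prod_beta intro: continuous_on_subset)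
  then have "compact ((\<lambda>z. exp (\<delta> * fst z) * \<phi> (fst z) (snd z)) ` ({0..T} \<times> UNIV))"
    by (intro compact_continuous_image compact_Times compact_Icc compact_torus)
  then have "bounded ((\<lambda>z. exp (\<delta> * fst z) * \<phi> (fst z) (snd z)) ` ({0..T} \<times> UNIV))"
    by (rule compact_imp_bounded)
  then obtain C where "\<forall>w \<in> (\<lambda>z. exp (\<delta> * fst z) * \<phi> (fst z) (snd z)) ` ({0..T} \<times> UNIV). norm w \<le> C"
    unfolding bounded_iff by (rule exE)
  from bspec[OF this imageI]
  have C: "\<bar>exp (\<delta> * fst z) * \<phi> (fst z) (snd z)\<bar> \<le> C" if "z \<in> {0..T} \<times> UNIV" for z
    using that by simp
  have "\<bar>exp (\<delta> * t) * \<phi> t x\<bar> \<le> max C 0" if "0 \<le> t" for t x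
    using C[of "(t, x)"] T[of t x] that by (cases "t \<le> T") (auto simp: max_def)
  then show ?thesis by (rule that)
qed

lemma test_function_translate:
  fixes \<phi> :: "real \<Rightarrow> 'n::finite torus \<Rightarrow> real" and c :: "real^'n" and \<tau> :: real
  assumes \<phi>: "test_function \<phi>"
  defines "\<psi> \<equiv> \<lambda>t x. \<phi> (t + \<tau>) (x + tproj (exp (- t) *\<^sub>R c))"
  shows "test_function \<psi>"
    and "time_deriv \<psi> t x = time_deriv \<phi> (t + \<tau>) (x + tproj (exp (- t) *\<^sub>R c))
        - exp (- t) * (c \<bullet> tgrad (\<phi> (t + \<tau>)) (x + tproj (exp (- t) *\<^sub>R c)))"
    and "tgrad (\<psi> t) x = tgrad (\<phi> (t + \<tau>)) (x + tproj (exp (- t) *\<^sub>R c))"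
    and "tlap (\<psi> t) x = tlap (\<phi> (t + \<tau>)) (x + tproj (exp (- t) *\<^sub>R c))"
proof -
  have l: "lift \<psi> = (\<lambda>z. lift \<phi> (fst z + \<tau>, snd z + exp (- fst z) *\<^sub>R c))"
    by (auto simp: lift_def \<psi>_def tproj_add)
  obtain T where T: "\<And>t x. t \<ge> T \<Longrightarrow> \<phi> t x = 0" using \<phi> test_function_lift by blast
  show "test_function \<psi>"
    unfolding test_function_lift
  proof (intro conjI allI exI[of _ "T - \<tau>"] impI)
    show "Ck k (lift \<psi>)" for k unfolding l using \<phi> test_function_lift by (intro Ck_translate) blast
    show "\<psi> t x = 0" if "T - \<tau> \<le> t" for t x using that by (simp add: \<psi>_def T)
  qed
  have tr: "tpd i (\<lambda>x. f (x + a)) x = tpd i f (x + a)" for i and f :: "'n torus \<Rightarrow> real" and a x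
    unfolding tpd_def by (simp add: ac_simps)
  show "tgrad (\<psi> t) x = tgrad (\<phi> (t + \<tau>)) (x + tproj (exp (- t) *\<^sub>R c))"
    unfolding tgrad_def \<psi>_def tr ..
  show "tlap (\<psi> t) x = tlap (\<phi> (t + \<tau>)) (x + tproj (exp (- t) *\<^sub>R c))"
    unfolding tlap_def \<psi>_def tr ..
  obtain y where y: "tproj y = x" using tproj_surj by blast
  have "((\<lambda>s. (s + \<tau>, y + exp (- s) *\<^sub>R c)) has_derivative (\<lambda>h. (h, - (h * exp (- t)) *\<^sub>R c))) (at t)"
    by (auto intro!: derivative_eq_intros)
  from has_derivative_compose[OF this lift_has_derivative[OF \<phi>]]
  have "((\<lambda>s. lift \<phi> (s + \<tau>, y + exp (- s) *\<^sub>R c)) has_derivative (\<lambda>h. h *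
      (time_deriv \<phi> (t + \<tau>) (x + tproj (exp (- t) *\<^sub>R c))
        - exp (- t) * (c \<bullet> tgrad (\<phi> (t + \<tau>)) (x + tproj (exp (- t) *\<^sub>R c)))))) (at t)"
    by (simp add: tproj_add y algebra_simps)
  then have "((\<lambda>s. \<psi> s x) has_real_derivative
      (time_deriv \<phi> (t + \<tau>) (x + tproj (exp (- t) *\<^sub>R c))
        - exp (- t) * (c \<bullet> tgrad (\<phi> (t + \<tau>)) (x + tproj (exp (- t) *\<^sub>R c))))) (at t)"
    unfolding has_field_derivative_def lift_def \<psi>_def by (simp add: tproj_add y mult.commute[of _ "_ - _"])
  then show "time_deriv \<psi> t x = time_deriv \<phi> (t + \<tau>) (x + tproj (exp (- t) *\<^sub>R c))
        - exp (- t) * (c \<bullet> tgrad (\<phi> (t + \<tau>)) (x + tproj (exp (- t) *\<^sub>R c)))"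
    unfolding time_deriv_def by (rule DERIV_imp_deriv)
qed

section \<open>The control problem in space-time\<close>

text \<open>Extending the discount factor by zero turns integrals over the half line into integrals over the line.\<close>

definition disc :: "real \<Rightarrow> real \<Rightarrow> real" where
  "disc \<delta> t = (if 0 \<le> t then exp (- \<delta> * t) else 0)"

lemma disc_simps [simp]: "0 \<le> disc \<delta> t" "t < 0 \<Longrightarrow> disc \<delta> t = 0"
  and measurable_disc [measurable]: "disc \<delta> \<in> borel_measurable borel"
  unfolding disc_def by (auto, measurable)

lemma
  assumes "0 < \<delta>"
  shows integrable_disc: "integrable lborel (disc \<delta>)" and integral_disc: "(\<integral>t. disc \<delta> t \<partial>lborel) = 1 / \<delta>"
proof -
  interpret prob_space "density lborel (exponential_density \<delta>)"
    by (rule prob_space_exponential_density[OF assms])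
  have e: "exponential_density \<delta> t = \<delta> * disc \<delta> t" for t
    by (simp add: exponential_density_def disc_def mult.commute)
  have "(\<integral>\<^sup>+t. ennreal (exponential_density \<delta> t) \<partial>lborel) = 1"
    using emeasure_space_1 by (simp add: emeasure_density)
  then have *: "(\<integral>\<^sup>+t. ennreal (\<delta> * disc \<delta> t) \<partial>lborel) = 1" unfolding e .
  have i: "integrable lborel (\<lambda>t. \<delta> * disc \<delta> t)"
    by (rule integrableI_nonneg) (use * assms in auto)
  have "(\<integral>t. \<delta> * disc \<delta> t \<partial>lborel) = 1"
    by (subst integral_eq_nn_integral) (use * assms in auto)
  then show "(\<integral>t. disc \<delta> t \<partial>lborel) = 1 / \<delta>" using assms by (simp add: field_simps)
  show "integrable lborel (disc \<delta>)" using i assms by simp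
qed

text \<open>The factor \<open>exp (\<delta> * t)\<close> cancels the discount, so that the weak formulation of the Fokker-Planck equation
  becomes a pair of integrals against the same discounted measure that computes the cost.\<close>

definition heat_part :: "real \<Rightarrow> (real \<Rightarrow> 'n::finite torus \<Rightarrow> real) \<Rightarrow> real \<times> 'n torus \<Rightarrow> real" where
  "heat_part \<delta> \<phi> z = (if 0 \<le> fst z
     then exp (\<delta> * fst z) * (time_deriv \<phi> (fst z) (snd z) + tlap (\<phi> (fst z)) (snd z)) else 0)"

definition flux_part :: "real \<Rightarrow> (real \<Rightarrow> 'n::finite torus \<Rightarrow> real) \<Rightarrow> real \<times> 'n torus \<Rightarrow> real^'n" where
  "flux_part \<delta> \<phi> z = (if 0 \<le> fst z then exp (\<delta> * fst z) *\<^sub>R tgrad (\<phi> (fst z)) (snd z) else 0)"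

lemma measurable_tlap:
  assumes "test_function \<phi>"
  shows "(\<lambda>z. tlap (\<phi> (fst z)) (snd z)) \<in> borel_measurable borel"
proof -
  have "(\<lambda>z. tpd i (tpd i (\<phi> (fst z))) (snd z)) \<in> borel_measurable borel" for i
    using test_function_measurable[OF test_function_tpd[OF test_function_tpd[OF assms]]] by simp
  then show ?thesis unfolding tlap_def by (intro borel_measurable_sum)
qed

lemma measurable_vec_lambda:
  fixes f :: "'a \<Rightarrow> 'n::finite \<Rightarrow> real"
  assumes "\<And>i. (\<lambda>x. f x i) \<in> borel_measurable M" shows "(\<lambda>x. \<chi> i. f x i) \<in> borel_measurable M"
proof (subst borel_measurable_euclidean_space, intro ballI)
  fix e :: "real^'n" assume "e \<in> Basis"
  then obtain i where "e = axis i 1" unfolding Basis_vec_def by auto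
  then show "(\<lambda>x. (\<chi> i. f x i) \<bullet> e) \<in> borel_measurable M" using assms by (simp add: inner_axis)
qed

lemma measurable_tgrad:
  assumes "test_function \<phi>"
  shows "(\<lambda>z. tgrad (\<phi> (fst z)) (snd z)) \<in> borel_measurable borel"
  unfolding tgrad_def
  by (rule measurable_vec_lambda) (rule test_function_measurable[OF test_function_tpd[OF assms]])

lemma borel_fst [measurable]: "(fst :: real \<times> 'n::finite torus \<Rightarrow> real) \<in> borel_measurable borel"
  and borel_snd [measurable]: "(snd :: real \<times> 'n::finite torus \<Rightarrow> 'n torus) \<in> borel_measurable borel"
  by (intro borel_measurable_continuous_onI continuous_intros)+

lemma
  fixes \<phi> :: "real \<Rightarrow> 'n::finite torus \<Rightarrow> real"
  assumes \<phi>: "test_function \<phi>"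
  shows measurable_heat_part: "heat_part \<delta> \<phi> \<in> borel_measurable borel"
    and measurable_flux_part: "flux_part \<delta> \<phi> \<in> borel_measurable borel"
    and bounded_heat_part: "\<exists>C. \<forall>z. \<bar>heat_part \<delta> \<phi> z\<bar> \<le> C"
    and bounded_flux_part: "\<exists>C. \<forall>z. norm (flux_part \<delta> \<phi> z) \<le> C"
proof -
  note [measurable] = measurable_tlap[OF \<phi>] measurable_tgrad[OF \<phi>]
    test_function_measurable[OF test_function_time_deriv[OF \<phi>]]
  show "heat_part \<delta> \<phi> \<in> borel_measurable borel" unfolding heat_part_def by measurable
  show "flux_part \<delta> \<phi> \<in> borel_measurable borel" unfolding flux_part_def by measurable
  have tt: "test_function (\<lambda>t. tpd i (tpd i (\<phi> t)))" for i
    by (rule test_function_tpd[OF test_function_tpd[OF \<phi>]])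
  obtain C0 where C0: "\<And>t x. 0 \<le> t \<Longrightarrow> \<bar>exp (\<delta> * t) * time_deriv \<phi> t x\<bar> \<le> C0"
    using test_function_bounded[OF test_function_time_deriv[OF \<phi>]] by blast
  have "\<forall>i. \<exists>C. \<forall>t x. 0 \<le> t \<longrightarrow> \<bar>exp (\<delta> * t) * tpd i (tpd i (\<phi> t)) x\<bar> \<le> C"
  proof
    fix i
    obtain C where "\<And>t x. 0 \<le> t \<Longrightarrow> \<bar>exp (\<delta> * t) * tpd i (tpd i (\<phi> t)) x\<bar> \<le> C"
      using test_function_bounded[OF tt] by blast
    then show "\<exists>C. \<forall>t x. 0 \<le> t \<longrightarrow> \<bar>exp (\<delta> * t) * tpd i (tpd i (\<phi> t)) x\<bar> \<le> C" by blast
  qed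
  from choice[OF this] obtain C2 where
    C2: "\<And>i t x. 0 \<le> t \<Longrightarrow> \<bar>exp (\<delta> * t) * tpd i (tpd i (\<phi> t)) x\<bar> \<le> C2 i" by blast
  have "\<forall>i. \<exists>C. \<forall>t x. 0 \<le> t \<longrightarrow> \<bar>exp (\<delta> * t) * tpd i (\<phi> t) x\<bar> \<le> C"
  proof
    fix i
    obtain C where "\<And>t x. 0 \<le> t \<Longrightarrow> \<bar>exp (\<delta> * t) * tpd i (\<phi> t) x\<bar> \<le> C"
      using test_function_bounded[OF test_function_tpd[OF \<phi>]] by blast
    then show "\<exists>C. \<forall>t x. 0 \<le> t \<longrightarrow> \<bar>exp (\<delta> * t) * tpd i (\<phi> t) x\<bar> \<le> C" by blast
  qed
  from choice[OF this] obtain C1 where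
    C1: "\<And>i t x. 0 \<le> t \<Longrightarrow> \<bar>exp (\<delta> * t) * tpd i (\<phi> t) x\<bar> \<le> C1 i" by blast
  show "\<exists>C. \<forall>z. \<bar>heat_part \<delta> \<phi> z\<bar> \<le> C"
  proof (intro exI allI)
    fix z :: "real \<times> 'n torus"
    obtain t x where z: "z = (t, x)" by (cases z)
    show "\<bar>heat_part \<delta> \<phi> z\<bar> \<le> max 0 (C0 + (\<Sum>i\<in>UNIV. C2 i))"
    proof (cases "0 \<le> t")
      case True
      have "\<bar>exp (\<delta> * t) * tlap (\<phi> t) x\<bar> \<le> (\<Sum>i\<in>UNIV. \<bar>exp (\<delta> * t) * tpd i (tpd i (\<phi> t)) x\<bar>)"
        unfolding tlap_def sum_distrib_left by (rule sum_abs)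
      also have "\<dots> \<le> (\<Sum>i\<in>UNIV. C2 i)" by (rule sum_mono) (rule C2[OF True])
      finally have "\<bar>exp (\<delta> * t) * tlap (\<phi> t) x\<bar> \<le> (\<Sum>i\<in>UNIV. C2 i)" .
      then show ?thesis
        using C0[OF True, of x] True
          abs_triangle_ineq[of "exp (\<delta> * t) * time_deriv \<phi> t x" "exp (\<delta> * t) * tlap (\<phi> t) x"]
        by (simp add: heat_part_def z distrib_left)
    qed (simp add: heat_part_def z)
  qed
  show "\<exists>C. \<forall>z. norm (flux_part \<delta> \<phi> z) \<le> C"
  proof (intro exI allI)
    fix z :: "real \<times> 'n torus"
    obtain t x where z: "z = (t, x)" by (cases z)
    show "norm (flux_part \<delta> \<phi> z) \<le> max 0 (\<Sum>i\<in>UNIV. C1 i)"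
    proof (cases "0 \<le> t")
      case True
      have "norm (flux_part \<delta> \<phi> z) \<le> (\<Sum>i\<in>UNIV. \<bar>flux_part \<delta> \<phi> z $ i\<bar>)" by (rule norm_le_l1_cart)
      also have "\<dots> \<le> (\<Sum>i\<in>UNIV. C1 i)"
        by (rule sum_mono) (use C1[OF True] True in \<open>simp add: flux_part_def z tgrad_def\<close>)
      finally show ?thesis by simp
    qed (simp add: flux_part_def z)
  qed
qed

abbreviation Sp :: "real \<Rightarrow> (real \<Rightarrow> 'n::finite tprob) \<Rightarrow> (real \<times> 'n torus) measure" where
  "Sp \<delta> m \<equiv> spacetime (disc \<delta>) m"

lemma Sp_facts:
  assumes "continuous_on {0..} m" "0 < \<delta>"
  shows "sets (Sp \<delta> m) = sets borel" "space (Sp \<delta> m) = UNIV" "finite_measure (Sp \<delta> m)"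
  by (rule sets_spacetime[OF assms(1)] space_spacetime[OF assms(1)]
      finite_measure_spacetime[OF assms(1) _ _ _ integrable_disc[OF assms(2)]]; simp)+

lemma integrable_Sp_bounded:
  fixes f :: "_ \<Rightarrow> real"
  assumes "continuous_on {0..} m" "0 < \<delta>" "f \<in> borel_measurable borel" "\<And>z. \<bar>f z\<bar> \<le> C"
  shows "integrable (Sp \<delta> m) f"
proof (rule finite_measure.integrable_const_bound[OF Sp_facts(3)[OF assms(1,2)], where B=C])
  show "f \<in> borel_measurable (Sp \<delta> m)"
    using assms(3) measurable_cong_sets[OF Sp_facts(1)[OF assms(1,2)] refl] by blast
qed (use assms(4) in auto)

lemma integrable_inner_bounded:
  fixes B g :: "'w \<Rightarrow> real^'n::finite"
  assumes "finite_measure M" and [measurable]: "B \<in> borel_measurable M" "g \<in> borel_measurable M"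
    and B2: "integrable M (\<lambda>\<omega>. (norm (B \<omega>))\<^sup>2)" and C: "\<And>\<omega>. norm (g \<omega>) \<le> C"
  shows "integrable M (\<lambda>\<omega>. B \<omega> \<bullet> g \<omega>)"
proof (rule integrable_dominated)
  interpret finite_measure M by fact
  show "integrable M (\<lambda>\<omega>. (1 + (norm (B \<omega>))\<^sup>2) * C)" using B2 by simp
  show "AE \<omega> in M. norm (B \<omega> \<bullet> g \<omega>) \<le> norm ((1 + (norm (B \<omega>))\<^sup>2) * C)"
  proof (rule AE_I2)
    fix \<omega>
    have C0: "0 \<le> C" using C[of \<omega>] norm_ge_zero order_trans by blast
    have "norm (B \<omega> \<bullet> g \<omega>) \<le> norm (B \<omega>) * norm (g \<omega>)" by (simp add: Cauchy_Schwarz_ineq2)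
    also have "\<dots> \<le> (1 + (norm (B \<omega>))\<^sup>2) * C"
      by (intro mult_mono C norm_le_one_plus_square) auto
    finally show "norm (B \<omega> \<bullet> g \<omega>) \<le> norm ((1 + (norm (B \<omega>))\<^sup>2) * C)" using C0 by simp
  qed
qed measurable

text \<open>With a single measure on space-time, admissible pairs can be produced as images of measures on
  spaces of random paths.\<close>

definition spacetime_admissible ::
    "real \<Rightarrow> (real \<Rightarrow> 'n::finite tprob) \<Rightarrow> (real \<times> 'n torus \<Rightarrow> real^'n) \<Rightarrow> bool" where
  "spacetime_admissible \<delta> m a \<longleftrightarrow> continuous_on {0..} m \<and> a \<in> borel_measurable borel \<and>
     integrable (Sp \<delta> m) (\<lambda>z. (norm (a z))\<^sup>2) \<and>
     (\<forall>\<phi>. test_function \<phi> \<longrightarrow> (\<integral>x. \<phi> 0 x \<partial>meas (m 0)) + (\<integral>z. heat_part \<delta> \<phi> z \<partial>Sp \<delta> m)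
        - (\<integral>z. a z \<bullet> flux_part \<delta> \<phi> z \<partial>Sp \<delta> m) = 0)"

lemma spacetime_admissibleD:
  assumes "spacetime_admissible \<delta> m a"
  shows "continuous_on {0..} m" and "a \<in> borel_measurable borel"
    and "integrable (Sp \<delta> m) (\<lambda>z. (norm (a z))\<^sup>2)"
    and "\<And>\<phi>. test_function \<phi> \<Longrightarrow> (\<integral>x. \<phi> 0 x \<partial>meas (m 0)) + (\<integral>z. heat_part \<delta> \<phi> z \<partial>Sp \<delta> m)
        - (\<integral>z. a z \<bullet> flux_part \<delta> \<phi> z \<partial>Sp \<delta> m) = 0"
  using assms unfolding spacetime_admissible_def by blast+

lemma fokker_planck_term:
  assumes m: "continuous_on {0..} m" and \<delta>: "0 < \<delta>" and a [measurable]: "a \<in> borel_measurable borel"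
    and a2: "integrable (Sp \<delta> m) (\<lambda>z. (norm (a z))\<^sup>2)" and \<phi>: "test_function \<phi>"
    and \<alpha>: "\<And>t x. 0 \<le> t \<Longrightarrow> a (t, x) = \<alpha> t x"
  shows "(LINT t:{0..}|lborel. \<integral>x. deriv (\<lambda>s. \<phi> s x) t + tlap (\<phi> t) x - \<alpha> t x \<bullet> tgrad (\<phi> t) x \<partial>meas (m t))
    = (\<integral>z. heat_part \<delta> \<phi> z \<partial>Sp \<delta> m) - (\<integral>z. a z \<bullet> flux_part \<delta> \<phi> z \<partial>Sp \<delta> m)"
proof -
  note ms = measurable_cong_sets[OF Sp_facts(1)[OF m \<delta>] refl]
  obtain C1 where C1: "\<And>z. \<bar>heat_part \<delta> \<phi> z\<bar> \<le> C1" using bounded_heat_part[OF \<phi>] by blast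
  obtain C2 where C2: "\<And>z. norm (flux_part \<delta> \<phi> z) \<le> C2" using bounded_flux_part[OF \<phi>] by blast
  have i1: "integrable (Sp \<delta> m) (heat_part \<delta> \<phi>)"
    by (rule integrable_Sp_bounded[OF m \<delta> measurable_heat_part[OF \<phi>] C1])
  have i2: "integrable (Sp \<delta> m) (\<lambda>z. a z \<bullet> flux_part \<delta> \<phi> z)"
    by (rule integrable_inner_bounded[OF Sp_facts(3)[OF m \<delta>] _ _ a2 C2])
       (use a measurable_flux_part[OF \<phi>] in \<open>auto simp: ms\<close>)
  have "(\<integral>z. heat_part \<delta> \<phi> z \<partial>Sp \<delta> m) - (\<integral>z. a z \<bullet> flux_part \<delta> \<phi> z \<partial>Sp \<delta> m)
      = (\<integral>z. heat_part \<delta> \<phi> z - a z \<bullet> flux_part \<delta> \<phi> z \<partial>Sp \<delta> m)"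
    using i1 i2 by simp
  also have "\<dots> = (\<integral>t. disc \<delta> t * (\<integral>x. heat_part \<delta> \<phi> (t, x) - a (t, x) \<bullet> flux_part \<delta> \<phi> (t, x) \<partial>meas (m t)) \<partial>lborel)"
    by (rule integral_spacetime[OF m]) (use i1 i2 in auto)
  also have "\<dots> = (LINT t:{0..}|lborel. \<integral>x. deriv (\<lambda>s. \<phi> s x) t + tlap (\<phi> t) x - \<alpha> t x \<bullet> tgrad (\<phi> t) x \<partial>meas (m t))"
    unfolding set_lebesgue_integral_def
  proof (rule Lebesgue_integral_cong[OF refl])
    fix t :: real
    show "disc \<delta> t * (\<integral>x. heat_part \<delta> \<phi> (t, x) - a (t, x) \<bullet> flux_part \<delta> \<phi> (t, x) \<partial>meas (m t)) =
      indicator {0..} t *\<^sub>R (\<integral>x. deriv (\<lambda>s. \<phi> s x) t + tlap (\<phi> t) x - \<alpha> t x \<bullet> tgrad (\<phi> t) x \<partial>meas (m t))"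
    proof (cases "0 \<le> t")
      case True
      have "(\<integral>x. heat_part \<delta> \<phi> (t, x) - a (t, x) \<bullet> flux_part \<delta> \<phi> (t, x) \<partial>meas (m t)) =
        (\<integral>x. exp (\<delta> * t) * (deriv (\<lambda>s. \<phi> s x) t + tlap (\<phi> t) x - \<alpha> t x \<bullet> tgrad (\<phi> t) x) \<partial>meas (m t))"
        using True by (simp add: heat_part_def flux_part_def \<alpha> time_deriv_def algebra_simps)
      also have "\<dots> = exp (\<delta> * t) * (\<integral>x. deriv (\<lambda>s. \<phi> s x) t + tlap (\<phi> t) x - \<alpha> t x \<bullet> tgrad (\<phi> t) x \<partial>meas (m t))"
        by (rule integral_mult_right_zero)
      finally show ?thesis using True by (simp add: disc_def exp_minus field_simps)
    qed simp
  qed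
  finally show ?thesis by simp
qed

lemma nn_integral_Sp:
  assumes "continuous_on {0..} m" "f \<in> borel_measurable borel"
  shows "(\<integral>\<^sup>+z. f z \<partial>Sp \<delta> m) = (\<integral>\<^sup>+t\<in>{0..}. ennreal (exp (- \<delta> * t)) * (\<integral>\<^sup>+x. f (t, x) \<partial>meas (m t)) \<partial>lborel)"
proof -
  have "(\<integral>\<^sup>+z. f z \<partial>Sp \<delta> m) = (\<integral>\<^sup>+t. ennreal (disc \<delta> t) * (\<integral>\<^sup>+x. f (t, x) \<partial>meas (m t)) \<partial>lborel)"
    by (rule nn_integral_spacetime[OF assms(1) _ _ _ assms(2)]) auto
  also have "\<dots> = (\<integral>\<^sup>+t\<in>{0..}. ennreal (exp (- \<delta> * t)) * (\<integral>\<^sup>+x. f (t, x) \<partial>meas (m t)) \<partial>lborel)"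
    by (rule nn_integral_cong) (auto simp: disc_def indicator_def)
  finally show ?thesis .
qed

lemma integrable_Sp_square_iff:
  fixes a :: "real \<times> 'n::finite torus \<Rightarrow> real^'n"
  assumes m: "continuous_on {0..} m" and \<delta>: "0 < \<delta>" and a [measurable]: "a \<in> borel_measurable borel"
    and \<alpha>: "\<And>t x. 0 \<le> t \<Longrightarrow> a (t, x) = \<alpha> t x"
  shows "integrable (Sp \<delta> m) (\<lambda>z. (norm (a z))\<^sup>2) \<longleftrightarrow>
    (\<integral>\<^sup>+t\<in>{0..}. ennreal (exp (- \<delta> * t)) * (\<integral>\<^sup>+x. ennreal ((norm (\<alpha> t x))\<^sup>2) \<partial>meas (m t)) \<partial>lborel) < \<infinity>"
proof -
  note ms = measurable_cong_sets[OF Sp_facts(1)[OF m \<delta>] refl]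
  have "(\<lambda>z. (norm (a z))\<^sup>2) \<in> borel_measurable (Sp \<delta> m)" unfolding ms by measurable
  then have "integrable (Sp \<delta> m) (\<lambda>z. (norm (a z))\<^sup>2) \<longleftrightarrow> (\<integral>\<^sup>+z. ennreal ((norm (a z))\<^sup>2) \<partial>Sp \<delta> m) < \<infinity>"
    by (simp add: integrable_iff_bounded)
  also have "(\<integral>\<^sup>+z. ennreal ((norm (a z))\<^sup>2) \<partial>Sp \<delta> m) =
      (\<integral>\<^sup>+t\<in>{0..}. ennreal (exp (- \<delta> * t)) * (\<integral>\<^sup>+x. ennreal ((norm (a (t, x)))\<^sup>2) \<partial>meas (m t)) \<partial>lborel)"
    by (rule nn_integral_Sp[OF m]) measurable
  also have "\<dots> = (\<integral>\<^sup>+t\<in>{0..}. ennreal (exp (- \<delta> * t)) * (\<integral>\<^sup>+x. ennreal ((norm (\<alpha> t x))\<^sup>2) \<partial>meas (m t)) \<partial>lborel)"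
    by (rule nn_integral_cong) (auto simp: \<alpha> indicator_def)
  finally show ?thesis .
qed

lemma borel_time_halfspace: "{0..} \<times> UNIV \<in> sets (borel :: (real \<times> 'n::finite torus) measure)"
  by (intro borel_closed closed_Times) auto

lemma spacetime_admissible_imp_admissible:
  assumes "spacetime_admissible \<delta> m a" "0 < \<delta>"
  shows "admissible \<delta> (m 0) m (\<lambda>t x. a (t, x))"
proof -
  note * = assms(1)[unfolded spacetime_admissible_def]
  have am: "a \<in> borel_measurable borel" using * by blast
  have "(\<lambda>(t, x). a (t, x)) \<in> borel_measurable (restrict_space borel ({0..} \<times> UNIV))"
    using measurable_restrict_space1[OF am] by simp
  then show ?thesis
    unfolding admissible_def fokker_planck_def
    using * integrable_Sp_square_iff[of m \<delta> a "\<lambda>t x. a (t, x)"]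
      fokker_planck_term[of m \<delta> a _ "\<lambda>t x. a (t, x)"] assms(2) by auto
qed

lemma admissible_imp_spacetime_admissible:
  fixes m :: "real \<Rightarrow> 'n::finite tprob"
  assumes "admissible \<delta> m0 m \<alpha>" "0 < \<delta>"
  obtains a where "spacetime_admissible \<delta> m a" "m 0 = m0" "\<And>t x. 0 \<le> t \<Longrightarrow> a (t, x) = \<alpha> t x"
proof
  let ?a = "\<lambda>(t, x). indicator ({0..} \<times> UNIV) (t, x) *\<^sub>R \<alpha> t x"
  note * = assms(1)[unfolded admissible_def fokker_planck_def]
  have am: "?a \<in> borel_measurable borel"
    using * borel_measurable_restrict_space_iff[of "{0..} \<times> UNIV" borel "\<lambda>(t, x). \<alpha> t x"] borel_time_halfspace
    by (simp add: case_prod_beta')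
  show e: "?a (t, x) = \<alpha> t x" if "0 \<le> t" for t x using that by simp
  have i: "integrable (Sp \<delta> m) (\<lambda>z. (norm (?a z))\<^sup>2)"
    using integrable_Sp_square_iff[OF _ assms(2) am e] * by blast
  show "m 0 = m0" using * by blast
  show "spacetime_admissible \<delta> m ?a"
    unfolding spacetime_admissible_def
  proof (intro conjI allI impI)
    fix \<phi> :: "real \<Rightarrow> 'n torus \<Rightarrow> real" assume \<phi>: "test_function \<phi>"
    have c: "continuous_on {0..} m" using * by blast
    show "(\<integral>x. \<phi> 0 x \<partial>meas (m 0)) + (\<integral>z. heat_part \<delta> \<phi> z \<partial>Sp \<delta> m)
        - (\<integral>z. ?a z \<bullet> flux_part \<delta> \<phi> z \<partial>Sp \<delta> m) = 0"
      using fokker_planck_term[OF c assms(2) am i \<phi> e] * \<phi> by auto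
  qed (use * am i in auto)
qed

section \<open>The Lagrangian and the cost\<close>

locale control_problem =
  fixes H :: "'n::finite torus \<Rightarrow> real^'n \<Rightarrow> real" and \<F> :: "'n tprob \<Rightarrow> real" and K :: real
  assumes K1: "1 \<le> K"
    and H_lower: "\<And>x p. (norm p)\<^sup>2 / K - K \<le> H x p"
    and H_upper: "\<And>x p. H x p \<le> K * (1 + (norm p)\<^sup>2)"
    and H_space: "\<And>x y p. \<bar>H x p - H y p\<bar> \<le> K * dist x y * (1 + (norm p)\<^sup>2)"
    and H_cont: "continuous_on UNIV (\<lambda>(x, p). H x p)"
    and F_bound: "\<And>m. \<bar>\<F> m\<bar> \<le> K"
    and F_Lip: "\<And>m m'. \<bar>\<F> m - \<F> m'\<bar> \<le> K * dist m m'"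
begin

abbreviation L :: "'n torus \<Rightarrow> real^'n \<Rightarrow> real" where "L \<equiv> H_star H"

lemma legendre_term_le: "p \<bullet> q - H x p \<le> K / 4 * (norm q)\<^sup>2 + K"
proof -
  have "p \<bullet> q - H x p \<le> norm p * norm q - ((norm p)\<^sup>2 / K - K)"
    using H_lower[of p x] norm_cauchy_schwarz[of p q] by linarith
  also have "\<dots> = K / 4 * (norm q)\<^sup>2 + K - (norm p - K / 2 * norm q)\<^sup>2 / K"
    using K1 by (simp add: field_simps power2_eq_square)
  also have "\<dots> \<le> K / 4 * (norm q)\<^sup>2 + K" using K1 by simp
  finally show ?thesis .
qed

lemma legendre_term_le_L: "p \<bullet> q - H x p \<le> L x q"
  unfolding H_star_def
  by (rule cSUP_upper) (auto intro!: bdd_aboveI2 legendre_term_le)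

lemma L_leI: "(\<And>p. p \<bullet> q - H x p \<le> c) \<Longrightarrow> L x q \<le> c"
  unfolding H_star_def by (rule cSUP_least) auto

lemma L_upper: "L x q \<le> K * (1 + (norm q)\<^sup>2)"
proof (rule L_leI)
  fix p
  have "K / 4 * (norm q)\<^sup>2 \<le> K * (norm q)\<^sup>2" using K1 by (intro mult_right_mono) auto
  then show "p \<bullet> q - H x p \<le> K * (1 + (norm q)\<^sup>2)"
    using legendre_term_le[of p q x] by (simp add: distrib_left)
qed

lemma L_lower: "(norm q)\<^sup>2 / (4 * K) - K \<le> L x q"
proof -
  let ?p = "(1 / (2 * K)) *\<^sub>R q"
  have "(norm q)\<^sup>2 / (4 * K) - K = ?p \<bullet> q - K * (1 + (norm ?p)\<^sup>2)"
    using K1 by (simp add: dot_square_norm field_simps power2_eq_square)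
  also have "\<dots> \<le> ?p \<bullet> q - H x ?p" using H_upper[of x ?p] by simp
  also have "\<dots> \<le> L x q" by (rule legendre_term_le_L)
  finally show ?thesis .
qed

lemma L_ge: "- K \<le> L x q"
  using L_lower[of q x] K1 order_trans[of "- K" "(norm q)\<^sup>2 / (4 * K) - K"] by simp

text \<open>Slopes beyond \<open>K |q| + 2 K\<close> do not contribute to the supremum defining \<open>L x q\<close>, so the
  quadratic growth of \<open>H\<close> controls the variation of \<open>L\<close> in both variables.\<close>

lemma L_perturb:
  assumes x: "dist x y \<le> h" and q: "norm (q - q') \<le> h"
  shows "L y q' \<le> L x q + 32 * K ^ 3 * (h * (1 + (norm q)\<^sup>2 + h\<^sup>2))"
proof (rule L_leI)
  fix p
  have h: "0 \<le> h" using x zero_le_dist order_trans by blast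
  have K3: "0 \<le> K ^ 3" "1 \<le> K\<^sup>2" using K1 by auto
  show "p \<bullet> q' - H y p \<le> L x q + 32 * K ^ 3 * (h * (1 + (norm q)\<^sup>2 + h\<^sup>2))"
  proof (cases "norm p \<le> K * norm q' + 2 * K")
    case False
    then have p: "K * norm q' + 2 * K \<le> norm p" by simp
    then have "norm q' + 2 \<le> norm p / K" using K1 by (simp add: field_simps)
    then have "norm p * (norm q' + 2) \<le> norm p * (norm p / K)" by (rule mult_left_mono) simp
    then have "norm p * norm q' - (norm p)\<^sup>2 / K \<le> - 2 * norm p" by (simp add: power2_eq_square algebra_simps)
    moreover have "2 * K \<le> norm p" using p K1 order_trans[of "2 * K" "K * norm q' + 2 * K"] by simp
    ultimately have "p \<bullet> q' - H y p \<le> - K"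
      using norm_cauchy_schwarz[of p q'] H_lower[of p y] K1 by linarith
    also have "\<dots> \<le> L x q + 32 * K ^ 3 * (h * (1 + (norm q)\<^sup>2 + h\<^sup>2))"
      using L_ge[of x q] h K3 by (simp add: add_increasing2)
    finally show ?thesis .
  next
    case True
    have q': "norm q' \<le> norm q + h"
      using q norm_triangle_ineq2[of q' q] by (simp add: norm_minus_commute)
    have "norm p \<le> 2 * K * (1 + norm q')" 
    proof -
      have "2 * K * (1 + norm q') = (K * norm q' + 2 * K) + K * norm q'" by (simp add: algebra_simps)
      moreover have "0 \<le> K * norm q'" using K1 by simp
      ultimately show ?thesis using True by linarith
    qed
    then have "(norm p)\<^sup>2 \<le> (2 * K * (1 + norm q'))\<^sup>2" by (rule power_mono) simp
    also have "\<dots> \<le> 4 * K\<^sup>2 * (3 * (1 + (norm q)\<^sup>2 + h\<^sup>2))"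
    proof -
      have "(1 + norm q')\<^sup>2 \<le> (1 + norm q + h)\<^sup>2" using q' by (intro power_mono) auto
      also have "\<dots> \<le> 3 * (1 + (norm q)\<^sup>2 + h\<^sup>2)"
        using zero_le_power2[of "1 - norm q"] zero_le_power2[of "1 - h"] zero_le_power2[of "norm q - h"]
        by (simp add: power2_eq_square algebra_simps)
      finally show ?thesis using K1 by (simp add: power_mult_distrib)
    qed
    finally have p2: "(norm p)\<^sup>2 \<le> 12 * K\<^sup>2 * (1 + (norm q)\<^sup>2 + h\<^sup>2)" by (simp add: algebra_simps)
    have s: "1 \<le> 1 + (norm q)\<^sup>2 + h\<^sup>2" by simp
    have "1 \<le> K\<^sup>2 * (1 + (norm q)\<^sup>2 + h\<^sup>2)" using mult_mono[OF K3(2) s] by simp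
    then have p3: "1 + (norm p)\<^sup>2 \<le> 13 * (K\<^sup>2 * (1 + (norm q)\<^sup>2 + h\<^sup>2))" using p2 by simp
    have "p \<bullet> q' - H y p = (p \<bullet> q - H x p) + p \<bullet> (q' - q) + (H x p - H y p)"
      by (simp add: inner_diff_right)
    also have "\<dots> \<le> L x q + norm p * h + K * h * (1 + (norm p)\<^sup>2)"
    proof -
      have "p \<bullet> (q' - q) \<le> norm p * norm (q' - q)" by (rule norm_cauchy_schwarz)
      also have "\<dots> \<le> norm p * h" using q by (intro mult_left_mono) (auto simp: norm_minus_commute)
      finally have 1: "p \<bullet> (q' - q) \<le> norm p * h" .
      have "H x p - H y p \<le> K * dist x y * (1 + (norm p)\<^sup>2)" using H_space[of x p y] by linarith
      also have "\<dots> \<le> K * h * (1 + (norm p)\<^sup>2)"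
        using x K1 by (intro mult_right_mono mult_left_mono) auto
      finally show ?thesis using 1 legendre_term_le_L[of p q x] by linarith
    qed
    also have "norm p * h \<le> K * h * (1 + (norm p)\<^sup>2)"
    proof -
      have "norm p * h \<le> (1 + (norm p)\<^sup>2) * h" by (rule mult_right_mono[OF norm_le_one_plus_square h])
      also have "\<dots> \<le> K * ((1 + (norm p)\<^sup>2) * h)" using K1 h mult_right_mono[of 1 K "(1 + (norm p)\<^sup>2) * h"] by simp
      finally show ?thesis by (simp add: mult_ac)
    qed
    finally have "p \<bullet> q' - H y p \<le> L x q + 2 * (K * h) * (1 + (norm p)\<^sup>2)" by simp
    also have "\<dots> \<le> L x q + 2 * (K * h) * (13 * (K\<^sup>2 * (1 + (norm q)\<^sup>2 + h\<^sup>2)))"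
      using p3 K1 h by (intro add_left_mono mult_left_mono) auto
    also have "\<dots> = L x q + 26 * (K ^ 3 * (h * (1 + (norm q)\<^sup>2 + h\<^sup>2)))"
      by (simp add: power2_eq_square power3_eq_cube)
    also have "\<dots> \<le> L x q + 32 * K ^ 3 * (h * (1 + (norm q)\<^sup>2 + h\<^sup>2))"
      using K3 h by simp
    finally show ?thesis .
  qed
qed

lemma continuous_L: "continuous_on UNIV (\<lambda>(x, q). L x q)"
  unfolding continuous_on_iff
proof (intro ballI allI impI)
  fix z :: "'n torus \<times> (real^'n)" and e :: real assume e: "0 < e"
  obtain x q where z: "z = (x, q)" by (cases z)
  define M where "M = 32 * K ^ 3 * (2 * (norm q + 1)\<^sup>2 + 2)"
  have M: "0 < M" using K1 by (auto simp: M_def intro!: mult_pos_pos add_nonneg_pos)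
  define d where "d = min 1 (e / (2 * M))"
  have d: "0 < d" "d \<le> 1" "M * d < e"
    using e M by (auto simp: d_def min_def field_simps)
  have "dist (case w of (x, q) \<Rightarrow> L x q) (L x q) < e" if w: "dist w z < d" for w
  proof -
    obtain y q' where w': "w = (y, q')" by (cases w)
    have 1: "dist y x \<le> d" "dist x y \<le> d" and 2: "norm (q' - q) \<le> d" "norm (q - q') \<le> d"
      using dist_fst_le[of w z] dist_snd_le[of w z] w unfolding z w'
      by (auto simp: dist_commute dist_norm norm_minus_commute)
    have qq: "norm q' \<le> norm q + 1"
      using 2(1) d(2) norm_triangle_ineq2[of q' q] by linarith
    have b: "32 * K ^ 3 * (d * (1 + (norm r)\<^sup>2 + d\<^sup>2)) \<le> M * d" if r: "norm r \<le> norm q + 1" for r :: "real^'n"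
    proof -
      have "(norm r)\<^sup>2 \<le> (norm q + 1)\<^sup>2" using r by (intro power_mono) auto
      moreover have "d\<^sup>2 \<le> 1" using d by (simp add: power_le_one)
      ultimately have "1 + (norm r)\<^sup>2 + d\<^sup>2 \<le> 2 * (norm q + 1)\<^sup>2 + 2"
        using zero_le_power2[of "norm q + 1"] by linarith
      then have "32 * K ^ 3 * d * (1 + (norm r)\<^sup>2 + d\<^sup>2) \<le> 32 * K ^ 3 * d * (2 * (norm q + 1)\<^sup>2 + 2)"
        using K1 d by (intro mult_left_mono) auto
      then show ?thesis by (simp add: M_def algebra_simps)
    qed
    have "L y q' \<le> L x q + M * d" using L_perturb[OF 1(2) 2(2)] b[of q] by simp
    moreover have "L x q \<le> L y q' + M * d" using L_perturb[OF 1(1) 2(1)] b[OF qq] by simp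
    ultimately show ?thesis using d(3) by (simp add: w' dist_real_def)
  qed
  then show "\<exists>d>0. \<forall>w\<in>UNIV. dist w z < d \<longrightarrow> dist (case w of (x, q) \<Rightarrow> L x q) (case z of (x, q) \<Rightarrow> L x q) < e"
    using d(1) by (intro exI[of _ d]) (auto simp: z)
qed

lemma measurable_L [measurable (raw)]:
  assumes "f \<in> borel_measurable M" "g \<in> borel_measurable M"
  shows "(\<lambda>\<omega>. L (f \<omega>) (g \<omega>)) \<in> borel_measurable M"
  by (rule borel_measurable_continuous_Pair[OF assms]) (use continuous_L in \<open>simp add: case_prod_beta'\<close>)

lemma abs_L_le: "\<bar>L x q\<bar> \<le> K * (1 + (norm q)\<^sup>2)"
proof -
  have "K * 1 \<le> K * (1 + (norm q)\<^sup>2)" using K1 by (intro mult_left_mono) auto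
  then show ?thesis using L_upper[of x q] L_ge[of x q] by linarith
qed

lemma integrable_L:
  assumes "finite_measure M" and [measurable]: "Y \<in> borel_measurable M" "B \<in> borel_measurable M"
    and B2: "integrable M (\<lambda>\<omega>. (norm (B \<omega>))\<^sup>2)"
  shows "integrable M (\<lambda>\<omega>. L (Y \<omega>) (B \<omega>))"
proof (rule integrable_dominated)
  interpret finite_measure M by fact
  show "integrable M (\<lambda>\<omega>. K * (1 + (norm (B \<omega>))\<^sup>2))" using B2 by simp
  show "AE \<omega> in M. norm (L (Y \<omega>) (B \<omega>)) \<le> norm (K * (1 + (norm (B \<omega>))\<^sup>2))"
    using abs_L_le K1 by (auto simp: abs_mult)
qed measurable

definition run_cost :: "(real \<Rightarrow> 'n tprob) \<Rightarrow> (real \<times> 'n torus \<Rightarrow> real^'n) \<Rightarrow> real \<Rightarrow> real" where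
  "run_cost m a t = (\<integral>x. L x (a (t, x)) \<partial>meas (m t)) + \<F> (m t)"

abbreviation J :: "real \<Rightarrow> (real \<Rightarrow> 'n tprob) \<Rightarrow> (real \<times> 'n torus \<Rightarrow> real^'n) \<Rightarrow> real" where
  "J \<delta> m a \<equiv> cost H \<F> \<delta> m (\<lambda>t x. a (t, x))"

lemma measurable_F_path:
  assumes "continuous_on {0..} m" shows "(\<lambda>t. disc \<delta> t * \<F> (m t)) \<in> borel_measurable borel"
proof -
  have "K-lipschitz_on UNIV \<F>"
    using F_Lip K1 by (intro lipschitz_onI) (auto simp: dist_real_def)
  moreover have "continuous_on UNIV (\<lambda>t. m (max 0 t))"
    by (rule continuous_on_compose2[OF assms]) (auto intro!: continuous_intros)
  ultimately
  have "continuous_on UNIV (\<lambda>t. \<F> (m (max 0 t)))"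
    using continuous_on_compose2[OF lipschitz_on_continuous_on] by blast
  then have [measurable]: "(\<lambda>t. \<F> (m (max 0 t))) \<in> borel_measurable borel"
    by (rule borel_measurable_continuous_onI)
  have "(\<lambda>t. disc \<delta> t * \<F> (m t)) = (\<lambda>t. disc \<delta> t * \<F> (m (max 0 t)))"
    by (auto simp: disc_def)
  then show ?thesis by simp
qed

lemma integrable_F_path:
  assumes "continuous_on {0..} m" "0 < \<delta>" shows "integrable lborel (\<lambda>t. disc \<delta> t * \<F> (m t))"
proof (rule integrable_dominated)
  show "integrable lborel (\<lambda>t. K * disc \<delta> t)" using integrable_disc[OF assms(2)] by simp
  show "(\<lambda>t. disc \<delta> t * \<F> (m t)) \<in> borel_measurable lborel" using measurable_F_path[OF assms(1)] by simp
  show "AE t in lborel. norm (disc \<delta> t * \<F> (m t)) \<le> norm (K * disc \<delta> t)"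
    using F_bound K1 by (auto simp: abs_mult mult.commute[of K] intro!: mult_left_mono)
qed

lemma
  assumes a: "spacetime_admissible \<delta> m a" and \<delta>: "0 < \<delta>"
  shows integrable_L_Sp: "integrable (Sp \<delta> m) (\<lambda>z. L (snd z) (a z))"
    and integrable_run_cost: "integrable lborel (\<lambda>t. disc \<delta> t * run_cost m a t)"
    and integral_run_cost: "(\<integral>t. disc \<delta> t * run_cost m a t \<partial>lborel)
      = (\<integral>z. L (snd z) (a z) \<partial>Sp \<delta> m) + (\<integral>t. disc \<delta> t * \<F> (m t) \<partial>lborel)"
    and cost_eq_run_cost: "J \<delta> m a = (\<integral>t. disc \<delta> t * run_cost m a t \<partial>lborel)"
proof -
  note m = spacetime_admissibleD(1)[OF a] and am = spacetime_admissibleD(2)[OF a] and a2 = spacetime_admissibleD(3)[OF a]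
  note ms = measurable_cong_sets[OF Sp_facts(1)[OF m \<delta>] refl]
  show i: "integrable (Sp \<delta> m) (\<lambda>z. L (snd z) (a z))"
    by (rule integrable_L[OF Sp_facts(3)[OF m \<delta>] _ _ a2]) (use am in \<open>auto simp: ms\<close>)
  have i2: "integrable lborel (\<lambda>t. disc \<delta> t * (\<integral>x. L x (a (t, x)) \<partial>meas (m t)))"
    using integrable_spacetimeD[OF m _ _ _ i] by simp
  have e: "disc \<delta> t * run_cost m a t = disc \<delta> t * (\<integral>x. L x (a (t, x)) \<partial>meas (m t)) + disc \<delta> t * \<F> (m t)" for t
    by (simp add: run_cost_def distrib_left)
  show "integrable lborel (\<lambda>t. disc \<delta> t * run_cost m a t)"
    unfolding e using i2 integrable_F_path[OF m \<delta>] by simp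
  show "(\<integral>t. disc \<delta> t * run_cost m a t \<partial>lborel)
      = (\<integral>z. L (snd z) (a z) \<partial>Sp \<delta> m) + (\<integral>t. disc \<delta> t * \<F> (m t) \<partial>lborel)"
    unfolding e using i2 integrable_F_path[OF m \<delta>] integral_spacetime[OF m _ _ _ i] by simp
  show "J \<delta> m a = (\<integral>t. disc \<delta> t * run_cost m a t \<partial>lborel)"
    unfolding cost_def set_lebesgue_integral_def run_cost_def
    by (rule Lebesgue_integral_cong) (auto simp: disc_def)
qed

lemma cost_lower:
  assumes a: "spacetime_admissible \<delta> m a" and \<delta>: "0 < \<delta>"
  shows "- (2 * K) / \<delta> \<le> J \<delta> m a"
proof -
  have m: "continuous_on {0..} m" using a unfolding spacetime_admissible_def by blast
  interpret finite_measure "Sp \<delta> m" by (rule Sp_facts(3)[OF m \<delta>])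
  have S1: "(\<integral>z. c \<partial>Sp \<delta> m) = c / \<delta>" for c :: real
  proof -
    have "(\<integral>z. c \<partial>Sp \<delta> m) = (\<integral>t. disc \<delta> t * (\<integral>x. c \<partial>meas (m t)) \<partial>lborel)"
      by (rule integral_spacetime[OF m]) auto
    also have "\<dots> = c / \<delta>" using integral_disc[OF \<delta>] by (simp add: prob_space.prob_space[OF prob_space_meas])
    finally show ?thesis .
  qed
  have "- K / \<delta> = (\<integral>z. - K \<partial>Sp \<delta> m)" by (rule S1[symmetric])
  also have "\<dots> \<le> (\<integral>z. L (snd z) (a z) \<partial>Sp \<delta> m)"
    by (rule integral_mono[OF _ integrable_L_Sp[OF a \<delta>]]) (use L_ge in auto)
  finally have 1: "- K / \<delta> \<le> (\<integral>z. L (snd z) (a z) \<partial>Sp \<delta> m)" .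
  have "- K / \<delta> = (\<integral>t. disc \<delta> t * (- K) \<partial>lborel)" using integral_disc[OF \<delta>] by simp
  also have "\<dots> \<le> (\<integral>t. disc \<delta> t * \<F> (m t) \<partial>lborel)"
  proof (rule integral_mono[OF _ integrable_F_path[OF m \<delta>]])
    show "integrable lborel (\<lambda>t. disc \<delta> t * (- K))" using integrable_disc[OF \<delta>] by simp
    fix t show "disc \<delta> t * (- K) \<le> disc \<delta> t * \<F> (m t)"
      using F_bound[of "m t"] by (intro mult_left_mono) auto
  qed
  finally show ?thesis
    using 1 unfolding cost_eq_run_cost[OF a \<delta>] integral_run_cost[OF a \<delta>] by simp
qed

lemma value_le_cost:
  assumes a: "spacetime_admissible \<delta> m a" and \<delta>: "0 < \<delta>"
  shows "value_fun H \<F> \<delta> (m 0) \<le> J \<delta> m a"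
  unfolding value_fun_def
proof (rule cInf_lower)
  show "J \<delta> m a \<in> {cost H \<F> \<delta> m' \<alpha> |m' \<alpha>. admissible \<delta> (m 0) m' \<alpha>}"
    using spacetime_admissible_imp_admissible[OF a \<delta>] by blast
  show "bdd_below {cost H \<F> \<delta> m' \<alpha> |m' \<alpha>. admissible \<delta> (m 0) m' \<alpha>}"
  proof (rule bdd_belowI, clarify)
    fix m' \<alpha> assume "admissible \<delta> (m 0) m' \<alpha>"
    then obtain b where b: "spacetime_admissible \<delta> m' b" "\<And>t x. 0 \<le> t \<Longrightarrow> b (t, x) = \<alpha> t x"
      using admissible_imp_spacetime_admissible \<delta> by metis
    have "cost H \<F> \<delta> m' \<alpha> = J \<delta> m' b"
      unfolding cost_def set_lebesgue_integral_def
      by (rule Lebesgue_integral_cong) (auto simp: b(2) indicator_def)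
    then show "- (2 * K) / \<delta> \<le> cost H \<F> \<delta> m' \<alpha>" using cost_lower[OF b(1) \<delta>] by simp
  qed
qed

lemma value_approx:
  assumes \<delta>: "0 < \<delta>" and e: "0 < e" and ex: "\<exists>m a. spacetime_admissible \<delta> m a \<and> m 0 = \<mu>"
  obtains m a where "spacetime_admissible \<delta> m a" "m 0 = \<mu>"
    "J \<delta> m a < value_fun H \<F> \<delta> \<mu> + e"
proof -
  let ?S = "{cost H \<F> \<delta> m' \<alpha> |m' \<alpha>. admissible \<delta> \<mu> m' \<alpha>}"
  have "?S \<noteq> {}" using ex spacetime_admissible_imp_admissible[OF _ \<delta>] by blast
  moreover have "Inf ?S < value_fun H \<F> \<delta> \<mu> + e" using e by (simp add: value_fun_def)
  ultimately obtain c where "c \<in> ?S" "c < value_fun H \<F> \<delta> \<mu> + e" by (rule cInf_lessD[THEN bexE])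
  then obtain m' \<alpha> where *: "admissible \<delta> \<mu> m' \<alpha>" "cost H \<F> \<delta> m' \<alpha> < value_fun H \<F> \<delta> \<mu> + e" by blast
  obtain b where b: "spacetime_admissible \<delta> m' b" "m' 0 = \<mu>" "\<And>t x. 0 \<le> t \<Longrightarrow> b (t, x) = \<alpha> t x"
    using admissible_imp_spacetime_admissible[OF *(1) \<delta>] by metis
  have "cost H \<F> \<delta> m' \<alpha> = J \<delta> m' b"
    unfolding cost_def set_lebesgue_integral_def
    by (rule Lebesgue_integral_cong) (auto simp: b(3) indicator_def)
  then show ?thesis using that[OF b(1,2)] *(2) by simp
qed

text \<open>The Lagrangian is a supremum of affine functions of the drift, so averaging a random drift over its
  conditional law given time and position does not increase the cost.\<close>

lemma feedback_of_random_drift: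
  fixes X :: "'w \<Rightarrow> real \<times> 'n torus" and B :: "'w \<Rightarrow> real^'n"
  assumes M: "finite_measure M" and X [measurable]: "X \<in> borel_measurable M"
    and B [measurable]: "B \<in> borel_measurable M" and B2: "integrable M (\<lambda>\<omega>. (norm (B \<omega>))\<^sup>2)"
  obtains \<beta> where "\<beta> \<in> borel_measurable borel" "integrable (distr M borel X) (\<lambda>z. (norm (\<beta> z))\<^sup>2)"
    "(\<integral>z. L (snd z) (\<beta> z) \<partial>distr M borel X) \<le> (\<integral>\<omega>. L (snd (X \<omega>)) (B \<omega>) \<partial>M)"
    "\<And>g C. g \<in> borel_measurable borel \<Longrightarrow> (\<And>z. norm (g z) \<le> C) \<Longrightarrow>
      (\<integral>z. \<beta> z \<bullet> g z \<partial>distr M borel X) = (\<integral>\<omega>. B \<omega> \<bullet> g (X \<omega>) \<partial>M)"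
proof (rule relaxed_to_feedback[OF X M B B2])
  let ?S = "distr M borel X"
  fix \<beta> :: "real \<times> 'n torus \<Rightarrow> real^'n"
  assume \<beta>m [measurable]: "\<beta> \<in> borel_measurable borel"
    and lin: "\<And>g C. g \<in> borel_measurable borel \<Longrightarrow> (\<And>z. norm (g z) \<le> C) \<Longrightarrow>
      integrable ?S (\<lambda>z. \<beta> z \<bullet> g z) \<and> (\<integral>z. \<beta> z \<bullet> g z \<partial>?S) = (\<integral>\<omega>. B \<omega> \<bullet> g (X \<omega>) \<partial>M)"
    and jensen: "\<And>h b u. (\<And>p. (\<lambda>z. h z p) \<in> borel_measurable borel) \<Longrightarrow> (\<And>z p. \<bar>h z p\<bar> \<le> b p) \<Longrightarrow>
      (\<And>z. continuous_on UNIV (h z)) \<Longrightarrow> integrable M u \<Longrightarrow>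
      (\<And>\<omega> p. B \<omega> \<bullet> p - h (X \<omega>) p \<le> u \<omega>) \<Longrightarrow>
      \<exists>k. integrable ?S k \<and> (\<integral>z. k z \<partial>?S) = (\<integral>\<omega>. u \<omega> \<partial>M) \<and>
        (AE z in ?S. \<forall>p. \<beta> z \<bullet> p - h z p \<le> k z)"
  have fS: "finite_measure ?S" by (rule finite_measure.finite_measure_distr[OF M X])
  have "\<exists>k. integrable ?S k \<and> (\<integral>z. k z \<partial>?S) = (\<integral>\<omega>. (norm (B \<omega>))\<^sup>2 \<partial>M) \<and>
      (AE z in ?S. \<forall>p. \<beta> z \<bullet> p - (norm p)\<^sup>2 / 4 \<le> k z)"
  proof (rule jensen[where b="\<lambda>p. (norm p)\<^sup>2 / 4"])
    show "B \<omega> \<bullet> p - (norm p)\<^sup>2 / 4 \<le> (norm (B \<omega>))\<^sup>2" for \<omega> p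
    proof -
      have "0 \<le> (norm (B \<omega>) - norm p / 2)\<^sup>2" by simp
      then show ?thesis
        using norm_cauchy_schwarz[of "B \<omega>" p] by (simp add: power2_eq_square algebra_simps)
    qed
  qed (use B2 in \<open>auto intro!: continuous_intros\<close>)
  then obtain k where k: "integrable ?S k" "AE z in ?S. \<forall>p. \<beta> z \<bullet> p - (norm p)\<^sup>2 / 4 \<le> k z" by blast
  have sq: "AE z in ?S. (norm (\<beta> z))\<^sup>2 \<le> k z"
    using k(2)
  proof eventually_elim
    case (elim z)
    have "\<beta> z \<bullet> (2 *\<^sub>R \<beta> z) - (norm (2 *\<^sub>R \<beta> z))\<^sup>2 / 4 \<le> k z" using elim by blast
    then show ?case by (simp add: power2_norm_eq_inner power_mult_distrib)
  qed
  have \<beta>2: "integrable ?S (\<lambda>z. (norm (\<beta> z))\<^sup>2)"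
    by (rule integrable_dominated[OF k(1)]) (use sq in \<open>auto elim!: eventually_mono\<close>)
  have Hp: "continuous_on UNIV (H x)" for x
  proof -
    have "continuous_on UNIV (\<lambda>p. (x, p))"
      by (intro continuous_on_Pair continuous_on_const continuous_on_id)
    from continuous_on_compose2[OF H_cont this] show ?thesis by simp
  qed
  have Hx: "continuous_on UNIV (\<lambda>x. H x p)" for p
  proof -
    have "continuous_on UNIV (\<lambda>x. (x, p))"
      by (intro continuous_on_Pair continuous_on_const continuous_on_id)
    from continuous_on_compose2[OF H_cont this] show ?thesis by simp
  qed
  have Hm [measurable]: "(\<lambda>x. H x p) \<in> borel_measurable borel" for p
    by (rule borel_measurable_continuous_onI[OF Hx])
  have Hb: "\<bar>H x p\<bar> \<le> K * (1 + (norm p)\<^sup>2)" for x p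
  proof -
    have "- (K * (1 + (norm p)\<^sup>2)) \<le> - K" using K1 by (simp add: distrib_left)
    also have "\<dots> \<le> (norm p)\<^sup>2 / K - K" using K1 by simp
    finally show ?thesis using H_lower[of p x] H_upper[of x p] by linarith
  qed
  have LM: "integrable M (\<lambda>\<omega>. L (snd (X \<omega>)) (B \<omega>))"
    by (rule integrable_L[OF M _ B B2]) measurable
  have "\<exists>k. integrable ?S k \<and> (\<integral>z. k z \<partial>?S) = (\<integral>\<omega>. L (snd (X \<omega>)) (B \<omega>) \<partial>M) \<and>
      (AE z in ?S. \<forall>p. \<beta> z \<bullet> p - H (snd z) p \<le> k z)"
  proof (rule jensen[where b="\<lambda>p. K * (1 + (norm p)\<^sup>2)"])
    show "B \<omega> \<bullet> p - H (snd (X \<omega>)) p \<le> L (snd (X \<omega>)) (B \<omega>)" for \<omega> p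
      using legendre_term_le_L[of p "B \<omega>" "snd (X \<omega>)"] by (simp add: inner_commute)
  qed (use Hb Hp LM in auto)
  then obtain k' where k': "integrable ?S k'" "(\<integral>z. k' z \<partial>?S) = (\<integral>\<omega>. L (snd (X \<omega>)) (B \<omega>) \<partial>M)"
    "AE z in ?S. \<forall>p. \<beta> z \<bullet> p - H (snd z) p \<le> k' z" by blast
  have "(\<integral>z. L (snd z) (\<beta> z) \<partial>?S) \<le> (\<integral>z. k' z \<partial>?S)"
  proof (rule integral_mono_AE[OF integrable_L[OF fS _ _ \<beta>2] k'(1)])
    show "AE z in ?S. L (snd z) (\<beta> z) \<le> k' z"
      using k'(3) by eventually_elim (rule L_leI, simp add: inner_commute)
  qed auto
  then show thesis
    using that[OF \<beta>m \<beta>2] lin k'(2) by auto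
qed

end

section \<open>A diffusing particle with random drift\<close>

lemma integrable_gauss_norm: "integrable gauss (\<lambda>z :: real^'n::finite. norm z)"
  and integrable_gauss_norm2: "integrable gauss (\<lambda>z :: real^'n::finite. (norm z)\<^sup>2)"
  and integrable_gauss_norm3: "integrable gauss (\<lambda>z :: real^'n::finite. (norm z) ^ 3)"
proof -
  interpret prob_space "gauss :: (real^'n) measure" by (rule prob_space_gauss)
  have b: "r ^ k \<le> 1 + r ^ 4" if "0 \<le> r" "k \<le> 4" for r :: real and k
  proof (cases "r \<le> 1")
    case True
    then have "r ^ k \<le> 1" using that by (simp add: power_le_one)
    then show ?thesis using that by (simp add: add_increasing2)
  next
    case False
    then have "r ^ k \<le> r ^ 4" using that by (intro power_increasing) auto
    then show ?thesis by simp
  qed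
  have i: "integrable gauss (\<lambda>z :: real^'n. (norm z) ^ k)" if "k \<le> 4" for k
  proof (rule integrable_dominated)
    show "integrable gauss (\<lambda>z :: real^'n. 1 + (norm z) ^ 4)"
      by (intro Bochner_Integration.integrable_add integrable_const gauss_moments)
    show "AE z :: real^'n in gauss. norm ((norm z) ^ k) \<le> norm (1 + (norm z) ^ 4)"
      using b[OF norm_ge_zero that] by (auto intro!: AE_I2 simp: add_nonneg_nonneg)
  qed measurable
  show "integrable gauss (\<lambda>z :: real^'n::finite. norm z)" using i[of 1] by simp
  show "integrable gauss (\<lambda>z :: real^'n::finite. (norm z)\<^sup>2)" using i[of 2] by simp
  show "integrable gauss (\<lambda>z :: real^'n::finite. (norm z) ^ 3)" using i[of 3] by simp
qed

lemma test_function_gauss_by_parts: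
  fixes \<phi> :: "real \<Rightarrow> 'n::finite torus \<Rightarrow> real"
  assumes \<phi>: "test_function \<phi>" and t: "0 \<le> t"
  shows "(\<integral>z. z \<bullet> tgrad (\<phi> t) (x + tproj (s *\<^sub>R z)) \<partial>gauss) = s * (\<integral>z. tlap (\<phi> t) (x + tproj (s *\<^sub>R z)) \<partial>gauss)"
proof -
  interpret prob_space "gauss :: (real^'n) measure" by (rule prob_space_gauss)
  have cont: "continuous_on UNIV (\<lambda>z :: real^'n. \<psi> t (x + tproj (s *\<^sub>R z)))" if "test_function \<psi>" for \<psi>
  proof -
    have "continuous_on UNIV (\<lambda>z :: real^'n. (t, x + tproj (s *\<^sub>R z)))" by (intro continuous_intros)
    from continuous_on_compose2[OF test_function_continuous[OF that] this] show ?thesis by simp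
  qed
  have bd: "\<exists>C. \<forall>y. \<bar>\<psi> t y\<bar> \<le> C" if "test_function \<psi>" for \<psi>
    using test_function_bounded[OF that, of 0] t by (metis exp_zero mult_1 mult_zero_left)
  have one: "integrable gauss (\<lambda>z. z $ i * tpd i (\<phi> t) (x + tproj (s *\<^sub>R z))) \<and>
      integrable gauss (\<lambda>z. tpd i (tpd i (\<phi> t)) (x + tproj (s *\<^sub>R z))) \<and>
      (\<integral>z. z $ i * tpd i (\<phi> t) (x + tproj (s *\<^sub>R z)) \<partial>gauss)
      = s * (\<integral>z. tpd i (tpd i (\<phi> t)) (x + tproj (s *\<^sub>R z)) \<partial>gauss)" for i
  proof -
    have t1: "test_function (\<lambda>t. tpd i (\<phi> t))" by (rule test_function_tpd[OF \<phi>])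
    have t2: "test_function (\<lambda>t. tpd i (tpd i (\<phi> t)))" by (rule test_function_tpd[OF t1])
    obtain C1 where C1: "\<And>y. \<bar>tpd i (\<phi> t) y\<bar> \<le> C1" using bd[OF t1] by blast
    obtain C2 where C2: "\<And>y. \<bar>tpd i (tpd i (\<phi> t)) y\<bar> \<le> C2" using bd[OF t2] by blast
    have c1: "continuous_on UNIV (\<lambda>z :: real^'n. tpd i (\<phi> t) (x + tproj (s *\<^sub>R z)))" by (rule cont[OF t1])
    have c2: "continuous_on UNIV (\<lambda>z :: real^'n. tpd i (tpd i (\<phi> t)) (x + tproj (s *\<^sub>R z)))" by (rule cont[OF t2])
    note m1 = borel_measurable_continuous_onI[OF c1] and m2 = borel_measurable_continuous_onI[OF c2]
    have i2: "integrable gauss (\<lambda>z. tpd i (tpd i (\<phi> t)) (x + tproj (s *\<^sub>R z)))"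
      by (rule integrable_const_bound[where B=C2]) (use C2 m2 in auto)
    have i1: "integrable gauss (\<lambda>z. z $ i * tpd i (\<phi> t) (x + tproj (s *\<^sub>R z)))"
    proof (rule integrable_dominated)
      show "integrable gauss (\<lambda>z :: real^'n. C1 * norm z)"
        by (intro integrable_mult_right integrable_gauss_norm)
      show "AE z in gauss. norm (z $ i * tpd i (\<phi> t) (x + tproj (s *\<^sub>R z))) \<le> norm (C1 * norm z)"
      proof (rule AE_I2)
        fix z :: "real^'n"
        have "\<bar>z $ i\<bar> * \<bar>tpd i (\<phi> t) (x + tproj (s *\<^sub>R z))\<bar> \<le> norm z * C1"
          by (intro mult_mono component_le_norm_cart C1) auto
        then show "norm (z $ i * tpd i (\<phi> t) (x + tproj (s *\<^sub>R z))) \<le> norm (C1 * norm z)"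
          using order_trans[OF abs_ge_zero C1[of x]] by (simp add: abs_mult mult.commute[of C1])
      qed
    qed (use m1 in measurable)
    have "(\<integral>z. z $ i * tpd i (\<phi> t) (x + tproj (s *\<^sub>R z)) \<partial>gauss)
        = (\<integral>z. s * tpd i (tpd i (\<phi> t)) (x + tproj (s *\<^sub>R z)) \<partial>gauss)"
    proof (rule gauss_integration_by_parts[where B="max C1 (\<bar>s\<bar> * C2)"])
      fix z :: "real^'n"
      obtain y where y: "tproj y = x" using tproj_surj by blast
      have L: "(lift (\<lambda>t. tpd i (\<phi> t)) has_derivative (\<lambda>(a, h). a * time_deriv (\<lambda>t. tpd i (\<phi> t)) t (tproj (y + s *\<^sub>R z))
          + h \<bullet> tgrad (tpd i (\<phi> t)) (tproj (y + s *\<^sub>R z)))) (at (t, y + s *\<^sub>R z))"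
        by (rule lift_has_derivative[OF t1])
      have "((\<lambda>r. (t, y + s *\<^sub>R (z + r *\<^sub>R axis i 1))) has_derivative (\<lambda>h. (0, s *\<^sub>R (h *\<^sub>R axis i 1)))) (at 0)"
        by (auto intro!: derivative_eq_intros)
      moreover have "(lift (\<lambda>t. tpd i (\<phi> t)) has_derivative (\<lambda>(a, h). a * time_deriv (\<lambda>t. tpd i (\<phi> t)) t (tproj (y + s *\<^sub>R z))
          + h \<bullet> tgrad (tpd i (\<phi> t)) (tproj (y + s *\<^sub>R z)))) (at (t, y + s *\<^sub>R (z + 0 *\<^sub>R axis i 1)))"
        using L by simp
      ultimately have "((\<lambda>r. lift (\<lambda>t. tpd i (\<phi> t)) (t, y + s *\<^sub>R (z + r *\<^sub>R axis i 1))) has_derivative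
          (\<lambda>h. case (0, s *\<^sub>R (h *\<^sub>R axis i 1)) of (a, h) \<Rightarrow> a * time_deriv (\<lambda>t. tpd i (\<phi> t)) t (tproj (y + s *\<^sub>R z))
          + h \<bullet> tgrad (tpd i (\<phi> t)) (tproj (y + s *\<^sub>R z)))) (at 0)"
        by (rule has_derivative_compose)
      then have "((\<lambda>r. lift (\<lambda>t. tpd i (\<phi> t)) (t, y + s *\<^sub>R (z + r *\<^sub>R axis i 1))) has_derivative
          (\<lambda>h. (s *\<^sub>R (h *\<^sub>R axis i 1)) \<bullet> tgrad (tpd i (\<phi> t)) (tproj (y + s *\<^sub>R z)))) (at 0)" by simp
      then show "((\<lambda>r. tpd i (\<phi> t) (x + tproj (s *\<^sub>R (z + r *\<^sub>R axis i 1)))) has_real_derivative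
          s * tpd i (tpd i (\<phi> t)) (x + tproj (s *\<^sub>R z))) (at 0)"
        by (intro has_derivative_imp_has_field_derivative)
           (auto simp: lift_def tproj_add y tgrad_def inner_axis' mult_ac)
    next
      show "\<bar>tpd i (\<phi> t) (x + tproj (s *\<^sub>R z))\<bar> \<le> max C1 (\<bar>s\<bar> * C2)" for z
        using C1 by (simp add: le_max_iff_disj)
      show "\<bar>s * tpd i (tpd i (\<phi> t)) (x + tproj (s *\<^sub>R z))\<bar> \<le> max C1 (\<bar>s\<bar> * C2)" for z
        using C2 by (simp add: le_max_iff_disj abs_mult mult_left_mono)
      show "continuous_on UNIV (\<lambda>z. s * tpd i (tpd i (\<phi> t)) (x + tproj (s *\<^sub>R z)))"
        by (intro continuous_on_mult_left c2)
    qed (rule c1)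
    then show ?thesis using i1 i2 by simp
  qed
  have "(\<integral>z. z \<bullet> tgrad (\<phi> t) (x + tproj (s *\<^sub>R z)) \<partial>gauss)
      = (\<Sum>i\<in>UNIV. \<integral>z. z $ i * tpd i (\<phi> t) (x + tproj (s *\<^sub>R z)) \<partial>gauss)"
    unfolding inner_vec_def tgrad_def using one by simp
  also have "\<dots> = s * (\<integral>z. tlap (\<phi> t) (x + tproj (s *\<^sub>R z)) \<partial>gauss)"
    unfolding tlap_def using one by (simp add: sum_distrib_left)
  finally show ?thesis .
qed

text \<open>The weak Fokker-Planck equation sees the laws at single times only, so Brownian motion can be replaced by
  \<open>sqrt (2 t) z\<close> with one Gaussian vector \<open>z\<close>.\<close>

locale drifted_particle = P: prob_space P for P :: "'w measure" +
  fixes x1 :: "'w \<Rightarrow> 'n::finite torus" and v :: "'w \<Rightarrow> real^'n" and V :: real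
  assumes x1 [measurable]: "x1 \<in> borel_measurable P" and v [measurable]: "v \<in> borel_measurable P"
    and V: "\<And>\<omega>. norm (v \<omega>) \<le> V"
begin

sublocale G: prob_space "gauss :: (real^'n) measure" by (rule prob_space_gauss)

abbreviation Q :: "('w \<times> (real^'n)) measure" where "Q \<equiv> P \<Otimes>\<^sub>M gauss"

sublocale PG: pair_prob_space P "gauss :: (real^'n) measure" ..

definition pos :: "real \<Rightarrow> 'w \<times> (real^'n) \<Rightarrow> 'n torus" where
  "pos t \<omega> = x1 (fst \<omega>) + tproj (t *\<^sub>R v (fst \<omega>) + sqrt (2 * t) *\<^sub>R snd \<omega>)"

lemma pos_measurable [measurable]: "pos t \<in> borel_measurable Q"
  unfolding pos_def by measurable

lemma pos_joint_measurable [measurable]: "(\<lambda>(t, \<omega>). pos t \<omega>) \<in> borel_measurable (borel \<Otimes>\<^sub>M Q)"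
  unfolding pos_def by measurable

definition path :: "real \<Rightarrow> 'n tprob" where "path t = law Q (pos t)"

lemma V_nonneg: "0 \<le> V"
proof -
  obtain \<omega> where "\<omega> \<in> space P" using P.not_empty by blast
  then show ?thesis using V[of \<omega>] norm_ge_zero order_trans by blast
qed

lemma integrable_snd_norm: "integrable Q (\<lambda>\<omega>. norm (snd \<omega>))"
proof -
  have "integrable gauss (\<lambda>z :: real^'n. norm z)" by (rule integrable_gauss_norm)
  then have "(\<integral>\<^sup>+\<omega>. ennreal (norm (snd \<omega>)) \<partial>Q) < \<infinity>"
    by (subst G.nn_integral_fst[symmetric]) (auto simp: P.emeasure_space_1 integrable_iff_bounded)
  then show ?thesis by (simp add: integrable_iff_bounded)
qed

lemma dist_path_le:
  "dist (path t) (path s) \<le> \<bar>t - s\<bar> * V + \<bar>sqrt (2 * t) - sqrt (2 * s)\<bar> * (\<integral>\<omega>. norm (snd \<omega>) \<partial>Q)"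
proof -
  have "dist (path t) (path s) \<le> (\<integral>\<omega>. \<bar>t - s\<bar> * V + \<bar>sqrt (2 * t) - sqrt (2 * s)\<bar> * norm (snd \<omega>) \<partial>Q)"
    unfolding path_def
  proof (rule dist_law_le[OF PG.prob_space_axioms])
    fix \<omega> :: "'w \<times> (real^'n)"
    have "dist (pos t \<omega>) (pos s \<omega>) \<le>
        norm ((t *\<^sub>R v (fst \<omega>) + sqrt (2 * t) *\<^sub>R snd \<omega>) - (s *\<^sub>R v (fst \<omega>) + sqrt (2 * s) *\<^sub>R snd \<omega>))"
      unfolding pos_def by (rule dist_torus_add_le)
    also have "\<dots> = norm ((t - s) *\<^sub>R v (fst \<omega>) + (sqrt (2 * t) - sqrt (2 * s)) *\<^sub>R snd \<omega>)"
      by (simp add: algebra_simps)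
    also have "\<dots> \<le> \<bar>t - s\<bar> * norm (v (fst \<omega>)) + \<bar>sqrt (2 * t) - sqrt (2 * s)\<bar> * norm (snd \<omega>)"
      by (rule norm_triangle_le) simp
    also have "\<dots> \<le> \<bar>t - s\<bar> * V + \<bar>sqrt (2 * t) - sqrt (2 * s)\<bar> * norm (snd \<omega>)"
      by (intro add_right_mono mult_left_mono V) simp
    finally show "dist (pos t \<omega>) (pos s \<omega>) \<le> \<bar>t - s\<bar> * V + \<bar>sqrt (2 * t) - sqrt (2 * s)\<bar> * norm (snd \<omega>)" .
  qed (use integrable_snd_norm in auto)
  also have "\<dots> = \<bar>t - s\<bar> * V + \<bar>sqrt (2 * t) - sqrt (2 * s)\<bar> * (\<integral>\<omega>. norm (snd \<omega>) \<partial>Q)"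
    using integrable_snd_norm by (simp add: PG.prob_space)
  finally show ?thesis .
qed

lemma continuous_path: "continuous_on A path"
  unfolding continuous_on_def
proof
  fix s assume "s \<in> A"
  have "((\<lambda>t. \<bar>t - s\<bar> * V + \<bar>sqrt (2 * t) - sqrt (2 * s)\<bar> * (\<integral>\<omega>. norm (snd \<omega>) \<partial>Q)) \<longlongrightarrow>
      \<bar>s - s\<bar> * V + \<bar>sqrt (2 * s) - sqrt (2 * s)\<bar> * (\<integral>\<omega>. norm (snd \<omega>) \<partial>Q)) (at s within A)"
    by (intro tendsto_intros)
  then have lim: "((\<lambda>t. \<bar>t - s\<bar> * V + \<bar>sqrt (2 * t) - sqrt (2 * s)\<bar> * (\<integral>\<omega>. norm (snd \<omega>) \<partial>Q)) \<longlongrightarrow> 0)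
      (at s within A)" by (simp only: diff_self abs_zero mult_zero_left add_0_left)
  have "((\<lambda>t. dist (path t) (path s)) \<longlongrightarrow> 0) (at s within A)"
    by (rule Lim_null_comparison[OF always_eventually lim], rule allI) (use dist_path_le in simp)
  then show "(path \<longlongrightarrow> path s) (at s within A)" by (rule tendsto_dist_iff[THEN iffD2])
qed

text \<open>Ito's formula. In the variable \<open>s\<close> with \<open>t = s\<^sup>2 / 2\<close> the particle moves smoothly along
  \<open>s z\<close>, and Gaussian integration by parts turns the radial derivative into the Laplacian.\<close>

lemma ito:
  assumes \<phi>: "test_function \<phi>" and T: "0 \<le> T"
  shows "(\<integral>\<omega>. \<phi> T (pos T \<omega>) \<partial>Q) - (\<integral>\<omega>. \<phi> 0 (pos 0 \<omega>) \<partial>Q) =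
    (LINT t:{0..T}|lborel. \<integral>\<omega>. time_deriv \<phi> t (pos t \<omega>) + tlap (\<phi> t) (pos t \<omega>)
        + v (fst \<omega>) \<bullet> tgrad (\<phi> t) (pos t \<omega>) \<partial>Q)"
proof -
  \<comment> \<open>The value of \<open>s\<close> at time \<open>T\<close>.\<close>
  define R where "R = sqrt (2 * T)"
  have R: "0 \<le> R" "R\<^sup>2 / 2 = T" using T by (auto simp: R_def)
  have cf: "test_function (\<lambda>t. tpd i (\<phi> t))" "test_function (\<lambda>t. tpd i (tpd i (\<phi> t)))" for i
    by (intro test_function_tpd \<phi>)+
  have bd: "\<exists>C. \<forall>t y. 0 \<le> t \<longrightarrow> \<bar>\<psi> t y\<bar> \<le> C" if "test_function \<psi>" for \<psi>
    using test_function_bounded[OF that, of 0] by (metis exp_zero mult_1 mult_zero_left)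
  obtain C0 where C0: "\<And>t y. 0 \<le> t \<Longrightarrow> \<bar>\<phi> t y\<bar> \<le> C0" using bd[OF \<phi>] by blast
  obtain C1 where C1: "\<And>t y. 0 \<le> t \<Longrightarrow> \<bar>time_deriv \<phi> t y + tlap (\<phi> t) y\<bar> \<le> C1"
  proof -
    obtain C where C: "\<And>z. \<bar>heat_part 0 \<phi> z\<bar> \<le> C" using bounded_heat_part[OF \<phi>] by blast
    have "\<bar>time_deriv \<phi> t y + tlap (\<phi> t) y\<bar> \<le> C" if "0 \<le> t" for t y
      using C[of "(t, y)"] that by (simp add: heat_part_def)
    then show ?thesis by (rule that)
  qed
  obtain C1' where C1': "\<And>t y. 0 \<le> t \<Longrightarrow> \<bar>time_deriv \<phi> t y\<bar> \<le> C1'"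
    using bd[OF test_function_time_deriv[OF \<phi>]] by blast
  obtain C2 where C2: "\<And>t y. 0 \<le> t \<Longrightarrow> norm (tgrad (\<phi> t) y) \<le> C2"
  proof -
    obtain C where C: "\<And>z. norm (flux_part 0 \<phi> z) \<le> C" using bounded_flux_part[OF \<phi>] by blast
    have "norm (tgrad (\<phi> t) y) \<le> C" if "0 \<le> t" for t y
      using C[of "(t, y)"] that by (simp add: flux_part_def)
    then show ?thesis by (rule that)
  qed
  have C2n: "0 \<le> C2" using C2[of 0 0] norm_ge_zero order_trans by blast
  have meas1: "(\<lambda>(t, y). time_deriv \<phi> t y) \<in> borel_measurable (borel \<Otimes>\<^sub>M borel)"
    using test_function_measurable[OF test_function_time_deriv[OF \<phi>]] by (simp add: borel_prod case_prod_beta')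
  have meas2: "(\<lambda>(t, y). tlap (\<phi> t) y) \<in> borel_measurable (borel \<Otimes>\<^sub>M borel)"
    using measurable_tlap[OF \<phi>] by (simp add: borel_prod case_prod_beta')
  have meas3: "(\<lambda>(t, y). tgrad (\<phi> t) y) \<in> borel_measurable (borel \<Otimes>\<^sub>M borel)"
    using measurable_tgrad[OF \<phi>] by (simp add: borel_prod case_prod_beta')
  have meas0: "(\<lambda>(t, y). \<phi> t y) \<in> borel_measurable (borel \<Otimes>\<^sub>M borel)"
    using test_function_measurable[OF \<phi>] by (simp add: borel_prod case_prod_beta')
  have comp: "(\<lambda>p. h (g p) (Y p)) \<in> borel_measurable N"
    if "(\<lambda>(t, y). h t y) \<in> borel_measurable (borel \<Otimes>\<^sub>M borel)" "g \<in> borel_measurable N" "Y \<in> borel_measurable N"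
    for h :: "real \<Rightarrow> 'n torus \<Rightarrow> 'c::topological_space" and g Y and N :: "'d measure"
    using measurable_compose[OF measurable_Pair[OF that(2,3)] that(1)] by simp
  let ?L = "\<lambda>t \<omega>. time_deriv \<phi> t (pos t \<omega>) + tlap (\<phi> t) (pos t \<omega>) + v (fst \<omega>) \<bullet> tgrad (\<phi> t) (pos t \<omega>)"
  let ?h = "\<lambda>t. \<integral>\<omega>. ?L t \<omega> \<partial>Q"
  let ?D = "\<lambda>s \<omega>. s * time_deriv \<phi> (s\<^sup>2 / 2) (pos (s\<^sup>2 / 2) \<omega>)
      + s * (v (fst \<omega>) \<bullet> tgrad (\<phi> (s\<^sup>2 / 2)) (pos (s\<^sup>2 / 2) \<omega>)) + snd \<omega> \<bullet> tgrad (\<phi> (s\<^sup>2 / 2)) (pos (s\<^sup>2 / 2) \<omega>)"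
  have posm: "(\<lambda>p. pos (g p) (W p)) \<in> borel_measurable N"
    if [measurable]: "g \<in> borel_measurable N" "W \<in> N \<rightarrow>\<^sub>M Q" for g W and N :: "'d measure"
    using measurable_compose[OF measurable_Pair[OF that(1,2)] pos_joint_measurable] by simp
  have pos_s: "pos (s\<^sup>2 / 2) \<omega> = x1 (fst \<omega>) + tproj ((s\<^sup>2 / 2) *\<^sub>R v (fst \<omega>) + s *\<^sub>R snd \<omega>)" if "0 \<le> s" for s \<omega>
    using that by (simp add: pos_def)
  have pathwise: "\<phi> T (pos T \<omega>) - \<phi> 0 (pos 0 \<omega>) = (LINT s:{0..R}|lborel. ?D s \<omega>)" for \<omega>
  proof -
    obtain y where y: "tproj y = x1 (fst \<omega>)" using tproj_surj by blast
    let ?c = "\<lambda>s. (s\<^sup>2 / 2, y + (s\<^sup>2 / 2) *\<^sub>R v (fst \<omega>) + s *\<^sub>R snd \<omega>)"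
    let ?Y = "\<lambda>s. x1 (fst \<omega>) + tproj ((s\<^sup>2 / 2) *\<^sub>R v (fst \<omega>) + s *\<^sub>R snd \<omega>)"
    let ?E = "\<lambda>s. s * time_deriv \<phi> (s\<^sup>2 / 2) (?Y s) + s * (v (fst \<omega>) \<bullet> tgrad (\<phi> (s\<^sup>2 / 2)) (?Y s)) + snd \<omega> \<bullet> tgrad (\<phi> (s\<^sup>2 / 2)) (?Y s)"
    have Ye: "tproj (snd (?c s)) = ?Y s" for s by (simp add: tproj_add y add.assoc)
    have "((\<lambda>s. \<phi> (s\<^sup>2 / 2) (?Y s)) has_real_derivative ?E s) (at s)" for s
    proof -
      have "(?c has_derivative (\<lambda>h. (h * s, (h * s) *\<^sub>R v (fst \<omega>) + h *\<^sub>R snd \<omega>))) (at s)"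
        by (auto intro!: derivative_eq_intros simp: power2_eq_square algebra_simps)
      from has_derivative_compose[OF this lift_has_derivative[OF \<phi>]]
      have "((\<lambda>s. lift \<phi> (?c s)) has_derivative (\<lambda>h. h * ?E s)) (at s)"
        using Ye[of s] by (simp add: algebra_simps)
      moreover have "lift \<phi> (?c s) = \<phi> (s\<^sup>2 / 2) (?Y s)" for s
        using Ye[of s] by (simp add: lift_def)
      ultimately have "((\<lambda>s. \<phi> (s\<^sup>2 / 2) (?Y s)) has_derivative (\<lambda>h. h * ?E s)) (at s)" by simp
      then show ?thesis by (rule has_derivative_imp_has_field_derivative) simp
    qed
    moreover have "continuous_on UNIV ?E"
    proof -
      have cY: "continuous_on UNIV (\<lambda>s. (s\<^sup>2 / 2, ?Y s))" by (intro continuous_intros) auto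
      have c1: "continuous_on UNIV (\<lambda>s. \<psi> (s\<^sup>2 / 2) (?Y s))" if "test_function \<psi>" for \<psi>
        using continuous_on_compose2[OF test_function_continuous[OF that] cY] by simp
      have c2: "continuous_on UNIV (\<lambda>s. tgrad (\<phi> (s\<^sup>2 / 2)) (?Y s))"
        unfolding tgrad_def by (rule continuous_on_vec_lambda) (rule c1[OF cf(1)])
      show ?thesis by (intro continuous_intros c1 c2 test_function_time_deriv \<phi>)
    qed
    ultimately have "(\<integral>s. ?E s * indicator {0..R} s \<partial>lborel) = \<phi> (R\<^sup>2 / 2) (?Y R) - \<phi> (0\<^sup>2 / 2) (?Y 0)"
      by (intro integral_FTC_Icc_real) (auto simp: R continuous_on_eq_continuous_at)
    moreover have "(LINT s:{0..R}|lborel. ?D s \<omega>) = (\<integral>s. ?E s * indicator {0..R} s \<partial>lborel)"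
      unfolding set_lebesgue_integral_def
      by (rule Lebesgue_integral_cong) (auto simp: pos_s indicator_def)
    moreover have "pos T \<omega> = ?Y R" "pos 0 \<omega> = ?Y 0" using pos_s[OF R(1), of \<omega>] R(2) by (auto simp: pos_def)
    ultimately show ?thesis using R(2) by simp
  qed
  let ?M = "density lborel (\<lambda>s. ennreal (indicator {0..R} s))"
  have fin: "finite_measure ?M"
    by (rule finite_measureI) (use R(1) in \<open>simp add: emeasure_density ennreal_indicator\<close>)
  interpret M: finite_measure ?M by (rule fin)
  interpret MQ: pair_sigma_finite ?M Q
    by (intro pair_sigma_finite.intro M.sigma_finite_measure_axioms PG.sigma_finite_measure_axioms)
  have Dm [measurable]: "(\<lambda>(s, \<omega>). ?D s \<omega>) \<in> borel_measurable (?M \<Otimes>\<^sub>M Q)"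
    unfolding case_prod_beta
    by (intro borel_measurable_add borel_measurable_times borel_measurable_inner
        comp[OF meas1] comp[OF meas3] posm) measurable
  have Db: "\<bar>?D s \<omega>\<bar> \<le> R * C1' + R * (V * C2) + norm (snd \<omega>) * C2" if "0 \<le> s" "s \<le> R" for s \<omega>
  proof -
    have "\<bar>s * time_deriv \<phi> (s\<^sup>2 / 2) (pos (s\<^sup>2 / 2) \<omega>)\<bar> \<le> R * C1'"
      unfolding abs_mult using that C1' by (intro mult_mono) auto
    moreover have "\<bar>s * (v (fst \<omega>) \<bullet> tgrad (\<phi> (s\<^sup>2 / 2)) (pos (s\<^sup>2 / 2) \<omega>))\<bar> \<le> R * (V * C2)"
      unfolding abs_mult using that C2 V V_nonneg
      by (intro mult_mono order_trans[OF Cauchy_Schwarz_ineq2]) auto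
    moreover have "\<bar>snd \<omega> \<bullet> tgrad (\<phi> (s\<^sup>2 / 2)) (pos (s\<^sup>2 / 2) \<omega>)\<bar> \<le> norm (snd \<omega>) * C2"
      using C2 by (intro order_trans[OF Cauchy_Schwarz_ineq2] mult_left_mono) auto
    ultimately show ?thesis by linarith
  qed
  have Di: "integrable (?M \<Otimes>\<^sub>M Q) (\<lambda>(s, \<omega>). ?D s \<omega>)"
  proof (rule integrable_dominated)
    have "(\<integral>\<^sup>+p. ennreal (R * C1' + R * (V * C2) + norm (snd (snd p)) * C2) \<partial>(?M \<Otimes>\<^sub>M Q))
        = (\<integral>\<^sup>+s. \<integral>\<^sup>+\<omega>. ennreal (R * C1' + R * (V * C2) + norm (snd \<omega>) * C2) \<partial>Q \<partial>?M)"
      by (subst PG.nn_integral_fst[symmetric]) auto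
    also have "\<dots> < \<infinity>"
    proof -
      have "integrable Q (\<lambda>\<omega>. R * C1' + R * (V * C2) + norm (snd \<omega>) * C2)" using integrable_snd_norm by simp
      then have "(\<integral>\<^sup>+\<omega>. ennreal (norm (R * C1' + R * (V * C2) + norm (snd \<omega>) * C2)) \<partial>Q) < \<infinity>"
        by (simp only: integrable_iff_bounded)
      moreover have "(\<integral>\<^sup>+\<omega>. ennreal (R * C1' + R * (V * C2) + norm (snd \<omega>) * C2) \<partial>Q) \<le>
          (\<integral>\<^sup>+\<omega>. ennreal (norm (R * C1' + R * (V * C2) + norm (snd \<omega>) * C2)) \<partial>Q)"
        by (intro nn_integral_mono ennreal_leI) simp
      ultimately have "(\<integral>\<^sup>+\<omega>. ennreal (R * C1' + R * (V * C2) + norm (snd \<omega>) * C2) \<partial>Q) < \<infinity>"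
        by (rule le_less_trans[rotated])
      moreover have "emeasure ?M UNIV < top"
        by (rule top.not_eq_extremum[THEN iffD1]) (rule M.emeasure_finite[of UNIV, unfolded infinity_ennreal_def])
      ultimately show ?thesis by (simp add: ennreal_mult_less_top)
    qed
    finally show "integrable (?M \<Otimes>\<^sub>M Q) (\<lambda>p. R * C1' + R * (V * C2) + norm (snd (snd p)) * C2)"
      using R(1) C2n V_nonneg C1'[of 0 0] by (intro integrableI_nonneg) (auto intro!: AE_I2 add_nonneg_nonneg)
    have "AE p in ?M \<Otimes>\<^sub>M Q. 0 \<le> fst p \<and> fst p \<le> R"
    proof (rule MQ.AE_pair_measure)
      have "{x \<in> space (?M \<Otimes>\<^sub>M Q). 0 \<le> fst x \<and> fst x \<le> R} \<in> sets (?M \<Otimes>\<^sub>M Q)" by measurable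
      then show "{x \<in> space (?M \<Otimes>\<^sub>M Q). 0 \<le> fst x \<and> fst x \<le> R} \<in> sets (?M \<Otimes>\<^sub>M Q)" .
      show "AE x in ?M. AE y in Q. 0 \<le> fst (x, y) \<and> fst (x, y) \<le> R"
        by (subst AE_density) (auto simp: indicator_def)
    qed
    then show "AE p in ?M \<Otimes>\<^sub>M Q. norm (case p of (s, \<omega>) \<Rightarrow> ?D s \<omega>) \<le> norm (R * C1' + R * (V * C2) + norm (snd (snd p)) * C2)"
    proof eventually_elim
      case (elim p)
      then show ?case using Db[of "fst p" "snd p"] by (simp add: case_prod_beta)
    qed
  qed measurable
  have ibp: "(\<integral>\<omega>. ?D s \<omega> \<partial>Q) = ?h (s\<^sup>2 / 2) * s" if s: "0 \<le> s" for s
  proof -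
    let ?t = "s\<^sup>2 / 2"
    have t: "0 \<le> ?t" by simp
    have m1: "(\<lambda>\<omega>. time_deriv \<phi> ?t (pos ?t \<omega>)) \<in> borel_measurable Q"
      and m2: "(\<lambda>\<omega>. tlap (\<phi> ?t) (pos ?t \<omega>)) \<in> borel_measurable Q"
      and m3: "(\<lambda>\<omega>. tgrad (\<phi> ?t) (pos ?t \<omega>)) \<in> borel_measurable Q"
      by (rule comp[OF meas1] comp[OF meas2] comp[OF meas3]; measurable)+
    note [measurable] = m1 m2 m3
    have i1: "integrable Q (\<lambda>\<omega>. time_deriv \<phi> ?t (pos ?t \<omega>))"
      by (rule PG.integrable_const_bound[where B=C1']) (use C1' in auto)
    have tl: "\<bar>tlap (\<phi> ?t) y\<bar> \<le> C1 + C1'" for y using C1[OF t, of y] C1'[OF t, of y] by linarith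
    have i2: "integrable Q (\<lambda>\<omega>. tlap (\<phi> ?t) (pos ?t \<omega>))"
      by (rule PG.integrable_const_bound[where B="C1 + C1'"]) (use tl in auto)
    have i3: "integrable Q (\<lambda>\<omega>. v (fst \<omega>) \<bullet> tgrad (\<phi> ?t) (pos ?t \<omega>))"
    proof (rule PG.integrable_const_bound[where B="V * C2"])
      show "AE \<omega> in Q. norm (v (fst \<omega>) \<bullet> tgrad (\<phi> ?t) (pos ?t \<omega>)) \<le> V * C2"
        using V C2[OF t] V_nonneg by (auto intro!: AE_I2 order_trans[OF Cauchy_Schwarz_ineq2] mult_mono)
    qed measurable
    have i4: "integrable Q (\<lambda>\<omega>. snd \<omega> \<bullet> tgrad (\<phi> ?t) (pos ?t \<omega>))"
    proof (rule integrable_dominated)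
      show "integrable Q (\<lambda>\<omega>. norm (snd \<omega>) * C2)" using integrable_snd_norm by simp
      show "AE \<omega> in Q. norm (snd \<omega> \<bullet> tgrad (\<phi> ?t) (pos ?t \<omega>)) \<le> norm (norm (snd \<omega>) * C2)"
        using C2[OF t] C2n by (auto intro!: AE_I2 order_trans[OF Cauchy_Schwarz_ineq2] mult_left_mono)
    qed measurable
    have "(\<integral>\<omega>. snd \<omega> \<bullet> tgrad (\<phi> ?t) (pos ?t \<omega>) \<partial>Q) = (\<integral>\<omega>. \<integral>z. z \<bullet> tgrad (\<phi> ?t) (pos ?t (\<omega>, z)) \<partial>gauss \<partial>P)"
      using PG.integral_fst'[OF i4] by simp
    also have "\<dots> = (\<integral>\<omega>. s * (\<integral>z. tlap (\<phi> ?t) (pos ?t (\<omega>, z)) \<partial>gauss) \<partial>P)"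
      using test_function_gauss_by_parts[OF \<phi> t, where s=s] by (simp add: pos_s[OF s] tproj_add flip: add.assoc)
    also have "\<dots> = s * (\<integral>\<omega>. tlap (\<phi> ?t) (pos ?t \<omega>) \<partial>Q)"
      using PG.integral_fst'[OF i2] by simp
    finally show ?thesis using i1 i2 i3 i4 by (simp add: algebra_simps)
  qed
  have hm: "?h \<in> borel_measurable borel"
  proof (rule PG.borel_measurable_lebesgue_integral)
    show "(\<lambda>(t, \<omega>). ?L t \<omega>) \<in> borel_measurable (borel \<Otimes>\<^sub>M Q)"
      unfolding case_prod_beta
      by (intro borel_measurable_add borel_measurable_inner comp[OF meas1] comp[OF meas2] comp[OF meas3] posm) measurable
  qed
  have hb: "\<bar>?h t\<bar> \<le> C1 + V * C2" if t: "0 \<le> t" for t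
  proof -
    have b: "\<bar>?L t \<omega>\<bar> \<le> C1 + V * C2" for \<omega>
    proof -
      have "\<bar>v (fst \<omega>) \<bullet> tgrad (\<phi> t) (pos t \<omega>)\<bar> \<le> V * C2"
        using V C2[OF t] V_nonneg by (intro order_trans[OF Cauchy_Schwarz_ineq2] mult_mono) auto
      then show ?thesis using C1[OF t, of "pos t \<omega>"] by linarith
    qed
    have Lm: "?L t \<in> borel_measurable Q"
      by (intro borel_measurable_add borel_measurable_inner comp[OF meas1] comp[OF meas2] comp[OF meas3]) measurable
    have Li: "integrable Q (?L t)"
      by (rule PG.integrable_const_bound[where B="C1 + V * C2", OF _ Lm]) (use b in auto)
    have "\<bar>?h t\<bar> \<le> (\<integral>\<omega>. \<bar>?L t \<omega>\<bar> \<partial>Q)" by (rule integral_abs_bound)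
    also have "\<dots> \<le> C1 + V * C2"
      by (rule PG.integral_le_const[OF integrable_abs[OF Li]]) (use b in auto)
    finally show ?thesis .
  qed
  have "(\<integral>\<omega>. \<phi> T (pos T \<omega>) \<partial>Q) - (\<integral>\<omega>. \<phi> 0 (pos 0 \<omega>) \<partial>Q) = (\<integral>\<omega>. \<phi> T (pos T \<omega>) - \<phi> 0 (pos 0 \<omega>) \<partial>Q)"
    by (subst Bochner_Integration.integral_diff)
       (auto intro!: PG.integrable_const_bound[where B=C0] comp[OF meas0] simp: C0 T)
  also have "\<dots> = (\<integral>\<omega>. \<integral>s. ?D s \<omega> \<partial>?M \<partial>Q)"
    unfolding pathwise set_lebesgue_integral_def
    by (rule Lebesgue_integral_cong[OF refl], subst integral_density) auto
  also have "\<dots> = (\<integral>s. \<integral>\<omega>. ?D s \<omega> \<partial>Q \<partial>?M)"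
    using MQ.Fubini_integral[OF Di] by simp
  also have "\<dots> = (\<integral>s. (\<integral>\<omega>. ?D s \<omega> \<partial>Q) * indicator {0..R} s \<partial>lborel)"
    by (subst integral_density) (use PG.borel_measurable_lebesgue_integral[OF Dm] in \<open>auto simp: mult.commute\<close>)
  also have "\<dots> = (\<integral>s. ?h (s\<^sup>2 / 2) * s * indicator {0..R} s \<partial>lborel)"
    by (rule Lebesgue_integral_cong) (auto simp: indicator_def ibp)
  also have "\<dots> = (\<integral>t. ?h t * indicator {0\<^sup>2 / 2..R\<^sup>2 / 2} t \<partial>lborel)"
  proof (rule integral_substitution(2)[symmetric])
    show "set_integrable lborel {0\<^sup>2 / 2..R\<^sup>2 / 2} ?h"
      unfolding set_integrable_def
    proof (rule integrable_dominated)
      show "integrable lborel (\<lambda>t. (C1 + V * C2) * indicator {0\<^sup>2 / 2..R\<^sup>2 / 2} t)" by simp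
      show "AE t in lborel. norm (indicator {0\<^sup>2 / 2..R\<^sup>2 / 2} t *\<^sub>R ?h t) \<le> norm ((C1 + V * C2) * indicator {0\<^sup>2 / 2..R\<^sup>2 / 2} t)"
        by (auto simp: indicator_def intro!: AE_I2 order_trans[OF hb abs_ge_self])
    qed (use hm in measurable)
    show "((\<lambda>s. s\<^sup>2 / 2) has_real_derivative s) (at s)" for s :: real
      by (auto intro!: derivative_eq_intros)
  qed (use R in auto)
  also have "\<dots> = (LINT t:{0..T}|lborel. ?h t)"
    unfolding set_lebesgue_integral_def by (simp add: R mult.commute)
  finally show ?thesis .
qed

end

section \<open>Cutting and joining paths\<close>

definition disc_until :: "real \<Rightarrow> real \<Rightarrow> real \<Rightarrow> real" where
  "disc_until \<delta> \<tau> t = disc \<delta> t * indicator {..<\<tau>} t"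

lemma disc_until_simps [simp]: "0 \<le> disc_until \<delta> \<tau> t" "t < 0 \<Longrightarrow> disc_until \<delta> \<tau> t = 0"
  and measurable_disc_until [measurable]: "disc_until \<delta> \<tau> \<in> borel_measurable borel"
  unfolding disc_until_def by (auto, measurable)

lemma disc_until_le: "disc_until \<delta> \<tau> t \<le> disc \<delta> t"
  by (auto simp: disc_until_def indicator_def)

lemma integrable_disc_until: "0 < \<delta> \<Longrightarrow> integrable lborel (disc_until \<delta> \<tau>)"
  by (rule integrable_dominated[OF integrable_disc]) (auto simp: disc_until_le)

lemma disc_split:
  assumes "0 \<le> \<tau>" shows "disc \<delta> t = disc_until \<delta> \<tau> t + exp (- \<delta> * \<tau>) * disc \<delta> (t - \<tau>)"
  using assms by (auto simp: disc_def disc_until_def indicator_def algebra_simps simp flip: exp_add)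

lemma
  fixes g :: "real \<Rightarrow> real"
  assumes g: "integrable lborel (\<lambda>t. disc \<delta> t * g t)" and \<tau>: "0 \<le> \<tau>"
  shows integrable_disc_until_mult: "integrable lborel (\<lambda>t. disc_until \<delta> \<tau> t * g t)"
    and integrable_disc_shift: "integrable lborel (\<lambda>t. disc \<delta> t * g (t + \<tau>))"
    and integral_disc_split: "(\<integral>t. disc \<delta> t * g t \<partial>lborel) =
      (\<integral>t. disc_until \<delta> \<tau> t * g t \<partial>lborel) + exp (- \<delta> * \<tau>) * (\<integral>t. disc \<delta> t * g (t + \<tau>) \<partial>lborel)"
proof -
  have e: "disc_until \<delta> \<tau> t * g t = indicator {..<\<tau>} t *\<^sub>R (disc \<delta> t * g t)" for t
    by (simp add: disc_until_def)
  show i1: "integrable lborel (\<lambda>t. disc_until \<delta> \<tau> t * g t)"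
    unfolding e by (rule integrable_mult_indicator[OF _ g]) simp
  have i2: "integrable lborel (\<lambda>t. exp (- \<delta> * \<tau>) * disc \<delta> (t - \<tau>) * g t)"
  proof -
    have "exp (- \<delta> * \<tau>) * disc \<delta> (t - \<tau>) * g t = disc \<delta> t * g t - disc_until \<delta> \<tau> t * g t" for t
      unfolding disc_split[OF \<tau>, of \<delta> t] by (simp add: algebra_simps)
    then show ?thesis using g i1 by simp
  qed
  have i3: "integrable lborel (\<lambda>t. exp (- \<delta> * \<tau>) * disc \<delta> t * g (t + \<tau>))"
    using lborel_integrable_real_affine[OF i2, of 1 \<tau>] by (simp add: add.commute)
  then show "integrable lborel (\<lambda>t. disc \<delta> t * g (t + \<tau>))" by (simp add: mult.assoc)
  have "(\<integral>t. disc \<delta> t * g t \<partial>lborel) = (\<integral>t. disc_until \<delta> \<tau> t * g t + exp (- \<delta> * \<tau>) * disc \<delta> (t - \<tau>) * g t \<partial>lborel)"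
    by (rule Lebesgue_integral_cong[OF refl]) (subst disc_split[OF \<tau>], simp add: algebra_simps)
  also have "\<dots> = (\<integral>t. disc_until \<delta> \<tau> t * g t \<partial>lborel) + (\<integral>t. exp (- \<delta> * \<tau>) * disc \<delta> (t - \<tau>) * g t \<partial>lborel)"
    using i1 i2 by simp
  also have "(\<integral>t. exp (- \<delta> * \<tau>) * disc \<delta> (t - \<tau>) * g t \<partial>lborel) = (\<integral>t. exp (- \<delta> * \<tau>) * disc \<delta> t * g (t + \<tau>) \<partial>lborel)"
    using lborel_integral_real_affine[of 1 "\<lambda>t. exp (- \<delta> * \<tau>) * disc \<delta> (t - \<tau>) * g t" \<tau>] by (simp add: add.commute)
  also have "\<dots> = exp (- \<delta> * \<tau>) * (\<integral>t. disc \<delta> t * g (t + \<tau>) \<partial>lborel)" by (simp add: mult.assoc)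
  finally show "(\<integral>t. disc \<delta> t * g t \<partial>lborel) =
      (\<integral>t. disc_until \<delta> \<tau> t * g t \<partial>lborel) + exp (- \<delta> * \<tau>) * (\<integral>t. disc \<delta> t * g (t + \<tau>) \<partial>lborel)" .
qed

abbreviation shift :: "real \<Rightarrow> real \<times> 'a \<Rightarrow> real \<times> 'a" where
  "shift \<tau> z \<equiv> (fst z + \<tau>, snd z)"

lemma measurable_shift: "shift \<tau> \<in> borel \<rightarrow>\<^sub>M (borel :: (real \<times> 'n::finite torus) measure)"
  by (intro borel_measurable_continuous_onI continuous_intros)

lemma Sp_until_facts:
  assumes "continuous_on {0..} m" "0 < \<delta>"
  shows "sets (spacetime (disc_until \<delta> \<tau>) m) = sets borel" "space (spacetime (disc_until \<delta> \<tau>) m) = UNIV"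
    "finite_measure (spacetime (disc_until \<delta> \<tau>) m)"
  by (rule sets_spacetime[OF assms(1)] space_spacetime[OF assms(1)]
      finite_measure_spacetime[OF assms(1) _ _ _ integrable_disc_until[OF assms(2)]]; simp)+

lemma nn_integral_Sp_split:
  fixes m :: "real \<Rightarrow> 'n::finite tprob" and f :: "real \<times> 'n torus \<Rightarrow> ennreal"
  assumes m: "continuous_on {0..} m" and \<tau>: "0 \<le> \<tau>" and f: "f \<in> borel_measurable borel"
  shows "(\<integral>\<^sup>+z. f z \<partial>Sp \<delta> m) = (\<integral>\<^sup>+z. f z \<partial>spacetime (disc_until \<delta> \<tau>) m)
    + ennreal (exp (- \<delta> * \<tau>)) * (\<integral>\<^sup>+z. f (shift \<tau> z) \<partial>Sp \<delta> (\<lambda>t. m (t + \<tau>)))"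
proof -
  have m': "continuous_on {0..} (\<lambda>t. m (t + \<tau>))"
    by (rule continuous_on_compose2[OF m]) (use \<tau> in \<open>auto intro!: continuous_intros\<close>)
  have fs: "(\<lambda>z. f (shift \<tau> z)) \<in> borel_measurable borel"
    by (rule measurable_compose[OF measurable_shift f])
  define g where "g t = (\<integral>\<^sup>+x. f (t, x) \<partial>meas (m (max 0 t)))" for t
  have gm [measurable]: "g \<in> borel_measurable borel"
    using measurable_compose[OF spacetime_kernel[OF m, of "\<lambda>_. 0"] nn_integral_measurable_subprob_algebra[OF f]]
    unfolding g_def by (simp add: nn_integral_distr_Pair[OF m _ _ _ f, of "\<lambda>_. 0"])
  have e: "(\<integral>\<^sup>+z. f z \<partial>spacetime w m) = (\<integral>\<^sup>+t. ennreal (w t) * g t \<partial>lborel)"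
    if [measurable]: "w \<in> borel_measurable borel" and "\<And>t. 0 \<le> w t" "\<And>t. t < 0 \<Longrightarrow> w t = 0" for w
  proof -
    have "(\<integral>\<^sup>+z. f z \<partial>spacetime w m) = (\<integral>\<^sup>+t. ennreal (w t) * (\<integral>\<^sup>+x. f (t, x) \<partial>meas (m t)) \<partial>lborel)"
      by (rule nn_integral_spacetime[OF m that f])
    also have "\<dots> = (\<integral>\<^sup>+t. ennreal (w t) * g t \<partial>lborel)"
    proof (rule nn_integral_cong)
      fix t show "ennreal (w t) * (\<integral>\<^sup>+x. f (t, x) \<partial>meas (m t)) = ennreal (w t) * g t"
        using that(3)[of t] by (cases "t < 0") (auto simp: g_def max_def)
    qed
    finally show ?thesis .
  qed
  have "(\<integral>\<^sup>+z. f z \<partial>Sp \<delta> m) = (\<integral>\<^sup>+t. ennreal (disc \<delta> t) * g t \<partial>lborel)" by (rule e) auto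
  also have "\<dots> = (\<integral>\<^sup>+t. ennreal (disc_until \<delta> \<tau> t) * g t + ennreal (exp (- \<delta> * \<tau>) * disc \<delta> (t - \<tau>)) * g t \<partial>lborel)"
    by (rule nn_integral_cong) (subst disc_split[OF \<tau>], simp add: distrib_right ennreal_plus)
  also have "\<dots> = (\<integral>\<^sup>+t. ennreal (disc_until \<delta> \<tau> t) * g t \<partial>lborel)
      + (\<integral>\<^sup>+t. ennreal (exp (- \<delta> * \<tau>) * disc \<delta> (t - \<tau>)) * g t \<partial>lborel)"
    by (rule nn_integral_add) auto
  also have "(\<integral>\<^sup>+t. ennreal (disc_until \<delta> \<tau> t) * g t \<partial>lborel) = (\<integral>\<^sup>+z. f z \<partial>spacetime (disc_until \<delta> \<tau>) m)"
    by (rule e[symmetric]) auto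
  also have "(\<integral>\<^sup>+t. ennreal (exp (- \<delta> * \<tau>) * disc \<delta> (t - \<tau>)) * g t \<partial>lborel)
      = (\<integral>\<^sup>+t. ennreal (exp (- \<delta> * \<tau>)) * (ennreal (disc \<delta> t) * g (t + \<tau>)) \<partial>lborel)"
    by (subst nn_integral_real_affine[where c=1 and t=\<tau>]) (auto simp: ennreal_mult mult.assoc add.commute)
  also have "\<dots> = ennreal (exp (- \<delta> * \<tau>)) * (\<integral>\<^sup>+t. ennreal (disc \<delta> t) * g (t + \<tau>) \<partial>lborel)"
    by (rule nn_integral_cmult) auto
  also have "(\<integral>\<^sup>+t. ennreal (disc \<delta> t) * g (t + \<tau>) \<partial>lborel) = (\<integral>\<^sup>+z. f (shift \<tau> z) \<partial>Sp \<delta> (\<lambda>t. m (t + \<tau>)))"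
  proof -
    have "(\<integral>\<^sup>+z. f (shift \<tau> z) \<partial>Sp \<delta> (\<lambda>t. m (t + \<tau>)))
        = (\<integral>\<^sup>+t. ennreal (disc \<delta> t) * (\<integral>\<^sup>+x. f (shift \<tau> (t, x)) \<partial>meas (m (t + \<tau>))) \<partial>lborel)"
      by (rule nn_integral_spacetime[OF m' _ _ _ fs]) auto
    also have "\<dots> = (\<integral>\<^sup>+t. ennreal (disc \<delta> t) * g (t + \<tau>) \<partial>lborel)"
    proof (rule nn_integral_cong)
      fix t show "ennreal (disc \<delta> t) * (\<integral>\<^sup>+x. f (shift \<tau> (t, x)) \<partial>meas (m (t + \<tau>))) = ennreal (disc \<delta> t) * g (t + \<tau>)"
        using \<tau> by (cases "t < 0") (auto simp: g_def max_def)
    qed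
    finally show ?thesis by simp
  qed
  finally show ?thesis .
qed

lemma
  fixes m :: "real \<Rightarrow> 'n::finite tprob" and f :: "real \<times> 'n torus \<Rightarrow> real"
  assumes m: "continuous_on {0..} m" and \<tau>: "0 \<le> \<tau>" and \<delta>: "0 < \<delta>" and f: "f \<in> borel_measurable borel"
  shows integrable_Sp_split: "integrable (Sp \<delta> m) f \<longleftrightarrow>
      integrable (spacetime (disc_until \<delta> \<tau>) m) f \<and> integrable (Sp \<delta> (\<lambda>t. m (t + \<tau>))) (\<lambda>z. f (shift \<tau> z))" (is ?A)
    and integral_Sp_split: "integrable (Sp \<delta> m) f \<Longrightarrow> (\<integral>z. f z \<partial>Sp \<delta> m) =
      (\<integral>z. f z \<partial>spacetime (disc_until \<delta> \<tau>) m) + exp (- \<delta> * \<tau>) * (\<integral>z. f (shift \<tau> z) \<partial>Sp \<delta> (\<lambda>t. m (t + \<tau>)))"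
proof -
  have m': "continuous_on {0..} (\<lambda>t. m (t + \<tau>))"
    by (rule continuous_on_compose2[OF m]) (use \<tau> in \<open>auto intro!: continuous_intros\<close>)
  have fs: "(\<lambda>z. f (shift \<tau> z)) \<in> borel_measurable borel"
    by (rule measurable_compose[OF measurable_shift f])
  note msr = measurable_cong_sets[OF Sp_facts(1)[OF m \<delta>] refl] measurable_cong_sets[OF Sp_facts(1)[OF m' \<delta>] refl]
    measurable_cong_sets[OF Sp_until_facts(1)[OF m \<delta>] refl]
  have c: "0 < ennreal (exp (- \<delta> * \<tau>))" "ennreal (exp (- \<delta> * \<tau>)) < top" by auto
  have nn: "(\<integral>\<^sup>+z. ennreal (g (f z)) \<partial>Sp \<delta> m) = (\<integral>\<^sup>+z. ennreal (g (f z)) \<partial>spacetime (disc_until \<delta> \<tau>) m)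
    + ennreal (exp (- \<delta> * \<tau>)) * (\<integral>\<^sup>+z. ennreal (g (f (shift \<tau> z))) \<partial>Sp \<delta> (\<lambda>t. m (t + \<tau>)))"
    if [measurable]: "g \<in> borel_measurable borel" for g :: "real \<Rightarrow> real"
  proof -
    have "(\<lambda>z. ennreal (g (f z))) \<in> borel_measurable borel" using f by measurable
    from nn_integral_Sp_split[OF m \<tau> this] show ?thesis .
  qed
  show iff: ?A
    unfolding integrable_iff_bounded msr using f fs nn[of "\<lambda>x. \<bar>x\<bar>"] c
    by (auto simp: ennreal_mult_less_top)
  assume i: "integrable (Sp \<delta> m) f"
  then have i1: "integrable (spacetime (disc_until \<delta> \<tau>) m) f"
    and i2: "integrable (Sp \<delta> (\<lambda>t. m (t + \<tau>))) (\<lambda>z. f (shift \<tau> z))" using iff by auto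
  note r1 = i1[unfolded real_integrable_def] and r2 = i2[unfolded real_integrable_def]
  have enn: "enn2real (a + ennreal k * b) = enn2real a + k * enn2real b" if "a \<noteq> top" "b \<noteq> top" "0 \<le> k" for a b k
    using that by (simp add: enn2real_plus enn2real_mult ennreal_mult_less_top top.not_eq_extremum)
  show "(\<integral>z. f z \<partial>Sp \<delta> m) =
      (\<integral>z. f z \<partial>spacetime (disc_until \<delta> \<tau>) m) + exp (- \<delta> * \<tau>) * (\<integral>z. f (shift \<tau> z) \<partial>Sp \<delta> (\<lambda>t. m (t + \<tau>)))"
    unfolding real_lebesgue_integral_def[OF i] real_lebesgue_integral_def[OF i1] real_lebesgue_integral_def[OF i2]
      nn[of "\<lambda>x. x", simplified] nn[of "\<lambda>x. - x", simplified]
    using r1 r2 by (simp add: enn algebra_simps)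
qed

lemma AE_spacetime_time:
  fixes m :: "real \<Rightarrow> 'n::finite tprob"
  assumes m: "continuous_on {0..} m" and w: "w \<in> borel_measurable borel" "\<And>t. 0 \<le> w t" "\<And>t. t < 0 \<Longrightarrow> w t = 0"
    and P: "Measurable.pred borel P" "\<And>t. w t \<noteq> 0 \<Longrightarrow> P t"
  shows "AE z in spacetime w m. P (fst z)"
proof -
  let ?f = "\<lambda>z :: real \<times> 'n torus. indicator {t. \<not> P t} (fst z) :: ennreal"
  have s: "{t. \<not> P t} \<in> sets borel" using P(1) by measurable
  have f: "?f \<in> borel_measurable borel"
    by (rule measurable_compose[OF borel_fst borel_measurable_indicator[OF s]])
  have "(\<integral>\<^sup>+z. ?f z \<partial>spacetime w m) = (\<integral>\<^sup>+t. ennreal (w t) * (\<integral>\<^sup>+x. ?f (t, x) \<partial>meas (m t)) \<partial>lborel)"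
    by (rule nn_integral_spacetime[OF m w f])
  also have "\<dots> = (\<integral>\<^sup>+t. 0 \<partial>(lborel :: real measure))"
  proof (rule nn_integral_cong)
    fix t show "ennreal (w t) * (\<integral>\<^sup>+x. ?f (t, x) \<partial>meas (m t)) = 0"
      using P(2)[of t] by (cases "w t = 0") (auto simp: indicator_def)
  qed
  finally have "(\<integral>\<^sup>+z. ?f z \<partial>spacetime w m) = 0" by simp
  then have "AE z in spacetime w m. ?f z = 0"
    using f measurable_cong_sets[OF sets_spacetime[OF m w] refl] by (subst (asm) nn_integral_0_iff_AE) auto
  then show ?thesis by eventually_elim (auto simp: indicator_def split: if_splits)
qed

text \<open>This exhibits a space-time measure as the law of time and position, the form in which a random drift
  can be conditioned.\<close>

lemma distr_time_position:
  fixes m :: "real \<Rightarrow> 'n::finite tprob" and Y :: "real \<Rightarrow> 'w \<Rightarrow> 'n torus"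
  assumes m: "continuous_on {0..} m" and w [measurable]: "w \<in> borel_measurable borel" and w0: "\<And>t. 0 \<le> w t" "\<And>t. t < 0 \<Longrightarrow> w t = 0"
    and Q: "prob_space Q" and Y [measurable]: "(\<lambda>(t, \<omega>). Y t \<omega>) \<in> borel_measurable (borel \<Otimes>\<^sub>M Q)"
    and law: "\<And>t. w t \<noteq> 0 \<Longrightarrow> m t = law Q (Y t)"
  shows "distr (density lborel (\<lambda>t. ennreal (w t)) \<Otimes>\<^sub>M Q) borel (\<lambda>p. (fst p, Y (fst p) (snd p))) = spacetime w m"
proof (rule measure_eqI)
  let ?W = "density lborel (\<lambda>t. ennreal (w t)) \<Otimes>\<^sub>M Q"
  interpret prob_space Q by (rule Q)
  show "sets (distr ?W borel (\<lambda>p. (fst p, Y (fst p) (snd p)))) = sets (spacetime w m)"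
    using sets_spacetime[OF m w w0] by simp
  have Yt: "Y t \<in> borel_measurable Q" for t
    using measurable_compose[OF measurable_Pair1'[of t borel Q] Y] by simp
  have X: "(\<lambda>p. (fst p, Y (fst p) (snd p))) \<in> density lborel (\<lambda>t. ennreal (w t)) \<Otimes>\<^sub>M Q \<rightarrow>\<^sub>M borel"
    by (subst borel_prod[symmetric]) (use Y in \<open>auto simp: case_prod_beta'\<close>)
  fix A assume "A \<in> sets (distr ?W borel (\<lambda>p. (fst p, Y (fst p) (snd p))))"
  then have A: "A \<in> sets borel" by simp
  then have iA: "indicator A \<in> borel_measurable (borel :: (real \<times> 'n torus) measure)" by simp
  have As: "(\<lambda>x. indicator A (t, x) :: ennreal) \<in> borel_measurable borel" for t
    using measurable_compose[OF measurable_Pair_torus[OF m w w0] iA] by simp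
  have "emeasure (distr ?W borel (\<lambda>p. (fst p, Y (fst p) (snd p)))) A
      = (\<integral>\<^sup>+p. indicator A (fst p, Y (fst p) (snd p)) \<partial>?W)"
    using A nn_integral_distr[OF X, of "indicator A"] by simp
  also have "\<dots> = (\<integral>\<^sup>+t. \<integral>\<^sup>+\<omega>. indicator A (t, Y t \<omega>) \<partial>Q \<partial>density lborel (\<lambda>t. ennreal (w t)))"
    using nn_integral_fst[OF measurable_compose[OF X iA], symmetric] by simp
  also have "\<dots> = (\<integral>\<^sup>+t. ennreal (w t) * (\<integral>\<^sup>+\<omega>. indicator A (t, Y t \<omega>) \<partial>Q) \<partial>lborel)"
    using borel_measurable_nn_integral_fst[OF measurable_compose[OF X iA]]
    by (subst nn_integral_density) auto
  also have "\<dots> = (\<integral>\<^sup>+t. ennreal (w t) * (\<integral>\<^sup>+x. indicator A (t, x) \<partial>meas (m t)) \<partial>lborel)"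
  proof (rule nn_integral_cong)
    fix t show "ennreal (w t) * (\<integral>\<^sup>+\<omega>. indicator A (t, Y t \<omega>) \<partial>Q) = ennreal (w t) * (\<integral>\<^sup>+x. indicator A (t, x) \<partial>meas (m t))"
      using law[of t] As[of t] by (cases "w t = 0") (auto simp: meas_law[OF Q Yt] nn_integral_distr[OF Yt])
  qed
  also have "\<dots> = (\<integral>\<^sup>+z. indicator A z \<partial>spacetime w m)"
    by (rule nn_integral_spacetime[OF m w w0 iA, symmetric])
  also have "\<dots> = emeasure (spacetime w m) A"
    using A sets_spacetime[OF m w w0] by simp
  finally show "emeasure (distr ?W borel (\<lambda>p. (fst p, Y (fst p) (snd p)))) A
    = emeasure (spacetime w m) A" .
qed

text \<open>The weights of a shifted test function differ by the factor that discounts later costs.\<close>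

lemma heat_flux_shift:
  assumes "0 \<le> fst z" "0 \<le> \<tau>"
  shows "heat_part \<delta> \<phi> (shift \<tau> z) = exp (\<delta> * \<tau>) * heat_part \<delta> (\<lambda>t. \<phi> (t + \<tau>)) z"
    and "flux_part \<delta> \<phi> (shift \<tau> z) = exp (\<delta> * \<tau>) *\<^sub>R flux_part \<delta> (\<lambda>t. \<phi> (t + \<tau>)) z"
proof -
  have "time_deriv (\<lambda>t. \<phi> (t + \<tau>)) t x = time_deriv \<phi> (t + \<tau>) x" for t x
    unfolding time_deriv_def deriv_def
    using DERIV_shift[of "\<lambda>s. \<phi> s x" _ t \<tau>] by (simp add: add.commute)
  then show "heat_part \<delta> \<phi> (shift \<tau> z) = exp (\<delta> * \<tau>) * heat_part \<delta> (\<lambda>t. \<phi> (t + \<tau>)) z"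
    using assms by (simp add: heat_part_def exp_add distrib_left mult_ac)
  show "flux_part \<delta> \<phi> (shift \<tau> z) = exp (\<delta> * \<tau>) *\<^sub>R flux_part \<delta> (\<lambda>t. \<phi> (t + \<tau>)) z"
    using assms by (simp add: flux_part_def exp_add distrib_left mult_ac)
qed

lemma test_function_shift:
  assumes "test_function \<phi>" shows "test_function (\<lambda>t. \<phi> (t + \<tau>))"
  using test_function_translate(1)[OF assms, of \<tau> 0] by (simp add: tproj_zero)

section \<open>Heat flow and steering\<close>

context drifted_particle
begin

lemma time_pos_measurable:
  assumes N: "sets N = sets borel"
  shows "(\<lambda>p. (fst p, pos (fst p) (snd p))) \<in> borel_measurable (N \<Otimes>\<^sub>M Q)"
proof -
  have "(\<lambda>p. pos (fst p) (snd p)) \<in> borel_measurable (N \<Otimes>\<^sub>M Q)"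
    using pos_joint_measurable
    unfolding case_prod_beta' measurable_cong_sets[OF sets_pair_measure_cong[OF N refl] refl] .
  moreover have "fst \<in> N \<Otimes>\<^sub>M Q \<rightarrow>\<^sub>M borel"
    using measurable_fst[of N Q] measurable_cong_sets[OF refl N] by blast
  ultimately have "(\<lambda>p. (fst p, pos (fst p) (snd p))) \<in> N \<Otimes>\<^sub>M Q \<rightarrow>\<^sub>M borel \<Otimes>\<^sub>M borel"
    by (intro measurable_Pair)
  then show ?thesis by (simp only: borel_prod)
qed

lemma path_0: "path 0 = law P x1"
  unfolding path_def
proof (rule law_eqI[OF PG.prob_space_axioms pos_measurable])
  have "distr Q borel (pos 0) = distr Q borel (\<lambda>\<omega>. x1 (fst \<omega>))"
    by (rule distr_cong) (auto simp: pos_def tproj_zero)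
  also have "\<dots> = distr (distr Q P fst) borel x1"
    by (subst distr_distr) (auto simp: o_def)
  also have "distr Q P fst = P" by (rule G.distr_pair_fst)
  finally show "distr Q borel (pos 0) = meas (law P x1)"
    by (simp add: meas_law[OF P.prob_space_axioms x1])
qed

lemma integral_path:
  assumes "test_function \<phi>"
  shows "(\<integral>x. \<phi> t x \<partial>meas (path t)) = (\<integral>\<omega>. \<phi> t (pos t \<omega>) \<partial>Q)"
proof -
  have "(\<lambda>x. \<phi> t x) \<in> borel_measurable borel"
    using measurable_compose[OF measurable_Pair_torus[of "\<lambda>_. path 0" "\<lambda>_. 0" t] test_function_measurable[OF assms]]
    by simp
  then show ?thesis unfolding path_def by (rule integral_law[OF PG.prob_space_axioms pos_measurable])
qed

text \<open>The diffusion is built with velocity \<open>v\<close>, which is the drift \<open>- v\<close> in the sign convention of the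
  Fokker-Planck equation.\<close>

lemma ito_discounted:
  assumes \<phi>: "test_function \<phi>" and \<tau>: "0 \<le> \<tau>" and \<delta>: "0 < \<delta>"
  defines "M \<equiv> density lborel (\<lambda>t. ennreal (disc_until \<delta> \<tau> t)) \<Otimes>\<^sub>M Q"
  shows "(\<integral>p. heat_part \<delta> \<phi> (fst p, pos (fst p) (snd p)) \<partial>M)
      + (\<integral>p. v (fst (snd p)) \<bullet> flux_part \<delta> \<phi> (fst p, pos (fst p) (snd p)) \<partial>M)
    = (\<integral>x. \<phi> \<tau> x \<partial>meas (path \<tau>)) - (\<integral>x. \<phi> 0 x \<partial>meas (path 0))"
proof -
  let ?D = "density lborel (\<lambda>t. ennreal (disc_until \<delta> \<tau> t))"
  let ?X = "\<lambda>p. (fst p, pos (fst p) (snd p))"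
  have fD: "finite_measure ?D"
    using integrable_disc_until[OF \<delta>, of \<tau>]
    by (intro finite_measureI) (simp add: emeasure_density integrable_iff_bounded less_top[symmetric])
  interpret D: finite_measure ?D by (rule fD)
  interpret DQ: pair_sigma_finite ?D Q
    by (intro pair_sigma_finite.intro D.sigma_finite_measure_axioms PG.sigma_finite_measure_axioms)
  have fM: "finite_measure M"
    unfolding M_def by (rule finite_measure_pair_measure[OF PG.finite_measure_axioms fD])
  interpret M: finite_measure M by (rule fM)
  have X: "?X \<in> borel_measurable M"
    unfolding M_def by (rule time_pos_measurable) simp
  obtain C1 where C1: "\<And>z. \<bar>heat_part \<delta> \<phi> z\<bar> \<le> C1" using bounded_heat_part[OF \<phi>] by blast
  obtain C2 where C2: "\<And>z. norm (flux_part \<delta> \<phi> z) \<le> C2" using bounded_flux_part[OF \<phi>] by blast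
  have m1: "(\<lambda>p. heat_part \<delta> \<phi> (?X p)) \<in> borel_measurable M"
    by (rule measurable_compose[OF X measurable_heat_part[OF \<phi>]])
  have m2: "(\<lambda>p. flux_part \<delta> \<phi> (?X p)) \<in> borel_measurable M"
    by (rule measurable_compose[OF X measurable_flux_part[OF \<phi>]])
  have vm [measurable]: "(\<lambda>p. v (fst (snd p))) \<in> borel_measurable M" unfolding M_def by measurable
  have i1: "integrable M (\<lambda>p. heat_part \<delta> \<phi> (?X p))"
    by (rule M.integrable_const_bound[where B=C1]) (use C1 m1 in auto)
  have i2: "integrable M (\<lambda>p. v (fst (snd p)) \<bullet> flux_part \<delta> \<phi> (?X p))"
  proof (rule M.integrable_const_bound[where B="V * C2"])
    show "AE p in M. norm (v (fst (snd p)) \<bullet> flux_part \<delta> \<phi> (?X p)) \<le> V * C2"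
      using V C2 V_nonneg by (auto intro!: AE_I2 order_trans[OF Cauchy_Schwarz_ineq2] mult_mono)
  qed (use m2 in measurable)
  let ?f = "\<lambda>p. heat_part \<delta> \<phi> (?X p) + v (fst (snd p)) \<bullet> flux_part \<delta> \<phi> (?X p)"
  have i: "integrable (?D \<Otimes>\<^sub>M Q) ?f" using i1 i2 unfolding M_def by simp
  let ?L = "\<lambda>t. \<integral>\<omega>. time_deriv \<phi> t (pos t \<omega>) + tlap (\<phi> t) (pos t \<omega>) + v (fst \<omega>) \<bullet> tgrad (\<phi> t) (pos t \<omega>) \<partial>Q"
  have "(\<integral>p. heat_part \<delta> \<phi> (?X p) \<partial>M) + (\<integral>p. v (fst (snd p)) \<bullet> flux_part \<delta> \<phi> (?X p) \<partial>M) = (\<integral>p. ?f p \<partial>M)"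
    using i1 i2 by simp
  also have "\<dots> = (\<integral>t. \<integral>\<omega>. ?f (t, \<omega>) \<partial>Q \<partial>?D)"
    unfolding M_def using DQ.integral_fst'[OF i] by simp
  also have "\<dots> = (\<integral>t. disc_until \<delta> \<tau> t * (\<integral>\<omega>. ?f (t, \<omega>) \<partial>Q) \<partial>lborel)"
    using PG.borel_measurable_lebesgue_integral[of "\<lambda>t \<omega>. ?f (t, \<omega>)" ?D] borel_measurable_integrable[OF i]
    by (subst integral_density) auto
  also have "\<dots> = (LINT t:{0..\<tau>}|lborel. ?L t)"
    unfolding set_lebesgue_integral_def
  proof (rule integral_cong_AE)
    show "AE t in lborel. disc_until \<delta> \<tau> t * (\<integral>\<omega>. ?f (t, \<omega>) \<partial>Q) = indicator {0..\<tau>} t *\<^sub>R ?L t"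
      using AE_lborel_singleton[of \<tau>]
    proof eventually_elim
      case (elim t)
      show ?case
      proof (cases "0 \<le> t \<and> t < \<tau>")
        case True
        have "(\<integral>\<omega>. ?f (t, \<omega>) \<partial>Q) = (\<integral>\<omega>. exp (\<delta> * t) * (time_deriv \<phi> t (pos t \<omega>) + tlap (\<phi> t) (pos t \<omega>)
            + v (fst \<omega>) \<bullet> tgrad (\<phi> t) (pos t \<omega>)) \<partial>Q)"
          using True by (simp add: heat_part_def flux_part_def algebra_simps)
        also have "\<dots> = exp (\<delta> * t) * ?L t" by (rule integral_mult_right_zero)
        finally show ?thesis using True by (simp add: disc_until_def disc_def exp_minus field_simps)
      qed (use elim in \<open>auto simp: disc_until_def disc_def indicator_def\<close>)
    qed
    show "(\<lambda>t. disc_until \<delta> \<tau> t * (\<integral>\<omega>. ?f (t, \<omega>) \<partial>Q)) \<in> borel_measurable lborel"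
      using PG.borel_measurable_lebesgue_integral[of "\<lambda>t \<omega>. ?f (t, \<omega>)" ?D] borel_measurable_integrable[OF i]
      by auto
    have "?L \<in> borel_measurable borel"
    proof (rule PG.borel_measurable_lebesgue_integral)
      have Z: "(\<lambda>p. (fst p, pos (fst p) (snd p))) \<in> borel_measurable (borel \<Otimes>\<^sub>M Q)"
        by (rule time_pos_measurable) simp
      note [measurable] = measurable_compose[OF Z test_function_measurable[OF test_function_time_deriv[OF \<phi>]], simplified]
        measurable_compose[OF Z measurable_tlap[OF \<phi>], simplified] measurable_compose[OF Z measurable_tgrad[OF \<phi>], simplified]
      show "(\<lambda>(t, \<omega>). time_deriv \<phi> t (pos t \<omega>) + tlap (\<phi> t) (pos t \<omega>) + v (fst \<omega>) \<bullet> tgrad (\<phi> t) (pos t \<omega>))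
          \<in> borel_measurable (borel \<Otimes>\<^sub>M Q)"
        unfolding case_prod_beta' by measurable
    qed
    then show "(\<lambda>t. indicator {0..\<tau>} t *\<^sub>R ?L t) \<in> borel_measurable lborel" by measurable
  qed
  also have "\<dots> = (\<integral>\<omega>. \<phi> \<tau> (pos \<tau> \<omega>) \<partial>Q) - (\<integral>\<omega>. \<phi> 0 (pos 0 \<omega>) \<partial>Q)"
    by (rule ito[OF \<phi> \<tau>, symmetric])
  finally show ?thesis by (simp add: integral_path[OF \<phi>])
qed

end

text \<open>Without drift the particle realises the heat flow, an admissible competitor.\<close>

lemma heat_flow_admissible:
  fixes \<mu> :: "'n::finite tprob"
  assumes \<delta>: "0 < \<delta>"
  shows "\<exists>m. spacetime_admissible \<delta> m (\<lambda>_. 0) \<and> m 0 = \<mu>"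
proof -
  interpret D: drifted_particle "meas \<mu>" "\<lambda>x. x" "\<lambda>_. 0" 0
    by (intro drifted_particle.intro drifted_particle_axioms.intro prob_space_meas)
       (auto simp: measurable_cong_sets[OF sets_meas refl])
  have 0: "D.path 0 = \<mu>"
    unfolding D.path_0
    by (rule law_eqI[OF prob_space_meas])
       (auto simp: measurable_cong_sets[OF sets_meas refl] intro!: distr_id2 simp: sets_meas)
  note m = D.continuous_path[of "{0..}"]
  have "spacetime_admissible \<delta> D.path (\<lambda>_. 0)"
    unfolding spacetime_admissible_def
  proof (intro conjI allI impI)
    fix \<phi> :: "real \<Rightarrow> 'n torus \<Rightarrow> real" assume \<phi>: "test_function \<phi>"
    obtain T where T: "\<And>t x. t \<ge> T \<Longrightarrow> \<phi> t x = 0" using \<phi> test_function_lift by blast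
    define \<tau> where "\<tau> = max T 0 + 1"
    have \<tau>: "0 \<le> \<tau>" "\<And>t x. t \<ge> \<tau> - 1 \<Longrightarrow> \<phi> t x = 0" using T by (auto simp: \<tau>_def)
    let ?M = "density lborel (\<lambda>t. ennreal (disc_until \<delta> \<tau> t)) \<Otimes>\<^sub>M D.Q"
    let ?X = "\<lambda>p. (fst p, D.pos (fst p) (snd p))"
    have X: "?X \<in> borel_measurable ?M"
      by (rule D.time_pos_measurable) simp
    obtain C1 where C1: "\<And>z. \<bar>heat_part \<delta> \<phi> z\<bar> \<le> C1" using bounded_heat_part[OF \<phi>] by blast
    have i: "integrable (Sp \<delta> D.path) (heat_part \<delta> \<phi>)"
      by (rule integrable_Sp_bounded[OF m \<delta> measurable_heat_part[OF \<phi>] C1])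
    have z: "heat_part \<delta> (\<lambda>t. \<phi> (t + \<tau>)) z = 0" if "0 \<le> fst z" for z
    proof -
      have 1: "tlap (\<phi> (fst z + \<tau>)) (snd z) = 0"
        using \<tau>(2)[of "fst z + \<tau>"] that by (simp add: tlap_def tpd_def)
      have "eventually (\<lambda>s. -1 < s) (nhds (fst z))"
        using that by (intro eventually_nhds_in_open[of "{-1<..}", simplified]) auto
      then have "eventually (\<lambda>s. \<phi> (s + \<tau>) (snd z) = 0) (nhds (fst z))"
        by eventually_elim (simp add: \<tau>)
      then have "deriv (\<lambda>s. \<phi> (s + \<tau>) (snd z)) (fst z) = deriv (\<lambda>s. 0) (fst z)"
        by (intro deriv_cong_ev) auto
      then have "time_deriv (\<lambda>t. \<phi> (t + \<tau>)) (fst z) (snd z) = 0" by (simp add: time_deriv_def)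
      then show ?thesis using 1 by (simp add: heat_part_def)
    qed
    have "(\<integral>z. heat_part \<delta> \<phi> (shift \<tau> z) \<partial>Sp \<delta> (\<lambda>t. D.path (t + \<tau>))) = (\<integral>z. 0 \<partial>Sp \<delta> (\<lambda>t. D.path (t + \<tau>)))"
    proof (rule integral_cong_AE)
      have m': "continuous_on {0..} (\<lambda>t. D.path (t + \<tau>))"
        by (rule continuous_on_compose2[OF D.continuous_path[of UNIV]]) (auto intro!: continuous_intros)
      show "(\<lambda>z. heat_part \<delta> \<phi> (shift \<tau> z)) \<in> borel_measurable (Sp \<delta> (\<lambda>t. D.path (t + \<tau>)))"
        unfolding measurable_cong_sets[OF Sp_facts(1)[OF m' \<delta>] refl]
        by (rule measurable_compose[OF measurable_shift measurable_heat_part[OF \<phi>]])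
      have "AE z in Sp \<delta> (\<lambda>t. D.path (t + \<tau>)). 0 \<le> fst z"
        by (rule AE_spacetime_time[OF m']) (auto simp: disc_def split: if_splits)
      then show "AE z in Sp \<delta> (\<lambda>t. D.path (t + \<tau>)). heat_part \<delta> \<phi> (shift \<tau> z) = 0"
        by eventually_elim (simp add: heat_flux_shift \<tau> z)
    qed simp
    then have "(\<integral>z. heat_part \<delta> \<phi> z \<partial>Sp \<delta> D.path) = (\<integral>z. heat_part \<delta> \<phi> z \<partial>spacetime (disc_until \<delta> \<tau>) D.path)"
      unfolding integral_Sp_split[OF m \<tau>(1) \<delta> measurable_heat_part[OF \<phi>] i] by simp
    also have "spacetime (disc_until \<delta> \<tau>) D.path = distr ?M borel ?X"
      by (rule distr_time_position[OF m measurable_disc_until disc_until_simps D.PG.prob_space_axioms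
            D.pos_joint_measurable, symmetric]) (assumption, rule D.path_def)
    also have "(\<integral>z. heat_part \<delta> \<phi> z \<partial>distr ?M borel ?X) = (\<integral>p. heat_part \<delta> \<phi> (?X p) \<partial>?M)"
      by (rule integral_distr[OF X measurable_heat_part[OF \<phi>]])
    also have "\<dots> = - (\<integral>x. \<phi> 0 x \<partial>meas (D.path 0))"
      using D.ito_discounted[OF \<phi> \<tau>(1) \<delta>] \<tau>(2)[of \<tau>] by simp
    finally show "(\<integral>x. \<phi> 0 x \<partial>meas (D.path 0)) + (\<integral>z. heat_part \<delta> \<phi> z \<partial>Sp \<delta> D.path)
        - (\<integral>z. 0 \<bullet> flux_part \<delta> \<phi> z \<partial>Sp \<delta> D.path) = 0" by simp
  qed (use m in auto)
  then show ?thesis using 0 by blast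
qed

context control_problem
begin

text \<open>Before time \<open>\<tau>\<close> the particle moves with constant velocity, which brings its law to the initial
  law of a given admissible pair; from then on that pair is followed.\<close>

lemma steering:
  assumes D: "drifted_particle P x1 v V" and \<delta>: "0 < \<delta>" and \<tau>: "0 < \<tau>"
    and b: "spacetime_admissible \<delta> m2 b" and m20: "m2 0 = drifted_particle.path P x1 v \<tau>"
  obtains m a where "spacetime_admissible \<delta> m a" "m 0 = law P x1"
    "J \<delta> m a \<le> K * \<tau> * (2 + (\<integral>\<omega>. (norm (v \<omega>))\<^sup>2 \<partial>P))
      + exp (- \<delta> * \<tau>) * J \<delta> m2 b"
proof -
  let ?v2 = "\<integral>\<omega>. (norm (v \<omega>))\<^sup>2 \<partial>P"
  interpret D: drifted_particle P x1 v V by (rule D)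
  note m2 = spacetime_admissibleD(1)[OF b] and bm [measurable] = spacetime_admissibleD(2)[OF b] and b2 = spacetime_admissibleD(3)[OF b]
    and bFP = spacetime_admissibleD(4)[OF b]
  define m where "m t = (if t \<le> \<tau> then D.path t else m2 (t - \<tau>))" for t
  have m: "continuous_on {0..} m"
  proof -
    have "continuous_on ({0..\<tau>} \<union> {\<tau>..}) m"
      unfolding m_def
    proof (rule continuous_on_cases)
      show "continuous_on {\<tau>..} (\<lambda>t. m2 (t - \<tau>))"
        by (rule continuous_on_compose2[OF m2]) (auto intro!: continuous_intros)
    qed (use m20 D.continuous_path in auto)
    moreover have "{0..\<tau>} \<union> {\<tau>..} = {0..}" using \<tau> by auto
    ultimately show ?thesis by simp
  qed
  have m0: "m 0 = law P x1" using \<tau> by (simp add: m_def D.path_0)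
  have mshift: "Sp \<delta> (\<lambda>t. m (t + \<tau>)) = Sp \<delta> m2"
  proof -
    have "m (max 0 t + \<tau>) = m2 (max 0 t)" for t using m20 by (auto simp: m_def max_def)
    then show ?thesis unfolding spacetime_def by simp
  qed
  let ?D = "density lborel (\<lambda>t. ennreal (disc_until \<delta> \<tau> t))"
  let ?M = "?D \<Otimes>\<^sub>M D.Q"
  let ?X = "\<lambda>p. (fst p, D.pos (fst p) (snd p))"
  let ?B = "\<lambda>p. - v (fst (snd p))"
  let ?S1 = "spacetime (disc_until \<delta> \<tau>) m"
  have fD: "finite_measure ?D"
    using integrable_disc_until[OF \<delta>, of \<tau>]
    by (intro finite_measureI) (simp add: emeasure_density integrable_iff_bounded less_top[symmetric])
  have fM: "finite_measure ?M"
    by (rule finite_measure_pair_measure[OF D.PG.finite_measure_axioms fD])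
  interpret M: finite_measure ?M by (rule fM)
  have X: "?X \<in> borel_measurable ?M"
    by (rule D.time_pos_measurable) simp
  have Bm [measurable]: "?B \<in> borel_measurable ?M" by measurable
  have V2: "(norm (v \<omega>))\<^sup>2 \<le> V\<^sup>2" for \<omega> using D.V by (intro power_mono) auto
  have B2: "integrable ?M (\<lambda>p. (norm (?B p))\<^sup>2)"
    by (rule M.integrable_const_bound[where B="V\<^sup>2"]) (use V2 in auto)
  have dS1: "distr ?M borel ?X = ?S1"
    by (rule distr_time_position[OF m measurable_disc_until disc_until_simps D.PG.prob_space_axioms
          D.pos_joint_measurable])
       (auto simp: m_def disc_until_def indicator_def split: if_splits intro!: D.path_def)
  obtain \<beta> where \<beta>m [measurable]: "\<beta> \<in> borel_measurable borel" and \<beta>2: "integrable ?S1 (\<lambda>z. (norm (\<beta> z))\<^sup>2)"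
    and \<beta>L: "(\<integral>z. L (snd z) (\<beta> z) \<partial>?S1) \<le> (\<integral>p. L (snd (?X p)) (?B p) \<partial>?M)"
    and \<beta>lin: "\<And>g C. g \<in> borel_measurable borel \<Longrightarrow> (\<And>z. norm (g z) \<le> C) \<Longrightarrow>
      (\<integral>z. \<beta> z \<bullet> g z \<partial>?S1) = (\<integral>p. ?B p \<bullet> g (?X p) \<partial>?M)"
    using feedback_of_random_drift[OF fM X Bm B2] unfolding dS1 by blast
  \<comment> \<open>Conditioned drift of the particle up to time \<open>\<tau>\<close>, the given control afterwards.\<close>
  define a where "a z = (if fst z < \<tau> then \<beta> z else b (fst z - \<tau>, snd z))" for z :: "real \<times> 'n torus"
  have bshift [measurable]: "(\<lambda>z. b (fst z - \<tau>, snd z)) \<in> borel_measurable borel"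
    using measurable_compose[OF measurable_shift[of "- \<tau>"] bm] by simp
  have am [measurable]: "a \<in> borel_measurable borel" unfolding a_def by measurable
  have ae1: "AE z in ?S1. a z = \<beta> z"
  proof -
    have "AE z in ?S1. fst z < \<tau>"
      by (rule AE_spacetime_time[OF m]) (auto simp: disc_until_def indicator_def split: if_splits)
    then show ?thesis by eventually_elim (simp add: a_def)
  qed
  have ae2: "AE z in Sp \<delta> m2. 0 \<le> fst z"
    by (rule AE_spacetime_time[OF m2]) (auto simp: disc_def split: if_splits)
  have as: "a (shift \<tau> z) = b z" if "0 \<le> fst z" for z using that by (simp add: a_def)
  note ms1 = measurable_cong_sets[OF Sp_until_facts(1)[OF m \<delta>] refl]
  note ms2 = measurable_cong_sets[OF Sp_facts(1)[OF m2 \<delta>] refl]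
  have s1: "(\<integral>z. G (a z) z \<partial>?S1) = (\<integral>z. G (\<beta> z) z \<partial>?S1)"
    "integrable ?S1 (\<lambda>z. G (a z) z) = integrable ?S1 (\<lambda>z. G (\<beta> z) z)"
    if "(\<lambda>z. G (a z) z) \<in> borel_measurable borel" "(\<lambda>z. G (\<beta> z) z) \<in> borel_measurable borel"
    for G :: "real^'n \<Rightarrow> real \<times> 'n torus \<Rightarrow> real"
  proof -
    have e: "AE z in ?S1. G (a z) z = G (\<beta> z) z" using ae1 by eventually_elim simp
    show "(\<integral>z. G (a z) z \<partial>?S1) = (\<integral>z. G (\<beta> z) z \<partial>?S1)"
      "integrable ?S1 (\<lambda>z. G (a z) z) = integrable ?S1 (\<lambda>z. G (\<beta> z) z)"
      by (rule integral_cong_AE[OF _ _ e] integrable_cong_AE[OF _ _ e]; unfold ms1; rule that)+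
  qed
  have s2: "(\<integral>z. G (shift \<tau> z) \<partial>Sp \<delta> m2) = (\<integral>z. G' z \<partial>Sp \<delta> m2)"
    "integrable (Sp \<delta> m2) (\<lambda>z. G (shift \<tau> z)) = integrable (Sp \<delta> m2) G'"
    if G: "G \<in> borel_measurable borel" and G': "G' \<in> borel_measurable borel"
      and e: "\<And>z. 0 \<le> fst z \<Longrightarrow> G (shift \<tau> z) = G' z"
    for G G' :: "real \<times> 'n torus \<Rightarrow> real"
  proof -
    have e: "AE z in Sp \<delta> m2. G (shift \<tau> z) = G' z" using ae2 by eventually_elim (rule e)
    show "(\<integral>z. G (shift \<tau> z) \<partial>Sp \<delta> m2) = (\<integral>z. G' z \<partial>Sp \<delta> m2)"
      "integrable (Sp \<delta> m2) (\<lambda>z. G (shift \<tau> z)) = integrable (Sp \<delta> m2) G'"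
      by (rule integral_cong_AE[OF _ _ e] integrable_cong_AE[OF _ _ e]; unfold ms2;
          rule measurable_compose[OF measurable_shift G] G')+
  qed
  have a2: "integrable (Sp \<delta> m) (\<lambda>z. (norm (a z))\<^sup>2)"
  proof (subst integrable_Sp_split[OF m less_imp_le[OF \<tau>] \<delta>], goal_cases)
    case 1 show ?case by measurable
  next
    case 2
    have "integrable ?S1 (\<lambda>z. (norm (a z))\<^sup>2)" using s1(2)[of "\<lambda>r z. (norm r)\<^sup>2"] \<beta>2 by simp
    moreover have "integrable (Sp \<delta> m2) (\<lambda>z. (norm (a (shift \<tau> z)))\<^sup>2)"
      using s2(2)[of "\<lambda>z. (norm (a z))\<^sup>2" "\<lambda>z. (norm (b z))\<^sup>2"] b2 as by simp
    ultimately show ?case unfolding mshift by blast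
  qed
  have adm: "spacetime_admissible \<delta> m a"
    unfolding spacetime_admissible_def
  proof (intro conjI allI impI)
    fix \<phi> :: "real \<Rightarrow> 'n torus \<Rightarrow> real" assume \<phi>: "test_function \<phi>"
    let ?\<psi> = "\<lambda>t. \<phi> (t + \<tau>)"
    have \<psi>: "test_function ?\<psi>" by (rule test_function_shift[OF \<phi>])
    obtain C1 where C1: "\<And>z. \<bar>heat_part \<delta> \<phi> z\<bar> \<le> C1" using bounded_heat_part[OF \<phi>] by blast
    obtain C2 where C2: "\<And>z. norm (flux_part \<delta> \<phi> z) \<le> C2" using bounded_flux_part[OF \<phi>] by blast
    note [measurable] = measurable_heat_part[OF \<phi>] measurable_flux_part[OF \<phi>] measurable_heat_part[OF \<psi>] measurable_flux_part[OF \<psi>]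
    have i1: "integrable (Sp \<delta> m) (heat_part \<delta> \<phi>)"
      by (rule integrable_Sp_bounded[OF m \<delta> _ C1]) measurable
    have i2: "integrable (Sp \<delta> m) (\<lambda>z. a z \<bullet> flux_part \<delta> \<phi> z)"
      by (rule integrable_inner_bounded[OF Sp_facts(3)[OF m \<delta>] _ _ a2 C2])
         (auto simp: measurable_cong_sets[OF Sp_facts(1)[OF m \<delta>] refl])
    have e: "exp (- \<delta> * \<tau>) * exp (\<delta> * \<tau>) = 1" by (simp flip: exp_add)
    have h: "(\<integral>z. heat_part \<delta> \<phi> z \<partial>Sp \<delta> m) = (\<integral>z. heat_part \<delta> \<phi> z \<partial>?S1) + (\<integral>z. heat_part \<delta> ?\<psi> z \<partial>Sp \<delta> m2)"
    proof -
      have "(\<integral>z. heat_part \<delta> \<phi> (shift \<tau> z) \<partial>Sp \<delta> m2) = (\<integral>z. exp (\<delta> * \<tau>) * heat_part \<delta> ?\<psi> z \<partial>Sp \<delta> m2)"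
        by (rule s2(1)) (use \<tau> in \<open>auto simp: heat_flux_shift\<close>)
      then show ?thesis
        unfolding integral_Sp_split[OF m less_imp_le[OF \<tau>] \<delta> measurable_heat_part[OF \<phi>] i1] mshift
        using e by (simp flip: mult.assoc)
    qed
    have f: "(\<integral>z. a z \<bullet> flux_part \<delta> \<phi> z \<partial>Sp \<delta> m) = (\<integral>z. \<beta> z \<bullet> flux_part \<delta> \<phi> z \<partial>?S1) + (\<integral>z. b z \<bullet> flux_part \<delta> ?\<psi> z \<partial>Sp \<delta> m2)"
    proof -
      have mm: "(\<lambda>z. a z \<bullet> flux_part \<delta> \<phi> z) \<in> borel_measurable borel" by measurable
      have "(\<integral>z. a (shift \<tau> z) \<bullet> flux_part \<delta> \<phi> (shift \<tau> z) \<partial>Sp \<delta> m2) = (\<integral>z. exp (\<delta> * \<tau>) * (b z \<bullet> flux_part \<delta> ?\<psi> z) \<partial>Sp \<delta> m2)"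
        by (rule s2(1)[OF mm]) (use \<tau> in \<open>auto simp: heat_flux_shift as\<close>)
      moreover have "(\<integral>z. a z \<bullet> flux_part \<delta> \<phi> z \<partial>?S1) = (\<integral>z. \<beta> z \<bullet> flux_part \<delta> \<phi> z \<partial>?S1)"
        by (rule s1(1)) measurable
      ultimately show ?thesis
        unfolding integral_Sp_split[OF m less_imp_le[OF \<tau>] \<delta> mm i2] mshift
        using e by (simp flip: mult.assoc)
    qed
    have "(\<integral>z. heat_part \<delta> \<phi> z \<partial>?S1) - (\<integral>z. \<beta> z \<bullet> flux_part \<delta> \<phi> z \<partial>?S1)
        = (\<integral>x. \<phi> \<tau> x \<partial>meas (D.path \<tau>)) - (\<integral>x. \<phi> 0 x \<partial>meas (D.path 0))"
    proof -
      have "(\<integral>z. heat_part \<delta> \<phi> z \<partial>?S1) = (\<integral>p. heat_part \<delta> \<phi> (?X p) \<partial>?M)"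
        unfolding dS1[symmetric] by (rule integral_distr[OF X]) measurable
      moreover have "(\<integral>z. \<beta> z \<bullet> flux_part \<delta> \<phi> z \<partial>?S1) = - (\<integral>p. v (fst (snd p)) \<bullet> flux_part \<delta> \<phi> (?X p) \<partial>?M)"
        using \<beta>lin[OF measurable_flux_part[OF \<phi>] C2] by simp
      ultimately show ?thesis using D.ito_discounted[OF \<phi> less_imp_le[OF \<tau>] \<delta>] by simp
    qed
    moreover have "m 0 = D.path 0" using \<tau> by (simp add: m_def)
    ultimately show "(\<integral>x. \<phi> 0 x \<partial>meas (m 0)) + (\<integral>z. heat_part \<delta> \<phi> z \<partial>Sp \<delta> m) - (\<integral>z. a z \<bullet> flux_part \<delta> \<phi> z \<partial>Sp \<delta> m) = 0"
      unfolding h f using bFP[OF \<psi>] m20 by simp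
  qed (use m a2 in auto)
  have iL: "integrable (Sp \<delta> m) (\<lambda>z. L (snd z) (a z))" by (rule integrable_L_Sp[OF adm \<delta>])
  have U: "(\<integral>t. disc_until \<delta> \<tau> t \<partial>lborel) \<le> \<tau>"
  proof -
    have "(\<integral>t. disc_until \<delta> \<tau> t \<partial>lborel) \<le> (\<integral>t. indicator {0..\<tau>} t \<partial>lborel)"
    proof (rule integral_mono[OF integrable_disc_until[OF \<delta>]])
      show "disc_until \<delta> \<tau> t \<le> indicator {0..\<tau>} t" for t
        using \<delta> by (auto simp: disc_until_def disc_def indicator_def)
      show "integrable lborel (indicator {0..\<tau>} :: real \<Rightarrow> real)"
        by (rule integrable_real_indicator) (use \<tau> in auto)
    qed
    then show ?thesis using \<tau> by simp
  qed
  have Lsplit: "(\<integral>z. L (snd z) (a z) \<partial>Sp \<delta> m) = (\<integral>z. L (snd z) (\<beta> z) \<partial>?S1) + exp (- \<delta> * \<tau>) * (\<integral>z. L (snd z) (b z) \<partial>Sp \<delta> m2)"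
  proof -
    have mm: "(\<lambda>z. L (snd z) (a z)) \<in> borel_measurable borel" by measurable
    have "(\<integral>z. L (snd (shift \<tau> z)) (a (shift \<tau> z)) \<partial>Sp \<delta> m2) = (\<integral>z. L (snd z) (b z) \<partial>Sp \<delta> m2)"
      by (rule s2(1)[OF mm]) (auto simp: as)
    moreover have "(\<integral>z. L (snd z) (a z) \<partial>?S1) = (\<integral>z. L (snd z) (\<beta> z) \<partial>?S1)"
      by (rule s1(1)) measurable
    ultimately show ?thesis
      unfolding integral_Sp_split[OF m less_imp_le[OF \<tau>] \<delta> mm iL] mshift by simp
  qed
  have iF: "integrable lborel (\<lambda>t. disc \<delta> t * \<F> (m t))" by (rule integrable_F_path[OF m \<delta>])
  have Fsplit: "(\<integral>t. disc \<delta> t * \<F> (m t) \<partial>lborel) \<le> K * \<tau> + exp (- \<delta> * \<tau>) * (\<integral>t. disc \<delta> t * \<F> (m2 t) \<partial>lborel)"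
  proof -
    have "(\<integral>t. disc_until \<delta> \<tau> t * \<F> (m t) \<partial>lborel) \<le> (\<integral>t. disc_until \<delta> \<tau> t * K \<partial>lborel)"
      using F_bound integrable_disc_until[OF \<delta>]
      by (intro integral_mono integrable_disc_until_mult[OF iF less_imp_le[OF \<tau>]])
         (auto intro!: mult_left_mono simp: abs_le_iff)
    also have "\<dots> \<le> K * \<tau>" using U K1 by (simp add: mult.commute mult_left_mono)
    finally have 1: "(\<integral>t. disc_until \<delta> \<tau> t * \<F> (m t) \<partial>lborel) \<le> K * \<tau>" .
    have "disc \<delta> t * \<F> (m (t + \<tau>)) = disc \<delta> t * \<F> (m2 t)" for t
      using m20 by (cases "t = 0") (auto simp: disc_def m_def)
    then have "(\<integral>t. disc \<delta> t * \<F> (m (t + \<tau>)) \<partial>lborel) = (\<integral>t. disc \<delta> t * \<F> (m2 t) \<partial>lborel)"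
      by (simp only:)
    then show ?thesis
      unfolding integral_disc_split[OF iF less_imp_le[OF \<tau>]] using 1 by simp
  qed
  have "(\<integral>p. L (snd (?X p)) (?B p) \<partial>?M) \<le> (\<integral>p. K * (1 + (norm (v (fst (snd p))))\<^sup>2) \<partial>?M)"
  proof (rule integral_mono)
    show "integrable ?M (\<lambda>p. L (snd (?X p)) (?B p))"
      using integrable_L[OF fM measurable_compose[OF X borel_snd] Bm B2] by simp
    show "L (snd (?X p)) (?B p) \<le> K * (1 + (norm (v (fst (snd p))))\<^sup>2)" for p
      using L_upper[of "snd (?X p)" "?B p"] by simp
  qed (use B2 in simp)
  also have "\<dots> = (\<integral>t. (\<integral>\<omega>. K * (1 + (norm (v (fst \<omega>)))\<^sup>2) \<partial>D.Q) \<partial>?D)"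
  proof -
    interpret D': finite_measure ?D by (rule fD)
    interpret DQ: pair_sigma_finite ?D D.Q
      by (intro pair_sigma_finite.intro D'.sigma_finite_measure_axioms D.PG.sigma_finite_measure_axioms)
    have "integrable ?M (\<lambda>p. K * (1 + (norm (v (fst (snd p))))\<^sup>2))" using B2 by simp
    from DQ.integral_fst'[OF this, symmetric] show ?thesis by (simp only: snd_conv)
  qed
  also have "(\<integral>\<omega>. K * (1 + (norm (v (fst \<omega>)))\<^sup>2) \<partial>D.Q) = K * (1 + ?v2)"
  proof -
    have iv: "integrable P (\<lambda>\<omega>. (norm (v \<omega>))\<^sup>2)"
      by (rule D.P.integrable_const_bound[where B="V\<^sup>2"]) (use V2 in auto)
    have "integrable D.Q (\<lambda>\<omega>. K * (1 + (norm (v (fst \<omega>)))\<^sup>2))"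
      by (rule D.PG.integrable_const_bound[where B="K * (1 + V\<^sup>2)"]) (use V2 K1 in auto)
    from D.PG.integral_fst'[OF this] show ?thesis
      using iv D.G.prob_space by (auto simp: D.P.prob_space)
  qed
  also have "(\<integral>t. K * (1 + ?v2) \<partial>?D) = (\<integral>t. disc_until \<delta> \<tau> t \<partial>lborel) * (K * (1 + ?v2))"
    by (subst integral_density) auto
  also have "\<dots> \<le> \<tau> * (K * (1 + ?v2))"
    using K1 by (intro mult_right_mono[OF U]) (auto intro!: mult_nonneg_nonneg add_nonneg_nonneg)
  finally have LB: "(\<integral>p. L (snd (?X p)) (?B p) \<partial>?M) \<le> \<tau> * (K * (1 + ?v2))" .
  have "J \<delta> m a \<le> K * \<tau> * (2 + ?v2)
      + exp (- \<delta> * \<tau>) * J \<delta> m2 b"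
    unfolding cost_eq_run_cost[OF adm \<delta>] integral_run_cost[OF adm \<delta>]
      cost_eq_run_cost[OF b \<delta>] integral_run_cost[OF b \<delta>] Lsplit
    using \<beta>L LB Fsplit by (simp add: algebra_simps)
  then show ?thesis using that[OF adm m0] by blast
qed

end

section \<open>Undoing a Gaussian perturbation\<close>

definition smear :: "'n::finite tprob \<Rightarrow> real \<Rightarrow> 'n tprob" where
  "smear \<mu> c = law (meas \<mu> \<Otimes>\<^sub>M gauss) (\<lambda>p. fst p + tproj (c *\<^sub>R snd p))"

lemma pair_prob_space_meas_gauss: "pair_prob_space (meas (\<mu> :: 'a::finite tprob)) (gauss :: (real^'b::finite) measure)"
  by (intro pair_prob_space.intro pair_sigma_finite.intro prob_space_meas prob_space_gauss
      prob_space_imp_sigma_finite)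

lemma measurable_smear_map:
  "(\<lambda>p. fst p + tproj (c *\<^sub>R snd p)) \<in> borel_measurable (meas (\<mu> :: 'n::finite tprob) \<Otimes>\<^sub>M gauss)"
  by measurable

lemma prob_space_meas_gauss: "prob_space (meas (\<mu> :: 'a::finite tprob) \<Otimes>\<^sub>M (gauss :: (real^'b::finite) measure))"
proof -
  interpret pair_prob_space "meas \<mu>" "gauss :: (real^'b) measure" by (rule pair_prob_space_meas_gauss)
  show ?thesis by (rule prob_space_axioms)
qed

lemma integral_smear:
  fixes f :: "'n::finite torus \<Rightarrow> real"
  assumes [measurable]: "f \<in> borel_measurable borel" and b: "\<And>x. \<bar>f x\<bar> \<le> C"
  shows "integral\<^sup>L (meas (smear \<mu> c)) f = (\<integral>z. (\<integral>x. f (x + tproj (c *\<^sub>R z)) \<partial>meas \<mu>) \<partial>gauss)"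
proof -
  interpret PG: pair_prob_space "meas \<mu>" "gauss :: (real^'n) measure" by (rule pair_prob_space_meas_gauss)
  have i: "integrable (meas \<mu> \<Otimes>\<^sub>M gauss) (\<lambda>(x, z). f (x + tproj (c *\<^sub>R z)))"
    by (rule PG.integrable_const_bound[where B=C]) (use b in \<open>auto simp: case_prod_beta\<close>)
  have "integral\<^sup>L (meas (smear \<mu> c)) f = (\<integral>p. f (fst p + tproj (c *\<^sub>R snd p)) \<partial>(meas \<mu> \<Otimes>\<^sub>M gauss))"
    unfolding smear_def by (rule integral_law[OF prob_space_meas_gauss measurable_smear_map assms(1)])
  also have "\<dots> = (\<integral>p. (case p of (x, z) \<Rightarrow> f (x + tproj (c *\<^sub>R z))) \<partial>(meas \<mu> \<Otimes>\<^sub>M gauss))"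
    by (simp add: case_prod_beta)
  also have "\<dots> = (\<integral>z. (\<integral>x. f (x + tproj (c *\<^sub>R z)) \<partial>meas \<mu>) \<partial>gauss)"
    by (rule PG.integral_snd[OF i, symmetric])
  finally show ?thesis .
qed

text \<open>The type argument carries the dimension, the only datum besides \<open>k\<close> on which the moment depends.\<close>

definition gauss_moment :: "nat \<Rightarrow> 'n::finite itself \<Rightarrow> real" where
  "gauss_moment k _ = (\<integral>z. (norm (z :: real^'n)) ^ k \<partial>gauss)"

lemma gauss_moment_nonneg: "0 \<le> gauss_moment k TYPE('n::finite)"
  unfolding gauss_moment_def by (rule integral_nonneg_AE) auto

lemma dist_smear_le:
  fixes \<mu> \<nu> :: "'n::finite tprob"
  shows "dist (smear \<mu> c) (smear \<nu> d) \<le> dist \<mu> \<nu> + \<bar>c - d\<bar> * gauss_moment 1 TYPE('n)"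
proof (rule dist_tprob_leI)
  fix \<phi> :: "'n torus \<Rightarrow> real" assume L: "1-lipschitz_on UNIV \<phi>"
  interpret G: prob_space "gauss :: (real^'n) measure" by (rule prob_space_gauss)
  have m [measurable]: "\<phi> \<in> borel_measurable borel"
    using lipschitz_on_continuous_on[OF L] by (rule borel_measurable_continuous_onI)
  define C where "C = \<bar>\<phi> 0\<bar> + CARD('n)"
  have b: "\<bar>\<phi> x\<bar> \<le> C" for x
    using lipschitz_bound_torus[OF L, of x 0] by (simp add: C_def)
  let ?I = "\<lambda>\<mu> c z. \<integral>x. \<phi> (x + tproj (c *\<^sub>R z)) \<partial>meas \<mu>"
  have ii: "integrable (meas \<rho>) (\<lambda>x. \<phi> (x + w))" for \<rho> w
    by (rule integrable_bounded_torus) (use b in auto)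
  have ib: "\<bar>?I \<rho> e z\<bar> \<le> C" for \<rho> e z
  proof -
    interpret prob_space "meas \<rho>" by (rule prob_space_meas)
    have "\<bar>?I \<rho> e z\<bar> \<le> (\<integral>x. \<bar>\<phi> (x + tproj (e *\<^sub>R z))\<bar> \<partial>meas \<rho>)" by (rule integral_abs_bound)
    also have "\<dots> \<le> C" by (rule integral_le_const) (use b ii in auto)
    finally show ?thesis .
  qed
  have im: "?I \<rho> e \<in> borel_measurable gauss" for \<rho> e
  proof -
    interpret P: prob_space "meas \<rho>" by (rule prob_space_meas)
    show ?thesis by (rule P.borel_measurable_lebesgue_integral) measurable
  qed
  have iI: "integrable gauss (?I \<rho> e)" for \<rho> e
    by (rule G.integrable_const_bound[where B=C, OF _ im]) (use ib in auto)
  have "integral\<^sup>L (meas (smear \<mu> c)) \<phi> - integral\<^sup>L (meas (smear \<nu> d)) \<phi> = (\<integral>z. ?I \<mu> c z - ?I \<nu> d z \<partial>gauss)"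
    unfolding integral_smear[OF m b] using iI by simp
  also have "\<dots> \<le> (\<integral>z. dist \<mu> \<nu> + \<bar>c - d\<bar> * norm z \<partial>(gauss :: (real^'n) measure))"
  proof (rule integral_mono)
    fix z :: "real^'n"
    have "1-lipschitz_on UNIV (\<lambda>x. \<phi> (x + tproj (c *\<^sub>R z)))"
    proof (rule lipschitz_onI)
      fix x y show "dist (\<phi> (x + tproj (c *\<^sub>R z))) (\<phi> (y + tproj (c *\<^sub>R z))) \<le> 1 * dist x y"
        using lipschitz_onD[OF L, of "x + tproj (c *\<^sub>R z)" "y + tproj (c *\<^sub>R z)"] by (simp add: dist_torus_translate)
    qed simp
    from integral_diff_le_dist_tprob[OF this, of \<mu> \<nu>]
    have 1: "?I \<mu> c z - ?I \<nu> c z \<le> dist \<mu> \<nu>" by simp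
    have "?I \<nu> c z - ?I \<nu> d z = (\<integral>x. \<phi> (x + tproj (c *\<^sub>R z)) - \<phi> (x + tproj (d *\<^sub>R z)) \<partial>meas \<nu>)"
      using ii by simp
    also have "\<dots> \<le> \<bar>c - d\<bar> * norm z"
    proof (rule prob_space.integral_le_const[OF prob_space_meas])
      show "AE x in meas \<nu>. \<phi> (x + tproj (c *\<^sub>R z)) - \<phi> (x + tproj (d *\<^sub>R z)) \<le> \<bar>c - d\<bar> * norm z"
      proof (rule AE_I2)
        fix x
        have "\<phi> (x + tproj (c *\<^sub>R z)) - \<phi> (x + tproj (d *\<^sub>R z)) \<le> dist (x + tproj (c *\<^sub>R z)) (x + tproj (d *\<^sub>R z))"
          using lipschitz_onD[OF L, of "x + tproj (c *\<^sub>R z)" "x + tproj (d *\<^sub>R z)"] by (simp add: dist_real_def)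
        also have "\<dots> \<le> norm (c *\<^sub>R z - d *\<^sub>R z)" by (rule dist_torus_add_le)
        also have "\<dots> = \<bar>c - d\<bar> * norm z" by (simp flip: scaleR_left_diff_distrib)
        finally show "\<phi> (x + tproj (c *\<^sub>R z)) - \<phi> (x + tproj (d *\<^sub>R z)) \<le> \<bar>c - d\<bar> * norm z" .
      qed
    qed (use ii in auto)
    finally show "?I \<mu> c z - ?I \<nu> d z \<le> dist \<mu> \<nu> + \<bar>c - d\<bar> * norm z" using 1 by linarith
  next
    show "integrable gauss (\<lambda>z :: real^'n. dist \<mu> \<nu> + \<bar>c - d\<bar> * norm z)"
      by (intro Bochner_Integration.integrable_add integrable_mult_right integrable_gauss_norm G.integrable_const)
  qed (use iI in auto)
  also have "\<dots> = dist \<mu> \<nu> + \<bar>c - d\<bar> * gauss_moment 1 TYPE('n)"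
    using integrable_gauss_norm[where 'n='n] G.prob_space by (simp add: gauss_moment_def)
  finally show "integral\<^sup>L (meas (smear \<mu> c)) \<phi> - integral\<^sup>L (meas (smear \<nu> d)) \<phi> \<le> dist \<mu> \<nu> + \<bar>c - d\<bar> * gauss_moment 1 TYPE('n)" .
qed

lemma smear_0: "smear \<mu> 0 = (\<mu> :: 'n::finite tprob)"
  unfolding smear_def
proof (rule law_eqI[OF prob_space_meas_gauss measurable_smear_map])
  interpret G: prob_space "gauss :: (real^'n) measure" by (rule prob_space_gauss)
  have "distr (meas \<mu> \<Otimes>\<^sub>M gauss) borel (\<lambda>p. fst p + tproj (0 *\<^sub>R snd p :: real^'n))
      = distr (meas \<mu> \<Otimes>\<^sub>M (gauss :: (real^'n) measure)) (meas \<mu>) fst"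
    by (rule distr_cong) (auto simp: sets_meas tproj_zero)
  also have "\<dots> = meas \<mu>" by (rule G.distr_pair_fst)
  finally show "distr (meas \<mu> \<Otimes>\<^sub>M gauss) borel (\<lambda>p. fst p + tproj (0 *\<^sub>R snd p :: real^'n)) = meas \<mu>" .
qed

lemma
  fixes u :: "'a \<Rightarrow> real" and w :: "'b \<Rightarrow> real"
  assumes S: "finite_measure S" and G: "finite_measure G" and u: "integrable S u" and w: "integrable G w"
  shows integrable_pair_mult: "integrable (S \<Otimes>\<^sub>M G) (\<lambda>p. u (fst p) * w (snd p))"
    and integral_pair_mult: "(\<integral>p. u (fst p) * w (snd p) \<partial>(S \<Otimes>\<^sub>M G)) = (\<integral>x. u x \<partial>S) * (\<integral>y. w y \<partial>G)"
proof -
  interpret S: finite_measure S by fact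
  interpret G: finite_measure G by fact
  interpret pair_sigma_finite S G ..
  have [measurable]: "u \<in> borel_measurable S" "w \<in> borel_measurable G" using u w by auto
  show i: "integrable (S \<Otimes>\<^sub>M G) (\<lambda>p. u (fst p) * w (snd p))"
  proof (rule Fubini_integrable)
    show "integrable S (\<lambda>x. \<integral>y. norm (u (fst (x, y)) * w (snd (x, y))) \<partial>G)"
      using u by (simp add: abs_mult)
    show "AE x in S. integrable G (\<lambda>y. u (fst (x, y)) * w (snd (x, y)))"
      using w by simp
  qed measurable
  show "(\<integral>p. u (fst p) * w (snd p) \<partial>(S \<Otimes>\<^sub>M G)) = (\<integral>x. u x \<partial>S) * (\<integral>y. w y \<partial>G)"
    using integral_fst'[OF i] by simp
qed

context control_problem
begin

text \<open>The first summand bounds the change of the Lagrangian under a perturbation of size \<open>h = r exp (- t) |z|\<close>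
  with \<open>r \<le> 2\<close>, whence \<open>h\<^sup>3 \<le> 4 r exp (- t) |z|\<^sup>3\<close>; the second one bounds the change of \<open>\<F>\<close>.\<close>

definition smear_const :: real where
  "smear_const = 32 * K ^ 3 * (gauss_moment 1 TYPE('n) + 4 * gauss_moment 3 TYPE('n)) + K * gauss_moment 1 TYPE('n)"

text \<open>A Gaussian displacement \<open>r z\<close> of the initial law is undone by translating every path by
  \<open>r exp (- t) z\<close>: a translate of a solution is a solution for the drift enlarged by the velocity of
  the translation, whose effect is integrable in time.\<close>

lemma cost_from_smeared:
  assumes a: "spacetime_admissible \<delta> m a" and \<delta>: "0 < \<delta>" and r: "0 \<le> r" "r \<le> 2"
  obtains m' a' where "spacetime_admissible \<delta> m' a'" "m' 0 = smear (m 0) r"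
    "J \<delta> m' a' \<le> J \<delta> m a
      + smear_const * r * (1 + (\<integral>z. exp (- max 0 (fst z)) * (norm (a z))\<^sup>2 \<partial>Sp \<delta> m))"
proof -
  note m = spacetime_admissibleD(1)[OF a] and am [measurable] = spacetime_admissibleD(2)[OF a] and a2 = spacetime_admissibleD(3)[OF a]
    and aFP = spacetime_admissibleD(4)[OF a]
  let ?S = "Sp \<delta> m"
  let ?G = "gauss :: (real^'n) measure"
  note msS = measurable_cong_sets[OF Sp_facts(1)[OF m \<delta>] refl]
  have fS: "finite_measure ?S" by (rule Sp_facts(3)[OF m \<delta>])
  interpret S: finite_measure ?S by (rule fS)
  interpret G: prob_space ?G by (rule prob_space_gauss)
  interpret SG: pair_sigma_finite ?S ?G ..
  let ?M = "?S \<Otimes>\<^sub>M ?G"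
  have fM: "finite_measure ?M" by (rule finite_measure_pair_measure[OF G.finite_measure_axioms fS])
  interpret M: finite_measure ?M by (rule fM)
  note [measurable_cong] = Sp_facts(1)[OF m \<delta>]
  define \<rho> where "\<rho> t = r * exp (- max 0 t)" for t :: real
  have \<rho>m [measurable]: "\<rho> \<in> borel_measurable borel" unfolding \<rho>_def by measurable
  have \<rho>c: "continuous_on A \<rho>" for A unfolding \<rho>_def by (intro continuous_intros)
  have \<rho>0: "0 \<le> \<rho> t" "\<rho> t \<le> r" for t using r by (auto simp: \<rho>_def intro!: mult_left_le)
  have \<rho>r: "\<rho> t = r * exp (- max 0 t)" for t by (simp add: \<rho>_def)
  let ?m = "\<lambda>t. smear (m t) (\<rho> t)"
  let ?g1 = "gauss_moment 1 TYPE('n)" and ?g3 = "gauss_moment 3 TYPE('n)"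
  have m': "continuous_on {0..} ?m"
    unfolding continuous_on_def
  proof
    fix s :: real assume s: "s \<in> {0..}"
    have "((\<lambda>t. dist (m t) (m s) + \<bar>\<rho> t - \<rho> s\<bar> * ?g1) \<longlongrightarrow> dist (m s) (m s) + \<bar>\<rho> s - \<rho> s\<bar> * ?g1) (at s within {0..})"
      using m \<rho>c[of "{0..}"] s unfolding continuous_on_def by (intro tendsto_intros) auto
    then have lim: "((\<lambda>t. dist (m t) (m s) + \<bar>\<rho> t - \<rho> s\<bar> * ?g1) \<longlongrightarrow> 0) (at s within {0..})" by simp
    have "((\<lambda>t. dist (?m t) (?m s)) \<longlongrightarrow> 0) (at s within {0..})"
      by (rule Lim_null_comparison[OF always_eventually lim], rule allI) (use dist_smear_le in simp)
    then show "(?m \<longlongrightarrow> ?m s) (at s within {0..})" by (rule tendsto_dist_iff[THEN iffD2])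
  qed
  \<comment> \<open>Translated position, and drift enlarged by the velocity of the translation: the derivative of
    \<open>r exp (- t) z\<close> is \<open>- r exp (- t) z\<close>, and the drift enters the equation with a minus sign.\<close>
  define X where "X p = (fst (fst p), snd (fst p) + tproj (\<rho> (fst (fst p)) *\<^sub>R snd p))" for p :: "(real \<times> 'n torus) \<times> (real^'n)"
  define B where "B p = a (fst p) + \<rho> (fst (fst p)) *\<^sub>R snd p" for p :: "(real \<times> 'n torus) \<times> (real^'n)"
  have X [measurable]: "X \<in> borel_measurable ?M"
    unfolding X_def by (subst borel_prod[symmetric]) measurable
  have Bm [measurable]: "B \<in> borel_measurable ?M" unfolding B_def by measurable
  have dX: "distr ?M borel X = Sp \<delta> ?m"
  proof (rule measure_eqI)
    show "sets (distr ?M borel X) = sets (Sp \<delta> ?m)" using Sp_facts(1)[OF m' \<delta>] by simp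
    fix A assume "A \<in> sets (distr ?M borel X)"
    then have A [measurable]: "A \<in> sets borel" by simp
    have iA: "indicator A \<in> borel_measurable (borel :: (real \<times> 'n torus) measure)" by simp
    let ?h = "\<lambda>s. \<integral>\<^sup>+z. indicator A (X (s, z)) \<partial>?G"
    have hm: "?h \<in> borel_measurable borel"
      using G.borel_measurable_nn_integral_fst[OF measurable_compose[OF X iA]] msS by simp
    have "emeasure (distr ?M borel X) A = (\<integral>\<^sup>+p. indicator A (X p) \<partial>?M)"
      using A nn_integral_distr[OF X, of "indicator A"] by simp
    also have "\<dots> = (\<integral>\<^sup>+s. ?h s \<partial>?S)"
      using G.nn_integral_fst[OF measurable_compose[OF X iA], symmetric] by simp
    also have "\<dots> = (\<integral>\<^sup>+t. ennreal (disc \<delta> t) * (\<integral>\<^sup>+x. ?h (t, x) \<partial>meas (m t)) \<partial>lborel)"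
      by (rule nn_integral_spacetime[OF m _ _ _ hm]) auto
    also have "\<dots> = (\<integral>\<^sup>+t. ennreal (disc \<delta> t) * (\<integral>\<^sup>+x. indicator A (t, x) \<partial>meas (?m t)) \<partial>lborel)"
    proof (rule nn_integral_cong)
      fix t
      have iAt: "(\<lambda>x. indicator A (t, x) :: ennreal) \<in> borel_measurable borel"
        using measurable_compose[OF measurable_Pair_torus[OF m, of "\<lambda>_. 0"] iA] by simp
      have "(\<integral>\<^sup>+x. indicator A (t, x) \<partial>meas (?m t))
          = (\<integral>\<^sup>+p. indicator A (t, fst p + tproj (\<rho> t *\<^sub>R snd p)) \<partial>(meas (m t) \<Otimes>\<^sub>M ?G))"
        unfolding smear_def meas_law[OF prob_space_meas_gauss measurable_smear_map]
        by (rule nn_integral_distr[OF measurable_smear_map]) (simp add: iAt)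
      also have "\<dots> = (\<integral>\<^sup>+x. ?h (t, x) \<partial>meas (m t))"
        using G.nn_integral_fst[OF measurable_compose[OF measurable_smear_map[of "\<rho> t" "m t"] iAt], symmetric]
        by (simp add: X_def)
      finally show "ennreal (disc \<delta> t) * (\<integral>\<^sup>+x. ?h (t, x) \<partial>meas (m t)) = ennreal (disc \<delta> t) * (\<integral>\<^sup>+x. indicator A (t, x) \<partial>meas (?m t))"
        by simp
    qed
    also have "\<dots> = (\<integral>\<^sup>+z. indicator A z \<partial>Sp \<delta> ?m)"
      by (rule nn_integral_spacetime[OF m' _ _ _ iA, symmetric]) auto
    also have "\<dots> = emeasure (Sp \<delta> ?m) A" using A Sp_facts(1)[OF m' \<delta>] by simp
    finally show "emeasure (distr ?M borel X) A = emeasure (Sp \<delta> ?m) A" .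
  qed
  have i_a2: "integrable ?M (\<lambda>p. (norm (a (fst p)))\<^sup>2)"
    using integrable_pair_mult[OF fS G.finite_measure_axioms a2, of "\<lambda>_. 1"] by simp
  have i_z2: "integrable ?M (\<lambda>p. (norm (snd p))\<^sup>2)"
    using integrable_pair_mult[OF fS G.finite_measure_axioms _ integrable_gauss_norm2, of "\<lambda>_. 1"] by simp
  have B2: "integrable ?M (\<lambda>p. (norm (B p))\<^sup>2)"
  proof (rule integrable_dominated)
    show "integrable ?M (\<lambda>p. 2 * (norm (a (fst p)))\<^sup>2 + 8 * (norm (snd p))\<^sup>2)" using i_a2 i_z2 by simp
    show "AE p in ?M. norm ((norm (B p))\<^sup>2) \<le> norm (2 * (norm (a (fst p)))\<^sup>2 + 8 * (norm (snd p))\<^sup>2)"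
    proof (rule AE_I2)
      fix p
      have "norm (B p) \<le> norm (a (fst p)) + \<rho> (fst (fst p)) * norm (snd p)"
        unfolding B_def using norm_triangle_ineq[of "a (fst p)" "\<rho> (fst (fst p)) *\<^sub>R snd p"] \<rho>0 by simp
      also have "\<dots> \<le> norm (a (fst p)) + 2 * norm (snd p)"
        using \<rho>0(2)[of "fst (fst p)"] r by (intro add_left_mono mult_right_mono) auto
      finally have "(norm (B p))\<^sup>2 \<le> (norm (a (fst p)) + 2 * norm (snd p))\<^sup>2" by (rule power_mono) simp
      also have "\<dots> \<le> 2 * (norm (a (fst p)))\<^sup>2 + 8 * (norm (snd p))\<^sup>2"
        using zero_le_power2[of "norm (a (fst p)) - 2 * norm (snd p)"] by (simp add: power2_eq_square algebra_simps)
      finally show "norm ((norm (B p))\<^sup>2) \<le> norm (2 * (norm (a (fst p)))\<^sup>2 + 8 * (norm (snd p))\<^sup>2)" by simp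
    qed
  qed measurable
  obtain \<beta> where \<beta>m [measurable]: "\<beta> \<in> borel_measurable borel" and \<beta>2: "integrable (Sp \<delta> ?m) (\<lambda>z. (norm (\<beta> z))\<^sup>2)"
    and \<beta>L: "(\<integral>z. L (snd z) (\<beta> z) \<partial>Sp \<delta> ?m) \<le> (\<integral>p. L (snd (X p)) (B p) \<partial>?M)"
    and \<beta>lin: "\<And>g C. g \<in> borel_measurable borel \<Longrightarrow> (\<And>z. norm (g z) \<le> C) \<Longrightarrow>
      (\<integral>z. \<beta> z \<bullet> g z \<partial>Sp \<delta> ?m) = (\<integral>p. B p \<bullet> g (X p) \<partial>?M)"
    using feedback_of_random_drift[OF fM X Bm B2] unfolding dX by blast
  have adm: "spacetime_admissible \<delta> ?m \<beta>"
    unfolding spacetime_admissible_def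
  proof (intro conjI allI impI)
    fix \<phi> :: "real \<Rightarrow> 'n torus \<Rightarrow> real" assume \<phi>: "test_function \<phi>"
    obtain C1 where C1: "\<And>z. \<bar>heat_part \<delta> \<phi> z\<bar> \<le> C1" using bounded_heat_part[OF \<phi>] by blast
    obtain C2 where C2: "\<And>z. norm (flux_part \<delta> \<phi> z) \<le> C2" using bounded_flux_part[OF \<phi>] by blast
    note hX = measurable_compose[OF X measurable_heat_part[OF \<phi>]] and fX = measurable_compose[OF X measurable_flux_part[OF \<phi>]]
    have i1: "integrable ?M (\<lambda>p. heat_part \<delta> \<phi> (X p))"
      by (rule M.integrable_const_bound[where B=C1, OF _ hX]) (use C1 in auto)
    have i2: "integrable ?M (\<lambda>p. B p \<bullet> flux_part \<delta> \<phi> (X p))"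
      by (rule integrable_inner_bounded[OF fM Bm fX B2 C2])
    have i: "integrable ?M (\<lambda>(s, z). heat_part \<delta> \<phi> (X (s, z)) - B (s, z) \<bullet> flux_part \<delta> \<phi> (X (s, z)))"
      unfolding case_prod_beta' prod.collapse by (rule Bochner_Integration.integrable_diff[OF i1 i2])
    have inner: "(\<integral>s. heat_part \<delta> \<phi> (X (s, z)) - B (s, z) \<bullet> flux_part \<delta> \<phi> (X (s, z)) \<partial>?S)
        = - (\<integral>x. \<phi> 0 (x + tproj (r *\<^sub>R z)) \<partial>meas (m 0))" for z
    proof -
      let ?\<psi> = "\<lambda>t x. \<phi> (t + 0) (x + tproj (exp (- t) *\<^sub>R (r *\<^sub>R z)))"
      note tr = test_function_translate[OF \<phi>, where \<tau>=0 and c="r *\<^sub>R z"]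
      obtain D1 where D1: "\<And>z. \<bar>heat_part \<delta> ?\<psi> z\<bar> \<le> D1" using bounded_heat_part[OF tr(1)] by blast
      obtain D2 where D2: "\<And>z. norm (flux_part \<delta> ?\<psi> z) \<le> D2" using bounded_flux_part[OF tr(1)] by blast
      have j1: "integrable ?S (heat_part \<delta> ?\<psi>)"
        by (rule integrable_Sp_bounded[OF m \<delta> measurable_heat_part[OF tr(1)] D1])
      have j2: "integrable ?S (\<lambda>s. a s \<bullet> flux_part \<delta> ?\<psi> s)"
        by (rule integrable_inner_bounded[OF fS _ _ a2 D2]) (use measurable_flux_part[OF tr(1)] in \<open>auto simp: msS\<close>)
      have "heat_part \<delta> \<phi> (X (s, z)) - B (s, z) \<bullet> flux_part \<delta> \<phi> (X (s, z)) = heat_part \<delta> ?\<psi> s - a s \<bullet> flux_part \<delta> ?\<psi> s" for s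
      proof (cases "0 \<le> fst s")
        case True
        define Y where "Y = snd s + tproj (exp (- fst s) *\<^sub>R (r *\<^sub>R z))"
        have Xs: "X (s, z) = (fst s, Y)" and Bs: "B (s, z) = a s + exp (- fst s) *\<^sub>R (r *\<^sub>R z)"
          using True by (simp_all add: X_def B_def Y_def \<rho>_def mult.commute)
        have t1: "time_deriv ?\<psi> (fst s) (snd s) = time_deriv \<phi> (fst s) Y - exp (- fst s) * ((r *\<^sub>R z) \<bullet> tgrad (\<phi> (fst s)) Y)"
          and t2: "tgrad (?\<psi> (fst s)) (snd s) = tgrad (\<phi> (fst s)) Y" and t3: "tlap (?\<psi> (fst s)) (snd s) = tlap (\<phi> (fst s)) Y"
          unfolding tr(2-4) Y_def by simp_all
        show ?thesis
          unfolding heat_part_def flux_part_def Xs Bs t1 t2 t3 fst_conv snd_conv using True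
          by (simp add: inner_add_left ring_distribs)
      qed (simp add: heat_part_def flux_part_def X_def)
      then have "(\<integral>s. heat_part \<delta> \<phi> (X (s, z)) - B (s, z) \<bullet> flux_part \<delta> \<phi> (X (s, z)) \<partial>?S)
          = (\<integral>s. heat_part \<delta> ?\<psi> s \<partial>?S) - (\<integral>s. a s \<bullet> flux_part \<delta> ?\<psi> s \<partial>?S)"
        using j1 j2 by simp
      also have "\<dots> = - (\<integral>x. \<phi> 0 (x + tproj (r *\<^sub>R z)) \<partial>meas (m 0))"
        using aFP[OF tr(1)] by simp
      finally show ?thesis .
    qed
    have "(\<integral>p. heat_part \<delta> \<phi> (X p) \<partial>?M) - (\<integral>p. B p \<bullet> flux_part \<delta> \<phi> (X p) \<partial>?M)
        = (\<integral>p. (case p of (s, z) \<Rightarrow> heat_part \<delta> \<phi> (X (s, z)) - B (s, z) \<bullet> flux_part \<delta> \<phi> (X (s, z))) \<partial>?M)"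
      unfolding case_prod_beta' prod.collapse by (rule Bochner_Integration.integral_diff[OF i1 i2, symmetric])
    also have "\<dots> = (\<integral>z. (\<integral>s. heat_part \<delta> \<phi> (X (s, z)) - B (s, z) \<bullet> flux_part \<delta> \<phi> (X (s, z)) \<partial>?S) \<partial>?G)"
      by (rule SG.integral_snd[OF i, symmetric])
    also have "\<dots> = - (\<integral>z. (\<integral>x. \<phi> 0 (x + tproj (r *\<^sub>R z)) \<partial>meas (m 0)) \<partial>?G)"
      unfolding inner by simp
    also have "\<dots> = - (\<integral>x. \<phi> 0 x \<partial>meas (?m 0))"
    proof -
      obtain C where C: "\<And>t x. 0 \<le> t \<Longrightarrow> \<bar>exp (0 * t) * \<phi> t x\<bar> \<le> C" using test_function_bounded[OF \<phi>] by blast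
      have "(\<lambda>x. \<phi> 0 x) \<in> borel_measurable borel"
        using measurable_compose[OF measurable_Pair_torus[OF m, of "\<lambda>_. 0" 0] test_function_measurable[OF \<phi>]] by simp
      from integral_smear[OF this, of C "m 0" r] C[of 0] show ?thesis by (simp add: \<rho>_def)
    qed
    finally have "(\<integral>p. heat_part \<delta> \<phi> (X p) \<partial>?M) - (\<integral>p. B p \<bullet> flux_part \<delta> \<phi> (X p) \<partial>?M) = - (\<integral>x. \<phi> 0 x \<partial>meas (?m 0))" .
    moreover have "(\<integral>z. heat_part \<delta> \<phi> z \<partial>Sp \<delta> ?m) = (\<integral>p. heat_part \<delta> \<phi> (X p) \<partial>?M)"
      unfolding dX[symmetric] by (rule integral_distr[OF X measurable_heat_part[OF \<phi>]])
    moreover have "(\<integral>z. \<beta> z \<bullet> flux_part \<delta> \<phi> z \<partial>Sp \<delta> ?m) = (\<integral>p. B p \<bullet> flux_part \<delta> \<phi> (X p) \<partial>?M)"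
      by (rule \<beta>lin[OF measurable_flux_part[OF \<phi>] C2])
    ultimately show "(\<integral>x. \<phi> 0 x \<partial>meas (?m 0)) + (\<integral>z. heat_part \<delta> \<phi> z \<partial>Sp \<delta> ?m) - (\<integral>z. \<beta> z \<bullet> flux_part \<delta> \<phi> z \<partial>Sp \<delta> ?m) = 0"
      by simp
  qed (use m' \<beta>2 in auto)
  \<comment> \<open>Both error terms carry the weight \<open>exp (- t)\<close>, whose discounted integral is at most one.\<close>
  define e where "e s = exp (- max 0 (fst s))" for s :: "real \<times> 'n torus"
  have em [measurable]: "e \<in> borel_measurable borel" unfolding e_def by measurable
  have e01: "0 \<le> e s" "e s \<le> 1" for s by (auto simp: e_def)
  have E1: "(\<integral>t. disc \<delta> t * exp (- max 0 t) \<partial>lborel) \<le> 1" and iE1: "integrable lborel (\<lambda>t. disc \<delta> t * exp (- max 0 t))"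
  proof -
    have "disc \<delta> t * exp (- max 0 t) = disc (1 + \<delta>) t" for t
      by (auto simp: disc_def max_def algebra_simps simp flip: exp_add)
    then show "(\<integral>t. disc \<delta> t * exp (- max 0 t) \<partial>lborel) \<le> 1" "integrable lborel (\<lambda>t. disc \<delta> t * exp (- max 0 t))"
      using integral_disc[of "1 + \<delta>"] integrable_disc[of "1 + \<delta>"] \<delta> by auto
  qed
  have ie: "integrable ?S e"
    by (rule integrable_Sp_bounded[OF m \<delta> em, of 1]) (use e01 in auto)
  have IE: "(\<integral>s. e s \<partial>?S) \<le> 1"
  proof -
    have "(\<integral>s. e s \<partial>?S) = (\<integral>t. disc \<delta> t * (\<integral>x. e (t, x) \<partial>meas (m t)) \<partial>lborel)"
      by (rule integral_spacetime[OF m _ _ _ ie]) auto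
    also have "\<dots> = (\<integral>t. disc \<delta> t * exp (- max 0 t) \<partial>lborel)"
      by (simp add: e_def prob_space.prob_space[OF prob_space_meas])
    finally show ?thesis using E1 by simp
  qed
  have iea: "integrable ?S (\<lambda>s. e s * (norm (a s))\<^sup>2)"
  proof (rule integrable_dominated[OF a2])
    show "AE s in ?S. norm (e s * (norm (a s))\<^sup>2) \<le> norm ((norm (a s))\<^sup>2)"
      using e01 by (auto intro!: AE_I2 mult_left_le_one_le simp: abs_mult)
  qed measurable
  let ?A = "\<integral>s. e s * (norm (a s))\<^sup>2 \<partial>?S"
  have A0: "0 \<le> ?A" by (rule integral_nonneg_AE) (use e01 in auto)
  let ?err = "\<lambda>p. 32 * K ^ 3 * (r * ((e (fst p) + e (fst p) * (norm (a (fst p)))\<^sup>2) * norm (snd p) + e (fst p) * (4 * (norm (snd p)) ^ 3)))"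
  have p1: "integrable ?M (\<lambda>p. (e (fst p) + e (fst p) * (norm (a (fst p)))\<^sup>2) * norm (snd p))"
    and q1: "(\<integral>p. (e (fst p) + e (fst p) * (norm (a (fst p)))\<^sup>2) * norm (snd p) \<partial>?M) = ((\<integral>s. e s \<partial>?S) + ?A) * ?g1"
    using integrable_pair_mult[OF fS G.finite_measure_axioms Bochner_Integration.integrable_add[OF ie iea] integrable_gauss_norm]
      integral_pair_mult[OF fS G.finite_measure_axioms Bochner_Integration.integrable_add[OF ie iea] integrable_gauss_norm]
      ie iea by (auto simp: gauss_moment_def)
  have p3: "integrable ?M (\<lambda>p. e (fst p) * (4 * (norm (snd p)) ^ 3))"
    and q3: "(\<integral>p. e (fst p) * (4 * (norm (snd p)) ^ 3) \<partial>?M) = (\<integral>s. e s \<partial>?S) * (4 * ?g3)"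
    using integrable_pair_mult[OF fS G.finite_measure_axioms ie integrable_mult_right[OF integrable_gauss_norm3, of 4]]
      integral_pair_mult[OF fS G.finite_measure_axioms ie integrable_mult_right[OF integrable_gauss_norm3, of 4]]
    by (auto simp: gauss_moment_def)
  have ierr: "integrable ?M ?err" using p1 p3 by simp
  have iLa: "integrable ?S (\<lambda>s. L (snd s) (a s))" by (rule integrable_L_Sp[OF a \<delta>])
  have iLaM: "integrable ?M (\<lambda>p. L (snd (fst p)) (a (fst p)))"
    and qLaM: "(\<integral>p. L (snd (fst p)) (a (fst p)) \<partial>?M) = (\<integral>s. L (snd s) (a s) \<partial>?S)"
    using integrable_pair_mult[OF fS G.finite_measure_axioms iLa, of "\<lambda>_. 1"]
      integral_pair_mult[OF fS G.finite_measure_axioms iLa, of "\<lambda>_. 1"] G.prob_space by auto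
  have K3: "0 \<le> 32 * K ^ 3" using K1 by simp
  have "(\<integral>p. L (snd (X p)) (B p) \<partial>?M) \<le> (\<integral>p. L (snd (fst p)) (a (fst p)) + ?err p \<partial>?M)"
  proof (rule integral_mono)
    show "integrable ?M (\<lambda>p. L (snd (X p)) (B p))"
      by (rule integrable_L[OF fM measurable_compose[OF X borel_snd] Bm B2])
    show "integrable ?M (\<lambda>p. L (snd (fst p)) (a (fst p)) + ?err p)" using iLaM ierr by simp
    fix p :: "(real \<times> 'n torus) \<times> (real^'n)"
    let ?h = "\<rho> (fst (fst p)) * norm (snd p)"
    have d: "dist (snd (fst p)) (snd (X p)) \<le> ?h"
      using dist_torus_shift_le[of "snd (fst p)" "\<rho> (fst (fst p)) *\<^sub>R snd p"] \<rho>0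
      by (simp add: X_def dist_commute)
    have n: "norm (a (fst p) - B p) \<le> ?h" using \<rho>0 by (simp add: B_def)
    have \<rho>e: "\<rho> (fst (fst p)) = r * e (fst p)" by (simp add: \<rho>_def e_def)
    have "?h * (1 + (norm (a (fst p)))\<^sup>2 + ?h\<^sup>2) \<le>
        r * ((e (fst p) + e (fst p) * (norm (a (fst p)))\<^sup>2) * norm (snd p) + e (fst p) * (4 * (norm (snd p)) ^ 3))"
    proof -
      have "(r * e (fst p))\<^sup>2 \<le> 2\<^sup>2" using \<rho>0[of "fst (fst p)"] r unfolding \<rho>e[symmetric] by (intro power_mono) auto
      then have "(r * e (fst p) * norm (snd p)) * ((r * e (fst p))\<^sup>2 * (norm (snd p))\<^sup>2) \<le> (r * e (fst p) * norm (snd p)) * (4 * (norm (snd p))\<^sup>2)"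
        using r e01 by (intro mult_left_mono mult_right_mono) auto
      then show ?thesis unfolding \<rho>e by (simp add: power_mult_distrib power2_eq_square power3_eq_cube algebra_simps)
    qed
    from mult_left_mono[OF this K3] L_perturb[OF d n]
    show "L (snd (X p)) (B p) \<le> L (snd (fst p)) (a (fst p)) + ?err p" by linarith
  qed
  also have "\<dots> = (\<integral>s. L (snd s) (a s) \<partial>?S) + 32 * K ^ 3 * (r * (((\<integral>s. e s \<partial>?S) + ?A) * ?g1 + (\<integral>s. e s \<partial>?S) * (4 * ?g3)))"
    using iLaM p1 p3 q1 q3 qLaM by simp
  also have "\<dots> \<le> (\<integral>s. L (snd s) (a s) \<partial>?S) + 32 * K ^ 3 * (r * ((?g1 + 4 * ?g3) * (1 + ?A)))"
  proof -
    have "((\<integral>s. e s \<partial>?S) + ?A) * ?g1 + (\<integral>s. e s \<partial>?S) * (4 * ?g3) \<le> (1 + ?A) * ?g1 + 1 * (4 * ?g3)"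
      using IE gauss_moment_nonneg[of 1, where 'n='n] gauss_moment_nonneg[of 3, where 'n='n]
      by (intro add_mono mult_right_mono) auto
    also have "\<dots> \<le> (?g1 + 4 * ?g3) * (1 + ?A)"
      using A0 gauss_moment_nonneg[of 3, where 'n='n] by (simp add: algebra_simps)
    finally show ?thesis using K3 r by (intro add_left_mono mult_left_mono) auto
  qed
  finally have LL: "(\<integral>z. L (snd z) (\<beta> z) \<partial>Sp \<delta> ?m) \<le> (\<integral>s. L (snd s) (a s) \<partial>?S) + 32 * K ^ 3 * (r * ((?g1 + 4 * ?g3) * (1 + ?A)))"
    using \<beta>L by linarith
  have "(\<integral>t. disc \<delta> t * \<F> (?m t) \<partial>lborel) \<le> (\<integral>t. disc \<delta> t * \<F> (m t) + K * r * ?g1 * (disc \<delta> t * exp (- max 0 t)) \<partial>lborel)"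
  proof (rule integral_mono[OF integrable_F_path[OF m' \<delta>]])
    show "integrable lborel (\<lambda>t. disc \<delta> t * \<F> (m t) + K * r * ?g1 * (disc \<delta> t * exp (- max 0 t)))"
      using integrable_F_path[OF m \<delta>] iE1 by simp
    fix t
    have "\<F> (?m t) \<le> \<F> (m t) + K * dist (?m t) (m t)" using F_Lip[of "?m t" "m t"] by linarith
    also have "\<dots> \<le> \<F> (m t) + K * (\<rho> t * ?g1)"
      using dist_smear_le[of "m t" "\<rho> t" "m t" 0] \<rho>0[of t] K1 by (intro add_left_mono mult_left_mono) (auto simp: smear_0)
    finally have "disc \<delta> t * \<F> (?m t) \<le> disc \<delta> t * (\<F> (m t) + K * (\<rho> t * ?g1))" by (rule mult_left_mono) simp
    then show "disc \<delta> t * \<F> (?m t) \<le> disc \<delta> t * \<F> (m t) + K * r * ?g1 * (disc \<delta> t * exp (- max 0 t))"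
      by (simp add: \<rho>r algebra_simps)
  qed
  also have "\<dots> = (\<integral>t. disc \<delta> t * \<F> (m t) \<partial>lborel) + K * r * ?g1 * (\<integral>t. disc \<delta> t * exp (- max 0 t) \<partial>lborel)"
    using integrable_F_path[OF m \<delta>] iE1 by simp
  also have "\<dots> \<le> (\<integral>t. disc \<delta> t * \<F> (m t) \<partial>lborel) + K * r * ?g1 * (1 + ?A)"
    using E1 A0 K1 r gauss_moment_nonneg[of 1, where 'n='n] by (intro add_left_mono mult_left_mono mult_nonneg_nonneg) auto
  finally have FF: "(\<integral>t. disc \<delta> t * \<F> (?m t) \<partial>lborel) \<le> (\<integral>t. disc \<delta> t * \<F> (m t) \<partial>lborel) + K * r * ?g1 * (1 + ?A)" .
  have "J \<delta> ?m \<beta> \<le> J \<delta> m a + smear_const * r * (1 + ?A)"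
    unfolding cost_eq_run_cost[OF adm \<delta>] integral_run_cost[OF adm \<delta>] cost_eq_run_cost[OF a \<delta>] integral_run_cost[OF a \<delta>]
      smear_const_def using LL FF by (simp add: algebra_simps)
  moreover have "?m 0 = smear (m 0) r" by (simp add: \<rho>_def)
  ultimately show ?thesis using that[OF adm] unfolding e_def by blast
qed

end

section \<open>Dynamic programming\<close>

text \<open>The logistic function \<open>1 / (1 + exp (- n (t - T)))\<close> is a smooth approximation of the indicator of
  \<open>t > T\<close>, and multiplying by it keeps test functions.\<close>

definition logistic :: "real \<Rightarrow> real" where "logistic s = 1 / (1 + exp (- s))"

lemma logistic_bounds: "0 < logistic s" "logistic s < 1"
  unfolding logistic_def by (auto simp: add_pos_pos)

lemma DERIV_logistic: "(logistic has_real_derivative logistic s * (1 - logistic s)) (at s)"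
proof -
  have p: "1 + exp (- s) \<noteq> 0" using exp_gt_zero[of "- s"] by linarith
  have "((\<lambda>s. 1 / (1 + exp (- s))) has_real_derivative exp (- s) / (1 + exp (- s))\<^sup>2) (at s)"
    using p by (auto intro!: derivative_eq_intros simp: power2_eq_square)
  moreover have "exp (- s) / (1 + exp (- s))\<^sup>2 = logistic s * (1 - logistic s)"
    using p by (simp add: logistic_def power2_eq_square field_simps)
  ultimately show ?thesis unfolding logistic_def[abs_def] by simp
qed

lemma DERIV_logistic_scaled:
  "((\<lambda>t. logistic (n * (t - T))) has_real_derivative n * (logistic (n * (t - T)) * (1 + (-1) * logistic (n * (t - T))))) (at t)"
proof -
  have "((\<lambda>t. n * (t - T)) has_real_derivative n) (at t)" by (auto intro!: derivative_eq_intros)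
  from DERIV_chain2[OF DERIV_logistic this] show ?thesis by (simp add: mult.commute)
qed

lemma continuous_logistic: "continuous_on A logistic"
  using DERIV_logistic by (intro DERIV_continuous_on[where D="\<lambda>s. logistic s * (1 - logistic s)"])
    (rule has_field_derivative_at_within)

lemma measurable_logistic [measurable]: "logistic \<in> borel_measurable borel"
  by (rule borel_measurable_continuous_onI[OF continuous_logistic])

lemma logistic_limits: "(logistic \<longlongrightarrow> 1) at_top" "(logistic \<longlongrightarrow> 0) at_bot"
  unfolding logistic_def by real_asymp+

lemma
  shows integrable_logistic_density: "integrable lborel (\<lambda>s. logistic s * (1 - logistic s))"
    and integral_logistic_density: "(\<integral>s. logistic s * (1 - logistic s) \<partial>lborel) = 1"
proof -
  have c: "isCont (\<lambda>s. logistic s * (1 - logistic s)) s" for s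
    using continuous_logistic[of UNIV] by (auto intro!: continuous_intros simp: continuous_on_eq_continuous_at)
  have lims: "((logistic \<circ> real_of_ereal) \<longlongrightarrow> 0) (at_right (-\<infinity>))" "((logistic \<circ> real_of_ereal) \<longlongrightarrow> 1) (at_left \<infinity>)"
    using logistic_limits by (simp_all add: ereal_tendsto_simps)
  have nn: "AE x in lborel. -\<infinity> < ereal x \<longrightarrow> ereal x < \<infinity> \<longrightarrow> 0 \<le> logistic x * (1 - logistic x)"
    using logistic_bounds by (intro AE_I2 impI mult_nonneg_nonneg) (auto simp: less_imp_le)
  have "set_integrable lborel (einterval (-\<infinity>) \<infinity>) (\<lambda>s. logistic s * (1 - logistic s))"
    by (rule interval_integral_FTC_nonneg(1)[OF _ DERIV_logistic c nn lims]) auto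
  then show "integrable lborel (\<lambda>s. logistic s * (1 - logistic s))" by (simp add: set_integrable_def)
  have "(LBINT x=-\<infinity>..\<infinity>. logistic x * (1 - logistic x)) = 1 - 0"
    by (rule interval_integral_FTC_nonneg(2)[OF _ DERIV_logistic c nn lims]) auto
  then show "(\<integral>s. logistic s * (1 - logistic s) \<partial>lborel) = 1"
    by (simp add: interval_lebesgue_integral_def set_lebesgue_integral_def)
qed

text \<open>The time derivative of the cutoff \<open>logistic (n * (t - T))\<close> concentrates at \<open>T\<close> as \<open>n\<close> grows.\<close>

lemma logistic_approximate_identity:
  fixes h :: "real \<Rightarrow> real"
  assumes T: "0 < T" and h: "continuous_on {0..} h" and b: "\<And>t. 0 \<le> t \<Longrightarrow> \<bar>h t\<bar> \<le> C"
  shows "(\<lambda>k. \<integral>t. indicator {0..} t * (Suc k * (logistic (Suc k * (t - T)) * (1 - logistic (Suc k * (t - T))))) * h t \<partial>lborel)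
    \<longlonglongrightarrow> h T"
proof -
  let ?\<kappa> = "\<lambda>s. logistic s * (1 - logistic s)"
  have C: "0 \<le> C" using b[of 0] by linarith
  define h0 where "h0 t = indicator {0..} t * h t" for t
  have h0m [measurable]: "h0 \<in> borel_measurable borel"
  proof -
    have "h0 = (\<lambda>t. indicator {0..} t *\<^sub>R h t)" by (auto simp: h0_def)
    then show ?thesis using borel_measurable_continuous_on_indicator[OF _ h] by simp
  qed
  have h0b: "\<bar>h0 t\<bar> \<le> C" for t using b C by (auto simp: h0_def indicator_def)
  have \<kappa>0: "0 \<le> ?\<kappa> s" for s using logistic_bounds[of s] by (intro mult_nonneg_nonneg) auto
  have e: "(\<integral>t. indicator {0..} t * (Suc k * ?\<kappa> (Suc k * (t - T))) * h t \<partial>lborel) = (\<integral>s. ?\<kappa> s * h0 (T + s / Suc k) \<partial>lborel)" for k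
  proof -
    have "(\<integral>t. indicator {0..} t * (Suc k * ?\<kappa> (Suc k * (t - T))) * h t \<partial>lborel)
        = (\<integral>t. Suc k * ?\<kappa> (Suc k * (t - T)) * h0 t \<partial>lborel)"
      by (rule Lebesgue_integral_cong) (auto simp: h0_def)
    also have "\<dots> = \<bar>1 / Suc k\<bar> *\<^sub>R (\<integral>s. Suc k * ?\<kappa> (Suc k * ((T + 1 / Suc k * s) - T)) * h0 (T + 1 / Suc k * s) \<partial>lborel)"
      by (rule lborel_integral_real_affine) simp
    also have "\<dots> = (\<integral>s. ?\<kappa> s * h0 (T + s / Suc k) \<partial>lborel)"
    proof -
      have "real (Suc k) * ((T + 1 / real (Suc k) * s) - T) = s" for s by (simp del: of_nat_Suc)
      then show ?thesis by (simp del: of_nat_Suc add: mult.assoc)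
    qed
    finally show ?thesis .
  qed
  have "(\<lambda>k. \<integral>s. ?\<kappa> s * h0 (T + s / Suc k) \<partial>lborel) \<longlonglongrightarrow> (\<integral>s. ?\<kappa> s * h T \<partial>lborel)"
  proof (rule integral_dominated_convergence[where w="\<lambda>s. ?\<kappa> s * C"])
    show "integrable lborel (\<lambda>s. ?\<kappa> s * C)" using integrable_logistic_density by simp
    show "AE s in lborel. (\<lambda>k. ?\<kappa> s * h0 (T + s / Suc k)) \<longlonglongrightarrow> ?\<kappa> s * h T"
    proof (rule AE_I2)
      fix s :: real
      have l: "(\<lambda>k. T + s / Suc k) \<longlonglongrightarrow> T + 0"
        by (intro tendsto_intros) real_asymp
      have "isCont h T"
        by (rule continuous_on_interior[OF h]) (use T in simp)
      then have "(\<lambda>k. h (T + s / Suc k)) \<longlonglongrightarrow> h T" using l by (auto intro: isCont_tendsto_compose)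
      moreover have "\<forall>\<^sub>F k in sequentially. h (T + s / Suc k) = h0 (T + s / Suc k)"
        using order_tendstoD(1)[OF l, of 0] T by (auto elim!: eventually_mono simp: h0_def)
      ultimately have "(\<lambda>k. h0 (T + s / Suc k)) \<longlonglongrightarrow> h T" by (rule Lim_transform_eventually)
      then show "(\<lambda>k. ?\<kappa> s * h0 (T + s / Suc k)) \<longlonglongrightarrow> ?\<kappa> s * h T" by (intro tendsto_intros)
    qed
    show "AE s in lborel. norm (?\<kappa> s * h0 (T + s / Suc k)) \<le> ?\<kappa> s * C" for k
    proof (rule AE_I2)
      fix s
      have "norm (?\<kappa> s * h0 (T + s / Suc k)) = ?\<kappa> s * \<bar>h0 (T + s / Suc k)\<bar>"
        unfolding real_norm_def abs_mult[of "?\<kappa> s"] abs_of_nonneg[OF \<kappa>0] ..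
      also have "\<dots> \<le> ?\<kappa> s * C" by (rule mult_left_mono[OF h0b \<kappa>0])
      finally show "norm (?\<kappa> s * h0 (T + s / Suc k)) \<le> ?\<kappa> s * C" .
    qed
  qed auto
  then show ?thesis unfolding e using integral_logistic_density by simp
qed

lemma test_function_logistic:
  fixes \<phi> :: "real \<Rightarrow> 'n::finite torus \<Rightarrow> real" and n T :: real
  assumes \<phi>: "test_function \<phi>"
  defines "\<eta> \<equiv> \<lambda>t. logistic (n * (t - T))"
  shows "test_function (\<lambda>t x. \<eta> t * \<phi> t x)"
    and "time_deriv (\<lambda>t x. \<eta> t * \<phi> t x) t x = n * (\<eta> t * (1 - \<eta> t)) * \<phi> t x + \<eta> t * time_deriv \<phi> t x"
    and "tgrad (\<lambda>x. \<eta> t * \<phi> t x) x = \<eta> t *\<^sub>R tgrad (\<phi> t) x"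
    and "tlap (\<lambda>x. \<eta> t * \<phi> t x) x = \<eta> t * tlap (\<phi> t) x"
proof -
  have d: "(\<eta> has_real_derivative n * (\<eta> t * (1 + (-1) * \<eta> t))) (at t)" for t
    unfolding \<eta>_def by (rule DERIV_logistic_scaled)
  obtain T0 where T0: "\<And>t x. t \<ge> T0 \<Longrightarrow> \<phi> t x = 0" using \<phi> test_function_lift by blast
  show "test_function (\<lambda>t x. \<eta> t * \<phi> t x)"
    unfolding test_function_lift
  proof (intro conjI allI exI[of _ T0] impI)
    fix k
    have "lift (\<lambda>t x. \<eta> t * \<phi> t x) = (\<lambda>z. \<eta> (fst z) * lift \<phi> z)" by (auto simp: lift_def)
    moreover have "Ck k (lift \<phi>)" using \<phi> test_function_lift by blast
    ultimately show "Ck k (lift (\<lambda>t x. \<eta> t * \<phi> t x))" using Ck_mult[OF Ck_autonomous_time[OF d]] by simp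
  qed (simp add: T0)
  have t1: "tpd i (\<lambda>x. c * g x) x = c * tpd i g x"
    if "\<forall>y. (\<lambda>z. g (tproj z)) differentiable (at y)" for i c x and g :: "'n torus \<Rightarrow> real"
  proof -
    have "((\<lambda>s. g (x + tproj (s *\<^sub>R axis i 1))) has_real_derivative tpd i g x) (at 0)"
      using tpd_DERIV[OF that, of x i 0] by (simp add: tproj_zero)
    from DERIV_cmult[OF this, of c] show ?thesis unfolding tpd_def[of i "\<lambda>x. c * g x"] by (rule DERIV_imp_deriv)
  qed
  have sm: "\<forall>y. (\<lambda>z. \<psi> t (tproj z)) differentiable (at y)" if "test_function \<psi>" for \<psi> :: "real \<Rightarrow> 'n torus \<Rightarrow> real"
  proof
    fix y
    have "((\<lambda>z :: real^'n. (t, z)) has_derivative (\<lambda>h. (0, h))) (at y)" by (auto intro!: derivative_eq_intros)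
    from has_derivative_compose[OF this lift_has_derivative[OF that, where t=t and y=y]]
    show "(\<lambda>z. \<psi> t (tproj z)) differentiable (at y)" unfolding lift_def differentiable_def by auto
  qed
  show "tgrad (\<lambda>x. \<eta> t * \<phi> t x) x = \<eta> t *\<^sub>R tgrad (\<phi> t) x"
    unfolding tgrad_def by (simp add: t1[OF sm[OF \<phi>]] vec_eq_iff)
  have "tpd i (\<lambda>x. \<eta> t * \<phi> t x) = (\<lambda>x. \<eta> t * tpd i (\<phi> t) x)" for i using t1[OF sm[OF \<phi>]] by auto
  then show "tlap (\<lambda>x. \<eta> t * \<phi> t x) x = \<eta> t * tlap (\<phi> t) x"
    unfolding tlap_def by (simp add: t1[OF sm[OF test_function_tpd[OF \<phi>]]] sum_distrib_left)
  show "time_deriv (\<lambda>t x. \<eta> t * \<phi> t x) t x = n * (\<eta> t * (1 - \<eta> t)) * \<phi> t x + \<eta> t * time_deriv \<phi> t x"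
    unfolding time_deriv_def[of "\<lambda>t x. \<eta> t * \<phi> t x"]
    by (rule DERIV_imp_deriv) (use DERIV_mult[OF d DERIV_time_deriv[OF \<phi>]] in \<open>simp add: mult_ac add.commute\<close>)
qed

lemma AE_Sp_not_time:
  fixes m :: "real \<Rightarrow> 'n::finite tprob"
  assumes m: "continuous_on {0..} m" shows "AE z in Sp \<delta> m. fst z \<noteq> T"
proof -
  let ?f = "\<lambda>z :: real \<times> 'n torus. indicator {T} (fst z) :: ennreal"
  have f: "?f \<in> borel_measurable borel" by (rule measurable_compose[OF borel_fst]) simp
  have "(\<integral>\<^sup>+z. ?f z \<partial>Sp \<delta> m) = (\<integral>\<^sup>+t. ennreal (disc \<delta> t) * (\<integral>\<^sup>+x. ?f (t, x) \<partial>meas (m t)) \<partial>lborel)"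
    by (rule nn_integral_spacetime[OF m _ _ _ f]) auto
  also have "\<dots> = (\<integral>\<^sup>+t. 0 \<partial>(lborel :: real measure))"
  proof (rule nn_integral_cong_AE)
    show "AE t in lborel. ennreal (disc \<delta> t) * (\<integral>\<^sup>+x. ?f (t, x) \<partial>meas (m t)) = 0"
      using AE_lborel_singleton[of T] by eventually_elim simp
  qed
  finally have "(\<integral>\<^sup>+z. ?f z \<partial>Sp \<delta> m) = 0" by simp
  moreover have "sets (Sp \<delta> m) = sets borel" by (rule sets_spacetime[OF m]) auto
  then have "?f \<in> borel_measurable (Sp \<delta> m)" using f measurable_cong_sets[OF _ refl] by blast
  ultimately have "AE z in Sp \<delta> m. ?f z = 0" by (subst (asm) nn_integral_0_iff_AE) auto
  then show ?thesis by eventually_elim (auto simp: indicator_def split: if_splits)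
qed

lemma continuous_test_integral:
  fixes m :: "real \<Rightarrow> 'n::finite tprob"
  assumes \<phi>: "test_function \<phi>" and m: "continuous_on {0..} m"
  shows "continuous_on {0..} (\<lambda>t. \<integral>x. \<phi> t x \<partial>meas (m t))"
  unfolding continuous_on_def
proof
  fix s :: real assume s: "s \<in> {0..}"
  obtain C1 where C1: "\<And>t x. 0 \<le> t \<Longrightarrow> \<bar>exp (0 * t) * time_deriv \<phi> t x\<bar> \<le> C1"
    using test_function_bounded[OF test_function_time_deriv[OF \<phi>]] by blast
  obtain C0 where C0: "\<And>t x. 0 \<le> t \<Longrightarrow> \<bar>exp (0 * t) * \<phi> t x\<bar> \<le> C0" using test_function_bounded[OF \<phi>] by blast
  obtain C2 where C2: "\<And>z. norm (flux_part 0 \<phi> z) \<le> C2" using bounded_flux_part[OF \<phi>] by blast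
  have g: "norm (tgrad (\<phi> t) x) \<le> C2" if "0 \<le> t" for t x
    using C2[of "(t, x)"] that by (simp add: flux_part_def)
  have C2n: "0 \<le> C2" using C2[of "(0, 0)"] norm_ge_zero order_trans by blast
  have L: "C2-lipschitz_on UNIV (\<phi> s)"
  proof (rule lipschitz_on_torusI[OF _ C2n])
    fix y w :: "real^'n"
    have "((\<lambda>z. \<phi> s (tproj z)) has_derivative (\<lambda>h. h \<bullet> tgrad (\<phi> s) (tproj y))) (at y)" for y
    proof -
      have "((\<lambda>z. (s, z)) has_derivative (\<lambda>h. (0, h))) (at y)" by (auto intro!: derivative_eq_intros)
      from has_derivative_compose[OF this lift_has_derivative[OF \<phi>]] show ?thesis by (simp add: lift_def)
    qed
    moreover have "onorm (\<lambda>h. h \<bullet> tgrad (\<phi> s) (tproj y)) \<le> C2" for y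
    proof (rule onorm_le)
      fix h :: "real^'n"
      have "norm (h \<bullet> tgrad (\<phi> s) (tproj y)) \<le> norm h * norm (tgrad (\<phi> s) (tproj y))"
        by (simp add: Cauchy_Schwarz_ineq2)
      also have "\<dots> \<le> norm h * C2" using g s by (intro mult_left_mono) auto
      finally show "norm (h \<bullet> tgrad (\<phi> s) (tproj y)) \<le> C2 * norm h" by (simp add: mult.commute)
    qed
    ultimately have "norm (\<phi> s (tproj y) - \<phi> s (tproj w)) \<le> C2 * norm (y - w)"
      by (intro differentiable_bound[of UNIV "\<lambda>z. \<phi> s (tproj z)" "\<lambda>y h. h \<bullet> tgrad (\<phi> s) (tproj y)"]) auto
    then show "\<bar>\<phi> s (tproj y) - \<phi> s (tproj w)\<bar> \<le> C2 * norm (y - w)" by simp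
  qed
  have dt: "\<bar>\<phi> t x - \<phi> s x\<bar> \<le> C1 * \<bar>t - s\<bar>" if t: "0 \<le> t" for t x
  proof -
    have "norm (\<phi> t x - \<phi> s x) \<le> C1 * norm (t - s)"
    proof (rule field_differentiable_bound[of "{0..}" "\<lambda>t. \<phi> t x" "\<lambda>t. time_deriv \<phi> t x"])
      show "((\<lambda>t. \<phi> t x) has_field_derivative time_deriv \<phi> z x) (at z within {0..})" for z
        by (rule has_field_derivative_at_within[OF DERIV_time_deriv[OF \<phi>]])
      show "norm (time_deriv \<phi> z x) \<le> C1" if "z \<in> {0..}" for z using C1[of z x] that by simp
    qed (use s t in auto)
    then show ?thesis by simp
  qed
  have ms: "\<phi> t \<in> borel_measurable borel" for t
    using measurable_compose[OF measurable_Pair_torus[OF m, of "\<lambda>_. 0" t] test_function_measurable[OF \<phi>]] by simp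
  have ip: "integrable (meas \<mu>) (\<phi> t)" if "0 \<le> t" for t \<mu>
    by (rule integrable_bounded_torus[OF ms, of _ C0]) (use C0[OF that] in simp)
  have bd: "\<bar>(\<integral>x. \<phi> t x \<partial>meas (m t)) - (\<integral>x. \<phi> s x \<partial>meas (m s))\<bar> \<le> C1 * \<bar>t - s\<bar> + C2 * dist (m t) (m s)"
    if t: "0 \<le> t" for t
  proof -
    have "\<bar>(\<integral>x. \<phi> t x \<partial>meas (m t)) - (\<integral>x. \<phi> s x \<partial>meas (m t))\<bar> = \<bar>\<integral>x. \<phi> t x - \<phi> s x \<partial>meas (m t)\<bar>"
      using ip t s by simp
    also have "\<dots> \<le> (\<integral>x. \<bar>\<phi> t x - \<phi> s x\<bar> \<partial>meas (m t))" by (rule integral_abs_bound)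
    also have "\<dots> \<le> C1 * \<bar>t - s\<bar>"
      by (rule prob_space.integral_le_const[OF prob_space_meas]) (use ip t s dt in auto)
    finally show ?thesis using integral_diff_le_dist_tprob[OF L, of "m t" "m s"] by linarith
  qed
  have "((\<lambda>t. C1 * \<bar>t - s\<bar> + C2 * dist (m t) (m s)) \<longlongrightarrow> C1 * \<bar>s - s\<bar> + C2 * dist (m s) (m s)) (at s within {0..})"
    using m s unfolding continuous_on_def by (intro tendsto_intros) auto
  then have lim: "((\<lambda>t. C1 * \<bar>t - s\<bar> + C2 * dist (m t) (m s)) \<longlongrightarrow> 0) (at s within {0..})" by simp
  have "((\<lambda>t. (\<integral>x. \<phi> t x \<partial>meas (m t)) - (\<integral>x. \<phi> s x \<partial>meas (m s))) \<longlongrightarrow> 0) (at s within {0..})"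
  proof (rule Lim_null_comparison[OF _ lim])
    show "\<forall>\<^sub>F t in at s within {0..}. norm ((\<integral>x. \<phi> t x \<partial>meas (m t)) - (\<integral>x. \<phi> s x \<partial>meas (m s))) \<le> C1 * \<bar>t - s\<bar> + C2 * dist (m t) (m s)"
      unfolding eventually_at_filter by (intro always_eventually allI impI) (use bd in auto)
  qed
  then show "((\<lambda>t. \<integral>x. \<phi> t x \<partial>meas (m t)) \<longlongrightarrow> (\<integral>x. \<phi> s x \<partial>meas (m s))) (at s within {0..})"
    by (rule LIM_zero_cancel)
qed

text \<open>The weak equation prescribes the initial law at time \<open>0\<close> only. Testing with a smooth cutoff of the past
  and letting it become sharp produces the term at the new initial time.\<close>

lemma shift_admissible:
  fixes m :: "real \<Rightarrow> 'n::finite tprob"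
  assumes a: "spacetime_admissible \<delta> m a" and \<delta>: "0 < \<delta>" and T: "0 < T"
  shows "spacetime_admissible \<delta> (\<lambda>t. m (t + T)) (\<lambda>z. a (shift T z))"
proof -
  note m = spacetime_admissibleD(1)[OF a] and am [measurable] = spacetime_admissibleD(2)[OF a] and a2 = spacetime_admissibleD(3)[OF a]
    and aFP = spacetime_admissibleD(4)[OF a]
  let ?S = "Sp \<delta> m"
  let ?ST = "Sp \<delta> (\<lambda>t. m (t + T))"
  note T0 = less_imp_le[OF T]
  have m': "continuous_on {0..} (\<lambda>t. m (t + T))"
    by (rule continuous_on_compose2[OF m]) (use T in \<open>auto intro!: continuous_intros\<close>)
  have sm [measurable]: "(\<lambda>z. a (shift T z)) \<in> borel_measurable borel"
    by (rule measurable_compose[OF measurable_shift am])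
  have nm: "(\<lambda>z. (norm (a z))\<^sup>2) \<in> borel_measurable borel" by measurable
  have a2': "integrable ?ST (\<lambda>z. (norm (a (shift T z)))\<^sup>2)"
    using integrable_Sp_split[OF m T0 \<delta> nm] a2 by blast
  note msS = measurable_cong_sets[OF Sp_facts(1)[OF m \<delta>] refl]
  note msT = measurable_cong_sets[OF Sp_facts(1)[OF m' \<delta>] refl]
  show ?thesis
    unfolding spacetime_admissible_def
  proof (intro conjI allI impI)
    fix \<phi> :: "real \<Rightarrow> 'n torus \<Rightarrow> real" assume \<phi>: "test_function \<phi>"
    let ?\<psi> = "\<lambda>t. \<phi> (t - T)"
    have \<psi>: "test_function ?\<psi>" using test_function_shift[OF \<phi>, of "- T"] by simp
    \<comment> \<open>The shifted test function is not supported after \<open>T\<close>; the cutoff removes its past in the limit.\<close>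
    let ?\<eta> = "\<lambda>k t. logistic (real (Suc k) * (t - T))"
    let ?\<psi>k = "\<lambda>k t x. ?\<eta> k t * ?\<psi> t x"
    note tl = test_function_logistic[OF \<psi>]
    note [measurable] = measurable_heat_part[OF \<phi>] measurable_flux_part[OF \<phi>] measurable_heat_part[OF \<psi>] measurable_flux_part[OF \<psi>]
    obtain C1 where C1: "\<And>z. \<bar>heat_part \<delta> ?\<psi> z\<bar> \<le> C1" using bounded_heat_part[OF \<psi>] by blast
    obtain C2 where C2: "\<And>z. norm (flux_part \<delta> ?\<psi> z) \<le> C2" using bounded_flux_part[OF \<psi>] by blast
    obtain C0 where C0: "\<And>t x. 0 \<le> t \<Longrightarrow> \<bar>exp (\<delta> * t) * ?\<psi> t x\<bar> \<le> C0" using test_function_bounded[OF \<psi>] by blast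
    obtain C0' where C0': "\<And>t x. 0 \<le> t \<Longrightarrow> \<bar>exp (0 * t) * ?\<psi> t x\<bar> \<le> C0'" using test_function_bounded[OF \<psi>] by blast
    define f where "f z = heat_part \<delta> ?\<psi> z - a z \<bullet> flux_part \<delta> ?\<psi> z" for z
    have i1: "integrable ?S (heat_part \<delta> ?\<psi>)"
      by (rule integrable_Sp_bounded[OF m \<delta> measurable_heat_part[OF \<psi>] C1])
    have i2: "integrable ?S (\<lambda>z. a z \<bullet> flux_part \<delta> ?\<psi> z)"
      by (rule integrable_inner_bounded[OF Sp_facts(3)[OF m \<delta>] _ _ a2 C2]) (auto simp: msS)
    have fi: "integrable ?S f" unfolding f_def using i1 i2 by simp
    have fm [measurable]: "f \<in> borel_measurable borel" unfolding f_def by measurable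
    define p where "p z = (if 0 \<le> fst z then exp (\<delta> * fst z) * ?\<psi> (fst z) (snd z) else 0)" for z :: "real \<times> 'n torus"
    have pm [measurable]: "p \<in> borel_measurable borel"
      unfolding p_def using test_function_measurable[OF \<psi>] by measurable
    have pb: "\<bar>p z\<bar> \<le> C0" for z using C0[of "fst z" "snd z"] order_trans[OF abs_ge_zero C0[of 0 0]] by (auto simp: p_def)
    have \<eta>01: "0 \<le> ?\<eta> k t" "?\<eta> k t \<le> 1" for k t
      using logistic_bounds[of "real (Suc k) * (t - T)"] by linarith+
    let ?n = "\<lambda>k t. Suc k * (?\<eta> k t * (1 - ?\<eta> k t))"
    have ident: "heat_part \<delta> (?\<psi>k k) z - a z \<bullet> flux_part \<delta> (?\<psi>k k) z = ?n k (fst z) * p z + ?\<eta> k (fst z) * f z" for k z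
      unfolding heat_part_def flux_part_def f_def p_def tl by (simp add: algebra_simps)
    have nb: "\<bar>?n k t * p z\<bar> \<le> Suc k * C0" for k t z
    proof -
      have "\<bar>?\<eta> k t * (1 - ?\<eta> k t)\<bar> \<le> 1"
        using logistic_bounds[of "real (Suc k) * (t - T)"] by (auto simp: abs_mult intro!: mult_le_one)
      then have "\<bar>?n k t\<bar> \<le> Suc k" by (simp add: abs_mult mult_left_le)
      then show ?thesis unfolding abs_mult using pb by (intro mult_mono) auto
    qed
    have in1: "integrable ?S (\<lambda>z. ?n k (fst z) * p z)" for k
      by (rule integrable_Sp_bounded[OF m \<delta> _ nb]) measurable
    have in2: "integrable ?S (\<lambda>z. ?\<eta> k (fst z) * f z)" for k
    proof (rule integrable_dominated[OF fi])
      show "AE z in ?S. norm (?\<eta> k (fst z) * f z) \<le> norm (f z)"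
        using \<eta>01 by (intro AE_I2) (simp add: abs_mult mult_left_le_one_le)
    qed (simp add: msS)
    have eq: "?\<eta> k 0 * (\<integral>x. \<phi> (- T) x \<partial>meas (m 0)) + (\<integral>z. ?n k (fst z) * p z \<partial>?S) + (\<integral>z. ?\<eta> k (fst z) * f z \<partial>?S) = 0" for k
    proof -
      obtain D1 where D1: "\<And>z. \<bar>heat_part \<delta> (?\<psi>k k) z\<bar> \<le> D1" using bounded_heat_part[OF tl(1)] by blast
      obtain D2 where D2: "\<And>z. norm (flux_part \<delta> (?\<psi>k k) z) \<le> D2" using bounded_flux_part[OF tl(1)] by blast
      have j1: "integrable ?S (heat_part \<delta> (?\<psi>k k))"
        by (rule integrable_Sp_bounded[OF m \<delta> measurable_heat_part[OF tl(1)] D1])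
      have j2: "integrable ?S (\<lambda>z. a z \<bullet> flux_part \<delta> (?\<psi>k k) z)"
        by (rule integrable_inner_bounded[OF Sp_facts(3)[OF m \<delta>] _ _ a2 D2])
           (use measurable_flux_part[OF tl(1)] in \<open>auto simp: msS\<close>)
      have "(\<integral>z. heat_part \<delta> (?\<psi>k k) z \<partial>?S) - (\<integral>z. a z \<bullet> flux_part \<delta> (?\<psi>k k) z \<partial>?S)
          = (\<integral>z. ?n k (fst z) * p z + ?\<eta> k (fst z) * f z \<partial>?S)"
        unfolding ident[symmetric] by (rule Bochner_Integration.integral_diff[OF j1 j2, symmetric])
      also have "\<dots> = (\<integral>z. ?n k (fst z) * p z \<partial>?S) + (\<integral>z. ?\<eta> k (fst z) * f z \<partial>?S)"
        using in1 in2 by (rule Bochner_Integration.integral_add)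
      finally show ?thesis using aFP[OF tl(1)[of "real (Suc k)" T]] by (simp add: algebra_simps)
    qed
    have l1: "(\<lambda>k. ?\<eta> k 0 * (\<integral>x. \<phi> (- T) x \<partial>meas (m 0))) \<longlonglongrightarrow> 0 * (\<integral>x. \<phi> (- T) x \<partial>meas (m 0))"
    proof (intro tendsto_intros filterlim_compose[OF logistic_limits(2)])
      show "filterlim (\<lambda>k. real (Suc k) * (0 - T)) at_bot sequentially" using T by real_asymp
    qed
    have l2: "(\<lambda>k. \<integral>z. ?n k (fst z) * p z \<partial>?S) \<longlonglongrightarrow> (\<integral>x. \<phi> 0 x \<partial>meas (m T))"
    proof -
      define h where "h t = (\<integral>x. ?\<psi> t x \<partial>meas (m t))" for t
      have "(\<integral>z. ?n k (fst z) * p z \<partial>?S) = (\<integral>t. indicator {0..} t * ?n k t * h t \<partial>lborel)" for k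
      proof -
        have "(\<integral>z. ?n k (fst z) * p z \<partial>?S) = (\<integral>t. disc \<delta> t * (\<integral>x. ?n k (fst (t, x)) * p (t, x) \<partial>meas (m t)) \<partial>lborel)"
          by (rule integral_spacetime[OF m _ _ _ in1]) auto
        also have "\<dots> = (\<integral>t. indicator {0..} t * ?n k t * h t \<partial>lborel)"
        proof (rule Lebesgue_integral_cong[OF refl])
          fix t :: real
          show "disc \<delta> t * (\<integral>x. ?n k (fst (t, x)) * p (t, x) \<partial>meas (m t)) = indicator {0..} t * ?n k t * h t"
          proof (cases "0 \<le> t")
            case True
            define c where "c = ?n k t"
            have "(\<integral>x. c * p (t, x) \<partial>meas (m t)) = c * (exp (\<delta> * t) * h t)"
              using True by (simp add: p_def h_def)
            then show ?thesis
              using True unfolding fst_conv c_def[symmetric] by (simp add: disc_def exp_minus field_simps)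
          qed (simp add: disc_def)
        qed
        finally show ?thesis .
      qed
      moreover have "(\<lambda>k. \<integral>t. indicator {0..} t * ?n k t * h t \<partial>lborel) \<longlonglongrightarrow> h T"
      proof (rule logistic_approximate_identity[OF T])
        show "\<bar>h t\<bar> \<le> C0'" if t: "0 \<le> t" for t
        proof -
          interpret prob_space "meas (m t)" by (rule prob_space_meas)
          have ps: "(\<lambda>x. ?\<psi> t x) \<in> borel_measurable borel"
            using measurable_compose[OF measurable_Pair_torus[OF m, of "\<lambda>_. 0" t] test_function_measurable[OF \<psi>]] by simp
          have ip: "integrable (meas (m t)) (\<lambda>x. ?\<psi> t x)"
            by (rule integrable_bounded_torus[OF ps, of C0']) (use C0'[OF t] in simp)
          have "\<bar>h t\<bar> \<le> (\<integral>x. \<bar>?\<psi> t x\<bar> \<partial>meas (m t))" unfolding h_def by (rule integral_abs_bound)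
          also have "\<dots> \<le> C0'" by (rule integral_le_const) (use ip C0'[OF t] in auto)
          finally show ?thesis .
        qed
        show "continuous_on {0..} h"
          unfolding h_def by (rule continuous_test_integral[OF \<psi> m])
      qed
      ultimately show ?thesis by (simp add: h_def)
    qed
    have l3: "(\<lambda>k. \<integral>z. ?\<eta> k (fst z) * f z \<partial>?S) \<longlonglongrightarrow> (\<integral>z. indicator {T<..} (fst z) * f z \<partial>?S)"
    proof (rule integral_dominated_convergence[where w="\<lambda>z. \<bar>f z\<bar>"])
      show "AE z in ?S. (\<lambda>k. ?\<eta> k (fst z) * f z) \<longlonglongrightarrow> indicator {T<..} (fst z) * f z"
        using AE_Sp_not_time[OF m, where \<delta>=\<delta> and T=T]
      proof eventually_elim
        case (elim z)
        have "(\<lambda>k. ?\<eta> k (fst z)) \<longlonglongrightarrow> indicator {T<..} (fst z)"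
        proof (cases "T < fst z")
          case True
          have "filterlim (\<lambda>k. real (Suc k) * (fst z - T)) at_top sequentially" using True by real_asymp
          from filterlim_compose[OF logistic_limits(1) this] True show ?thesis by simp
        next
          case False
          with elim have F: "fst z < T" by simp
          have "filterlim (\<lambda>k. real (Suc k) * (fst z - T)) at_bot sequentially" using F by real_asymp
          from filterlim_compose[OF logistic_limits(2) this] F show ?thesis by simp
        qed
        then show ?case by (intro tendsto_intros)
      qed
      show "AE z in ?S. norm (?\<eta> k (fst z) * f z) \<le> \<bar>f z\<bar>" for k
        using \<eta>01 by (intro AE_I2) (simp add: abs_mult mult_left_le_one_le)
    qed (use fi in \<open>auto simp: msS\<close>)
    have f3: "(\<integral>z. indicator {T<..} (fst z) * f z \<partial>?S) = (\<integral>z. heat_part \<delta> \<phi> z \<partial>?ST) - (\<integral>z. a (shift T z) \<bullet> flux_part \<delta> \<phi> z \<partial>?ST)"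
    proof -
      let ?F = "\<lambda>z :: real \<times> 'n torus. indicator {T<..} (fst z) * f z"
      have Fm: "?F \<in> borel_measurable borel" by measurable
      have Fi: "integrable ?S ?F"
        by (rule integrable_dominated[OF fi]) (auto simp: msS indicator_def)
      have z1: "(\<integral>z. ?F z \<partial>spacetime (disc_until \<delta> T) m) = 0"
      proof -
        have "AE z in spacetime (disc_until \<delta> T) m. fst z < T"
          by (rule AE_spacetime_time[OF m]) (auto simp: disc_until_def indicator_def split: if_splits)
        then have "AE z in spacetime (disc_until \<delta> T) m. ?F z = 0" by eventually_elim auto
        then show ?thesis by (rule integral_eq_zero_AE)
      qed
      have D: "integrable ?ST (heat_part \<delta> \<phi>)" "integrable ?ST (\<lambda>z. a (shift T z) \<bullet> flux_part \<delta> \<phi> z)"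
      proof -
        obtain D1 where D1: "\<And>z. \<bar>heat_part \<delta> \<phi> z\<bar> \<le> D1" using bounded_heat_part[OF \<phi>] by blast
        obtain D2 where D2: "\<And>z. norm (flux_part \<delta> \<phi> z) \<le> D2" using bounded_flux_part[OF \<phi>] by blast
        show "integrable ?ST (heat_part \<delta> \<phi>)"
          by (rule integrable_Sp_bounded[OF m' \<delta> measurable_heat_part[OF \<phi>] D1])
        show "integrable ?ST (\<lambda>z. a (shift T z) \<bullet> flux_part \<delta> \<phi> z)"
          by (rule integrable_inner_bounded[OF Sp_facts(3)[OF m' \<delta>] _ _ a2' D2]) (auto simp: msT)
      qed
      have "(\<integral>z. ?F (shift T z) \<partial>?ST) = (\<integral>z. exp (\<delta> * T) * (heat_part \<delta> \<phi> z - a (shift T z) \<bullet> flux_part \<delta> \<phi> z) \<partial>?ST)"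
      proof (rule integral_cong_AE)
        have "AE z in ?ST. 0 \<le> fst z"
          by (rule AE_spacetime_time[OF m']) (auto simp: disc_def split: if_splits)
        then show "AE z in ?ST. ?F (shift T z) = exp (\<delta> * T) * (heat_part \<delta> \<phi> z - a (shift T z) \<bullet> flux_part \<delta> \<phi> z)"
          using AE_Sp_not_time[OF m', where \<delta>=\<delta> and T=0]
        proof eventually_elim
          case (elim z)
          have "heat_part \<delta> ?\<psi> (shift T z) = exp (\<delta> * T) * heat_part \<delta> \<phi> z"
            "flux_part \<delta> ?\<psi> (shift T z) = exp (\<delta> * T) *\<^sub>R flux_part \<delta> \<phi> z"
            using heat_flux_shift[of z T \<delta> ?\<psi>] elim T by simp_all
          then show ?case using elim by (simp add: f_def algebra_simps)
        qed
        show "(\<lambda>z. ?F (shift T z)) \<in> borel_measurable ?ST"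
          unfolding msT by (rule measurable_compose[OF measurable_shift Fm])
      qed (unfold msT, measurable)
      also have "\<dots> = exp (\<delta> * T) * ((\<integral>z. heat_part \<delta> \<phi> z \<partial>?ST) - (\<integral>z. a (shift T z) \<bullet> flux_part \<delta> \<phi> z \<partial>?ST))"
        using D by simp
      finally have "exp (- \<delta> * T) * (\<integral>z. ?F (shift T z) \<partial>?ST) = (\<integral>z. heat_part \<delta> \<phi> z \<partial>?ST) - (\<integral>z. a (shift T z) \<bullet> flux_part \<delta> \<phi> z \<partial>?ST)"
        by (simp add: exp_minus)
      then show ?thesis unfolding integral_Sp_split[OF m T0 \<delta> Fm Fi] z1 by simp
    qed
    have "(\<lambda>k. 0) \<longlonglongrightarrow> 0 * (\<integral>x. \<phi> (- T) x \<partial>meas (m 0)) + (\<integral>x. \<phi> 0 x \<partial>meas (m T)) + (\<integral>z. indicator {T<..} (fst z) * f z \<partial>?S)"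
      using tendsto_add[OF tendsto_add[OF l1 l2] l3] unfolding eq .
    then have "(\<integral>x. \<phi> 0 x \<partial>meas (m T)) + (\<integral>z. indicator {T<..} (fst z) * f z \<partial>?S) = 0"
      using LIMSEQ_unique[OF tendsto_const] by fastforce
    then show "(\<integral>x. \<phi> 0 x \<partial>meas (m (0 + T))) + (\<integral>z. heat_part \<delta> \<phi> z \<partial>?ST) - (\<integral>z. a (shift T z) \<bullet> flux_part \<delta> \<phi> z \<partial>?ST) = 0"
      unfolding f3 by simp
  qed (use m' a2' in auto)
qed

section \<open>Estimates uniform in the discount\<close>

lemma integral_disc_until_le:
  assumes "0 < \<delta>" "0 \<le> \<tau>" shows "(\<integral>t. disc_until \<delta> \<tau> t \<partial>lborel) \<le> \<tau>"
proof -
  have "(\<integral>t. disc_until \<delta> \<tau> t \<partial>lborel) \<le> (\<integral>t. indicator {0..\<tau>} t \<partial>lborel)"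
  proof (rule integral_mono[OF integrable_disc_until[OF assms(1)]])
    show "disc_until \<delta> \<tau> t \<le> indicator {0..\<tau>} t" for t
      using assms by (auto simp: disc_until_def disc_def indicator_def)
    show "integrable lborel (indicator {0..\<tau>} :: real \<Rightarrow> real)"
      by (rule integrable_real_indicator) (use assms in auto)
  qed
  then show ?thesis using assms by simp
qed

lemma path_eq_smear:
  fixes x1 :: "'w \<Rightarrow> 'n::finite torus" and v :: "'w \<Rightarrow> real^'n"
  assumes D: "drifted_particle P x1 (\<lambda>\<omega>. (1 / \<tau>) *\<^sub>R v \<omega>) V" and \<tau>: "0 < \<tau>"
    and v: "v \<in> borel_measurable P"
  shows "drifted_particle.path P x1 (\<lambda>\<omega>. (1 / \<tau>) *\<^sub>R v \<omega>) \<tau> = smear (law P (\<lambda>\<omega>. x1 \<omega> + tproj (v \<omega>))) (sqrt (2 * \<tau>))"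
proof -
  interpret D: drifted_particle P x1 "\<lambda>\<omega>. (1 / \<tau>) *\<^sub>R v \<omega>" V by (rule D)
  note [measurable] = v
  let ?X0 = "\<lambda>\<omega>. x1 \<omega> + tproj (v \<omega>)"
  let ?G = "gauss :: (real^'n) measure"
  have X0 [measurable]: "?X0 \<in> borel_measurable P" by measurable
  have "meas (law P ?X0) \<Otimes>\<^sub>M ?G = distr P borel ?X0 \<Otimes>\<^sub>M distr ?G ?G (\<lambda>z. z)"
    by (simp add: meas_law[OF D.P.prob_space_axioms X0] distr_id)
  also have "\<dots> = distr (P \<Otimes>\<^sub>M ?G) (borel \<Otimes>\<^sub>M ?G) (\<lambda>(\<omega>, z). (?X0 \<omega>, z))"
  proof (rule pair_measure_distr)
    show "sigma_finite_measure (distr ?G ?G (\<lambda>z. z))" by (simp add: distr_id D.G.sigma_finite_measure_axioms)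
  qed auto
  finally have e: "meas (law P ?X0) \<Otimes>\<^sub>M ?G = distr (P \<Otimes>\<^sub>M ?G) (borel \<Otimes>\<^sub>M ?G) (\<lambda>(\<omega>, z). (?X0 \<omega>, z))" .
  have "distr (meas (law P ?X0) \<Otimes>\<^sub>M ?G) borel (\<lambda>p. fst p + tproj (sqrt (2 * \<tau>) *\<^sub>R snd p))
      = distr (P \<Otimes>\<^sub>M ?G) borel (D.pos \<tau>)"
    unfolding e
  proof (subst distr_distr)
    show "(\<lambda>p. fst p + tproj (sqrt (2 * \<tau>) *\<^sub>R snd p)) \<in> borel_measurable (borel \<Otimes>\<^sub>M ?G)" by measurable
    show "(\<lambda>(\<omega>, z). (?X0 \<omega>, z)) \<in> P \<Otimes>\<^sub>M ?G \<rightarrow>\<^sub>M borel \<Otimes>\<^sub>M ?G" by measurable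
    show "distr (P \<Otimes>\<^sub>M ?G) borel ((\<lambda>p. fst p + tproj (sqrt (2 * \<tau>) *\<^sub>R snd p)) \<circ> (\<lambda>(\<omega>, z). (?X0 \<omega>, z)))
      = distr (P \<Otimes>\<^sub>M ?G) borel (D.pos \<tau>)"
      by (rule distr_cong) (use \<tau> in \<open>auto simp: D.pos_def tproj_add add.assoc\<close>)
  qed
  then show ?thesis unfolding smear_def D.path_def law_def by simp
qed

context control_problem
begin

abbreviation val :: "real \<Rightarrow> 'n tprob \<Rightarrow> real" where "val \<equiv> value_fun H \<F>"

lemma run_cost_ge: "- 2 * K \<le> run_cost m a t"
proof -
  have "- K \<le> (\<integral>x. L x (a (t, x)) \<partial>meas (m t))"
  proof (cases "integrable (meas (m t)) (\<lambda>x. L x (a (t, x)))")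
    case True
    then show ?thesis by (rule prob_space.integral_ge_const[OF prob_space_meas]) (use L_ge in auto)
  qed (use K1 in \<open>simp add: not_integrable_integral_eq\<close>)
  then show ?thesis using F_bound[of "m t"] by (simp add: run_cost_def)
qed

lemma value_upper:
  assumes \<delta>: "0 < \<delta>" shows "val \<delta> \<mu> \<le> 2 * K / \<delta>"
proof -
  obtain m where m: "spacetime_admissible \<delta> m (\<lambda>_. 0)" "m 0 = \<mu>" using heat_flow_admissible[OF \<delta>] by blast
  have "run_cost m (\<lambda>_. 0) t \<le> 2 * K" for t
  proof -
    have "(\<integral>x. L x 0 \<partial>meas (m t)) \<le> K"
    proof (cases "integrable (meas (m t)) (\<lambda>x. L x 0)")
      case True
      then show ?thesis
        by (rule prob_space.integral_le_const[OF prob_space_meas]) (use L_upper[of _ 0] in auto)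
    qed (use K1 in \<open>simp add: not_integrable_integral_eq\<close>)
    then show ?thesis using F_bound[of "m t"] by (simp add: run_cost_def)
  qed
  then have "(\<integral>t. disc \<delta> t * run_cost m (\<lambda>_. 0) t \<partial>lborel) \<le> (\<integral>t. disc \<delta> t * (2 * K) \<partial>lborel)"
    using integrable_disc[OF \<delta>] by (intro integral_mono integrable_run_cost[OF m(1) \<delta>] mult_left_mono) auto
  then have "cost H \<F> \<delta> m (\<lambda>t x. 0) \<le> 2 * K / \<delta>"
    using cost_eq_run_cost[OF m(1) \<delta>] integral_disc[OF \<delta>] by simp
  then show ?thesis using value_le_cost[OF m(1) \<delta>] m(2) by simp
qed

lemma admissible_exists: "0 < \<delta> \<Longrightarrow> \<exists>m a. spacetime_admissible \<delta> m a \<and> m 0 = \<mu>"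
  using heat_flow_admissible by blast

lemma value_lower:
  assumes \<delta>: "0 < \<delta>" shows "- (2 * K) / \<delta> \<le> val \<delta> \<mu>"
proof (rule field_le_epsilon)
  fix e :: real assume e: "0 < e"
  obtain m a where ma: "spacetime_admissible \<delta> m a" "J \<delta> m a < val \<delta> \<mu> + e"
    using value_approx[OF \<delta> e admissible_exists[OF \<delta>, of \<mu>]] by metis
  then show "- (2 * K) / \<delta> \<le> val \<delta> \<mu> + e" using cost_lower[OF ma(1) \<delta>] by linarith
qed

lemma discount_loss:
  assumes \<delta>: "0 < \<delta>" and T: "0 \<le> T" and u: "u \<le> 2 * K / \<delta>"
  shows "(1 - exp (- \<delta> * T)) * u \<le> 2 * K * T"
proof -
  have e: "0 \<le> 1 - exp (- \<delta> * T)" "1 - exp (- \<delta> * T) \<le> \<delta> * T"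
    using \<delta> T exp_ge_add_one_self[of "- \<delta> * T"] by auto
  have "(1 - exp (- \<delta> * T)) * u \<le> (1 - exp (- \<delta> * T)) * (2 * K / \<delta>)" by (rule mult_left_mono[OF u e(1)])
  also have "\<dots> \<le> \<delta> * T * (2 * K / \<delta>)" using K1 \<delta> by (intro mult_right_mono[OF e(2)]) auto
  also have "\<dots> = 2 * K * T" using \<delta> by simp
  finally show ?thesis .
qed

text \<open>The dynamic programming inequality bounds the cost accumulated up to time \<open>T\<close> by the oscillation
  of the value function and a multiple of \<open>T\<close>, uniformly in the discount.\<close>

lemma cost_until_le:
  assumes a: "spacetime_admissible \<delta> m a" and \<delta>: "0 < \<delta>" and T: "0 < T"
    and osc: "\<And>\<mu> \<nu>. val \<delta> \<mu> - val \<delta> \<nu> \<le> R" and opt: "J \<delta> m a \<le> val \<delta> (m 0) + 1"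
  shows "(\<integral>t. disc_until \<delta> T t * (run_cost m a t + 2 * K) \<partial>lborel) \<le> 1 + R + 4 * K * T"
proof -
  note sh = shift_admissible[OF a \<delta> T]
  note ir = integrable_run_cost[OF a \<delta>]
  have h1: "J \<delta> m a = (\<integral>t. disc_until \<delta> T t * run_cost m a t \<partial>lborel)
      + exp (- \<delta> * T) * cost H \<F> \<delta> (\<lambda>t. m (t + T)) (\<lambda>t x. a (shift T (t, x)))"
    unfolding cost_eq_run_cost[OF a \<delta>] integral_disc_split[OF ir less_imp_le[OF T]] cost_eq_run_cost[OF sh \<delta>]
    by (simp add: run_cost_def)
  have h2: "exp (- \<delta> * T) * val \<delta> (m T) \<le> exp (- \<delta> * T) * cost H \<F> \<delta> (\<lambda>t. m (t + T)) (\<lambda>t x. a (shift T (t, x)))"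
    using value_le_cost[OF sh \<delta>] by (intro mult_left_mono) auto
  have h3: "(1 - exp (- \<delta> * T)) * val \<delta> (m T) \<le> 2 * K * T"
    by (rule discount_loss[OF \<delta> less_imp_le[OF T] value_upper[OF \<delta>]])
  have 1: "(\<integral>t. disc_until \<delta> T t * run_cost m a t \<partial>lborel) \<le> 1 + R + 2 * K * T"
    using opt osc[of "m 0" "m T"] h1 h2 h3[unfolded left_diff_distrib mult_1_left] by linarith
  have "(\<integral>t. disc_until \<delta> T t * (run_cost m a t + 2 * K) \<partial>lborel) = (\<integral>t. disc_until \<delta> T t * run_cost m a t \<partial>lborel)
      + 2 * K * (\<integral>t. disc_until \<delta> T t \<partial>lborel)"
    using integrable_disc_until_mult[OF ir less_imp_le[OF T]] integrable_disc_until[OF \<delta>, of T]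
    by (simp add: distrib_left mult.commute)
  also have "2 * K * (\<integral>t. disc_until \<delta> T t \<partial>lborel) \<le> 2 * K * T"
    using K1 integral_disc_until_le[OF \<delta> less_imp_le[OF T]] by (intro mult_left_mono) auto
  finally show ?thesis using 1 by simp
qed

lemma nn_integral_exp_tail: "(\<integral>\<^sup>+s. ennreal (exp (- s)) * indicator {t..} s \<partial>lborel) = ennreal (exp (- t))" for t :: real
proof -
  have "(\<integral>\<^sup>+s. ennreal (exp (- s)) * indicator {t..} s \<partial>lborel) = ennreal (0 - (- exp (- t)))"
  proof (rule nn_integral_FTC_atLeast)
    show "((\<lambda>s :: real. - exp (- s)) \<longlongrightarrow> 0) at_top" by real_asymp
    show "((\<lambda>s. - exp (- s)) has_real_derivative exp (- x)) (at x)" for x :: real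
      by (auto intro!: derivative_eq_intros)
  qed auto
  then show ?thesis by simp
qed

text \<open>Averaging the previous bound over \<open>T\<close> with weight \<open>exp (- T)\<close> controls the kinetic energy on
  bounded times.\<close>

lemma early_energy_le:
  assumes a: "spacetime_admissible \<delta> m a" and \<delta>: "0 < \<delta>"
    and osc: "\<And>\<mu> \<nu>. val \<delta> \<mu> - val \<delta> \<nu> \<le> R" and opt: "J \<delta> m a \<le> val \<delta> (m 0) + 1"
  shows "(\<integral>z. exp (- max 0 (fst z)) * (norm (a z))\<^sup>2 \<partial>Sp \<delta> m) \<le> 4 * K * (1 + R + 8 * K)"
proof -
  note m = spacetime_admissibleD(1)[OF a] and am [measurable] = spacetime_admissibleD(2)[OF a] and a2 = spacetime_admissibleD(3)[OF a]
  note ms = measurable_cong_sets[OF Sp_facts(1)[OF m \<delta>] refl]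
  interpret S: finite_measure "Sp \<delta> m" by (rule Sp_facts(3)[OF m \<delta>])
  have R: "0 \<le> R" using osc[of \<mu> \<mu> for \<mu>] by simp
  define g where "g t = disc \<delta> t * (run_cost m a t + 2 * K)" for t
  have g0: "0 \<le> g t" for t using run_cost_ge[of m a t] by (simp add: g_def)
  have gi: "integrable lborel g"
    unfolding g_def distrib_left using integrable_run_cost[OF a \<delta>] integrable_disc[OF \<delta>] by simp
  have gm [measurable]: "g \<in> borel_measurable borel" using borel_measurable_integrable[OF gi] by simp
  have G: "(\<integral>\<^sup>+t. ennreal (g t) * indicator {t..} s \<partial>lborel) \<le> ennreal (1 + R + 4 * K * (s + 1))" if s: "0 \<le> s" for s
  proof -
    let ?u = "\<lambda>t. disc_until \<delta> (s + 1) t * (run_cost m a t + 2 * K)"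
    have u: "?u t = indicator {..<s + 1} t * g t" for t by (simp add: disc_until_def g_def)
    have ui: "integrable lborel ?u"
      unfolding u using integrable_mult_indicator[OF _ gi, of "{..<s + 1}"] by simp
    have "(\<integral>\<^sup>+t. ennreal (g t) * indicator {t..} s \<partial>lborel) \<le> (\<integral>\<^sup>+t. ennreal (?u t) \<partial>lborel)"
      unfolding u by (rule nn_integral_mono) (auto simp: indicator_def)
    also have "\<dots> = ennreal (\<integral>t. ?u t \<partial>lborel)"
      by (rule nn_integral_eq_integral[OF ui]) (simp add: u g0)
    also have "\<dots> \<le> ennreal (1 + R + 4 * K * (s + 1))"
      by (rule ennreal_leI) (rule cost_until_le[OF a \<delta> _ osc opt], use s in simp)
    finally show ?thesis .
  qed
  have iT: "{p. fst p \<le> snd p} \<in> sets ((lborel :: real measure) \<Otimes>\<^sub>M (lborel :: real measure))"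
  proof -
    have "closed {p :: real \<times> real. fst p \<le> snd p}" by (intro closed_Collect_le continuous_intros)
    moreover have "sets ((lborel :: real measure) \<Otimes>\<^sub>M (lborel :: real measure)) = sets borel"
      unfolding borel_prod[symmetric] by (rule sets_pair_measure_cong) simp_all
    ultimately show ?thesis by (simp only: borel_closed)
  qed
  \<comment> \<open>Write \<open>exp (- t)\<close> as the integral of \<open>exp (- s)\<close> over \<open>s \<ge> t\<close> and exchange the integrals.\<close>
  have "(\<integral>\<^sup>+t. ennreal (g t) * ennreal (exp (- t)) \<partial>lborel)
      = (\<integral>\<^sup>+t. \<integral>\<^sup>+s. ennreal (g t) * (ennreal (exp (- s)) * indicator {t..} s) \<partial>lborel \<partial>lborel)"
    by (simp add: nn_integral_cmult nn_integral_exp_tail)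
  also have "\<dots> = (\<integral>\<^sup>+s. \<integral>\<^sup>+t. ennreal (g t) * (ennreal (exp (- s)) * indicator {t..} s) \<partial>lborel \<partial>lborel)"
  proof (rule lborel_pair.Fubini'[symmetric])
    have "(\<lambda>p. ennreal (g (fst p)) * (ennreal (exp (- snd p)) * indicator {p. fst p \<le> snd p} p))
        \<in> borel_measurable ((lborel :: real measure) \<Otimes>\<^sub>M (lborel :: real measure))"
      using iT by measurable
    moreover have "(\<lambda>p. ennreal (g (fst p)) * (ennreal (exp (- snd p)) * indicator {p. fst p \<le> snd p} p))
        = (\<lambda>(t, s). ennreal (g t) * (ennreal (exp (- s)) * indicator {t..} s))"
      by (auto simp: indicator_def)
    ultimately show "(\<lambda>(t, s). ennreal (g t) * (ennreal (exp (- s)) * indicator {t..} s))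
        \<in> borel_measurable ((lborel :: real measure) \<Otimes>\<^sub>M (lborel :: real measure))" by simp
  qed
  also have "\<dots> \<le> (\<integral>\<^sup>+s. ennreal (1 + R + 4 * K) * (ennreal (s ^ 0 * exp (- s)) * indicator {0..} s)
      + ennreal (4 * K) * (ennreal (s ^ 1 * exp (- s)) * indicator {0..} s) \<partial>lborel)"
  proof (rule nn_integral_mono)
    fix s :: real
    show "(\<integral>\<^sup>+t. ennreal (g t) * (ennreal (exp (- s)) * indicator {t..} s) \<partial>lborel) \<le>
      ennreal (1 + R + 4 * K) * (ennreal (s ^ 0 * exp (- s)) * indicator {0..} s)
      + ennreal (4 * K) * (ennreal (s ^ 1 * exp (- s)) * indicator {0..} s)"
    proof (cases "0 \<le> s")
      case True
      have "(\<integral>\<^sup>+t. ennreal (g t) * (ennreal (exp (- s)) * indicator {t..} s) \<partial>lborel)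
          = (\<integral>\<^sup>+t. ennreal (exp (- s)) * (ennreal (g t) * indicator {t..} s) \<partial>lborel)"
        by (simp add: mult_ac)
      also have "\<dots> = ennreal (exp (- s)) * (\<integral>\<^sup>+t. ennreal (g t) * indicator {t..} s \<partial>lborel)"
      proof (rule nn_integral_cmult)
        have "(\<lambda>t. ennreal (g t) * indicator {..s} t) \<in> borel_measurable lborel" by measurable
        moreover have "(\<lambda>t. ennreal (g t) * indicator {..s} t) = (\<lambda>t. ennreal (g t) * indicator {t..} s)"
          by (auto simp: indicator_def)
        ultimately show "(\<lambda>t. ennreal (g t) * indicator {t..} s) \<in> borel_measurable lborel" by simp
      qed
      also have "\<dots> \<le> ennreal (exp (- s)) * ennreal (1 + R + 4 * K * (s + 1))" by (rule mult_left_mono[OF G[OF True]]) simp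
      also have "\<dots> = ennreal ((1 + R + 4 * K) * exp (- s) + 4 * K * (s * exp (- s)))"
        by (simp add: ennreal_mult'[symmetric] algebra_simps)
      also have "\<dots> = ennreal (1 + R + 4 * K) * ennreal (exp (- s)) + ennreal (4 * K) * ennreal (s * exp (- s))"
        using True R K1 by (simp add: ennreal_plus ennreal_mult)
      finally show ?thesis using True by simp
    next
      case False
      have z: "ennreal (g t) * (ennreal (exp (- s)) * indicator {t..} s) = 0" for t
        using False by (cases "t < 0") (auto simp: g_def indicator_def)
      show ?thesis by (simp only: z nn_integral_const mult_zero_left zero_le)
    qed
  qed
  also have "\<dots> = ennreal (1 + R + 4 * K) * 1 + ennreal (4 * K) * 1"
    using nn_intergal_power_times_exp_Ici[of 0] nn_intergal_power_times_exp_Ici[of 1]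
    by (subst nn_integral_add) (auto simp: nn_integral_cmult)
  also have "\<dots> = ennreal (1 + R + 8 * K)" using R K1 by (simp flip: ennreal_plus)
  finally have N: "(\<integral>\<^sup>+t. ennreal (g t * exp (- t)) \<partial>lborel) \<le> ennreal (1 + R + 8 * K)"
    using g0 by (simp add: ennreal_mult)
  have gei: "integrable lborel (\<lambda>t. g t * exp (- t))"
    using N g0 by (intro integrableI_nonneg) (auto simp: le_less_trans[OF N])
  have E: "(\<integral>t. g t * exp (- t) \<partial>lborel) \<le> 1 + R + 8 * K"
  proof -
    have "ennreal (\<integral>t. g t * exp (- t) \<partial>lborel) \<le> ennreal (1 + R + 8 * K)"
      using N by (subst (asm) nn_integral_eq_integral[OF gei]) (simp_all add: g0)
    moreover have "0 \<le> 1 + R + 8 * K" using R K1 by simp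
    ultimately show ?thesis by (simp only: ennreal_le_iff)
  qed
  define e where "e z = exp (- max 0 (fst z))" for z :: "real \<times> 'n torus"
  have em [measurable]: "e \<in> borel_measurable borel" unfolding e_def by measurable
  have e01: "0 \<le> e z" "e z \<le> 1" for z by (auto simp: e_def)
  have iL: "integrable (Sp \<delta> m) (\<lambda>z. L (snd z) (a z))" by (rule integrable_L_Sp[OF a \<delta>])
  have ieL: "integrable (Sp \<delta> m) (\<lambda>z. e z * (L (snd z) (a z) + K))"
  proof (rule integrable_dominated)
    show "integrable (Sp \<delta> m) (\<lambda>z. L (snd z) (a z) + K)" using iL by simp
    show "AE z in Sp \<delta> m. norm (e z * (L (snd z) (a z) + K)) \<le> norm (L (snd z) (a z) + K)"
      using e01 by (intro AE_I2) (simp add: abs_mult mult_left_le_one_le)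
  qed (simp add: ms)
  have iea: "integrable (Sp \<delta> m) (\<lambda>z. e z * (norm (a z))\<^sup>2)"
  proof (rule integrable_dominated[OF a2])
    show "AE z in Sp \<delta> m. norm (e z * (norm (a z))\<^sup>2) \<le> norm ((norm (a z))\<^sup>2)"
      using e01 by (intro AE_I2) (simp add: abs_mult mult_left_le_one_le)
  qed (simp add: ms)
  have "(\<integral>z. e z * (norm (a z))\<^sup>2 \<partial>Sp \<delta> m) \<le> (\<integral>z. 4 * K * (e z * (L (snd z) (a z) + K)) \<partial>Sp \<delta> m)"
  proof (rule integral_mono[OF iea])
    show "integrable (Sp \<delta> m) (\<lambda>z. 4 * K * (e z * (L (snd z) (a z) + K)))" using ieL by simp
    fix z
    have "(norm (a z))\<^sup>2 \<le> 4 * K * (L (snd z) (a z) + K)"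
      using L_lower[of "a z" "snd z"] K1 by (simp add: field_simps)
    from mult_left_mono[OF this e01(1)[of z]]
    show "e z * (norm (a z))\<^sup>2 \<le> 4 * K * (e z * (L (snd z) (a z) + K))" by (simp add: mult_ac)
  qed
  also have "\<dots> = 4 * K * (\<integral>z. e z * (L (snd z) (a z) + K) \<partial>Sp \<delta> m)" by simp
  finally have energy: "(\<integral>z. e z * (norm (a z))\<^sup>2 \<partial>Sp \<delta> m) \<le> 4 * K * (\<integral>z. e z * (L (snd z) (a z) + K) \<partial>Sp \<delta> m)" .
  have "(\<integral>z. e z * (L (snd z) (a z) + K) \<partial>Sp \<delta> m)
      = (\<integral>t. disc \<delta> t * (\<integral>x. e (t, x) * (L (snd (t, x)) (a (t, x)) + K) \<partial>meas (m t)) \<partial>lborel)"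
    by (rule integral_spacetime[OF m _ _ _ ieL]) auto
  also have "\<dots> \<le> (\<integral>t. g t * exp (- t) \<partial>lborel)"
  proof (rule integral_mono_AE[OF _ gei])
    show "integrable lborel (\<lambda>t. disc \<delta> t * (\<integral>x. e (t, x) * (L (snd (t, x)) (a (t, x)) + K) \<partial>meas (m t)))"
      by (rule integrable_spacetimeD[OF m _ _ _ ieL]) auto
    have "AE t in lborel. disc \<delta> t \<noteq> 0 \<longrightarrow> integrable (meas (m t)) (\<lambda>x. L (snd (t, x)) (a (t, x)))"
      by (rule AE_integrable_spacetime[OF m _ _ _ iL]) auto
    then show "AE t in lborel. disc \<delta> t * (\<integral>x. e (t, x) * (L (snd (t, x)) (a (t, x)) + K) \<partial>meas (m t)) \<le> g t * exp (- t)"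
    proof eventually_elim
      case (elim t)
      show ?case
      proof (cases "disc \<delta> t = 0")
        case False
        then have t: "0 \<le> t" by (auto simp: disc_def split: if_splits)
        have iLt: "integrable (meas (m t)) (\<lambda>x. L x (a (t, x)))" using elim False by simp
        have "(\<integral>x. e (t, x) * (L (snd (t, x)) (a (t, x)) + K) \<partial>meas (m t)) = exp (- t) * ((\<integral>x. L x (a (t, x)) \<partial>meas (m t)) + K)"
          using t iLt prob_space.finite_measure[OF prob_space_meas, of "m t"]
          by (simp add: e_def finite_measure.integrable_const prob_space.prob_space[OF prob_space_meas])
        also have "\<dots> \<le> exp (- t) * (run_cost m a t + 2 * K)"
          using F_bound[of "m t"] by (intro mult_left_mono) (auto simp: run_cost_def)
        finally have "disc \<delta> t * (\<integral>x. e (t, x) * (L (snd (t, x)) (a (t, x)) + K) \<partial>meas (m t)) \<le> disc \<delta> t * (exp (- t) * (run_cost m a t + 2 * K))"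
          by (rule mult_left_mono) simp
        then show ?thesis by (simp add: g_def mult_ac)
      qed (simp add: g_def)
    qed
  qed
  also note E
  finally have "4 * K * (\<integral>z. e z * (L (snd z) (a z) + K) \<partial>Sp \<delta> m) \<le> 4 * K * (1 + R + 8 * K)"
    by (rule mult_left_mono) (use K1 in simp)
  with energy have "(\<integral>z. e z * (norm (a z))\<^sup>2 \<partial>Sp \<delta> m) \<le> 4 * K * (1 + R + 8 * K)" by (rule order_trans)
  then show ?thesis unfolding e_def .
qed

lemma smear_const_nonneg: "0 \<le> smear_const"
  unfolding smear_const_def using K1 gauss_moment_nonneg[of 1, where 'n='n] gauss_moment_nonneg[of 3, where 'n='n] by auto

text \<open>The running cost and the loss of discount during the steering phase give \<open>4 K\<close>. The number \<open>74\<close> is \<open>2 * 37\<close>: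
  the Gaussian displacement is \<open>sqrt (2 \<tau>) \<le> 2 sqrt \<tau>\<close>, and \<open>1 + 4 K (1 + R + 8 K) \<le> 37 K\<^sup>2 (1 + R)\<close>.\<close>

definition cmp_const :: real where "cmp_const = 4 * K + 74 * K\<^sup>2 * smear_const"

lemma cmp_const_pos: "0 < cmp_const"
  unfolding cmp_const_def using K1 smear_const_nonneg by (intro add_pos_nonneg) auto

text \<open>Comparison of the value at two measures joined by a coupling with displacement \<open>v\<close>: steer in time
  \<open>\<tau>\<close> to the heat flow at time \<open>\<tau>\<close> of the second measure, then follow a nearly optimal path from the
  second measure while undoing the Gaussian displacement.\<close>

lemma value_diff_le:
  assumes \<delta>: "0 < \<delta>" and osc: "\<And>\<mu> \<nu>. val \<delta> \<mu> - val \<delta> \<nu> \<le> R" and \<tau>: "0 < \<tau>" "\<tau> \<le> 1"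
    and P: "prob_space P" and x1 [measurable]: "x1 \<in> borel_measurable P" and v [measurable]: "v \<in> borel_measurable P"
    and V: "\<And>\<omega>. norm (v \<omega>) \<le> V"
  shows "val \<delta> (law P x1) - val \<delta> (law P (\<lambda>\<omega>. x1 \<omega> + tproj (v \<omega>)))
    \<le> cmp_const * ((\<integral>\<omega>. (norm (v \<omega>))\<^sup>2 \<partial>P) / \<tau> + sqrt \<tau> * (1 + R))"
proof -
  let ?\<mu>0 = "law P (\<lambda>\<omega>. x1 \<omega> + tproj (v \<omega>))"
  let ?c = "\<integral>\<omega>. (norm (v \<omega>))\<^sup>2 \<partial>P"
  have c0: "0 \<le> ?c" by (rule integral_nonneg_AE) auto
  have R: "0 \<le> R" using osc[of \<mu> \<mu> for \<mu>] by simp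
  have D: "drifted_particle P x1 (\<lambda>\<omega>. (1 / \<tau>) *\<^sub>R v \<omega>) (V / \<tau>)"
    by (intro drifted_particle.intro drifted_particle_axioms.intro P) (use V \<tau> in \<open>auto simp: divide_right_mono\<close>)
  \<comment> \<open>Standard deviation of the Gaussian part of the particle at time \<open>\<tau>\<close>.\<close>
  define r where "r = sqrt (2 * \<tau>)"
  have "r \<le> sqrt 4" unfolding r_def using \<tau> by (intro real_sqrt_le_mono) simp
  then have r2: "r \<le> 2" by simp
  have r: "0 \<le> r" "r \<le> 2 * sqrt \<tau>"
  proof -
    show "0 \<le> r" using \<tau> by (simp add: r_def)
    have "sqrt (2 * \<tau>) \<le> sqrt (4 * \<tau>)" using \<tau> by (intro real_sqrt_le_mono) simp
    then show "r \<le> 2 * sqrt \<tau>" by (simp add: r_def real_sqrt_mult)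
  qed
  have main: "val \<delta> (law P x1) \<le> val \<delta> ?\<mu>0 + cmp_const * (?c / \<tau> + sqrt \<tau> * (1 + R)) + \<epsilon>"
    if \<epsilon>: "0 < \<epsilon>" "\<epsilon> \<le> 1" for \<epsilon>
  proof -
    obtain m a where a: "spacetime_admissible \<delta> m a" "m 0 = ?\<mu>0" "J \<delta> m a < val \<delta> ?\<mu>0 + \<epsilon>"
      by (rule value_approx[OF \<delta> \<epsilon>(1) admissible_exists[OF \<delta>, of ?\<mu>0]])
    let ?A = "\<integral>z. exp (- max 0 (fst z)) * (norm (a z))\<^sup>2 \<partial>Sp \<delta> m"
    have A: "?A \<le> 4 * K * (1 + R + 8 * K)"
      by (rule early_energy_le[OF a(1) \<delta> osc]) (use a \<epsilon> in simp)
    obtain m2 b where b: "spacetime_admissible \<delta> m2 b" "m2 0 = smear (m 0) r"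
      "J \<delta> m2 b \<le> J \<delta> m a + smear_const * r * (1 + ?A)"
      by (rule cost_from_smeared[OF a(1) \<delta> r(1) r2])
    have m20: "m2 0 = drifted_particle.path P x1 (\<lambda>\<omega>. (1 / \<tau>) *\<^sub>R v \<omega>) \<tau>"
      unfolding path_eq_smear[OF D \<tau>(1) v] b(2) a(2) r_def ..
    obtain m3 d where d: "spacetime_admissible \<delta> m3 d" "m3 0 = law P x1"
      "J \<delta> m3 d \<le> K * \<tau> * (2 + (\<integral>\<omega>. (norm ((1 / \<tau>) *\<^sub>R v \<omega>))\<^sup>2 \<partial>P))
        + exp (- \<delta> * \<tau>) * J \<delta> m2 b"
      by (rule steering[OF D \<delta> \<tau>(1) b(1) m20])
    have 1: "K * \<tau> * (2 + (\<integral>\<omega>. (norm ((1 / \<tau>) *\<^sub>R v \<omega>))\<^sup>2 \<partial>P)) = 2 * K * \<tau> + K * (?c / \<tau>)"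
    proof -
      have "(norm ((1 / \<tau>) *\<^sub>R v \<omega>))\<^sup>2 = (norm (v \<omega>))\<^sup>2 / \<tau>\<^sup>2" for \<omega> by (simp add: power_divide)
      then have "(\<integral>\<omega>. (norm ((1 / \<tau>) *\<^sub>R v \<omega>))\<^sup>2 \<partial>P) = ?c / \<tau>\<^sup>2" by simp
      then show ?thesis using \<tau> by (simp add: power2_eq_square distrib_left)
    qed
    have 2: "exp (- \<delta> * \<tau>) * J \<delta> m2 b \<le> J \<delta> m2 b + 2 * K * \<tau>"
      using discount_loss[OF \<delta> less_imp_le[OF \<tau>(1)], of "- J \<delta> m2 b"] cost_lower[OF b(1) \<delta>]
      by (simp add: algebra_simps)
    have 3: "smear_const * r * (1 + ?A) \<le> 74 * K\<^sup>2 * smear_const * (sqrt \<tau> * (1 + R))"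
    proof -
      have K2: "1 \<le> K\<^sup>2" "K \<le> K\<^sup>2" using K1 mult_mono[of 1 K 1 K] mult_left_mono[of 1 K K] by (auto simp: power2_eq_square)
      have "4 * K * (1 + R + 8 * K) = 4 * K * (1 + R) + 32 * K\<^sup>2 * 1" by (simp add: algebra_simps power2_eq_square)
      also have "\<dots> \<le> 4 * K\<^sup>2 * (1 + R) + 32 * K\<^sup>2 * (1 + R)"
        using K2 R by (intro add_mono mult_right_mono mult_left_mono) auto
      also have "\<dots> = 36 * K\<^sup>2 * (1 + R)" by (simp add: algebra_simps)
      finally have "1 + ?A \<le> 1 + 36 * K\<^sup>2 * (1 + R)" using A by linarith
      moreover have "1 \<le> K\<^sup>2 * (1 + R)" using mult_mono[OF K2(1), of 1 "1 + R"] R by simp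
      ultimately have "1 + ?A \<le> 37 * K\<^sup>2 * (1 + R)" by linarith
      then have "smear_const * r * (1 + ?A) \<le> smear_const * r * (37 * K\<^sup>2 * (1 + R))"
        using smear_const_nonneg r by (intro mult_left_mono) auto
      also have "\<dots> \<le> smear_const * (2 * sqrt \<tau>) * (37 * K\<^sup>2 * (1 + R))"
        using smear_const_nonneg r R by (intro mult_right_mono mult_left_mono) auto
      also have "\<dots> = 74 * K\<^sup>2 * smear_const * (sqrt \<tau> * (1 + R))" by (simp add: algebra_simps)
      finally show ?thesis .
    qed
    have 4: "4 * K * \<tau> \<le> 4 * K * (sqrt \<tau> * (1 + R))"
    proof -
      have "\<tau> = sqrt \<tau> * sqrt \<tau>" using \<tau> by simp
      also have "\<dots> \<le> sqrt \<tau> * 1" using \<tau> by (intro mult_left_mono) auto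
      also have "\<dots> \<le> sqrt \<tau> * (1 + R)" using \<tau> R by (intro mult_left_mono) auto
      finally show ?thesis using K1 by simp
    qed
    have 5: "K * (?c / \<tau>) \<le> cmp_const * (?c / \<tau>)"
      using K1 smear_const_nonneg c0 \<tau> by (intro mult_right_mono) (auto simp: cmp_const_def intro: add_increasing2)
    have "val \<delta> (law P x1) \<le> J \<delta> m3 d" using value_le_cost[OF d(1) \<delta>] d(2) by simp
    also have "\<dots> \<le> K * (?c / \<tau>) + 4 * K * \<tau> + (val \<delta> ?\<mu>0 + \<epsilon> + smear_const * r * (1 + ?A))"
      using d(3) 1 2 b(3) a(3) by linarith
    also have "\<dots> \<le> val \<delta> ?\<mu>0 + cmp_const * (?c / \<tau> + sqrt \<tau> * (1 + R)) + \<epsilon>"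
      using 3 4 5 by (simp add: cmp_const_def algebra_simps)
    finally show ?thesis .
  qed
  have "val \<delta> (law P x1) \<le> val \<delta> ?\<mu>0 + cmp_const * (?c / \<tau> + sqrt \<tau> * (1 + R))"
  proof (rule field_le_epsilon)
    fix \<epsilon> :: real assume e: "0 < \<epsilon>"
    show "val \<delta> (law P x1) \<le> val \<delta> ?\<mu>0 + cmp_const * (?c / \<tau> + sqrt \<tau> * (1 + R)) + \<epsilon>"
      using main[of "min \<epsilon> 1"] e by auto
  qed
  then show ?thesis by simp
qed

end

section \<open>Couplings with small displacement\<close>

lemma nn_integral_finite_range:
  fixes g :: "'i \<Rightarrow> real"
  assumes J: "finite J" "\<And>x. c x \<in> J" and c [measurable]: "\<And>j. c -` {j} \<in> sets M" and M: "prob_space M"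
    and g: "\<And>j. 0 \<le> g j"
  shows "(\<integral>\<^sup>+x. ennreal (g (c x)) \<partial>M) = ennreal (\<Sum>j\<in>J. g j * measure M (c -` {j}))"
proof -
  interpret prob_space M by (rule M)
  have "ennreal (g (c x)) = (\<Sum>j\<in>J. ennreal (g j) * indicator (c -` {j}) x)" for x
  proof -
    have "(\<Sum>j\<in>J. ennreal (g j) * indicator (c -` {j}) x) = (\<Sum>j\<in>J. if c x = j then ennreal (g j) else 0)"
      by (rule sum.cong) (auto simp: indicator_def)
    then show ?thesis using J by (simp add: sum.delta')
  qed
  then have "(\<integral>\<^sup>+x. ennreal (g (c x)) \<partial>M) = (\<integral>\<^sup>+x. (\<Sum>j\<in>J. ennreal (g j) * indicator (c -` {j}) x) \<partial>M)" by simp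
  also have "\<dots> = (\<Sum>j\<in>J. \<integral>\<^sup>+x. ennreal (g j) * indicator (c -` {j}) x \<partial>M)"
    by (rule nn_integral_sum) measurable
  also have "\<dots> = (\<Sum>j\<in>J. ennreal (g j * measure M (c -` {j})))"
    by (rule sum.cong) (simp_all add: nn_integral_cmult_indicator emeasure_eq_measure ennreal_mult g)
  also have "\<dots> = ennreal (\<Sum>j\<in>J. g j * measure M (c -` {j}))"
    by (rule sum_ennreal) (simp add: g)
  finally show ?thesis .
qed

lemma marginals_of_density:
  assumes M: "prob_space M" and N: "prob_space N" and k [measurable]: "k \<in> borel_measurable (M \<Otimes>\<^sub>M N)"
    and 1: "AE x in M. (\<integral>\<^sup>+y. k (x, y) \<partial>N) = 1" and 2: "AE y in N. (\<integral>\<^sup>+x. k (x, y) \<partial>M) = 1"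
  shows "distr (density (M \<Otimes>\<^sub>M N) k) M fst = M" and "distr (density (M \<Otimes>\<^sub>M N) k) N snd = N"
proof -
  let ?P = "density (M \<Otimes>\<^sub>M N) k"
  interpret M: prob_space M by (rule M)
  interpret N: prob_space N by (rule N)
  interpret MN: pair_sigma_finite M N ..
  show "distr ?P M fst = M"
  proof (rule measure_eqI)
    fix A assume "A \<in> sets (distr ?P M fst)"
    then have A [measurable]: "A \<in> sets M" by simp
    have "emeasure (distr ?P M fst) A = (\<integral>\<^sup>+p. k p * indicator A (fst p) \<partial>(M \<Otimes>\<^sub>M N))"
      by (subst emeasure_distr) (auto simp: emeasure_density indicator_def intro!: nn_integral_cong)
    also have "\<dots> = (\<integral>\<^sup>+x. \<integral>\<^sup>+y. k (x, y) * indicator A x \<partial>N \<partial>M)"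
      by (subst N.nn_integral_fst[symmetric]) auto
    also have "\<dots> = (\<integral>\<^sup>+x. (\<integral>\<^sup>+y. k (x, y) \<partial>N) * indicator A x \<partial>M)"
      by (rule nn_integral_cong) (simp add: nn_integral_multc)
    also have "\<dots> = (\<integral>\<^sup>+x. indicator A x \<partial>M)"
      by (rule nn_integral_cong_AE) (use 1 in eventually_elim, simp)
    finally show "emeasure (distr ?P M fst) A = emeasure M A" by simp
  qed simp
  show "distr ?P N snd = N"
  proof (rule measure_eqI)
    fix A assume "A \<in> sets (distr ?P N snd)"
    then have A [measurable]: "A \<in> sets N" by simp
    have "emeasure (distr ?P N snd) A = (\<integral>\<^sup>+p. k p * indicator A (snd p) \<partial>(M \<Otimes>\<^sub>M N))"
      by (subst emeasure_distr) (auto simp: emeasure_density indicator_def intro!: nn_integral_cong)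
    also have "\<dots> = (\<integral>\<^sup>+y. \<integral>\<^sup>+x. k (x, y) * indicator A y \<partial>M \<partial>N)"
      by (subst MN.nn_integral_snd[symmetric]) auto
    also have "\<dots> = (\<integral>\<^sup>+y. (\<integral>\<^sup>+x. k (x, y) \<partial>M) * indicator A y \<partial>N)"
      by (rule nn_integral_cong) (simp add: nn_integral_multc)
    also have "\<dots> = (\<integral>\<^sup>+y. indicator A y \<partial>N)"
      by (rule nn_integral_cong_AE) (use 2 in eventually_elim, simp)
    finally show "emeasure (distr ?P N snd) A = emeasure N A" by simp
  qed simp
qed

lemma AE_cell_pos:
  assumes J: "finite J" "\<And>x. c x \<in> J" and c: "\<And>j. c -` {j} \<in> sets M" and M: "prob_space M"
  shows "AE x in M. 0 < measure M (c -` {c x})"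
proof -
  interpret prob_space M by (rule M)
  have "AE x in M. \<forall>j\<in>J. measure M (c -` {j}) = 0 \<longrightarrow> x \<notin> c -` {j}"
  proof (subst AE_finite_all[OF J(1)], intro ballI)
    fix j
    show "AE x in M. measure M (c -` {j}) = 0 \<longrightarrow> x \<notin> c -` {j}"
    proof (cases "measure M (c -` {j}) = 0")
      case True
      then have "c -` {j} \<in> null_sets M" using c by (auto simp: null_sets_def emeasure_eq_measure)
      from AE_not_in[OF this] show ?thesis by eventually_elim auto
    qed simp
  qed
  then show ?thesis
  proof eventually_elim
    case (elim x)
    then have "measure M (c -` {c x}) \<noteq> 0" using J(2)[of x] by auto
    then show ?case using measure_nonneg[of M "c -` {c x}"] by linarith
  qed
qed

text \<open>Within each cell of a partition as much mass as possible is coupled; the excess masses are coupled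
  independently. The cost is the squared diameter of the cells plus the total variation distance of
  the cell masses.\<close>

lemma cell_coupling:
  fixes \<mu> \<nu> :: "'n::finite tprob" and c :: "'n torus \<Rightarrow> 'i" and h e :: real
  assumes J: "finite J" "\<And>x. c x \<in> J" and c: "\<And>j. c -` {j} \<in> sets borel"
    and h: "\<And>x y. c x = c y \<Longrightarrow> (norm (cube_rep y - cube_rep x))\<^sup>2 \<le> h" "0 \<le> h"
    and d: "\<And>j. \<bar>measure (meas \<mu>) (c -` {j}) - measure (meas \<nu>) (c -` {j})\<bar> \<le> e"
  shows "\<exists>P :: ('n torus \<times> 'n torus) measure. prob_space P \<and> sets P = sets borel \<and>
    distr P borel fst = meas \<mu> \<and> distr P borel snd = meas \<nu> \<and>
    (\<integral>p. (norm (cube_rep (snd p) - cube_rep (fst p)))\<^sup>2 \<partial>P) \<le> h + (real CARD('n))\<^sup>2 * (card J * e)"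
proof -
  let ?M = "meas \<mu>" and ?N = "meas \<nu>"
  interpret M: prob_space ?M by (rule prob_space_meas)
  interpret N: prob_space ?N by (rule prob_space_meas)
  interpret MN: pair_sigma_finite ?M ?N ..
  interpret MNp: pair_prob_space ?M ?N ..
  define a where "a j = measure ?M (c -` {j})" for j
  define b where "b j = measure ?N (c -` {j})" for j
  define \<kappa> where "\<kappa> = (\<Sum>j\<in>J. max 0 (a j - b j))"
  define u where "u j = max 0 (a j - b j) / a j" for j
  define w where "w j = max 0 (b j - a j) / b j" for j
  define s where "s i j = (if i = j then min (a i) (b i) / (a i * b i) else 0)" for i j
  \<comment> \<open>Density of the coupling with respect to the product. The excess masses have the same total \<open>\<kappa>\<close>, so
    their normalised product has the right marginals; for \<open>\<kappa> = 0\<close> it vanishes since division by zero is zero.\<close>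
  define q where "q i j = s i j + u i * w j / \<kappa>" for i j
  have cM [measurable]: "c -` {j} \<in> sets ?M" and cN [measurable]: "c -` {j} \<in> sets ?N" for j
    using c by (auto simp: sets_meas)
  have ab0: "0 \<le> a j" "0 \<le> b j" for j by (auto simp: a_def b_def)
  have k0: "0 \<le> \<kappa>" unfolding \<kappa>_def by (rule sum_nonneg) auto
  have u0: "0 \<le> u j" "0 \<le> w j" for j using ab0 by (auto simp: u_def w_def)
  have s0: "0 \<le> s i j" for i j using ab0 by (auto simp: s_def)
  have q0: "0 \<le> q i j" for i j using k0 u0 s0 by (auto simp: q_def)
  have ua: "u j * a j = max 0 (a j - b j)" for j using ab0[of j] by (auto simp: u_def)
  have wb: "w j * b j = max 0 (b j - a j)" for j using ab0[of j] by (auto simp: w_def)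
  have sa1: "(\<Sum>j\<in>J. a j) = 1" and sb1: "(\<Sum>j\<in>J. b j) = 1"
    using nn_integral_finite_range[OF J cM prob_space_meas, of "\<lambda>_. 1"] nn_integral_finite_range[OF J cN prob_space_meas, of "\<lambda>_. 1"]
    by (simp_all add: a_def b_def M.emeasure_space_1 N.emeasure_space_1)
  have \<kappa>': "(\<Sum>j\<in>J. max 0 (b j - a j)) = \<kappa>"
  proof -
    have "(\<Sum>j\<in>J. max 0 (b j - a j)) - \<kappa> = (\<Sum>j\<in>J. b j - a j)"
      unfolding \<kappa>_def sum_subtractf[symmetric] by (rule sum.cong) auto
    then show ?thesis using sa1 sb1 by (simp add: sum_subtractf)
  qed
  have z: "max 0 (a i - b i) * \<kappa> / \<kappa> = max 0 (a i - b i)" "max 0 (b i - a i) * \<kappa> / \<kappa> = max 0 (b i - a i)" if i: "i \<in> J" for i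
  proof -
    have "max 0 (a i - b i) \<le> \<kappa>" unfolding \<kappa>_def using J(1) i by (intro member_le_sum) auto
    moreover have "max 0 (b i - a i) \<le> \<kappa>" unfolding \<kappa>'[symmetric] using J(1) i by (intro member_le_sum) auto
    ultimately show "max 0 (a i - b i) * \<kappa> / \<kappa> = max 0 (a i - b i)" "max 0 (b i - a i) * \<kappa> / \<kappa> = max 0 (b i - a i)"
      by (cases "\<kappa> = 0"; force)+
  qed
  have row: "(\<Sum>j\<in>J. q i j * b j) = 1" if i: "i \<in> J" "0 < a i" for i
  proof -
    have "(\<Sum>j\<in>J. q i j * b j) = (\<Sum>j\<in>J. (if i = j then min (a i) (b i) / (a i * b i) * b i else 0)) + (\<Sum>j\<in>J. u i / \<kappa> * (w j * b j))"
      unfolding sum.distrib[symmetric] by (rule sum.cong) (auto simp: q_def s_def algebra_simps)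
    also have "(\<Sum>j\<in>J. u i / \<kappa> * (w j * b j)) = u i * \<kappa> / \<kappa>" unfolding wb sum_distrib_left[symmetric] \<kappa>' by simp
    also have "u i * \<kappa> / \<kappa> = (max 0 (a i - b i) * \<kappa> / \<kappa>) / a i" by (simp add: u_def)
    also have "\<dots> = max 0 (a i - b i) / a i" unfolding z(1)[OF i(1)] ..
    also have "(\<Sum>j\<in>J. (if i = j then min (a i) (b i) / (a i * b i) * b i else 0)) = min (a i) (b i) / a i"
      using J(1) i ab0[of i] by (cases "b i = 0") auto
    also have "min (a i) (b i) / a i + max 0 (a i - b i) / a i = 1"
      using i unfolding add_divide_distrib[symmetric] by (auto simp: min_def max_def)
    finally show ?thesis .
  qed
  have col: "(\<Sum>i\<in>J. q i j * a i) = 1" if j: "j \<in> J" "0 < b j" for j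
  proof -
    have "(\<Sum>i\<in>J. q i j * a i) = (\<Sum>i\<in>J. (if j = i then min (a j) (b j) / (a j * b j) * a j else 0)) + (\<Sum>i\<in>J. w j / \<kappa> * (u i * a i))"
      unfolding sum.distrib[symmetric] by (rule sum.cong) (auto simp: q_def s_def algebra_simps)
    also have "(\<Sum>i\<in>J. w j / \<kappa> * (u i * a i)) = w j * \<kappa> / \<kappa>" unfolding ua sum_distrib_left[symmetric] \<kappa>_def[symmetric] by simp
    also have "w j * \<kappa> / \<kappa> = (max 0 (b j - a j) * \<kappa> / \<kappa>) / b j" by (simp add: w_def)
    also have "\<dots> = max 0 (b j - a j) / b j" unfolding z(2)[OF j(1)] ..
    also have "(\<Sum>i\<in>J. (if j = i then min (a j) (b j) / (a j * b j) * a j else 0)) = min (a j) (b j) / b j"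
      using J(1) j ab0[of j] by (cases "a j = 0") auto
    also have "min (a j) (b j) / b j + max 0 (b j - a j) / b j = 1"
      using j unfolding add_divide_distrib[symmetric] by (auto simp: min_def max_def)
    finally show ?thesis .
  qed
  define k where "k p = ennreal (q (c (fst p)) (c (snd p)))" for p :: "'n torus \<times> 'n torus"
  define r where "r p = ennreal (u (c (fst p)) * w (c (snd p)) / \<kappa>)" for p :: "'n torus \<times> 'n torus"
  have meas2: "(\<lambda>p. ennreal (f (c (fst p)) (c (snd p)))) \<in> borel_measurable (?M \<Otimes>\<^sub>M ?N)" for f :: "'i \<Rightarrow> 'i \<Rightarrow> real"
  proof -
    have "f (c (fst p)) (c (snd p)) = (\<Sum>i\<in>J. \<Sum>j\<in>J. f i j * indicator (c -` {i}) (fst p) * indicator (c -` {j}) (snd p))" for p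
    proof -
      have "(\<Sum>i\<in>J. \<Sum>j\<in>J. f i j * indicator (c -` {i}) (fst p) * indicator (c -` {j}) (snd p))
        = (\<Sum>i\<in>J. if c (fst p) = i then (\<Sum>j\<in>J. if c (snd p) = j then f i j else 0) else 0)"
        by (intro sum.cong refl) (auto simp: indicator_def intro!: sum.cong)
      also have "\<dots> = f (c (fst p)) (c (snd p))" using J by (simp add: sum.delta')
      finally show ?thesis ..
    qed
    then show ?thesis by simp
  qed
  have km [measurable]: "k \<in> borel_measurable (?M \<Otimes>\<^sub>M ?N)" unfolding k_def by (rule meas2)
  have rm [measurable]: "r \<in> borel_measurable (?M \<Otimes>\<^sub>M ?N)" unfolding r_def by (rule meas2)
  have "AE x in ?M. (\<integral>\<^sup>+y. k (x, y) \<partial>?N) = 1"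
    using AE_cell_pos[OF J cM prob_space_meas]
  proof eventually_elim
    case (elim x)
    have "(\<integral>\<^sup>+y. k (x, y) \<partial>?N) = ennreal (\<Sum>j\<in>J. q (c x) j * b j)"
      using nn_integral_finite_range[OF J cN prob_space_meas, of "q (c x)"] q0 by (simp add: k_def b_def)
    then show ?case using row[OF J(2)] elim by (simp add: a_def)
  qed
  moreover have "AE y in ?N. (\<integral>\<^sup>+x. k (x, y) \<partial>?M) = 1"
    using AE_cell_pos[OF J cN prob_space_meas]
  proof eventually_elim
    case (elim y)
    have "(\<integral>\<^sup>+x. k (x, y) \<partial>?M) = ennreal (\<Sum>i\<in>J. q i (c y) * a i)"
      using nn_integral_finite_range[OF J cM prob_space_meas, of "\<lambda>i. q i (c y)"] q0 by (simp add: k_def a_def)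
    then show ?case using col[OF J(2)] elim by (simp add: b_def)
  qed
  ultimately have marg: "distr (density (?M \<Otimes>\<^sub>M ?N) k) ?M fst = ?M" "distr (density (?M \<Otimes>\<^sub>M ?N) k) ?N snd = ?N"
    by (rule marginals_of_density[OF prob_space_meas prob_space_meas km])+
  define P where "P = density (?M \<Otimes>\<^sub>M ?N) k"
  have sP: "sets P = sets (borel :: ('n torus \<times> 'n torus) measure)"
    unfolding P_def sets_density borel_prod[symmetric] by (rule sets_pair_measure_cong) (simp_all add: sets_meas)
  have PP: "prob_space P"
  proof -
    have "fst \<in> P \<rightarrow>\<^sub>M ?M" unfolding P_def by simp
    then have "emeasure (distr P ?M fst) (space ?M) = emeasure P (space P)"
      by (subst emeasure_distr) (auto simp: space_meas)
    then show ?thesis using marg(1) M.emeasure_space_1 unfolding P_def by (intro prob_spaceI) simp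
  qed
  interpret P: prob_space P by (rule PP)
  have dP: "distr P borel fst = ?M" "distr P borel snd = ?N"
  proof -
    have "distr P borel fst = distr P ?M fst" by (rule distr_cong) (simp_all add: sets_meas)
    then show "distr P borel fst = ?M" using marg(1) by (simp add: P_def)
    have "distr P borel snd = distr P ?N snd" by (rule distr_cong) (simp_all add: sets_meas)
    then show "distr P borel snd = ?N" using marg(2) by (simp add: P_def)
  qed
  let ?D = "\<lambda>p :: 'n torus \<times> 'n torus. (norm (cube_rep (snd p) - cube_rep (fst p)))\<^sup>2"
  have D: "?D p \<le> (real CARD('n))\<^sup>2" for p using norm_cube_rep_diff[of "snd p" "fst p"] by (intro power_mono) auto
  have Dm [measurable]: "?D \<in> borel_measurable (borel \<Otimes>\<^sub>M borel)" by measurable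
  have DmP: "?D \<in> borel_measurable P" using Dm unfolding borel_prod measurable_cong_sets[OF sP refl] .
  have DmMN: "(\<lambda>p. ennreal (?D p)) \<in> borel_measurable (?M \<Otimes>\<^sub>M ?N)"
    using DmP unfolding P_def by simp
  have k1: "(\<integral>\<^sup>+p. k p \<partial>(?M \<Otimes>\<^sub>M ?N)) = 1"
  proof -
    have "emeasure P (space P) = (\<integral>\<^sup>+p. k p * indicator (space P) p \<partial>(?M \<Otimes>\<^sub>M ?N))"
      unfolding P_def by (subst emeasure_density) auto
    also have "\<dots> = (\<integral>\<^sup>+p. k p \<partial>(?M \<Otimes>\<^sub>M ?N))" by (rule nn_integral_cong) (simp add: P_def)
    finally show ?thesis using P.emeasure_space_1 by simp
  qed
  have r1: "(\<integral>\<^sup>+p. r p \<partial>(?M \<Otimes>\<^sub>M ?N)) \<le> ennreal (card J * e)"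
  proof -
    have "(\<integral>\<^sup>+p. r p \<partial>(?M \<Otimes>\<^sub>M ?N)) = (\<integral>\<^sup>+x. \<integral>\<^sup>+y. r (x, y) \<partial>?N \<partial>?M)"
      by (rule N.nn_integral_fst[symmetric]) simp
    also have "\<dots> = (\<integral>\<^sup>+x. ennreal (u (c x) * \<kappa> / \<kappa>) \<partial>?M)"
    proof (rule nn_integral_cong)
      fix x
      have "(\<integral>\<^sup>+y. r (x, y) \<partial>?N) = ennreal (\<Sum>j\<in>J. u (c x) * w j / \<kappa> * b j)"
        using nn_integral_finite_range[OF J cN prob_space_meas, of "\<lambda>j. u (c x) * w j / \<kappa>"] u0 k0 by (simp add: r_def b_def)
      also have "(\<Sum>j\<in>J. u (c x) * w j / \<kappa> * b j) = (\<Sum>j\<in>J. u (c x) / \<kappa> * (w j * b j))" by (simp add: mult_ac)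
      also have "\<dots> = u (c x) * \<kappa> / \<kappa>" unfolding wb sum_distrib_left[symmetric] \<kappa>' by simp
      finally show "(\<integral>\<^sup>+y. r (x, y) \<partial>?N) = ennreal (u (c x) * \<kappa> / \<kappa>)" .
    qed
    also have "\<dots> \<le> (\<integral>\<^sup>+x. ennreal (u (c x)) \<partial>?M)"
      using u0 by (intro nn_integral_mono ennreal_leI) (simp add: divide_self_if)
    also have "\<dots> = ennreal (\<Sum>i\<in>J. u i * a i)"
      using nn_integral_finite_range[OF J cM prob_space_meas, of u] u0 by (simp add: a_def)
    also have "\<dots> \<le> ennreal (\<Sum>i\<in>J. e)"
    proof (intro ennreal_leI sum_mono)
      fix i show "u i * a i \<le> e" using d[of i] ua[of i] unfolding a_def[symmetric] b_def[symmetric] by linarith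
    qed
    finally show ?thesis by simp
  qed
  have e0: "0 \<le> e" using d order_trans[OF abs_ge_zero] by blast
  have "(\<integral>\<^sup>+p. ennreal (?D p) \<partial>P) = (\<integral>\<^sup>+p. k p * ennreal (?D p) \<partial>(?M \<Otimes>\<^sub>M ?N))"
    unfolding P_def by (rule nn_integral_density[OF km DmMN])
  also have "\<dots> \<le> (\<integral>\<^sup>+p. ennreal h * k p + ennreal ((real CARD('n))\<^sup>2) * r p \<partial>(?M \<Otimes>\<^sub>M ?N))"
  proof (rule nn_integral_mono)
    fix p :: "'n torus \<times> 'n torus"
    have "q (c (fst p)) (c (snd p)) * ?D p \<le> h * q (c (fst p)) (c (snd p)) + (real CARD('n))\<^sup>2 * (u (c (fst p)) * w (c (snd p)) / \<kappa>)"
    proof (cases "c (fst p) = c (snd p)")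
      case True
      have "q (c (fst p)) (c (snd p)) * ?D p \<le> q (c (fst p)) (c (snd p)) * h"
        using h(1)[OF True] q0 by (intro mult_left_mono) auto
      moreover have "0 \<le> (real CARD('n))\<^sup>2 * (u (c (fst p)) * w (c (snd p)) / \<kappa>)" using u0 k0 by auto
      ultimately show ?thesis by (simp add: mult.commute)
    next
      case False
      then have "q (c (fst p)) (c (snd p)) = u (c (fst p)) * w (c (snd p)) / \<kappa>" by (simp add: q_def s_def)
      moreover have "q (c (fst p)) (c (snd p)) * ?D p \<le> q (c (fst p)) (c (snd p)) * (real CARD('n))\<^sup>2"
        using D q0 by (intro mult_left_mono) auto
      moreover have "0 \<le> h * q (c (fst p)) (c (snd p))" using h(2) q0 by auto
      ultimately show ?thesis by (simp add: mult.commute)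
    qed
    from ennreal_leI[OF this]
    have le: "ennreal (q (c (fst p)) (c (snd p)) * ?D p)
      \<le> ennreal (h * q (c (fst p)) (c (snd p)) + (real CARD('n))\<^sup>2 * (u (c (fst p)) * w (c (snd p)) / \<kappa>))" .
    have r0: "0 \<le> u (c (fst p)) * w (c (snd p)) / \<kappa>" using u0 k0 by simp
    have "k p * ennreal (?D p) = ennreal (q (c (fst p)) (c (snd p)) * ?D p)"
      unfolding k_def by (rule ennreal_mult[symmetric]) (use q0 in auto)
    also note le
    also have "ennreal (h * q (c (fst p)) (c (snd p)) + (real CARD('n))\<^sup>2 * (u (c (fst p)) * w (c (snd p)) / \<kappa>))
      = ennreal (h * q (c (fst p)) (c (snd p))) + ennreal ((real CARD('n))\<^sup>2 * (u (c (fst p)) * w (c (snd p)) / \<kappa>))"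
      by (rule ennreal_plus) (use h(2) q0 in simp, rule mult_nonneg_nonneg[OF _ r0], simp)
    also have "ennreal (h * q (c (fst p)) (c (snd p))) = ennreal h * k p"
      unfolding k_def by (rule ennreal_mult[OF h(2) q0])
    also have "ennreal ((real CARD('n))\<^sup>2 * (u (c (fst p)) * w (c (snd p)) / \<kappa>)) = ennreal ((real CARD('n))\<^sup>2) * r p"
      unfolding r_def by (rule ennreal_mult[OF _ r0]) simp
    finally show "k p * ennreal (?D p) \<le> ennreal h * k p + ennreal ((real CARD('n))\<^sup>2) * r p" .
  qed
  also have "\<dots> = ennreal h * 1 + ennreal ((real CARD('n))\<^sup>2) * (\<integral>\<^sup>+p. r p \<partial>(?M \<Otimes>\<^sub>M ?N))"
    by (simp add: nn_integral_add nn_integral_cmult k1)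
  also have "\<dots> \<le> ennreal h * 1 + ennreal ((real CARD('n))\<^sup>2) * ennreal (card J * e)"
    by (intro add_left_mono mult_left_mono r1) simp
  also have "\<dots> = ennreal (h + (real CARD('n))\<^sup>2 * (card J * e))"
    using h(2) e0 by (simp add: ennreal_mult[symmetric] ennreal_plus[symmetric] del: ennreal_plus)
  finally have N: "(\<integral>\<^sup>+p. ennreal (?D p) \<partial>P) \<le> ennreal (h + (real CARD('n))\<^sup>2 * (card J * e))" .
  have i: "integrable P ?D"
    by (rule P.integrable_const_bound[where B="(real CARD('n))\<^sup>2"]) (use D DmP in auto)
  have "ennreal (\<integral>p. ?D p \<partial>P) \<le> ennreal (h + (real CARD('n))\<^sup>2 * (card J * e))"
    using N by (subst (asm) nn_integral_eq_integral[OF i]) simp_all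
  moreover have "0 \<le> h + (real CARD('n))\<^sup>2 * (card J * e)" using h(2) e0 by auto
  ultimately have "(\<integral>p. ?D p \<partial>P) \<le> h + (real CARD('n))\<^sup>2 * (card J * e)" by (simp only: ennreal_le_iff)
  with PP sP dP show ?thesis by blast
qed

text \<open>Measures whose masses on a fine grid agree up to a fine rounding have a good coupling; there are only
  finitely many rounded mass distributions.\<close>

lemma finite_coupling_classes:
  fixes \<epsilon> :: real
  assumes \<epsilon>: "0 < \<epsilon>"
  shows "\<exists>f :: 'n::finite tprob \<Rightarrow> ('n \<Rightarrow> int) \<Rightarrow> int. finite (range f) \<and> (\<forall>\<mu> \<nu>. f \<mu> = f \<nu> \<longrightarrow>
    (\<exists>P :: ('n torus \<times> 'n torus) measure. prob_space P \<and> sets P = sets borel \<and>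
      distr P borel fst = meas \<mu> \<and> distr P borel snd = meas \<nu> \<and>
      (\<integral>p. (norm (cube_rep (snd p) - cube_rep (fst p)))\<^sup>2 \<partial>P) \<le> \<epsilon>))"
proof -
  let ?n = "real CARD('n)"
  obtain N :: nat where N: "?n / sqrt (\<epsilon> / 2) < real N" using reals_Archimedean2 by blast
  have "0 < ?n / sqrt (\<epsilon> / 2)" using \<epsilon> by (intro divide_pos_pos) auto
  then have N0: "0 < real N" using N by linarith
  have hN: "?n / real N \<le> sqrt (\<epsilon> / 2)" using N N0 \<epsilon> by (simp add: field_simps)
  define c where "c x = (\<lambda>i. \<lfloor>real N * cube_rep x $ i\<rfloor>)" for x :: "'n torus"
  define J where "J = (UNIV :: 'n set) \<rightarrow>\<^sub>E {0..<int N}"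
  have J1: "finite J" unfolding J_def by (rule finite_PiE) auto
  have J2: "c x \<in> J" for x
  proof -
    have "0 \<le> real N * cube_rep x $ i" "real N * cube_rep x $ i < real N" for i
      using cube_rep_bounds[of x i] N0 by auto
    then show ?thesis unfolding J_def c_def by (auto simp: floor_less_iff)
  qed
  have cm: "c -` {j} \<in> sets borel" for j
  proof -
    have m [measurable]: "(\<lambda>x :: 'n torus. cube_rep x $ i) \<in> borel_measurable borel" for i
      by (rule borel_measurable_component) (rule measurable_cube_rep)
    have "c -` {j} = {x \<in> space borel. \<forall>i. real_of_int (j i) \<le> real N * cube_rep x $ i \<and> real N * cube_rep x $ i < real_of_int (j i) + 1}"
      by (auto simp: c_def fun_eq_iff floor_eq_iff)
    also have "\<dots> \<in> sets borel" by measurable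
    finally show ?thesis .
  qed
  have cell: "(norm (cube_rep y - cube_rep x))\<^sup>2 \<le> \<epsilon> / 2" if xy: "c x = c y" for x y
  proof -
    have "\<bar>(cube_rep y - cube_rep x) $ i\<bar> \<le> 1 / real N" for i
    proof -
      have "\<lfloor>real N * cube_rep x $ i\<rfloor> = \<lfloor>real N * cube_rep y $ i\<rfloor>" using fun_cong[OF xy, of i] by (simp add: c_def)
      then have "\<bar>real N * cube_rep y $ i - real N * cube_rep x $ i\<bar> \<le> 1" by linarith
      then have "real N * \<bar>cube_rep y $ i - cube_rep x $ i\<bar> \<le> 1"
        using N0 by (simp add: right_diff_distrib[symmetric] abs_mult)
      then show ?thesis using N0 by (simp add: field_simps)
    qed
    then have "norm (cube_rep y - cube_rep x) \<le> CARD('n) * (1 / real N)" by (rule norm_le_of_components)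
    then have "norm (cube_rep y - cube_rep x) \<le> sqrt (\<epsilon> / 2)" using hN by simp
    then have "(norm (cube_rep y - cube_rep x))\<^sup>2 \<le> (sqrt (\<epsilon> / 2))\<^sup>2" by (rule power_mono) simp
    then show ?thesis using \<epsilon> by simp
  qed
  obtain M :: nat where M: "2 * (?n\<^sup>2 * card J) / \<epsilon> < real M" using reals_Archimedean2 by blast
  have "0 \<le> 2 * (?n\<^sup>2 * card J) / \<epsilon>" using \<epsilon> by simp
  then have M0: "0 < real M" using M by linarith
  have hM: "?n\<^sup>2 * (card J * (1 / real M)) \<le> \<epsilon> / 2" using M M0 \<epsilon> by (simp add: field_simps)
  define f where "f \<mu> = (\<lambda>j\<in>J. \<lfloor>real M * measure (meas \<mu>) (c -` {j})\<rfloor>)" for \<mu> :: "'n tprob"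
  have m01: "0 \<le> measure (meas \<mu>) A" "measure (meas \<mu>) A \<le> 1" for \<mu> :: "'n tprob" and A
    using prob_space.prob_le_1[OF prob_space_meas] by auto
  have "range f \<subseteq> J \<rightarrow>\<^sub>E {0..int M}"
  proof (intro image_subsetI)
    fix \<mu>
    have "real M * measure (meas \<mu>) (c -` {j}) \<le> real M" for j
      using m01[of \<mu> "c -` {j}"] M0 by auto
    then have "\<lfloor>real M * measure (meas \<mu>) (c -` {j})\<rfloor> \<le> int M" for j
      by (metis floor_mono floor_of_nat)
    then show "f \<mu> \<in> J \<rightarrow>\<^sub>E {0..int M}" unfolding f_def using m01(1) M0 by (auto simp: PiE_iff extensional_def)
  qed
  then have fin: "finite (range f)" by (rule finite_subset) (intro finite_PiE J1, simp)
  have "\<exists>P :: ('n torus \<times> 'n torus) measure. prob_space P \<and> sets P = sets borel \<and>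
      distr P borel fst = meas \<mu> \<and> distr P borel snd = meas \<nu> \<and>
      (\<integral>p. (norm (cube_rep (snd p) - cube_rep (fst p)))\<^sup>2 \<partial>P) \<le> \<epsilon>" if f: "f \<mu> = f \<nu>" for \<mu> \<nu>
  proof -
    have "\<bar>measure (meas \<mu>) (c -` {j}) - measure (meas \<nu>) (c -` {j})\<bar> \<le> 1 / real M" for j
    proof (cases "j \<in> J")
      case True
      then have "\<lfloor>real M * measure (meas \<mu>) (c -` {j})\<rfloor> = \<lfloor>real M * measure (meas \<nu>) (c -` {j})\<rfloor>"
        using fun_cong[OF f, of j] by (simp add: f_def)
      then have "\<bar>real M * measure (meas \<mu>) (c -` {j}) - real M * measure (meas \<nu>) (c -` {j})\<bar> \<le> 1" by linarith
      then have "real M * \<bar>measure (meas \<mu>) (c -` {j}) - measure (meas \<nu>) (c -` {j})\<bar> \<le> 1"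
        using M0 by (simp add: right_diff_distrib[symmetric] abs_mult)
      then show ?thesis using M0 by (simp add: field_simps)
    next
      case False
      then have "c -` {j} = {}" using J2 by auto
      then show ?thesis by simp
    qed
    from cell_coupling[OF J1 J2 cm cell _ this] obtain P :: "('n torus \<times> 'n torus) measure" where
      P: "prob_space P" "sets P = sets borel" "distr P borel fst = meas \<mu>" "distr P borel snd = meas \<nu>"
      "(\<integral>p. (norm (cube_rep (snd p) - cube_rep (fst p)))\<^sup>2 \<partial>P) \<le> \<epsilon> / 2 + ?n\<^sup>2 * (card J * (1 / real M))"
      using \<epsilon> by auto
    have "(\<integral>p. (norm (cube_rep (snd p) - cube_rep (fst p)))\<^sup>2 \<partial>P) \<le> \<epsilon>" using P(5) hM by linarith
    with P(1-4) show ?thesis by blast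
  qed
  with fin show ?thesis by (intro exI[of _ f]) blast
qed

section \<open>Compactness of the normalized value functions\<close>

context control_problem
begin

lemma value_diff_coupled:
  fixes P :: "('n torus \<times> 'n torus) measure"
  assumes \<delta>: "0 < \<delta>" and osc: "\<And>\<mu> \<nu>. val \<delta> \<mu> - val \<delta> \<nu> \<le> R" and \<tau>: "0 < \<tau>" "\<tau> \<le> 1"
    and P: "prob_space P" "sets P = sets borel" "distr P borel fst = meas \<mu>" "distr P borel snd = meas \<nu>"
    and c: "(\<integral>p. (norm (cube_rep (snd p) - cube_rep (fst p)))\<^sup>2 \<partial>P) \<le> c"
  shows "val \<delta> \<mu> - val \<delta> \<nu> \<le> cmp_const * (c / \<tau> + sqrt \<tau> * (1 + R))"
proof -
  have m: "f \<in> borel_measurable P" if "f \<in> borel_measurable (borel \<Otimes>\<^sub>M borel)" for f :: "'n torus \<times> 'n torus \<Rightarrow> 'x::topological_space"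
    using that unfolding borel_prod measurable_cong_sets[OF P(2) refl] .
  let ?v = "\<lambda>p :: 'n torus \<times> 'n torus. cube_rep (snd p) - cube_rep (fst p)"
  have f: "fst \<in> borel_measurable P" "snd \<in> borel_measurable P" by (rule m[OF measurable_fst], rule m[OF measurable_snd])
  have v: "?v \<in> borel_measurable P" by (rule m) measurable
  have "val \<delta> (law P fst) - val \<delta> (law P (\<lambda>p. fst p + tproj (?v p))) \<le> cmp_const * ((\<integral>p. (norm (?v p))\<^sup>2 \<partial>P) / \<tau> + sqrt \<tau> * (1 + R))"
    by (rule value_diff_le[OF \<delta> osc \<tau> P(1) f(1) v norm_cube_rep_diff])
  also have "\<dots> \<le> cmp_const * (c / \<tau> + sqrt \<tau> * (1 + R))"
    using c \<tau> cmp_const_pos by (intro mult_left_mono add_right_mono divide_right_mono) auto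
  also have "law P fst = \<mu>" by (rule law_eqI[OF P(1) f(1) P(3)])
  also have "(\<lambda>p. fst p + tproj (?v p)) = snd"
  proof
    fix p :: "'n torus \<times> 'n torus"
    have "fst p + tproj (?v p) = tproj (cube_rep (fst p)) + tproj (?v p)" by simp
    also have "\<dots> = tproj (cube_rep (fst p) + ?v p)" by (rule tproj_add[symmetric])
    also have "\<dots> = snd p" by simp
    finally show "fst p + tproj (?v p) = snd p" .
  qed
  also have "law P snd = \<nu>" by (rule law_eqI[OF P(1) f(2) P(4)])
  finally show ?thesis .
qed

text \<open>Each value function is bounded, so its oscillation is finite, and with a small but fixed steering time
  it is at most a constant plus half of itself.\<close>

lemma osc_bound: "\<exists>R\<ge>0. \<forall>\<delta> \<mu> \<nu>. 0 < \<delta> \<longrightarrow> val \<delta> \<mu> - val \<delta> \<nu> \<le> R"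
proof -
  let ?n = "real CARD('n)"
  define \<tau> where "\<tau> = min 1 (1 / (2 * cmp_const))^2"
  have "0 < min 1 (1 / (2 * cmp_const))" using cmp_const_pos by simp
  then have t: "0 < \<tau>" "\<tau> \<le> 1"
    unfolding \<tau>_def by (intro zero_less_power, assumption, intro power_le_one) auto
  have st: "cmp_const * sqrt \<tau> \<le> 1 / 2"
  proof -
    have "sqrt \<tau> = min 1 (1 / (2 * cmp_const))" unfolding \<tau>_def using cmp_const_pos by (intro real_sqrt_unique) auto
    then have "sqrt \<tau> \<le> 1 / (2 * cmp_const)" by simp
    then show ?thesis using cmp_const_pos by (simp add: field_simps)
  qed
  let ?R = "2 * (cmp_const * (?n\<^sup>2 / \<tau>)) + 1"
  have "val \<delta> \<mu> - val \<delta> \<nu> \<le> ?R" if \<delta>: "0 < \<delta>" for \<delta> \<mu> \<nu>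
  proof -
    let ?S = "range (\<lambda>(\<mu>, \<nu>). val \<delta> \<mu> - val \<delta> \<nu>)"
    define R where "R = Sup ?S"
    have bd: "bdd_above ?S"
    proof (rule bdd_aboveI2)
      fix p show "(case p of (\<mu>, \<nu>) \<Rightarrow> val \<delta> \<mu> - val \<delta> \<nu>) \<le> 2 * K / \<delta> - - (2 * K) / \<delta>"
        using value_upper[OF \<delta>, of "fst p"] value_lower[OF \<delta>, of "snd p"] by (simp add: case_prod_unfold)
    qed
    have osc: "val \<delta> \<mu> - val \<delta> \<nu> \<le> R" for \<mu> \<nu>
      unfolding R_def by (rule cSup_upper[OF _ bd]) auto
    have "R \<le> cmp_const * (?n\<^sup>2 / \<tau> + sqrt \<tau> * (1 + R))"
      unfolding R_def
    proof (rule cSup_least)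
      fix d assume "d \<in> ?S"
      then obtain \<mu> \<nu> where d: "d = val \<delta> \<mu> - val \<delta> \<nu>" by auto
      let ?M = "meas \<mu>" and ?N = "meas \<nu>"
      interpret M: prob_space ?M by (rule prob_space_meas)
      interpret N: prob_space ?N by (rule prob_space_meas)
      interpret MN: pair_prob_space ?M ?N ..
      have AM: "AE x in ?M. (\<integral>\<^sup>+y. 1 \<partial>?N) = 1" "AE y in ?N. (\<integral>\<^sup>+x. 1 \<partial>?M) = 1"
        by (simp_all add: N.emeasure_space_1 M.emeasure_space_1)
      have d1: "density (?M \<Otimes>\<^sub>M ?N) (\<lambda>_. 1) = ?M \<Otimes>\<^sub>M ?N" by (rule density_1)
      have marg: "distr (?M \<Otimes>\<^sub>M ?N) ?M fst = ?M" "distr (?M \<Otimes>\<^sub>M ?N) ?N snd = ?N"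
        using marginals_of_density[OF prob_space_meas[of \<mu>] prob_space_meas[of \<nu>], of "\<lambda>_. 1"] AM unfolding d1 by simp_all
      have s: "sets (?M \<Otimes>\<^sub>M ?N) = sets (borel :: ('n torus \<times> 'n torus) measure)"
        unfolding borel_prod[symmetric] by (rule sets_pair_measure_cong) (simp_all add: sets_meas)
      have dm: "distr (?M \<Otimes>\<^sub>M ?N) borel fst = ?M" "distr (?M \<Otimes>\<^sub>M ?N) borel snd = ?N"
      proof -
        have "distr (?M \<Otimes>\<^sub>M ?N) borel fst = distr (?M \<Otimes>\<^sub>M ?N) ?M fst" by (rule distr_cong) (simp_all add: sets_meas)
        then show "distr (?M \<Otimes>\<^sub>M ?N) borel fst = ?M" using marg by simp
        have "distr (?M \<Otimes>\<^sub>M ?N) borel snd = distr (?M \<Otimes>\<^sub>M ?N) ?N snd" by (rule distr_cong) (simp_all add: sets_meas)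
        then show "distr (?M \<Otimes>\<^sub>M ?N) borel snd = ?N" using marg by simp
      qed
      have le: "(norm (cube_rep (snd p) - cube_rep (fst p)))\<^sup>2 \<le> ?n\<^sup>2" for p :: "'n torus \<times> 'n torus"
        using norm_cube_rep_diff[of "snd p" "fst p"] by (intro power_mono) auto
      have "(\<lambda>p :: 'n torus \<times> 'n torus. (norm (cube_rep (snd p) - cube_rep (fst p)))\<^sup>2) \<in> borel_measurable (borel \<Otimes>\<^sub>M borel)" by measurable
      then have "(\<lambda>p :: 'n torus \<times> 'n torus. (norm (cube_rep (snd p) - cube_rep (fst p)))\<^sup>2) \<in> borel_measurable (?M \<Otimes>\<^sub>M ?N)"
        unfolding borel_prod measurable_cong_sets[OF s refl] .
      then have "integrable (?M \<Otimes>\<^sub>M ?N) (\<lambda>p. (norm (cube_rep (snd p) - cube_rep (fst p)))\<^sup>2)"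
        using le by (intro MN.P.integrable_const_bound[where B="?n\<^sup>2"]) auto
      then have "(\<integral>p. (norm (cube_rep (snd p) - cube_rep (fst p)))\<^sup>2 \<partial>(?M \<Otimes>\<^sub>M ?N)) \<le> ?n\<^sup>2"
        by (rule MN.P.integral_le_const) (use le in auto)
      from value_diff_coupled[OF \<delta> osc t MN.P.prob_space_axioms s dm this]
      show "d \<le> cmp_const * (?n\<^sup>2 / \<tau> + sqrt \<tau> * (1 + Sup ?S))" unfolding d R_def .
    qed simp
    also have "\<dots> = cmp_const * (?n\<^sup>2 / \<tau>) + cmp_const * sqrt \<tau> * (1 + R)" by (simp add: algebra_simps)
    also have "\<dots> \<le> cmp_const * (?n\<^sup>2 / \<tau>) + 1 / 2 * (1 + R)"
      using osc[of \<mu> \<mu>] by (intro add_left_mono mult_right_mono st) simp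
    finally have "R \<le> ?R" by (simp add: field_simps)
    then show ?thesis using osc[of \<mu> \<nu>] by simp
  qed
  moreover have "0 \<le> ?R" using cmp_const_pos t by (intro add_nonneg_nonneg) auto
  ultimately show ?thesis by blast
qed

text \<open>The steering time \<open>s\<^sup>2\<close> makes the term with the oscillation small; couplings with displacement small
  compared to \<open>s\<^sup>2\<close> make the other one small.\<close>

lemma finite_value_classes:
  assumes e: "0 < e"
  shows "\<exists>f :: 'n tprob \<Rightarrow> ('n \<Rightarrow> int) \<Rightarrow> int. finite (range f) \<and>
    (\<forall>\<delta> \<mu> \<nu>. 0 < \<delta> \<longrightarrow> f \<mu> = f \<nu> \<longrightarrow> val \<delta> \<mu> - val \<delta> \<nu> \<le> e)"
proof -
  obtain R where R: "0 \<le> R" and osc: "\<And>\<delta> \<mu> \<nu>. 0 < \<delta> \<Longrightarrow> val \<delta> \<mu> - val \<delta> \<nu> \<le> R" using osc_bound by blast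
  define s where "s = min 1 (e / (2 * cmp_const * (1 + R)))"
  have cR: "0 < 2 * cmp_const * (1 + R)" using cmp_const_pos R by simp
  have s: "0 < s" "s \<le> 1" "cmp_const * (s * (1 + R)) \<le> e / 2"
  proof -
    show "0 < s" unfolding s_def using e cR by simp
    show "s \<le> 1" by (simp add: s_def)
    have "s \<le> e / (2 * cmp_const * (1 + R))" by (simp add: s_def)
    then show "cmp_const * (s * (1 + R)) \<le> e / 2" using cR by (simp add: pos_le_divide_eq algebra_simps)
  qed
  define \<epsilon> where "\<epsilon> = s\<^sup>2 * e / (2 * cmp_const)"
  have \<epsilon>: "0 < \<epsilon>" unfolding \<epsilon>_def using s e cmp_const_pos by simp
  from finite_coupling_classes[OF \<epsilon>] obtain f :: "'n tprob \<Rightarrow> ('n \<Rightarrow> int) \<Rightarrow> int" where fin: "finite (range f)"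
    and f: "\<forall>\<mu> \<nu>. f \<mu> = f \<nu> \<longrightarrow> (\<exists>P :: ('n torus \<times> 'n torus) measure. prob_space P \<and> sets P = sets borel \<and>
      distr P borel fst = meas \<mu> \<and> distr P borel snd = meas \<nu> \<and>
      (\<integral>p. (norm (cube_rep (snd p) - cube_rep (fst p)))\<^sup>2 \<partial>P) \<le> \<epsilon>)" by blast
  have "val \<delta> \<mu> - val \<delta> \<nu> \<le> e" if \<delta>: "0 < \<delta>" and eq: "f \<mu> = f \<nu>" for \<delta> \<mu> \<nu>
  proof -
    obtain P :: "('n torus \<times> 'n torus) measure" where P: "prob_space P" "sets P = sets borel"
      "distr P borel fst = meas \<mu>" "distr P borel snd = meas \<nu>"
      "(\<integral>p. (norm (cube_rep (snd p) - cube_rep (fst p)))\<^sup>2 \<partial>P) \<le> \<epsilon>" using f eq by blast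
    have "s\<^sup>2 \<le> 1" using s by (intro power_le_one) auto
    with s have "val \<delta> \<mu> - val \<delta> \<nu> \<le> cmp_const * (\<epsilon> / s\<^sup>2 + sqrt (s\<^sup>2) * (1 + R))"
      by (intro value_diff_coupled[OF \<delta> osc[OF \<delta>] _ _ P]) auto
    also have "\<dots> = e / 2 + cmp_const * (s * (1 + R))"
      unfolding \<epsilon>_def using s cmp_const_pos by (simp add: field_simps)
    finally show ?thesis using s(3) by simp
  qed
  with fin show ?thesis by blast
qed

end

text \<open>A version of the Arzela-Ascoli theorem in which equicontinuity and total boundedness are merged: a
  sequence of functions that is uniformly almost constant on the classes of a finite classification.\<close>

lemma uniform_subsequence_of_finite_classes:
  fixes g :: "nat \<Rightarrow> 'a \<Rightarrow> real"
  assumes B: "\<And>n x. \<bar>g n x\<bar> \<le> B"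
    and cls: "\<And>e. 0 < e \<Longrightarrow> \<exists>f :: 'a \<Rightarrow> 'c. finite (range f) \<and> (\<forall>n x y. f x = f y \<longrightarrow> \<bar>g n x - g n y\<bar> \<le> e)"
  obtains k l where "strict_mono (k :: nat \<Rightarrow> nat)" "uniform_limit UNIV (\<lambda>n. g (k n)) l sequentially"
proof -
  have "\<forall>j::nat. \<exists>f :: 'a \<Rightarrow> 'c. finite (range f) \<and> (\<forall>n x y. f x = f y \<longrightarrow> \<bar>g n x - g n y\<bar> \<le> 1 / Suc j)"
    by (intro allI cls) simp
  then obtain f :: "nat \<Rightarrow> 'a \<Rightarrow> 'c" where f: "\<forall>j. finite (range (f j)) \<and> (\<forall>n x y. f j x = f j y \<longrightarrow> \<bar>g n x - g n y\<bar> \<le> 1 / Suc j)"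
    by (rule choice[THEN exE])
  define rep where "rep j x = (SOME y. f j y = f j x)" for j x
  have rep: "f j (rep j x) = f j x" for j x unfolding rep_def by (rule someI[of _ x]) simp
  define S where "S j = range (rep j)" for j
  have "S j = (\<lambda>c. SOME y. f j y = c) ` range (f j)" for j unfolding S_def rep_def by auto
  then have S: "finite (S j)" for j using f by simp
  then have "countable (\<Union>j. S j)" by (intro countable_UN) (auto intro: countable_finite)
  then obtain k where k: "strict_mono (k :: nat \<Rightarrow> nat)" "\<And>x. x \<in> (\<Union>j. S j) \<Longrightarrow> \<exists>l. (\<lambda>n. g (k n) x) \<longlonglongrightarrow> l"
    by (rule function_convergent_subsequence[where f=g and M=B]) (use B in auto)
  have "uniformly_Cauchy_on UNIV (\<lambda>n. g (k n))"
  proof (rule uniformly_Cauchy_onI)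
    fix e :: real assume e: "0 < e"
    obtain j :: nat where j: "1 / Suc j < e / 4" using reals_Archimedean[of "e / 4"] e by (auto simp: inverse_eq_divide)
    have "\<forall>\<^sub>F n in sequentially. \<forall>x\<in>S j. \<bar>g (k n) x - lim (\<lambda>n. g (k n) x)\<bar> < e / 4"
    proof (rule eventually_ball_finite[OF S], rule ballI)
      fix x assume "x \<in> S j"
      then have "convergent (\<lambda>n. g (k n) x)" using k(2)[of x] by (auto simp: convergent_def)
      then have "(\<lambda>n. g (k n) x) \<longlonglongrightarrow> lim (\<lambda>n. g (k n) x)" by (simp add: convergent_LIMSEQ_iff)
      from tendstoD[OF this, of "e / 4"] show "\<forall>\<^sub>F n in sequentially. \<bar>g (k n) x - lim (\<lambda>n. g (k n) x)\<bar> < e / 4"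
        using e by (simp add: dist_real_def)
    qed
    then obtain N where N: "\<And>n x. N \<le> n \<Longrightarrow> x \<in> S j \<Longrightarrow> \<bar>g (k n) x - lim (\<lambda>n. g (k n) x)\<bar> < e / 4"
      unfolding eventually_sequentially by blast
    have "dist (g (k m) x) (g (k n) x) < e" if "N \<le> m" "N \<le> n" for m n x
    proof -
      have c: "\<bar>g i x - g i (rep j x)\<bar> \<le> 1 / Suc j" for i using f rep[of j x] by metis
      have "rep j x \<in> S j" by (simp add: S_def)
      from N[OF that(1) this] N[OF that(2) this] c[of "k m"] c[of "k n"] j show ?thesis
        unfolding dist_real_def by linarith
    qed
    then show "\<exists>M. \<forall>x\<in>UNIV. \<forall>m\<ge>M. \<forall>n\<ge>M. dist (g (k m) x) (g (k n) x) < e" by blast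
  qed
  then obtain l where "uniform_limit UNIV (\<lambda>n. g (k n)) l sequentially"
    using Cauchy_uniformly_convergent[of UNIV "\<lambda>n. g (k n)"] unfolding uniformly_convergent_on_def by blast
  with k(1) show ?thesis by (rule that)
qed

context control_problem
begin

lemma ergodic_limit:
  "\<exists>\<delta> :: nat \<Rightarrow> real. (\<forall>n. \<delta> n > 0) \<and> \<delta> \<longlonglongrightarrow> 0 \<and>
    (\<exists>chi :: 'n tprob \<Rightarrow> real.
       uniform_limit UNIV (\<lambda>n m. val (\<delta> n) m - val (\<delta> n) \<eta>) chi sequentially) \<and>
    (\<exists>lam :: real. uniform_limit UNIV (\<lambda>n m. \<delta> n * val (\<delta> n) m) (\<lambda>_. - lam) sequentially)"
proof -
  define d where "d n = 1 / real (Suc n)" for n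
  have d0: "0 < d n" for n by (simp add: d_def)
  have dl: "d \<longlonglongrightarrow> 0" unfolding d_def by (rule LIMSEQ_Suc[OF lim_1_over_n])
  obtain R where R: "0 \<le> R" and osc: "\<And>\<delta> \<mu> \<nu>. 0 < \<delta> \<Longrightarrow> val \<delta> \<mu> - val \<delta> \<nu> \<le> R" using osc_bound by blast
  have ab: "\<bar>val (d n) \<mu> - val (d n) \<eta>\<bar> \<le> R" for n \<mu>
    using osc[OF d0, of n \<mu> \<eta>] osc[OF d0, of n \<eta> \<mu>] by linarith
  have cls: "\<exists>f :: 'n tprob \<Rightarrow> ('n \<Rightarrow> int) \<Rightarrow> int. finite (range f) \<and>
      (\<forall>n \<mu> \<nu>. f \<mu> = f \<nu> \<longrightarrow> \<bar>(val (d n) \<mu> - val (d n) \<eta>) - (val (d n) \<nu> - val (d n) \<eta>)\<bar> \<le> e)" if e: "0 < e" for e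
  proof -
    obtain f :: "'n tprob \<Rightarrow> ('n \<Rightarrow> int) \<Rightarrow> int" where f: "finite (range f)"
      "\<forall>\<delta> \<mu> \<nu>. 0 < \<delta> \<longrightarrow> f \<mu> = f \<nu> \<longrightarrow> val \<delta> \<mu> - val \<delta> \<nu> \<le> e" using finite_value_classes[OF e] by blast
    have "\<bar>(val (d n) \<mu> - val (d n) \<eta>) - (val (d n) \<nu> - val (d n) \<eta>)\<bar> \<le> e" if eq: "f \<mu> = f \<nu>" for n \<mu> \<nu>
      using f(2)[rule_format, OF d0 eq, of n] f(2)[rule_format, OF d0 eq[symmetric], of n] by linarith
    with f(1) show ?thesis by blast
  qed
  obtain k l where k: "strict_mono (k :: nat \<Rightarrow> nat)" and l: "uniform_limit UNIV (\<lambda>n m. val (d (k n)) m - val (d (k n)) \<eta>) l sequentially"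
    by (rule uniform_subsequence_of_finite_classes[of "\<lambda>n m. val (d n) m - val (d n) \<eta>" R, OF ab cls])
  have "\<bar>d (k n) * val (d (k n)) \<eta>\<bar> \<le> 2 * K" for n
    using value_upper[OF d0, of "k n" \<eta>] value_lower[OF d0, of "k n" \<eta>] d0[of "k n"]
    by (simp add: field_simps abs_le_iff)
  then have "bounded (range (\<lambda>n. d (k n) * val (d (k n)) \<eta>))" unfolding bounded_iff by (auto intro!: exI[of _ "2 * K"])
  then obtain c r where r: "strict_mono (r :: nat \<Rightarrow> nat)" and c: "((\<lambda>n. d (k n) * val (d (k n)) \<eta>) \<circ> r) \<longlonglongrightarrow> c"
    using bounded_imp_convergent_subsequence by blast
  define \<delta> where "\<delta> n = d (k (r n))" for n
  have \<delta>0: "0 < \<delta> n" for n by (simp add: \<delta>_def d0)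
  have "strict_mono (k \<circ> r)" by (rule strict_mono_o[OF k r])
  from LIMSEQ_subseq_LIMSEQ[OF dl this] have \<delta>l: "\<delta> \<longlonglongrightarrow> 0" by (simp add: \<delta>_def[abs_def] o_def)
  have u1: "uniform_limit UNIV (\<lambda>n m. val (\<delta> n) m - val (\<delta> n) \<eta>) l sequentially"
    using filterlim_compose[OF l filterlim_subseq[OF r]] by (simp add: \<delta>_def)
  have c': "(\<lambda>n. \<delta> n * val (\<delta> n) \<eta>) \<longlonglongrightarrow> c" using c by (simp add: \<delta>_def o_def)
  have u2: "uniform_limit UNIV (\<lambda>n m. \<delta> n * val (\<delta> n) m) (\<lambda>_. - (- c)) sequentially"
  proof (rule uniform_limitI)
    fix e :: real assume e: "0 < e"
    have "(\<lambda>n. \<delta> n * R) \<longlonglongrightarrow> 0" using tendsto_mult_left_zero[OF \<delta>l] by simp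
    then have "\<forall>\<^sub>F n in sequentially. \<delta> n * R < e / 2" by (rule order_tendstoD) (use e in simp)
    moreover have "\<forall>\<^sub>F n in sequentially. dist (\<delta> n * val (\<delta> n) \<eta>) c < e / 2" by (rule tendstoD[OF c']) (use e in simp)
    ultimately show "\<forall>\<^sub>F n in sequentially. \<forall>m\<in>UNIV. dist (\<delta> n * val (\<delta> n) m) (- (- c)) < e"
    proof eventually_elim
      case (elim n)
      show ?case
      proof
        fix m
        have "\<bar>\<delta> n * val (\<delta> n) m - \<delta> n * val (\<delta> n) \<eta>\<bar> = \<delta> n * \<bar>val (\<delta> n) m - val (\<delta> n) \<eta>\<bar>"
          using \<delta>0[of n] by (simp add: right_diff_distrib[symmetric] abs_mult)
        also have "\<dots> \<le> \<delta> n * R" using \<delta>0[of n] ab[of "k (r n)" m] by (intro mult_left_mono) (auto simp: \<delta>_def)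
        finally show "dist (\<delta> n * val (\<delta> n) m) (- (- c)) < e" using elim unfolding dist_real_def by linarith
      qed
    qed
  qed
  from \<delta>0 \<delta>l u1 u2 show ?thesis by blast
qed

end

section \<open>The structural assumptions\<close>

lemma abs_unit_interval_integral_le:
  fixes f :: "real \<Rightarrow> real"
  assumes f: "\<And>t. \<bar>f t\<bar> \<le> c"
  shows "\<bar>LINT t:{0..1}|lborel. f t\<bar> \<le> c"
proof -
  have c: "0 \<le> c" using f[of 0] by linarith
  have i: "integrable lborel (\<lambda>t. c * indicator {0..1 :: real} t)"
    by (intro integrable_mult_right integrable_real_indicator) auto
  have "\<bar>\<integral>t. indicator {0..1} t *\<^sub>R f t \<partial>lborel\<bar> \<le> (\<integral>t. c * indicator {0..1 :: real} t \<partial>lborel)"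
  proof (cases "integrable lborel (\<lambda>t. indicator {0..1} t *\<^sub>R f t)")
    case True
    have "\<bar>\<integral>t. indicator {0..1} t *\<^sub>R f t \<partial>lborel\<bar> \<le> (\<integral>t. \<bar>indicator {0..1} t *\<^sub>R f t\<bar> \<partial>lborel)"
      by (rule integral_abs_bound)
    also have "\<dots> \<le> (\<integral>t. c * indicator {0..1 :: real} t \<partial>lborel)"
      by (rule integral_mono[OF integrable_abs[OF True] i]) (use f in \<open>auto simp: indicator_def\<close>)
    finally show ?thesis .
  qed (use c in \<open>simp add: not_integrable_integral_eq\<close>)
  then show ?thesis by (simp add: set_lebesgue_integral_def)
qed

text \<open>A Lipschitz bound on the flat derivative in the space variable is a Lipschitz bound on the function,
  because both measures are tested against the same Lipschitz function.\<close>

lemma flat_derivative_Lipschitz: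
  assumes F: "flat_derivative \<Phi> D" and L: "\<And>m. L-lipschitz_on UNIV (D m)"
  shows "\<bar>\<Phi> m' - \<Phi> m\<bar> \<le> L * dist m' m"
proof -
  have "\<Phi> m' - \<Phi> m = (LINT t:{0..1}|lborel. (\<integral>x. D (mix t m m') x \<partial>meas m') - (\<integral>x. D (mix t m m') x \<partial>meas m))"
    using F unfolding flat_derivative_def by blast
  also have "\<bar>\<dots>\<bar> \<le> L * dist m' m"
    by (rule abs_unit_interval_integral_le) (rule integral_diff_le_dist_tprob[OF L])
  finally show ?thesis .
qed

lemma dist_tprob_bounded: "dist \<mu> (\<nu> :: 'n::finite tprob) \<le> 2 * real CARD('n)"
proof (rule dist_tprob_leI)
  fix \<phi> :: "'n torus \<Rightarrow> real" assume "1-lipschitz_on UNIV \<phi>"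
  from integral_lipschitz_bound[OF this, of \<mu>] integral_lipschitz_bound[OF this, of \<nu>]
  show "integral\<^sup>L (meas \<mu>) \<phi> - integral\<^sup>L (meas \<nu>) \<phi> \<le> 2 * real CARD('n)" by (simp add: abs_le_iff)
qed

lemma line_DERIV:
  fixes f :: "real^'n::finite \<Rightarrow> real"
  assumes "f differentiable (at (s *\<^sub>R \<xi>))"
  shows "((\<lambda>s. f (s *\<^sub>R \<xi>)) has_real_derivative (\<Sum>i\<in>UNIV. \<xi> $ i * pd i f (s *\<^sub>R \<xi>))) (at s)"
proof -
  obtain D where D: "(f has_derivative D) (at (s *\<^sub>R \<xi>))" using assms unfolding differentiable_def by blast
  have lin: "linear D" using D has_derivative_linear by blast
  have "D (axis i 1) = pd i f (s *\<^sub>R \<xi>)" for i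
    using has_derivative_imp_DERIV_line[of f D "s *\<^sub>R \<xi>" 0 "axis i 1"] D
    by (simp add: pd_def DERIV_imp_deriv has_real_derivative_iff_has_vector_derivative)
  moreover have "D \<xi> = D (\<Sum>i\<in>UNIV. \<xi> $ i *\<^sub>R axis i 1)"
    by (simp add: basis_expansion scalar_mult_eq_scaleR[symmetric])
  ultimately have "D \<xi> = (\<Sum>i\<in>UNIV. \<xi> $ i * pd i f (s *\<^sub>R \<xi>))"
    by (simp add: linear_sum[OF lin] linear_scale[OF lin])
  moreover have "((\<lambda>s. f (0 + s *\<^sub>R \<xi>)) has_vector_derivative D \<xi>) (at s)"
    by (rule has_derivative_imp_DERIV_line) (use D in simp)
  ultimately show ?thesis by (simp add: has_real_derivative_iff_has_vector_derivative)
qed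

lemma quadratic_expansion:
  fixes f :: "real^'n::finite \<Rightarrow> real"
  assumes f: "\<And>p. f differentiable (at p)" and f2: "\<And>j p. pd j f differentiable (at p)"
    and lo: "\<And>p. a * (norm \<xi>)\<^sup>2 \<le> \<xi> \<bullet> ((\<chi> i j. pd i (pd j f) p) *v \<xi>)"
    and up: "\<And>p. \<xi> \<bullet> ((\<chi> i j. pd i (pd j f) p) *v \<xi>) \<le> b * (norm \<xi>)\<^sup>2"
  shows "a / 2 * (norm \<xi>)\<^sup>2 \<le> f \<xi> - f 0 - (\<Sum>i\<in>UNIV. \<xi> $ i * pd i f 0)"
    and "f \<xi> - f 0 - (\<Sum>i\<in>UNIV. \<xi> $ i * pd i f 0) \<le> b / 2 * (norm \<xi>)\<^sup>2"
proof -
  define g1 where "g1 s = (\<Sum>j\<in>UNIV. \<xi> $ j * pd j f (s *\<^sub>R \<xi>))" for s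
  define g2 where "g2 s = \<xi> \<bullet> ((\<chi> i j. pd i (pd j f) (s *\<^sub>R \<xi>)) *v \<xi>)" for s
  have d1: "((\<lambda>s. f (s *\<^sub>R \<xi>)) has_real_derivative g1 s) (at s)" for s
    unfolding g1_def by (rule line_DERIV[OF f])
  have d2: "(g1 has_real_derivative g2 s) (at s)" for s
  proof -
    have "(g1 has_real_derivative (\<Sum>j\<in>UNIV. \<xi> $ j * (\<Sum>i\<in>UNIV. \<xi> $ i * pd i (pd j f) (s *\<^sub>R \<xi>)))) (at s)"
      unfolding g1_def by (intro DERIV_sum DERIV_cmult line_DERIV f2)
    also have "(\<Sum>j\<in>UNIV. \<xi> $ j * (\<Sum>i\<in>UNIV. \<xi> $ i * pd i (pd j f) (s *\<^sub>R \<xi>)))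
        = (\<Sum>j\<in>UNIV. \<Sum>i\<in>UNIV. \<xi> $ i * (pd i (pd j f) (s *\<^sub>R \<xi>) * \<xi> $ j))"
      by (simp add: sum_distrib_left mult_ac)
    also have "\<dots> = (\<Sum>i\<in>UNIV. \<Sum>j\<in>UNIV. \<xi> $ i * (pd i (pd j f) (s *\<^sub>R \<xi>) * \<xi> $ j))" by (rule sum.swap)
    also have "\<dots> = g2 s" by (simp add: g2_def inner_vec_def matrix_vector_mult_def sum_distrib_left)
    finally show ?thesis .
  qed
  define diff where "diff m = (if m = 0 then (\<lambda>s. f (s *\<^sub>R \<xi>)) else if m = 1 then g1 else g2)" for m :: nat
  have "\<exists>t::real. 0 < t \<and> t < 1 \<and> f (1 *\<^sub>R \<xi>) = (\<Sum>m<2. diff m 0 / fact m * 1 ^ m) + diff 2 t / fact 2 * 1 ^ 2"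
  proof (rule Maclaurin)
    show "\<forall>m t. m < 2 \<and> 0 \<le> t \<and> t \<le> 1 \<longrightarrow> (diff m has_real_derivative diff (Suc m) t) (at t)"
      using d1 d2 by (auto simp: diff_def less_2_cases_iff)
  qed (auto simp: diff_def)
  then obtain t where "f \<xi> = f 0 + g1 0 + g2 t / 2" by (auto simp: diff_def numeral_2_eq_2)
  moreover have "g1 0 = (\<Sum>i\<in>UNIV. \<xi> $ i * pd i f 0)" by (simp add: g1_def)
  moreover have "a * (norm \<xi>)\<^sup>2 \<le> g2 t" "g2 t \<le> b * (norm \<xi>)\<^sup>2" unfolding g2_def by (rule lo up)+
  ultimately show "a / 2 * (norm \<xi>)\<^sup>2 \<le> f \<xi> - f 0 - (\<Sum>i\<in>UNIV. \<xi> $ i * pd i f 0)"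
    "f \<xi> - f 0 - (\<Sum>i\<in>UNIV. \<xi> $ i * pd i f 0) \<le> b / 2 * (norm \<xi>)\<^sup>2" by linarith+
qed

text \<open>The linear part is controlled by the values on the unit sphere, so a bound on the unit ball and bounds
  on the Hessian give quadratic growth.\<close>

lemma quadratic_growth:
  fixes f :: "real^'n::finite \<Rightarrow> real"
  assumes f: "\<And>p. f differentiable (at p)" and f2: "\<And>j p. pd j f differentiable (at p)"
    and lo: "\<And>p \<xi>. a * (norm \<xi>)\<^sup>2 \<le> \<xi> \<bullet> ((\<chi> i j. pd i (pd j f) p) *v \<xi>)"
    and up: "\<And>p \<xi>. \<xi> \<bullet> ((\<chi> i j. pd i (pd j f) p) *v \<xi>) \<le> b * (norm \<xi>)\<^sup>2"
    and B: "\<And>p. norm p \<le> 1 \<Longrightarrow> \<bar>f p\<bar> \<le> B" and a: "0 \<le> a" and b: "0 \<le> b"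
  shows "a / 2 * (norm \<xi>)\<^sup>2 - (2 * B + b) * norm \<xi> - B \<le> f \<xi>"
    and "f \<xi> \<le> b / 2 * (norm \<xi>)\<^sup>2 + (2 * B + b) * norm \<xi> + B"
proof -
  define l where "l \<xi> = (\<Sum>i\<in>UNIV. \<xi> $ i * pd i f 0)" for \<xi> :: "real^'n"
  note expand = quadratic_expansion[OF f f2 lo up, folded l_def]
  have f0: "\<bar>f 0\<bar> \<le> B" using B[of 0] by simp
  have unit: "\<bar>l e\<bar> \<le> 2 * B + b" if "norm e = 1" for e
    using expand(1)[of e] expand(2)[of e] B[of e] f0 a b that by (simp add: abs_le_iff)
  have l: "\<bar>l \<xi>\<bar> \<le> (2 * B + b) * norm \<xi>"
  proof (cases "\<xi> = 0")
    case False
    have "l ((1 / norm \<xi>) *\<^sub>R \<xi>) = (1 / norm \<xi>) * l \<xi>" unfolding l_def sum_distrib_left by (simp add: mult_ac)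
    then have "\<bar>(1 / norm \<xi>) * l \<xi>\<bar> \<le> 2 * B + b" using unit[of "(1 / norm \<xi>) *\<^sub>R \<xi>"] False by simp
    then show ?thesis using False by (simp add: abs_mult field_simps)
  qed (simp add: l_def)
  show "a / 2 * (norm \<xi>)\<^sup>2 - (2 * B + b) * norm \<xi> - B \<le> f \<xi>"
    "f \<xi> \<le> b / 2 * (norm \<xi>)\<^sup>2 + (2 * B + b) * norm \<xi> + B"
    using expand[of \<xi>] l f0 by (simp_all add: abs_le_iff)
qed

text \<open>The derivatives of the Hamiltonian are defined one variable at a time along coordinate lines; as components of
  the Frechet derivative in both variables they inherit its smoothness.\<close>

lemma Ck_partial:
  fixes h :: "real^'n::finite \<Rightarrow> real^'n \<Rightarrow> real"
  assumes h: "Ck (Suc k) (\<lambda>(y, p). h y p)"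
  shows "(\<lambda>y. h y p) differentiable (at y)" and "h y differentiable (at p)"
    and "Ck k (\<lambda>(y, p). pd j (h y) p)"
    and "Ck k (\<lambda>(y, p). deriv (\<lambda>s. h (y + s *\<^sub>R axis i 1) p) 0)"
proof -
  obtain D where D: "\<And>z. ((\<lambda>(y, p). h y p) has_derivative D z) (at z)" and Dk: "\<And>b. b \<in> Basis \<Longrightarrow> Ck k (\<lambda>z. D z b)"
    using Ck_SucE[OF h] by blast
  have "((\<lambda>y. h y p) has_derivative (\<lambda>v. D (y, p) (v, 0))) (at y)" for y p
  proof -
    have "((\<lambda>y :: real^'n. (y, p)) has_derivative (\<lambda>v. (v, 0))) (at y)" by (auto intro!: derivative_eq_intros)
    from has_derivative_compose[OF this D] show ?thesis by simp
  qed
  note x = this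
  then show "(\<lambda>y. h y p) differentiable (at y)" unfolding differentiable_def by blast
  have "((\<lambda>p. h y p) has_derivative (\<lambda>v. D (y, p) (0, v))) (at p)" for y p
  proof -
    have "((\<lambda>p :: real^'n. (y, p)) has_derivative (\<lambda>v. (0, v))) (at p)" by (auto intro!: derivative_eq_intros)
    from has_derivative_compose[OF this D] show ?thesis by simp
  qed
  note p = this
  then show "h y differentiable (at p)" unfolding differentiable_def by blast
  have "pd j (h y) p = D (y, p) (0, axis j 1)" for y p
    using has_derivative_imp_DERIV_line[of "h y" "\<lambda>v. D (y, p) (0, v)" p 0 "axis j 1"] p[of y p]
    by (simp add: pd_def DERIV_imp_deriv has_real_derivative_iff_has_vector_derivative)
  then have "(\<lambda>(y, p). pd j (h y) p) = (\<lambda>z. D z (0, axis j 1))" by auto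
  then show "Ck k (\<lambda>(y, p). pd j (h y) p)" using Dk[of "(0, axis j 1)"] by (simp add: Basis_prod_def axis_in_Basis_iff)
  have "deriv (\<lambda>s. h (y + s *\<^sub>R axis i 1) p) 0 = D (y, p) (axis i 1, 0)" for y p
    using has_derivative_imp_DERIV_line[of "\<lambda>y. h y p" "\<lambda>v. D (y, p) (v, 0)" y 0 "axis i 1"] x[of p y]
    by (simp add: DERIV_imp_deriv has_real_derivative_iff_has_vector_derivative)
  then have "(\<lambda>(y, p). deriv (\<lambda>s. h (y + s *\<^sub>R axis i 1) p) 0) = (\<lambda>z. D z (axis i 1, 0))" by auto
  then show "Ck k (\<lambda>(y, p). deriv (\<lambda>s. h (y + s *\<^sub>R axis i 1) p) 0)"
    using Dk[of "(axis i 1, 0)"] by (simp add: Basis_prod_def axis_in_Basis_iff)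
qed

lemma twice_differentiable_slice:
  fixes H :: "'n::finite torus \<Rightarrow> real^'n \<Rightarrow> real"
  assumes H: "Ck 2 (\<lambda>(y, p). H (tproj y) p)"
  shows "twice_differentiable_torus (\<lambda>z. H z p)"
proof -
  have H2: "Ck (Suc (Suc 0)) (\<lambda>(y, p). H (tproj y) p)" using H by (simp add: numeral_2_eq_2)
  have "(\<lambda>z. tgrad (\<lambda>z. H z p) (tproj z)) differentiable (at y)" for y
  proof -
    have t: "tpd i (\<lambda>z. H z p) (tproj z) = deriv (\<lambda>s. H (tproj (z + s *\<^sub>R axis i 1)) p) 0" for i z
      by (rule tpd_lift)
    have "Ck (Suc 0) (\<lambda>(y, p). deriv (\<lambda>s. H (tproj (y + s *\<^sub>R axis i 1)) p) 0)" for i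
      by (rule Ck_partial(4)[of _ "\<lambda>y p. H (tproj y) p", OF H2])
    from Ck_partial(1)[of 0 "\<lambda>y p. deriv (\<lambda>s. H (tproj (y + s *\<^sub>R axis i 1)) p) 0" for i, OF this]
    have d: "(\<lambda>z. tpd i (\<lambda>z. H z p) (tproj z)) differentiable (at y)" for i by (simp add: t)
    have "tgrad (\<lambda>z. H z p) (tproj z) = (\<Sum>i\<in>UNIV. tpd i (\<lambda>z. H z p) (tproj z) *\<^sub>R axis i 1)" for z
      using basis_expansion[of "tgrad (\<lambda>z. H z p) (tproj z)"] by (simp add: tgrad_def scalar_mult_eq_scaleR)
    moreover have "(\<lambda>z. tpd i (\<lambda>z. H z p) (tproj z) *\<^sub>R (axis i 1 :: real^'n)) differentiable (at y)" for i
    proof -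
      obtain D where "((\<lambda>z. tpd i (\<lambda>z. H z p) (tproj z)) has_derivative D) (at y)"
        using d[of i] unfolding differentiable_def by blast
      from has_derivative_scaleR_left[OF this] show ?thesis unfolding differentiable_def by blast
    qed
    then have "(\<lambda>z. \<Sum>i\<in>UNIV. tpd i (\<lambda>z. H z p) (tproj z) *\<^sub>R (axis i 1 :: real^'n)) differentiable (at y)"
      by (intro differentiable_sum) auto
    ultimately show ?thesis by simp
  qed
  then show ?thesis
    unfolding twice_differentiable_torus_def
    using Ck_partial(1)[of _ "\<lambda>y p. H (tproj y) p", OF H2] by blast
qed

text \<open>Compactness bounds \<open>H\<close> on the unit ball, which with the bounds on \<open>D_pp H\<close> gives quadratic growth. The
  bound on \<open>D_xx H\<close> gives the variation in space, since \<open>(1 + |p|) powr (1 + \<theta>) \<le> 2 (1 + |p|\<^sup>2)\<close>.\<close>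

lemma hamiltonian_bounds:
  fixes H :: "'n::finite torus \<Rightarrow> real^'n \<Rightarrow> real" and c C \<theta> :: real
  assumes H: "Ck 2 (\<lambda>(y, p). H (tproj y) p)" and c: "0 < c"
    and lo: "\<And>x p \<xi>. inverse c * (norm \<xi>)\<^sup>2 \<le> \<xi> \<bullet> (D_pp H x p *v \<xi>)"
    and up: "\<And>x p \<xi>. \<xi> \<bullet> (D_pp H x p *v \<xi>) \<le> c * (norm \<xi>)\<^sup>2"
    and \<theta>: "\<theta> < 1" and C: "0 < C"
    and xx: "\<And>x p. norm (D_xx H x p) \<le> C * (1 + norm p) powr (1 + \<theta>)"
  shows "\<exists>K\<ge>1. (\<forall>x p. (norm p)\<^sup>2 / K - K \<le> H x p) \<and> (\<forall>x p. H x p \<le> K * (1 + (norm p)\<^sup>2)) \<and>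
    (\<forall>x y p. \<bar>H x p - H y p\<bar> \<le> K * dist x y * (1 + (norm p)\<^sup>2)) \<and>
    continuous_on UNIV (\<lambda>(x, p). H x p)"
proof -
  have H2: "Ck (Suc (Suc 0)) (\<lambda>(y, p). H (tproj y) p)" using H by (simp add: numeral_2_eq_2)
  have cont: "continuous_on UNIV (\<lambda>(x, p). H x p)"
  proof -
    have "continuous_on UNIV (\<lambda>(y, p). H (tproj y) p)" by (rule Ck_imp_continuous[OF H])
    then have "continuous_on UNIV (\<lambda>(p, y). H (tproj y) p)"
      using continuous_on_compose2[OF _ continuous_on_swap, of UNIV "\<lambda>(y, p). H (tproj y) p" UNIV]
      by (simp add: case_prod_beta' prod.swap_def)
    from continuous_on_torus_lift[of "\<lambda>p x. H x p", OF this]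
    have "continuous_on UNIV (\<lambda>(p, x). H x p)" .
    then show ?thesis
      using continuous_on_compose2[OF _ continuous_on_swap, of UNIV "\<lambda>(p, x). H x p" UNIV]
      by (simp add: case_prod_beta' prod.swap_def)
  qed
  obtain B where B: "\<And>x p. norm p \<le> 1 \<Longrightarrow> \<bar>H x p\<bar> \<le> B"
  proof -
    have "compact ((\<lambda>(x, p). H x p) ` (UNIV \<times> cball 0 1))"
      by (intro compact_continuous_image compact_Times compact_torus compact_cball continuous_on_subset[OF cont]) auto
    then have "bounded ((\<lambda>(x, p). H x p) ` (UNIV \<times> cball 0 1))" by (rule compact_imp_bounded)
    then obtain B where "\<forall>w\<in>(\<lambda>(x, p). H x p) ` (UNIV \<times> cball 0 1). norm w \<le> B" unfolding bounded_iff by blast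
    then show ?thesis by (intro that[of B]) force
  qed
  have B0: "0 \<le> B" using B[of 0 0] by simp
  have d1: "H x differentiable (at p)" for x p
    using Ck_partial(2)[of _ "\<lambda>y p. H (tproj y) p", OF H2, of "cube_rep x" p] by simp
  have d2: "pd j (H x) differentiable (at p)" for j x p
    using Ck_partial(2)[of 0 "\<lambda>y. pd j (H (tproj y))", of "cube_rep x" p]
      Ck_partial(3)[of "Suc 0" "\<lambda>y p. H (tproj y) p" j, OF H2] by simp
  have growth: "inverse c / 2 * (norm p)\<^sup>2 - (2 * B + c) * norm p - B \<le> H x p"
      "H x p \<le> c / 2 * (norm p)\<^sup>2 + (2 * B + c) * norm p + B" for x p
    using quadratic_growth[of "H x" "inverse c" c B p, OF d1 d2 lo[unfolded D_pp_def] up[unfolded D_pp_def] B] c by auto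
  define b where "b = 2 * B + c"
  have b0: "0 < b" using B0 c by (simp add: b_def)
  define K where "K = 1 + 4 * c + B + b + b\<^sup>2 * c + CARD('n) * (2 * C)"
  have Kge: "1 \<le> K" "4 * c \<le> K" "B + b\<^sup>2 * c \<le> K" "B + b + c / 2 \<le> K" "CARD('n) * (2 * C) \<le> K"
    unfolding K_def using B0 b0 c C by (auto intro!: add_nonneg_nonneg)
  show ?thesis
  proof (intro exI[of _ K] conjI allI Kge(1) cont)
    fix x :: "'n torus" and p :: "real^'n"
    have n1: "norm p \<le> 1 + (norm p)\<^sup>2"
      using zero_le_power2[of "norm p - 1"] norm_ge_zero[of p]
      unfolding power2_diff power_one mult_1_right by linarith
    have sq: "b * norm p \<le> (norm p)\<^sup>2 / (4 * c) + b\<^sup>2 * c"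
    proof -
      have "0 \<le> (norm p / 2 - b * c)\<^sup>2 / c" using c by simp
      also have "(norm p / 2 - b * c)\<^sup>2 / c = (norm p)\<^sup>2 / (4 * c) + b\<^sup>2 * c - b * norm p"
        using c by (simp add: power2_eq_square field_simps)
      finally show ?thesis by simp
    qed
    have "(norm p)\<^sup>2 / K \<le> (norm p)\<^sup>2 / (4 * c)" using Kge(2) c by (intro divide_left_mono) auto
    moreover have "inverse c / 2 * (norm p)\<^sup>2 = (norm p)\<^sup>2 / (4 * c) + (norm p)\<^sup>2 / (4 * c)"
      using c by (simp add: field_simps)
    ultimately show "(norm p)\<^sup>2 / K - K \<le> H x p"
      using growth(1)[of p x, folded b_def] sq Kge(3) by linarith
    have "c / 2 * (norm p)\<^sup>2 + b * norm p + B \<le> c / 2 * (1 + (norm p)\<^sup>2) + b * (1 + (norm p)\<^sup>2) + B * (1 + (norm p)\<^sup>2)"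
      using n1 b0 B0 c by (intro add_mono mult_left_mono) (auto simp: mult_le_cancel_left1)
    also have "\<dots> = (B + b + c / 2) * (1 + (norm p)\<^sup>2)" by (simp add: algebra_simps)
    also have "\<dots> \<le> K * (1 + (norm p)\<^sup>2)" using Kge(4) by (intro mult_right_mono) auto
    finally show "H x p \<le> K * (1 + (norm p)\<^sup>2)" using growth(2)[of x p, folded b_def] by linarith
  next
    fix x y :: "'n torus" and p :: "real^'n"
    have "(1 + norm p) powr (1 + \<theta>) \<le> (1 + norm p) powr 2" using \<theta> by (intro powr_mono) auto
    also have "\<dots> = (1 + norm p)\<^sup>2" by (rule powr_numeral) (simp add: add_pos_nonneg)
    also have "\<dots> \<le> 2 * (1 + (norm p)\<^sup>2)"
      using zero_le_power2[of "norm p - 1"] by (simp add: power2_eq_square algebra_simps)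
    finally have pw: "C * (1 + norm p) powr (1 + \<theta>) \<le> C * (2 * (1 + (norm p)\<^sup>2))" using C by (intro mult_left_mono) auto
    have "norm (thess (\<lambda>z. H z p) x) \<le> C * (2 * (1 + (norm p)\<^sup>2))" for x
      using xx[of x p] pw unfolding D_xx_def by linarith
    from lipschitz_onD[OF lipschitz_of_thess_bound[OF twice_differentiable_slice[OF H] this], of x y]
    have "\<bar>H x p - H y p\<bar> \<le> CARD('n) * (C * (2 * (1 + (norm p)\<^sup>2))) * dist x y" by (simp add: dist_real_def)
    also have "\<dots> = (CARD('n) * (2 * C)) * (dist x y * (1 + (norm p)\<^sup>2))" by simp
    also have "\<dots> \<le> K * (dist x y * (1 + (norm p)\<^sup>2))" using Kge(5) by (intro mult_right_mono) auto
    finally show "\<bar>H x p - H y p\<bar> \<le> K * dist x y * (1 + (norm p)\<^sup>2)" by (simp add: mult.assoc)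
  qed
qed

section \<open>The vanishing discount limit\<close>

theorem proposition1p6:
  fixes H :: "'n::finite torus \<Rightarrow> real ^ 'n \<Rightarrow> real"
    and \<F> :: "'n tprob \<Rightarrow> real"
    and F :: "'n torus \<Rightarrow> 'n tprob \<Rightarrow> real"
    and \<eta> :: "'n tprob"
    and C\<^sub>H C \<theta> :: real
  assumes H_C2: "Ck 2 (\<lambda>(y, p). H (tproj y) p)"
    and H_pp_Lip: "\<exists>L. \<forall>x. L-lipschitz_on UNIV (\<lambda>p. D_pp H x p)"
    and C\<^sub>H_pos: "C\<^sub>H > 0"
    and H_convex: "\<And>x p \<xi>. inverse C\<^sub>H * (norm \<xi>)\<^sup>2 \<le> \<xi> \<bullet> (D_pp H x p *v \<xi>)"
    and H_pp_bound: "\<And>x p \<xi>. \<xi> \<bullet> (D_pp H x p *v \<xi>) \<le> C\<^sub>H * (norm \<xi>)\<^sup>2"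
    and \<theta>: "0 < \<theta>" "\<theta> < 1"
    and C_pos: "C > 0"
    and H_xx: "\<And>x p. norm (D_xx H x p) \<le> C * (1 + norm p) powr (1 + \<theta>)"
    and H_xp: "\<And>x p. norm (D_xp H x p) \<le> C * (1 + norm p) powr \<theta>"
    and \<F>_C2: "C2_prob \<F>"
    and F_deriv: "flat_derivative \<F> (\<lambda>m x. F x m)"
    and F_twice: "\<And>m. twice_differentiable_torus (\<lambda>x. F x m)"
    and F_xx: "\<exists>K. \<forall>m x. norm (thess (\<lambda>z. F z m) x) \<le> K"
  shows "\<exists>\<delta> :: nat \<Rightarrow> real. (\<forall>n. \<delta> n > 0) \<and> \<delta> \<longlonglongrightarrow> 0 \<and>
    (\<exists>chi :: 'n tprob \<Rightarrow> real.
       uniform_limit UNIV (\<lambda>n m. value_fun H \<F> (\<delta> n) m - value_fun H \<F> (\<delta> n) \<eta>) chi sequentially) \<and>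
    (\<exists>lam :: real. uniform_limit UNIV (\<lambda>n m. \<delta> n * value_fun H \<F> (\<delta> n) m) (\<lambda>_. - lam) sequentially)"
proof -
  have "\<exists>K\<ge>1. (\<forall>x p. (norm p)\<^sup>2 / K - K \<le> H x p) \<and> (\<forall>x p. H x p \<le> K * (1 + (norm p)\<^sup>2)) \<and>
    (\<forall>x y p. \<bar>H x p - H y p\<bar> \<le> K * dist x y * (1 + (norm p)\<^sup>2)) \<and> continuous_on UNIV (\<lambda>(x, p). H x p)"
    by (rule hamiltonian_bounds[OF H_C2 C\<^sub>H_pos H_convex H_pp_bound \<theta>(2) C_pos H_xx])
  then obtain KH where KH: "1 \<le> KH" "\<And>x p. (norm p)\<^sup>2 / KH - KH \<le> H x p" "\<And>x p. H x p \<le> KH * (1 + (norm p)\<^sup>2)"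
    "\<And>x y p. \<bar>H x p - H y p\<bar> \<le> KH * dist x y * (1 + (norm p)\<^sup>2)" "continuous_on UNIV (\<lambda>(x, p). H x p)"
    by (elim exE conjE) blast
  obtain KF where KF: "\<And>m x. norm (thess (\<lambda>z. F z m) x) \<le> KF" using F_xx by blast
  define LF where "LF = CARD('n) * KF"
  have lip: "LF-lipschitz_on UNIV (\<lambda>x. F x m)" for m
    unfolding LF_def by (rule lipschitz_of_thess_bound[OF F_twice KF])
  have LF0: "0 \<le> LF" using lipschitz_on_nonneg[OF lip] .
  have FL: "\<bar>\<F> m - \<F> m'\<bar> \<le> LF * dist m m'" for m m'
    by (rule flat_derivative_Lipschitz[OF F_deriv lip])
  define K where "K = KH + \<bar>\<F> \<eta>\<bar> + LF * (1 + 2 * real CARD('n))"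
  have K: "KH \<le> K" "LF \<le> K" "\<bar>\<F> \<eta>\<bar> + LF * (2 * real CARD('n)) \<le> K"
    using KH(1) LF0 by (simp_all add: K_def distrib_left)
  interpret control_problem H \<F> K
  proof
    show "1 \<le> K" using KH(1) K(1) by simp
    show "(norm p)\<^sup>2 / K - K \<le> H x p" for x p
    proof -
      have "(norm p)\<^sup>2 / K \<le> (norm p)\<^sup>2 / KH" using KH(1) K(1) by (intro divide_left_mono) auto
      then show ?thesis using KH(2)[of p x] K(1) by linarith
    qed
    show "H x p \<le> K * (1 + (norm p)\<^sup>2)" for x p
      using KH(3)[of x p] mult_right_mono[OF K(1), of "1 + (norm p)\<^sup>2"] by simp
    show "\<bar>H x p - H y p\<bar> \<le> K * dist x y * (1 + (norm p)\<^sup>2)" for x y p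
      using KH(4)[of x p y] mult_right_mono[OF K(1), of "dist x y * (1 + (norm p)\<^sup>2)"] by (simp add: mult.assoc)
    show "continuous_on UNIV (\<lambda>(x, p). H x p)" by (rule KH(5))
    show "\<bar>\<F> m - \<F> m'\<bar> \<le> K * dist m m'" for m m'
      using FL[of m m'] mult_right_mono[OF K(2), of "dist m m'"] by simp
    show "\<bar>\<F> m\<bar> \<le> K" for m
      using FL[of m \<eta>] mult_left_mono[OF dist_tprob_bounded LF0, of m \<eta>] K(3) by linarith
  qed
  show ?thesis by (rule ergodic_limit)
qed

end
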